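(* Under the assumptions of the context, for any $\lambda>0$ the resolvent of $\mathcal{G}$ is given by $$(\lambda-\mathcal{G})^{-1}f=\lim_{n\to\infty}(\lambda-\mathcal{Z})^{-1}\sum_{k=0}^n\left[\widehat{\mathfrak{B}}(\lambda-\mathcal{Z})^{-1}\right]^kf,\qquad f\in\mathfrak{X}.$$ The semigroup $(\mathcal{T}(t))_{t\ge0}$ is the smallest substochastic $C_0$-semigroup on $\mathfrak{X}$ whose generator is an extension of $(\mathcal{Z}+\widehat{\mathfrak{B}},\mathscr{D}(\mathcal{Z}))$, and $$\mathcal{T}(t)f=\sum_{n=0}^\infty\mathcal{T}_n(t)f\qquad\forall t\ge 0,\ f\in\mathfrak{X}.$$
   Context: $\mathcal{E}$ is a real ordered Banach space with (closed) positive cone $\mathcal{E}_+$ that is generating, $\mathcal{E}=\mathcal{E}_+-\mathcal{E}_+$, and on which the norm is additive: $\|u+v\|=\|u\|+\|v\|$ for $u,v\in\mathcal{E}_+$. An evolution family in $\mathcal{E}$ is a family $(\mathbf{U}(t,s))_{t\ge s\ge 0}$ of bounded linear operators on $\mathcal{E}$ such that (a) for each $u\in\mathcal{E}$ the map $(t,s)\mapsto\mathbf{U}(t,s)u$ is continuous on $t\ge s\ge 0$; (b) $\mathbf{U}(t,s)=\mathbf{U}(t,r)\mathbf{U}(r,s)$ and $\mathbf{U}(t,t)=\mathbf{I}$ for $t\ge r\ge s$; (c) $\|\mathbf{U}(t,s)\|\le Ce^{\beta(t-s)}$ for $t\ge s$, for some constants $C,\beta>0$. Standing assumptions: $(\mathbf{U}(t,s))_{t\ge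 s\ge0}$ is a given evolution family in $\mathcal{E}$ and $(\mathbf{B}(t))_{t\ge 0}$ is a family of (possibly unbounded) linear operators $\mathbf{B}(t):\mathscr{D}(\mathbf{B}(t))\subset\mathcal{E}\to\mathcal{E}$ such that: (i) $\mathbf{U}(t,s)u\in\mathcal{E}_+$ for $u\in\mathcal{E}_+$, $t\ge s\ge 0$; (ii) $\|\mathbf{U}(t,s)u\|_{\mathcal{E}}\le\|u\|_{\mathcal{E}}$ for $u\in\mathcal{E}_+$, $t\ge s\ge 0$; (iii) $\mathbf{B}(t)u\in\mathcal{E}_+$ for $u\in\mathscr{D}(\mathbf{B}(t))\cap\mathcal{E}_+$, $t\ge 0$; (iv) for any $u\in\mathcal{E}$ and $s\ge 0$, $\mathbf{U}(t,s)u\in\mathscr{D}(\mathbf{B}(t))$ for a.e. $t\ge s$ and the mapping $t\in[s,\infty)\mapsto\mathbf{B}(t)\mathbf{U}(t,s)u$ is measurable; moreover, for any $t\ge s\ge 0$ and $u\in\mathcal{E}_+$, $\int_s^t\|\mathbf{B}(\tau)\mathbf{U}(\tau,s)u\|_{\mathcal{E}}\,\mathrm{d}\tau\le\|u\|_{\mathcal{E}}-\|\mathbf{U}(t,s)u\|_{\mathcal{E}}$. Let $\Delta=\{(t,s):0\le s\le t<\infty\}$ and $\mathfrak{X}=L^1(\mathbb{R}_+,\mathcal{E})$ with norm $\|f\|_{\mathfrak{X}}=\int_0^\infty\|f(s)\|_{\mathcal{E}}\,\mathrm{d}s$ and positive cone $\mathfrak{X}_+=\{f\in\mathfrak{X}: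 f(s)\in\mathcal{E}_+\text{ for a.e. }s\}$. It is further assumed that: (v) for any $f\in\mathfrak{X}$ the mapping $(t,s)\in\Delta\mapsto\mathbf{B}(t)\mathbf{U}(t,s)f(s)\in\mathcal{E}$ is well-defined for almost every $(t,s)\in\Delta$ and is measurable. Set $\mathbf{V}_0(t,s)=\mathbf{U}(t,s)$, $\mathbf{V}_{n+1}(t,s)u=\int_s^t\mathbf{V}_n(t,r)\mathbf{B}(r)\mathbf{U}(r,s)u\,\mathrm{d}r$, and $\mathbf{V}(t,s)u=\sum_{n=0}^\infty\mathbf{V}_n(t,s)u$ for $t\ge s\ge 0$, $u\in\mathcal{E}$. Under (i)–(iv) the $\mathbf{V}_n(t,s)$ are bounded positive operators, the series converges, and $(\mathbf{V}(t,s))_{t\ge s\ge 0}$ is an evolution family with $\|\mathbf{V}(t,s)u\|\le\|u\|$ for $u\in\mathcal{E}_+$. $(\mathcal{T}_0(t))_{t\ge0}$ is the $C_0$-semigroup on $\mathfrak{X}$ given by $[\mathcal{T}_0(t)f](s)=\mathbf{U}(s,s-t)f(s-t)$ if $s\ge t$ and $0$ if $0\le s<t$; its generator is $(\mathcal{Z},\mathscr{D}(\mathcal{Z}))$. $(\mathcal{T}(t))_{t\ge0}$ is the $C_0$-semigroup on $\mathfrak{X}$ given by $[\mathcal{T}(t)f](s)=\mathbf{V}(s,s-t)f(s-t)$ if $s\ge t$ and $0$ if $0\le s<t$; its generator is $(\mathcal{G},\mathscr{D}(\mathcal{G}))$. More generally, for $n\in\mathbb{N}$ (including $n=0$), $[\mathcal{T}_n(t)f](s)=\mathbf{V}_n(s,s-t)f(s-t)$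 if $s\ge t$ and $0$ if $0\le s<t$. Under (i)–(v), $\mathscr{D}(\mathcal{Z})\subset\mathscr{D}(\mathcal{G})$, and $\widehat{\mathfrak{B}}$ is the operator with domain $\mathscr{D}(\mathcal{Z})$ defined by $\widehat{\mathfrak{B}}f=\mathcal{G}f-\mathcal{Z}f$; it is $\mathcal{Z}$-bounded and positive. A $C_0$-semigroup $(\mathcal{S}(t))_{t\ge 0}$ on $\mathfrak{X}$ is substochastic if it maps $\mathfrak{X}_+$ into itself and $\|\mathcal{S}(t)f\|_{\mathfrak{X}}\le\|f\|_{\mathfrak{X}}$ for $f\in\mathfrak{X}_+$, $t\ge0$. "Smallest" refers to the order $\mathcal{T}(t)f\le\mathcal{S}(t)f$ for all $f\in\mathfrak{X}_+$, $t\ge 0$. *)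

theory Defs
  imports "HOL-Analysis.Analysis"
begin

section \<open>Bochner integration in arbitrary Banach spaces\<close>

text \<open>
  The library's Bochner integral is restricted to second countable (hence separable) target
  spaces.  Here the target space is arbitrary, so the notions are set up again from the library's
  simple functions.  Measurability of vector-valued functions always means strong measurability;
  convergence is only required almost everywhere, so the definition is the usual one for complete
  sigma-finite measures, and below only restrictions of Lebesgue measure are used.
\<close>

definition strongly_measurable :: "'a measure \<Rightarrow> ('a \<Rightarrow> 'b::real_normed_vector) \<Rightarrow> bool" where
  "strongly_measurable M f \<longleftrightarrow>
    (\<exists>s. (\<forall>i::nat. simple_function M (s i)) \<and> (AE x in M. (\<lambda>i. s i x) \<longlonglongrightarrow> f x))"

definition bochner_integrable :: "'a measure \<Rightarrow> ('a \<Rightarrow> 'b::real_normed_vector) \<Rightarrow> bool" where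
  "bochner_integrable M f \<longleftrightarrow>
    strongly_measurable M f \<and> (\<integral>\<^sup>+x. ennreal (norm (f x)) \<partial>M) < \<infinity>"

definition has_bochner_integral_value ::
    "'a measure \<Rightarrow> ('a \<Rightarrow> 'b::real_normed_vector) \<Rightarrow> 'b \<Rightarrow> bool" where
  "has_bochner_integral_value M f I \<longleftrightarrow> bochner_integrable M f \<and>
    (\<exists>s. (\<forall>i::nat. Bochner_Integration.simple_bochner_integrable M (s i)) \<and>
         (\<lambda>i. \<integral>\<^sup>+x. ennreal (norm (f x - s i x)) \<partial>M) \<longlonglongrightarrow> 0 \<and>
         (\<lambda>i. Bochner_Integration.simple_bochner_integral M (s i)) \<longlonglongrightarrow> I)"

definition bochner_integral :: "'a measure \<Rightarrow> ('a \<Rightarrow> 'b::real_normed_vector) \<Rightarrow> 'b" where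
  "bochner_integral M f =
    (if \<exists>I. has_bochner_integral_value M f I then THE I. has_bochner_integral_value M f I else 0)"

lemma strongly_measurable_const: "strongly_measurable M (\<lambda>x. c)"
  unfolding strongly_measurable_def by (intro exI[of _ "\<lambda>i x. c"]) auto

lemma strongly_measurable_add:
  assumes "strongly_measurable M f" "strongly_measurable M g"
  shows "strongly_measurable M (\<lambda>x. f x + g x)"
proof -
  obtain s where s: "\<And>i::nat. simple_function M (s i)" "AE x in M. (\<lambda>i. s i x) \<longlonglongrightarrow> f x"
    using assms(1) unfolding strongly_measurable_def by blast
  obtain t where t: "\<And>i::nat. simple_function M (t i)" "AE x in M. (\<lambda>i. t i x) \<longlonglongrightarrow> g x"
    using assms(2) unfolding strongly_measurable_def by blast
  have "simple_function M (\<lambda>x. s i x + t i x)" for i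
    using s(1)[of i] t(1)[of i] by (rule simple_function_compose2)
  moreover have "AE x in M. (\<lambda>i. s i x + t i x) \<longlonglongrightarrow> f x + g x"
    using s(2) t(2) by eventually_elim (rule tendsto_add)
  ultimately show ?thesis
    unfolding strongly_measurable_def by (intro exI[of _ "\<lambda>i x. s i x + t i x"]) auto
qed

lemma strongly_measurable_scaleR:
  assumes "strongly_measurable M f"
  shows "strongly_measurable M (\<lambda>x. c *\<^sub>R f x)"
proof -
  obtain s where s: "\<And>i::nat. simple_function M (s i)" "AE x in M. (\<lambda>i. s i x) \<longlonglongrightarrow> f x"
    using assms unfolding strongly_measurable_def by blast
  have "simple_function M (\<lambda>x. c *\<^sub>R s i x)" for i
    using simple_function_compose1[OF s(1)[of i]] .
  moreover have "AE x in M. (\<lambda>i. c *\<^sub>R s i x) \<longlonglongrightarrow> c *\<^sub>R f x"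
    using s(2) by eventually_elim (intro tendsto_intros)
  ultimately show ?thesis
    unfolding strongly_measurable_def by (intro exI[of _ "\<lambda>i x. c *\<^sub>R s i x"]) auto
qed

lemma strongly_measurable_norm:
  assumes "strongly_measurable (lebesgue_on S) f" and S: "S \<in> sets lebesgue"
  shows "(\<lambda>x. norm (f x)) \<in> borel_measurable (lebesgue_on S)"
proof -
  obtain s where s: "\<And>i::nat. simple_function (lebesgue_on S) (s i)"
    "AE x in lebesgue_on S. (\<lambda>i. s i x) \<longlonglongrightarrow> f x"
    using assms(1) unfolding strongly_measurable_def by blast
  define h where "h i x = (if x \<in> S then norm (s i x) else 0)" for i x
  have "(\<lambda>x. norm (s i x)) \<in> borel_measurable (lebesgue_on S)" for i
    by (rule borel_measurable_simple_function[OF simple_function_compose1[OF s(1)[of i]]])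
  then have h: "h i \<in> borel_measurable lebesgue" for i
    using S unfolding h_def by (simp add: borel_measurable_if)
  have "(\<lambda>x. lim (\<lambda>i. h i x)) \<in> borel_measurable lebesgue"
    by (rule borel_measurable_lim_metric[OF h])
  moreover have "AE x in lebesgue. lim (\<lambda>i. h i x) = (if x \<in> S then norm (f x) else 0)"
  proof -
    have "AE x in lebesgue. x \<in> S \<longrightarrow> (\<lambda>i. s i x) \<longlonglongrightarrow> f x"
      using s(2) S by (subst (asm) AE_restrict_space_iff) auto
    then show ?thesis
      by eventually_elim (auto simp: h_def intro!: limI tendsto_norm)
  qed
  ultimately have "(\<lambda>x. if x \<in> S then norm (f x) else 0) \<in> borel_measurable lebesgue"
    by (rule borel_measurable_AE)
  then show ?thesis
    using S by (simp add: borel_measurable_if)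
qed


section \<open>The space of integrable functions on the half-line\<close>

abbreviation half_line :: "real measure" where
  "half_line \<equiv> lebesgue_on {0..}"

lemma bochner_integrable_zero: "bochner_integrable M (\<lambda>x. 0)"
  by (simp add: bochner_integrable_def strongly_measurable_const)

lemma bochner_integrable_add:
  assumes "bochner_integrable half_line f" "bochner_integrable half_line g"
  shows "bochner_integrable half_line (\<lambda>x. f x + g x)"
proof -
  have [measurable]: "(\<lambda>x. norm (f x)) \<in> borel_measurable half_line"
      "(\<lambda>x. norm (g x)) \<in> borel_measurable half_line"
    using assms unfolding bochner_integrable_def by (auto intro!: strongly_measurable_norm)
  have "(\<integral>\<^sup>+x. ennreal (norm (f x + g x)) \<partial>half_line)
      \<le> (\<integral>\<^sup>+x. ennreal (norm (f x)) + ennreal (norm (g x)) \<partial>half_line)"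
    by (intro nn_integral_mono) (simp flip: ennreal_plus add: norm_triangle_ineq)
  also have "\<dots> = (\<integral>\<^sup>+x. ennreal (norm (f x)) \<partial>half_line) + (\<integral>\<^sup>+x. ennreal (norm (g x)) \<partial>half_line)"
    by (intro nn_integral_add) auto
  also have "\<dots> < \<infinity>"
    using assms by (auto simp: bochner_integrable_def)
  finally show ?thesis
    using assms by (auto simp: bochner_integrable_def intro: strongly_measurable_add)
qed

lemma bochner_integrable_scaleR:
  assumes "bochner_integrable half_line f"
  shows "bochner_integrable half_line (\<lambda>x. c *\<^sub>R f x)"
proof -
  have [measurable]: "(\<lambda>x. norm (f x)) \<in> borel_measurable half_line"
    using assms unfolding bochner_integrable_def by (auto intro!: strongly_measurable_norm)
  have "(\<integral>\<^sup>+x. ennreal (norm (c *\<^sub>R f x)) \<partial>half_line)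
      = ennreal \<bar>c\<bar> * (\<integral>\<^sup>+x. ennreal (norm (f x)) \<partial>half_line)"
    by (subst nn_integral_cmult[symmetric]) (auto simp: ennreal_mult)
  also have "\<dots> < \<infinity>"
    using assms by (auto simp: bochner_integrable_def ennreal_mult_less_top)
  finally show ?thesis
    using assms by (auto simp: bochner_integrable_def intro: strongly_measurable_scaleR)
qed

lemma bochner_integrable_uminus:
  assumes "bochner_integrable half_line f"
  shows "bochner_integrable half_line (\<lambda>x. - f x)"
  using bochner_integrable_scaleR[OF assms, of "-1"] by simp

lemma bochner_integrable_diff:
  assumes "bochner_integrable half_line f" "bochner_integrable half_line g"
  shows "bochner_integrable half_line (\<lambda>x. f x - g x)"
  using bochner_integrable_add[OF assms(1) bochner_integrable_uminus[OF assms(2)]] by simp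

lemma bochner_integrable_norm:
  assumes "bochner_integrable half_line f"
  shows "integrable half_line (\<lambda>x. norm (f x))"
proof (rule integrableI_bounded)
  show "(\<lambda>x. norm (f x)) \<in> borel_measurable half_line"
    using assms unfolding bochner_integrable_def by (auto intro!: strongly_measurable_norm)
  show "(\<integral>\<^sup>+x. ennreal (norm (norm (f x))) \<partial>half_line) < \<infinity>"
    using assms by (simp add: bochner_integrable_def)
qed

definition L1_rel ::
    "(real \<Rightarrow> 'e::real_normed_vector) \<Rightarrow> (real \<Rightarrow> 'e) \<Rightarrow> bool" where
  "L1_rel f g \<longleftrightarrow> bochner_integrable half_line f \<and> bochner_integrable half_line g \<and>
    (AE x in half_line. f x = g x)"

quotient_type (overloaded) 'e L1 = "real \<Rightarrow> 'e::real_normed_vector" / partial: L1_rel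
proof (rule part_equivpI)
  show "\<exists>f. L1_rel f f"
    using bochner_integrable_zero unfolding L1_rel_def by auto
  show "symp L1_rel"
    unfolding symp_def L1_rel_def by (auto simp: eq_commute)
  show "transp L1_rel"
    unfolding transp_def L1_rel_def by auto
qed

instantiation L1 :: (real_normed_vector) real_normed_vector
begin

lift_definition zero_L1 :: "'a L1" is "\<lambda>x. 0"
  by (simp add: L1_rel_def bochner_integrable_zero)

lift_definition plus_L1 :: "'a L1 \<Rightarrow> 'a L1 \<Rightarrow> 'a L1" is "\<lambda>f g x. f x + g x"
  by (auto simp: L1_rel_def intro: bochner_integrable_add)

lift_definition uminus_L1 :: "'a L1 \<Rightarrow> 'a L1" is "\<lambda>f x. - f x"
  by (auto simp: L1_rel_def intro: bochner_integrable_uminus)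

lift_definition minus_L1 :: "'a L1 \<Rightarrow> 'a L1 \<Rightarrow> 'a L1" is "\<lambda>f g x. f x - g x"
  by (auto simp: L1_rel_def intro: bochner_integrable_diff)

lift_definition scaleR_L1 :: "real \<Rightarrow> 'a L1 \<Rightarrow> 'a L1" is "\<lambda>c f x. c *\<^sub>R f x"
  by (auto simp: L1_rel_def intro: bochner_integrable_scaleR)

lift_definition norm_L1 :: "'a L1 \<Rightarrow> real" is "\<lambda>f. \<integral>x. norm (f x) \<partial>half_line"
  unfolding L1_rel_def
  by (intro integral_cong_AE) (auto dest!: bochner_integrable_norm)

definition "dist_L1 (f :: 'a L1) g = norm (f - g)"
definition "sgn_L1 (f :: 'a L1) = inverse (norm f) *\<^sub>R f"
definition uniformity_L1 :: "('a L1 \<times> 'a L1) filter"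
  where "uniformity_L1 = (INF e\<in>{0<..}. principal {(f, g). dist f g < e})"
definition open_L1 :: "'a L1 set \<Rightarrow> bool"
  where "open_L1 S = (\<forall>f\<in>S. \<forall>\<^sub>F (f', g) in uniformity. f' = f \<longrightarrow> g \<in> S)"

instance
proof
  fix f g h :: "'a L1" and a b :: real
  show "f + g + h = f + (g + h)"
    by transfer (auto simp: L1_rel_def add.assoc intro!: bochner_integrable_add)
  show "f + g = g + f"
    by transfer (auto simp: L1_rel_def add.commute intro!: bochner_integrable_add)
  show "0 + f = f"
    by transfer (auto simp: L1_rel_def)
  show "- f + f = 0"
    by transfer (auto simp: L1_rel_def bochner_integrable_zero)
  show "f - g = f + - g"
    by transfer (auto simp: L1_rel_def intro!: bochner_integrable_diff)
  show "a *\<^sub>R (f + g) = a *\<^sub>R f + a *\<^sub>R g"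
    by transfer (auto simp: L1_rel_def scaleR_add_right
        intro!: bochner_integrable_add bochner_integrable_scaleR)
  show "(a + b) *\<^sub>R f = a *\<^sub>R f + b *\<^sub>R f"
    by transfer (auto simp: L1_rel_def scaleR_add_left
        intro!: bochner_integrable_add bochner_integrable_scaleR)
  show "a *\<^sub>R b *\<^sub>R f = (a * b) *\<^sub>R f"
    by transfer (auto simp: L1_rel_def intro!: bochner_integrable_scaleR)
  show "1 *\<^sub>R f = f"
    by transfer (auto simp: L1_rel_def)
  show "dist f g = norm (f - g)"
    by (rule dist_L1_def)
  show "sgn f = inverse (norm f) *\<^sub>R f"
    by (rule sgn_L1_def)
  show "uniformity = (INF e\<in>{0<..}. principal {(f, g :: 'a L1). dist f g < e})"
    by (rule uniformity_L1_def)
  show "open S = (\<forall>f\<in>S. \<forall>\<^sub>F (f', g) in uniformity. f' = f \<longrightarrow> g \<in> S)" for S :: "'a L1 set"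
    by (rule open_L1_def)
  show "(norm f = 0) = (f = 0)"
  proof transfer
    fix f :: "real \<Rightarrow> 'a" assume f: "L1_rel f f"
    then have "((\<integral>x. norm (f x) \<partial>half_line) = 0) = (AE x in half_line. norm (f x) = 0)"
      by (intro integral_nonneg_eq_0_iff_AE) (auto simp: L1_rel_def bochner_integrable_norm)
    then show "((\<integral>x. norm (f x) \<partial>half_line) = 0) = L1_rel f (\<lambda>x. 0)"
      using f by (auto simp: L1_rel_def bochner_integrable_zero)
  qed
  show "norm (f + g) \<le> norm f + norm g"
  proof transfer
    fix f g :: "real \<Rightarrow> 'a" assume fg: "L1_rel f f" "L1_rel g g"
    have "(\<integral>x. norm (f x + g x) \<partial>half_line) \<le> (\<integral>x. norm (f x) + norm (g x) \<partial>half_line)"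
      using fg by (intro integral_mono)
        (auto simp: L1_rel_def bochner_integrable_add bochner_integrable_norm norm_triangle_ineq)
    also have "\<dots> = (\<integral>x. norm (f x) \<partial>half_line) + (\<integral>x. norm (g x) \<partial>half_line)"
      using fg by (intro Bochner_Integration.integral_add) (auto simp: L1_rel_def bochner_integrable_norm)
    finally show "(\<integral>x. norm (f x + g x) \<partial>half_line)
        \<le> (\<integral>x. norm (f x) \<partial>half_line) + (\<integral>x. norm (g x) \<partial>half_line)" .
  qed
  show "norm (a *\<^sub>R f) = \<bar>a\<bar> * norm f"
    by transfer simp
qed

end

instantiation L1 :: ("{real_normed_vector, ordered_real_vector}") ordered_real_vector
begin

lift_definition less_eq_L1 :: "'a L1 \<Rightarrow> 'a L1 \<Rightarrow> bool" is "\<lambda>f g. AE x in half_line. f x \<le> g x"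
proof -
  fix f f' g g' :: "real \<Rightarrow> 'a"
  assume "L1_rel f f'" "L1_rel g g'"
  then have "AE x in half_line. f x = f' x" "AE x in half_line. g x = g' x"
    by (auto simp: L1_rel_def)
  then have "AE x in half_line. (f x \<le> g x) = (f' x \<le> g' x)"
    by eventually_elim simp
  then show "(AE x in half_line. f x \<le> g x) = (AE x in half_line. f' x \<le> g' x)"
    by (rule eventually_subst)
qed

definition less_L1 :: "'a L1 \<Rightarrow> 'a L1 \<Rightarrow> bool" where "less_L1 f g \<longleftrightarrow> f \<le> g \<and> \<not> g \<le> f"

instance
proof
  fix f g h :: "'a L1" and a b :: real
  show "(f < g) = (f \<le> g \<and> \<not> g \<le> f)" by (rule less_L1_def)
  show "f \<le> f" by transfer simp
  show "f \<le> g \<Longrightarrow> g \<le> h \<Longrightarrow> f \<le> h"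
    by transfer (auto elim!: eventually_elim2)
  show "f \<le> g \<Longrightarrow> g \<le> f \<Longrightarrow> f = g"
    by transfer (auto simp: L1_rel_def elim!: eventually_elim2)
  show "f \<le> g \<Longrightarrow> h + f \<le> h + g"
    by transfer auto
  show "f \<le> g \<Longrightarrow> 0 \<le> a \<Longrightarrow> a *\<^sub>R f \<le> a *\<^sub>R g"
    by transfer (auto elim!: eventually_mono intro: scaleR_left_mono)
  show "a \<le> b \<Longrightarrow> 0 \<le> f \<Longrightarrow> a *\<^sub>R f \<le> b *\<^sub>R f"
    by transfer (auto elim!: eventually_mono intro: scaleR_right_mono)
qed

end


section \<open>Unbounded operators and semigroups\<close>

text \<open>
  An unbounded operator is a domain together with a total function whose values outside the
  domain are irrelevant.
\<close>

definition linear_on_domain :: "'x::real_vector set \<Rightarrow> ('x \<Rightarrow> 'y::real_vector) \<Rightarrow> bool" where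
  "linear_on_domain D A \<longleftrightarrow> subspace D \<and>
    (\<forall>x\<in>D. \<forall>y\<in>D. A (x + y) = A x + A y) \<and> (\<forall>c. \<forall>x\<in>D. A (c *\<^sub>R x) = c *\<^sub>R A x)"

definition operator_extends :: "'x set \<Rightarrow> ('x \<Rightarrow> 'x) \<Rightarrow> 'x set \<Rightarrow> ('x \<Rightarrow> 'x) \<Rightarrow> bool" where
  "operator_extends D' A' D A \<longleftrightarrow> D \<subseteq> D' \<and> (\<forall>x\<in>D. A' x = A x)"

definition resolvent :: "'x::real_normed_vector set \<Rightarrow> ('x \<Rightarrow> 'x) \<Rightarrow> real \<Rightarrow> 'x \<Rightarrow> 'x" where
  "resolvent D A \<mu> = inv_into D (\<lambda>x. \<mu> *\<^sub>R x - A x)"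

definition resolvent_set :: "'x::real_normed_vector set \<Rightarrow> ('x \<Rightarrow> 'x) \<Rightarrow> real set" where
  "resolvent_set D A =
    {\<mu>. bij_betw (\<lambda>x. \<mu> *\<^sub>R x - A x) D UNIV \<and> bounded_linear (resolvent D A \<mu>)}"

text \<open>
  One-parameter families are indexed by all reals, but only times \<open>t \<ge> 0\<close> are constrained.
\<close>

definition c0_semigroup :: "(real \<Rightarrow> 'x::real_normed_vector \<Rightarrow> 'x) \<Rightarrow> bool" where
  "c0_semigroup S \<longleftrightarrow>
    (\<forall>t\<ge>0. bounded_linear (S t)) \<and>
    (\<forall>x. S 0 x = x) \<and>
    (\<forall>s\<ge>0. \<forall>t\<ge>0. \<forall>x. S (s + t) x = S s (S t x)) \<and>
    (\<forall>x. ((\<lambda>t. S t x) \<longlongrightarrow> x) (at_right 0))"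

definition generator_domain :: "(real \<Rightarrow> 'x::real_normed_vector \<Rightarrow> 'x) \<Rightarrow> 'x set" where
  "generator_domain S = {x. \<exists>y. ((\<lambda>h. (S h x - x) /\<^sub>R h) \<longlongrightarrow> y) (at_right 0)}"

definition generator :: "(real \<Rightarrow> 'x::real_normed_vector \<Rightarrow> 'x) \<Rightarrow> 'x \<Rightarrow> 'x" where
  "generator S x = Lim (at_right 0) (\<lambda>h. (S h x - x) /\<^sub>R h)"

definition substochastic_semigroup ::
    "(real \<Rightarrow> 'x::{real_normed_vector, ordered_real_vector} \<Rightarrow> 'x) \<Rightarrow> bool" where
  "substochastic_semigroup S \<longleftrightarrow> c0_semigroup S \<and>
    (\<forall>t\<ge>0. \<forall>f\<ge>0. 0 \<le> S t f \<and> norm (S t f) \<le> norm f)"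


section \<open>Evolution families and their perturbations\<close>

definition evolution_family :: "(real \<Rightarrow> real \<Rightarrow> 'e::real_normed_vector \<Rightarrow> 'e) \<Rightarrow> bool" where
  "evolution_family U \<longleftrightarrow>
    (\<forall>t s. 0 \<le> s \<and> s \<le> t \<longrightarrow> bounded_linear (U t s)) \<and>
    (\<forall>u. continuous_on {(t, s). 0 \<le> s \<and> s \<le> t} (\<lambda>(t, s). U t s u)) \<and>
    (\<forall>t r s u. 0 \<le> s \<and> s \<le> r \<and> r \<le> t \<longrightarrow> U t s u = U t r (U r s u)) \<and>
    (\<forall>t\<ge>0. \<forall>u. U t t u = u) \<and>
    (\<exists>C>0. \<exists>\<beta>>0. \<forall>t s. 0 \<le> s \<and> s \<le> t \<longrightarrow> onorm (U t s) \<le> C * exp (\<beta> * (t - s)))"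

text \<open>
  In the perturbation terms, \<open>B r\<close> may be evaluated outside its domain, but (under the domain
  hypothesis on \<open>B\<close> and \<open>U\<close>) only for \<open>r\<close> in a null set, which does not affect the integral.
\<close>

primrec perturbation_term ::
    "(real \<Rightarrow> real \<Rightarrow> 'e::real_normed_vector \<Rightarrow> 'e) \<Rightarrow> (real \<Rightarrow> 'e \<Rightarrow> 'e) \<Rightarrow> nat \<Rightarrow>
     real \<Rightarrow> real \<Rightarrow> 'e \<Rightarrow> 'e" where
  "perturbation_term U B 0 = U"
| "perturbation_term U B (Suc n) = (\<lambda>t s u.
    bochner_integral (lebesgue_on {s..t}) (\<lambda>r. perturbation_term U B n t r (B r (U r s u))))"

definition perturbed_family ::
    "(real \<Rightarrow> real \<Rightarrow> 'e::real_normed_vector \<Rightarrow> 'e) \<Rightarrow> (real \<Rightarrow> 'e \<Rightarrow> 'e) \<Rightarrow>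
     real \<Rightarrow> real \<Rightarrow> 'e \<Rightarrow> 'e" where
  "perturbed_family U B t s u = (\<Sum>n. perturbation_term U B n t s u)"

text \<open>
  A change of the representative \<open>rep_L1 f\<close> on a null set changes the translated function below
  only on a null set, so the class does not depend on it.
\<close>

definition evolution_semigroup ::
    "(real \<Rightarrow> real \<Rightarrow> 'e::real_normed_vector \<Rightarrow> 'e) \<Rightarrow> real \<Rightarrow> 'e L1 \<Rightarrow> 'e L1" where
  "evolution_semigroup W t f =
    abs_L1 (\<lambda>s. if t \<le> s then W s (s - t) (rep_L1 f (s - t)) else 0)"

end

theory Submission
  imports Defs
begin

text \<open>
  Write \<open>R\<^sub>Z = (\<mu> - Z)\<inverse>\<close> and \<open>R\<^sub>G = (\<mu> - G)\<inverse>\<close> for the resolvents of the generators of the two evolution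
  semigroups. The whole theorem follows from one operator identity: there is a positive operator
  \<open>K \<mu>\<close> on the space of integrable functions with
  \<open>R\<^sub>G = R\<^sub>Z + R\<^sub>Z K + R\<^sub>Z K\<^sup>2 + \<dots>\<close> (\<open>res_series\<close>), hence \<open>R\<^sub>G = R\<^sub>Z + R\<^sub>G K\<close>. The latter says that
  \<open>R\<^sub>Z g = R\<^sub>G (g - K g)\<close>, so the domain of \<open>Z\<close> is contained in that of \<open>G\<close> and
  \<open>(G - Z) R\<^sub>Z = K\<close> (\<open>res_T0_in_domain\<close>); inserting this in the series gives the resolvent formula.

  The identity is found by computing resolvents as integral operators. For an evolution family
  \<open>W\<close> the resolvent of the generator of its evolution semigroup is
  \<open>(\<Lambda>\<^sub>W f)(s) = \<integral> exp (- \<mu> (s - r)) W(s, r) f(r) dr\<close> over \<open>0 \<le> r \<le> s\<close> (\<open>laplace_resolvent\<close>); the right-hand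
  side makes sense for every perturbation term \<open>V\<^sub>n\<close> as well. The defining recursion of \<open>V\<^sub>n\<close>
  and Fubini's theorem give \<open>\<Lambda>\<close> of \<open>V\<^sub>n\<^sub>+\<^sub>1\<close> as \<open>\<Lambda>\<close> of \<open>V\<^sub>n\<close> composed with \<open>K\<close> (\<open>laplace_Suc\<close>), where \<open>K\<close> is the
  integral operator with kernel \<open>exp (- \<mu> (s - r)) B(s) U(s, r)\<close>, and summation over \<open>n\<close> under the
  integral is dominated convergence (\<open>laplace_sums\<close>).

  Minimality uses the same algebra. If the generator of a substochastic semigroup \<open>S\<close> extends
  \<open>G\<close> restricted to the domain of \<open>Z\<close>, then \<open>R\<^sub>S = R\<^sub>Z + R\<^sub>S K\<close>, and iterating this,
  \<open>R\<^sub>S = R\<^sub>Z + R\<^sub>Z K + \<dots> + R\<^sub>Z K\<^sup>n + R\<^sub>S K\<^sup>n\<^sup>+\<^sup>1\<close>, where the last term is positive; so \<open>R\<^sub>S \<ge> R\<^sub>G\<close>, and the exponential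
  formula \<open>S(t) = lim ((n/t) R\<^sub>S(n/t))\<^sup>n\<close> carries the inequality over to the semigroups
  (\<open>semigroup_le_of_resolvent_le\<close>).

  Two facts about the cone and the perturbation terms make all this possible. By Baire's theorem a
  closed generating cone allows decompositions \<open>w = u - v\<close> with \<open>\<parallel>u\<parallel> + \<parallel>v\<parallel> \<le> M \<parallel>w\<parallel>\<close>
  (\<open>generating_closed_cone_decomposition\<close>), which turns every estimate on the cone into one on
  the whole space and passes to integrable functions. And on the cone
  \<open>\<parallel>V\<^sub>0 u\<parallel> + \<dots> + \<parallel>V\<^sub>n u\<parallel> \<le> \<parallel>u\<parallel>\<close> (\<open>good_Suc\<close>): the integral bound on \<open>B U\<close> says exactly that the mass lost by \<open>U\<close>
  is enough for all later terms. It yields the convergence of the series for \<open>V\<close>, and also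
  \<open>\<parallel>V(t, s) u - u\<parallel> \<le> 2 \<parallel>U(t, s) u - u\<parallel>\<close>, so that continuity and measurability of \<open>V\<^sub>n\<close> and \<open>V\<close> are inherited
  from the continuity of \<open>U\<close>.
\<close>

section \<open>Strong measurability\<close>

lemma strongly_measurableI:
  assumes "\<And>i::nat. simple_function M (s i)" "AE x in M. (\<lambda>i. s i x) \<longlonglongrightarrow> f x"
  shows "strongly_measurable M f"
  using assms unfolding strongly_measurable_def by (intro exI[of _ s]) auto

lemma strongly_measurable_AE_cong:
  assumes "strongly_measurable M f" "AE x in M. f x = g x"
  shows "strongly_measurable M g"
proof -
  obtain s where s: "\<And>i::nat. simple_function M (s i)" "AE x in M. (\<lambda>i. s i x) \<longlonglongrightarrow> f x"
    using assms(1) unfolding strongly_measurable_def by blast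
  from s(2) assms(2) have "AE x in M. (\<lambda>i. s i x) \<longlonglongrightarrow> g x"
    by eventually_elim simp
  with s(1) show ?thesis by (rule strongly_measurableI)
qed

lemma simple_function_lebesgue:
  "simple_function lborel f \<Longrightarrow> simple_function lebesgue f"
  by (auto simp: simple_function_def)

lemma strongly_measurable_lebesgue_iff:
  "strongly_measurable lebesgue f \<longleftrightarrow> strongly_measurable lborel f"
proof
  assume "strongly_measurable lebesgue f"
  then obtain s where s: "\<And>i::nat. simple_function lebesgue (s i)" "AE x in lebesgue. (\<lambda>i. s i x) \<longlonglongrightarrow> f x"
    unfolding strongly_measurable_def by blast
  have "\<forall>i. \<exists>t. simple_function lborel t \<and> (AE x in lborel. s i x = t x)"
    using completion_ex_simple_function[OF s(1)] by blast
  then obtain t where t: "\<And>i. simple_function lborel (t i)" "\<And>i. AE x in lborel. s i x = t i x"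
    by metis
  have "AE x in lborel. \<forall>i. s i x = t i x"
    using t(2) by (simp add: AE_all_countable)
  moreover have "AE x in lborel. (\<lambda>i. s i x) \<longlonglongrightarrow> f x"
    using s(2) by (simp add: AE_completion_iff)
  ultimately have "AE x in lborel. (\<lambda>i. t i x) \<longlonglongrightarrow> f x"
    by eventually_elim simp
  with t(1) show "strongly_measurable lborel f"
    by (rule strongly_measurableI)
next
  assume "strongly_measurable lborel f"
  then obtain s where s: "\<And>i::nat. simple_function lborel (s i)" "AE x in lborel. (\<lambda>i. s i x) \<longlonglongrightarrow> f x"
    unfolding strongly_measurable_def by blast
  have "AE x in lebesgue. (\<lambda>i. s i x) \<longlonglongrightarrow> f x"
    using s(2) by (simp only: AE_completion_iff)
  with simple_function_lebesgue[OF s(1)] show "strongly_measurable lebesgue f"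
    by (rule strongly_measurableI)
qed

text \<open>
  Restrictions of Lebesgue measure are treated throughout by extending functions by zero, so that
  all integrals are taken over the whole space.
\<close>

lemma simple_function_restrict_iff:
  assumes S: "S \<in> sets lebesgue"
  shows "simple_function (lebesgue_on S) f \<longleftrightarrow> simple_function lebesgue (\<lambda>x. if x \<in> S then f x else 0)"
    (is "_ \<longleftrightarrow> simple_function _ ?g")
proof
  assume f: "simple_function (lebesgue_on S) f"
  have fin: "finite (?g ` UNIV)"
    by (rule finite_subset[of _ "insert 0 (f ` S)"])
       (use f in \<open>auto simp: simple_function_def\<close>)
  have "?g -` {y} \<in> sets lebesgue" for y
  proof -
    have "f -` {y} \<inter> S \<in> sets lebesgue"
    proof (cases "y \<in> f ` S")
      case True
      then show ?thesis
        using f S by (auto simp: simple_function_def sets_restrict_space_iff)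
    next
      case False
      then have "f -` {y} \<inter> S = {}" by auto
      then show ?thesis by (metis sets.empty_sets)
    qed
    moreover have "?g -` {y} = (if y = 0 then (f -` {y} \<inter> S) \<union> - S else f -` {y} \<inter> S)"
      by (auto split: if_splits)
    moreover have "- S \<in> sets lebesgue"
      using S sets.compl_sets[OF S] by (simp add: Compl_eq_Diff_UNIV)
    ultimately show ?thesis by auto
  qed
  with fin show "simple_function lebesgue ?g"
    by (auto simp: simple_function_def)
next
  assume g: "simple_function lebesgue ?g"
  have "finite (?g ` UNIV)" "\<And>y. y \<in> range ?g \<Longrightarrow> ?g -` {y} \<in> sets lebesgue"
    using g unfolding simple_function_def by simp_all
  note gg = this
  have 1: "f ` S \<subseteq> range ?g" by auto
  have "f -` {y} \<inter> S \<in> sets lebesgue" if "y \<in> f ` S" for y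
  proof -
    have "?g -` {y} \<in> sets lebesgue" using gg(2) that 1 by blast
    then have "?g -` {y} \<inter> S \<in> sets lebesgue" using S by blast
    moreover have "?g -` {y} \<inter> S = f -` {y} \<inter> S" by auto
    ultimately show ?thesis by simp
  qed
  then show "simple_function (lebesgue_on S) f"
    using gg(1) 1 S
    by (auto simp: simple_function_def sets_restrict_space_iff intro: finite_subset)
qed

lemma AE_lebesgue_on_iff:
  assumes S: "S \<in> sets lebesgue"
  shows "(AE x in lebesgue_on S. P x) \<longleftrightarrow> (AE x in lebesgue. x \<in> S \<longrightarrow> P x)"
  using S by (subst AE_restrict_space_iff) auto

lemma strongly_measurable_restrict_iff:
  assumes S: "S \<in> sets lebesgue"
  shows "strongly_measurable (lebesgue_on S) f \<longleftrightarrow>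
    strongly_measurable lebesgue (\<lambda>x. if x \<in> S then f x else 0)"
proof
  assume "strongly_measurable (lebesgue_on S) f"
  then obtain s where s: "\<And>i::nat. simple_function (lebesgue_on S) (s i)"
      "AE x in lebesgue. x \<in> S \<longrightarrow> (\<lambda>i. s i x) \<longlonglongrightarrow> f x"
    unfolding strongly_measurable_def AE_lebesgue_on_iff[OF S] by blast
  have "AE x in lebesgue. (\<lambda>i. if x \<in> S then s i x else 0) \<longlonglongrightarrow> (if x \<in> S then f x else 0)"
    using s(2) by eventually_elim auto
  with s(1) show "strongly_measurable lebesgue (\<lambda>x. if x \<in> S then f x else 0)"
    unfolding simple_function_restrict_iff[OF S]
    by (rule strongly_measurableI)
next
  assume "strongly_measurable lebesgue (\<lambda>x. if x \<in> S then f x else 0)"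
  then obtain s where s: "\<And>i::nat. simple_function lebesgue (s i)"
      "AE x in lebesgue. (\<lambda>i. s i x) \<longlonglongrightarrow> (if x \<in> S then f x else 0)"
    unfolding strongly_measurable_def by blast
  have "simple_function (lebesgue_on S) (s i)" for i
    unfolding simple_function_restrict_iff[OF S]
    using S s(1) by (intro simple_function_If_set) auto
  moreover have "AE x in lebesgue_on S. (\<lambda>i. s i x) \<longlonglongrightarrow> f x"
    unfolding AE_lebesgue_on_iff[OF S] using s(2) by eventually_elim auto
  ultimately show "strongly_measurable (lebesgue_on S) f"
    by (rule strongly_measurableI)
qed

lemma borel_measurable_norm_strongly_measurable:
  "strongly_measurable lebesgue f \<Longrightarrow> (\<lambda>x. norm (f x)) \<in> borel_measurable lebesgue"
  using strongly_measurable_norm[of UNIV f] by (simp add: lebesgue_on_UNIV_eq)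

lemma strongly_measurable_diff:
  assumes "strongly_measurable M f" "strongly_measurable M g"
  shows "strongly_measurable M (\<lambda>x. f x - g x)"
  using strongly_measurable_add[OF assms(1) strongly_measurable_scaleR[OF assms(2), of "-1"]] by simp

lemma strongly_measurable_sum:
  assumes "\<And>i. i \<in> I \<Longrightarrow> strongly_measurable M (f i)"
  shows "strongly_measurable M (\<lambda>x. \<Sum>i\<in>I. f i x)"
  using assms
  by (induction I rule: infinite_finite_induct)
     (auto intro: strongly_measurable_add strongly_measurable_const)

lemma strongly_measurable_simple: "simple_function M f \<Longrightarrow> strongly_measurable M f"
  unfolding strongly_measurable_def by (intro exI[of _ "\<lambda>i. f"]) auto

lemma strongly_measurable_If_zero:
  assumes "strongly_measurable lebesgue f" "A \<in> sets lebesgue"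
  shows "strongly_measurable lebesgue (\<lambda>x. if x \<in> A then f x else 0)"
proof -
  obtain s where s: "\<And>i::nat. simple_function lebesgue (s i)" "AE x in lebesgue. (\<lambda>i. s i x) \<longlonglongrightarrow> f x"
    using assms(1) unfolding strongly_measurable_def by blast
  have "simple_function lebesgue (\<lambda>x. if x \<in> A then s i x else 0)" for i
    using s(1) assms(2) by (intro simple_function_If_set) auto
  moreover have "AE x in lebesgue. (\<lambda>i. if x \<in> A then s i x else 0) \<longlonglongrightarrow> (if x \<in> A then f x else 0)"
    using s(2) by eventually_elim auto
  ultimately show ?thesis by (rule strongly_measurableI)
qed

lemma strongly_measurable_scaleR_fun:
  assumes c: "c \<in> borel_measurable lebesgue" and f: "strongly_measurable lebesgue f"
  shows "strongly_measurable lebesgue (\<lambda>x. (c x :: real) *\<^sub>R f x)"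
proof -
  obtain s where s: "\<And>i::nat. simple_function lebesgue (s i)" "AE x in lebesgue. (\<lambda>i. s i x) \<longlonglongrightarrow> f x"
    using f unfolding strongly_measurable_def by blast
  obtain t where t: "\<And>i::nat. simple_function lebesgue (t i)"
      "\<And>x. x \<in> space lebesgue \<Longrightarrow> (\<lambda>i. t i x) \<longlonglongrightarrow> c x"
    using borel_measurable_implies_sequence_metric[OF c, of 0] by blast
  have "AE x in lebesgue. (\<lambda>i. t i x *\<^sub>R s i x) \<longlonglongrightarrow> c x *\<^sub>R f x"
    using s(2) by eventually_elim (rule tendsto_scaleR[OF t(2)], simp_all)
  moreover have "simple_function lebesgue (\<lambda>x. t i x *\<^sub>R s i x)" for i
    using t(1) s(1) by (rule simple_function_compose2)
  ultimately show ?thesis by (intro strongly_measurableI[where s="\<lambda>i x. t i x *\<^sub>R s i x"]) auto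
qed

text \<open>
  Each \<open>f i\<close> is replaced by a simple function \<open>t i\<close> that is close to it in the distance
  \<open>\<integral> min(1, \<parallel>f - g\<parallel>) w\<close> of convergence in measure, for an integrable weight \<open>w > 0\<close>. With distances bounded by
  \<open>2\<^sup>-\<^sup>i\<close> the sum of the integrands is finite almost everywhere, so \<open>f i - t i\<close> tends to zero.
\<close>

lemma strongly_measurable_lim:
  fixes f :: "nat \<Rightarrow> 'a::euclidean_space \<Rightarrow> 'b::real_normed_vector"
  assumes f: "\<And>i. strongly_measurable lebesgue (f i)"
    and lim: "AE x in lebesgue. (\<lambda>i. f i x) \<longlonglongrightarrow> g x"
  shows "strongly_measurable lebesgue g"
proof -
  obtain w :: "'a \<Rightarrow> ennreal" where w0: "w \<in> borel_measurable lborel" "integral\<^sup>N lborel w \<noteq> \<infinity>"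
      and w1: "\<forall>x\<in>space lborel. 0 < w x \<and> w x < \<infinity>"
    using sigma_finite_measure.Ex_finite_integrable_function[OF lborel.sigma_finite_measure_axioms] by blast
  \<comment> \<open>the weight, in a form that is convenient in the reals\<close>
  define h where "h x = enn2real (w x)" for x
  have h: "h x > 0" "ennreal (h x) = w x" for x
    using w1[rule_format, of x] by (auto simp: h_def enn2real_positive_iff less_top)
  have wl: "w \<in> borel_measurable lebesgue" using w0(1) by (rule measurable_completion)
  then have hl [measurable]: "h \<in> borel_measurable lebesgue" unfolding h_def by measurable
  have "\<exists>t. simple_function lebesgue t \<and> (\<integral>\<^sup>+x. ennreal (min 1 (norm (f i x - t x)) * h x) \<partial>lebesgue) < ennreal ((1/2)^i)" for i
  proof -
    obtain s where s: "\<And>j::nat. simple_function lebesgue (s j)" "AE x in lebesgue. (\<lambda>j. s j x) \<longlonglongrightarrow> f i x"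
      using f[of i] unfolding strongly_measurable_def by blast
    have [measurable]: "(\<lambda>x. norm (f i x - s j x)) \<in> borel_measurable lebesgue" for j
      by (intro borel_measurable_norm_strongly_measurable strongly_measurable_diff f
          strongly_measurable_simple s)
    have "(\<lambda>j. \<integral>\<^sup>+x. ennreal (min 1 (norm (f i x - s j x)) * h x) \<partial>lebesgue) \<longlonglongrightarrow> (\<integral>\<^sup>+x. 0 \<partial>(lebesgue::'a measure))"
    proof (rule nn_integral_dominated_convergence[where w=w])
      show "AE x in lebesgue. ennreal (min 1 (norm (f i x - s j x)) * h x) \<le> w x" for j
      proof (rule AE_I2)
        fix x
        have "min 1 (norm (f i x - s j x)) * h x \<le> 1 * h x"
          using h(1)[of x] by (intro mult_right_mono) auto
        then show "ennreal (min 1 (norm (f i x - s j x)) * h x) \<le> w x"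
          unfolding h(2)[symmetric] by (intro ennreal_leI) simp
      qed
      show "integral\<^sup>N lebesgue w < \<infinity>" using w0(2) by (simp add: nn_integral_completion less_top)
      show "AE x in lebesgue. (\<lambda>j. ennreal (min 1 (norm (f i x - s j x)) * h x)) \<longlonglongrightarrow> 0"
        using s(2)
      proof eventually_elim
        case (elim x)
        have "(\<lambda>j. min 1 (norm (f i x - s j x)) * h x) \<longlonglongrightarrow> min 1 (norm (f i x - f i x)) * h x"
          by (intro tendsto_intros elim)
        then have "(\<lambda>j. ennreal (min 1 (norm (f i x - s j x)) * h x)) \<longlonglongrightarrow> ennreal (min 1 (norm (f i x - f i x)) * h x)"
          by (intro tendsto_ennrealI)
        then show ?case by simp
      qed
    qed (use wl in auto)
    then have "\<forall>\<^sub>F j in sequentially. (\<integral>\<^sup>+x. ennreal (min 1 (norm (f i x - s j x)) * h x) \<partial>lebesgue) < ennreal ((1/2)^i)"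
      by (intro order_tendstoD) auto
    then show ?thesis using s(1) by (auto simp: eventually_sequentially)
  qed
  then obtain t where t: "\<And>i. simple_function lebesgue (t i)"
      "\<And>i. (\<integral>\<^sup>+x. ennreal (min 1 (norm (f i x - t i x)) * h x) \<partial>lebesgue) < ennreal ((1/2)^i)"
    by metis
  have [measurable]: "(\<lambda>x. norm (f i x - t i x)) \<in> borel_measurable lebesgue" for i
    by (intro borel_measurable_norm_strongly_measurable strongly_measurable_diff f
        strongly_measurable_simple t)
  have "(\<integral>\<^sup>+x. (\<Sum>i. ennreal (min 1 (norm (f i x - t i x)) * h x)) \<partial>lebesgue)
      = (\<Sum>i. \<integral>\<^sup>+x. ennreal (min 1 (norm (f i x - t i x)) * h x) \<partial>lebesgue)"
    by (rule nn_integral_suminf) measurable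
  also have "\<dots> \<le> (\<Sum>i. ennreal ((1/2)^i))"
    by (intro suminf_le less_imp_le t(2)) auto
  also have "\<dots> = ennreal (\<Sum>i. (1/2)^i)"
    by (intro suminf_ennreal2) (auto intro: summable_geometric)
  finally have fin: "(\<integral>\<^sup>+x. (\<Sum>i. ennreal (min 1 (norm (f i x - t i x)) * h x)) \<partial>lebesgue) \<noteq> \<infinity>"
    by (auto simp: top_unique)
  have "AE x in lebesgue. (\<Sum>i. ennreal (min 1 (norm (f i x - t i x)) * h x)) \<noteq> \<infinity>"
    by (rule nn_integral_PInf_AE[OF _ fin]) measurable
  with lim have "AE x in lebesgue. (\<lambda>i. t i x) \<longlonglongrightarrow> g x"
  proof eventually_elim
    case (elim x)
    have "summable (\<lambda>i. min 1 (norm (f i x - t i x)) * h x)"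
      using elim(2) h(1)[of x] by (intro summable_suminf_not_top) auto
    then have "(\<lambda>i. min 1 (norm (f i x - t i x)) * h x / h x) \<longlonglongrightarrow> 0 / h x"
      by (intro tendsto_divide tendsto_const summable_LIMSEQ_zero) (use h(1)[of x] in auto)
    then have *: "(\<lambda>i. min 1 (norm (f i x - t i x))) \<longlonglongrightarrow> 0"
      using h(1)[of x] by simp
    then have "\<forall>\<^sub>F i in sequentially. min 1 (norm (f i x - t i x)) < 1"
      by (intro order_tendstoD) auto
    then have "\<forall>\<^sub>F i in sequentially. min 1 (norm (f i x - t i x)) = norm (f i x - t i x)"
      by eventually_elim auto
    with * have "(\<lambda>i. norm (f i x - t i x)) \<longlonglongrightarrow> 0"
      by (rule Lim_transform_eventually)
    then have "(\<lambda>i. f i x - t i x) \<longlonglongrightarrow> 0" by (rule tendsto_norm_zero_cancel)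
    from tendsto_diff[OF elim(1) this] show ?case by simp
  qed
  with t(1) show ?thesis by (rule strongly_measurableI)
qed

text \<open>
  For simple \<open>g\<close> the function \<open>W x (g x)\<close> is a finite sum of restrictions of the functions \<open>W x w\<close>; the
  general case is a limit because each \<open>W x\<close> is continuous.
\<close>

lemma strongly_measurable_apply:
  fixes W :: "'a::euclidean_space \<Rightarrow> 'b::real_normed_vector \<Rightarrow> 'c::real_normed_vector"
  assumes S: "S \<in> sets lebesgue"
    and lin: "\<And>x. x \<in> S \<Longrightarrow> bounded_linear (W x)"
    and W: "\<And>w. strongly_measurable lebesgue (\<lambda>x. if x \<in> S then W x w else 0)"
    and g: "strongly_measurable lebesgue g"
  shows "strongly_measurable lebesgue (\<lambda>x. if x \<in> S then W x (g x) else 0)"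
proof -
  obtain s where s: "\<And>i::nat. simple_function lebesgue (s i)" "AE x in lebesgue. (\<lambda>i. s i x) \<longlonglongrightarrow> g x"
    using g unfolding strongly_measurable_def by blast
  have "strongly_measurable lebesgue (\<lambda>x. if x \<in> S then W x (s i x) else 0)" for i
  proof -
    have fin: "finite (range (s i))" using s(1)[of i] by (auto simp: simple_function_def)
    have "(\<lambda>x. if x \<in> S then W x (s i x) else 0) =
       (\<lambda>x. \<Sum>y\<in>range (s i). if x \<in> s i -` {y} then (if x \<in> S then W x y else 0) else 0)"
    proof
      fix x
      have "(\<Sum>y\<in>range (s i). if x \<in> s i -` {y} then (if x \<in> S then W x y else 0) else 0)
         = (\<Sum>y\<in>range (s i). if y = s i x then (if x \<in> S then W x y else 0) else 0)"
        by (rule sum.cong) auto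
      also have "\<dots> = (if x \<in> S then W x (s i x) else 0)"
        using fin by (subst sum.delta) auto
      finally show "(if x \<in> S then W x (s i x) else 0) =
        (\<Sum>y\<in>range (s i). if x \<in> s i -` {y} then (if x \<in> S then W x y else 0) else 0)" ..
    qed
    moreover have "s i -` {y} \<in> sets lebesgue" if "y \<in> range (s i)" for y
      using s(1)[of i] that by (auto simp: simple_function_def)
    ultimately show ?thesis
      by (simp only:) (intro strongly_measurable_sum strongly_measurable_If_zero W)
  qed
  moreover have "AE x in lebesgue. (\<lambda>i. if x \<in> S then W x (s i x) else 0) \<longlonglongrightarrow> (if x \<in> S then W x (g x) else 0)"
    using s(2) by eventually_elim (auto intro: bounded_linear.tendsto[OF lin])
  ultimately show ?thesis by (rule strongly_measurable_lim)
qed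

text \<open>
  Simple functions approximating the identity from above. Evaluating a right-continuous
  function at these points exhibits it as a limit of simple functions; truncation to \<open>\<bar>x\<bar> \<le> k\<close> makes the
  range finite.
\<close>

definition right_dyadic :: "nat \<Rightarrow> real \<Rightarrow> real" where
  "right_dyadic k x = (if \<bar>x\<bar> \<le> real k then (of_int \<lfloor>2^k * x\<rfloor> + 1) / 2^k else 0)"

lemma simple_function_right_dyadic: "simple_function borel (right_dyadic k)"
proof (rule simple_function_borel_measurable)
  show "right_dyadic k \<in> borel_measurable borel"
    unfolding right_dyadic_def by measurable
  let ?I = "{- int (2^k * k)..int (2^k * k)}"
  have "right_dyadic k ` space borel \<subseteq> insert 0 ((\<lambda>j. (of_int j + 1) / 2^k) ` ?I)"
  proof
    fix y assume "y \<in> right_dyadic k ` space borel"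
    then obtain x where y: "y = right_dyadic k x" by auto
    show "y \<in> insert 0 ((\<lambda>j. (of_int j + 1) / 2^k) ` ?I)"
    proof (cases "\<bar>x\<bar> \<le> real k")
      case False then show ?thesis by (simp add: y right_dyadic_def)
    next
      case True
      have "2^k * x \<le> 2^k * real k" "2^k * (- real k) \<le> 2^k * x"
        using True by (intro mult_left_mono; simp add: abs_le_iff)+
      then have "of_int \<lfloor>2^k * x\<rfloor> \<le> (of_int (int (2^k * k)) :: real)"
          "(of_int (- int (2^k * k)) :: real) \<le> 2^k * x"
        by (simp_all, linarith)
      then have "\<lfloor>2^k * x\<rfloor> \<in> ?I"
        by (simp only: atLeastAtMost_iff le_floor_iff of_int_le_iff)
    then show ?thesis using True by (auto simp: y right_dyadic_def)
    qed
  qed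
  then show "finite (right_dyadic k ` space borel)"
    by (rule finite_subset) auto
qed

lemma right_dyadic_bounds:
  assumes "\<bar>x\<bar> \<le> real k"
  shows "x \<le> right_dyadic k x" "right_dyadic k x \<le> x + 1 / 2^k"
proof -
  have "2^k * x \<le> of_int \<lfloor>2^k * x\<rfloor> + 1" "of_int \<lfloor>2^k * x\<rfloor> \<le> 2^k * x" by linarith+
  then show "x \<le> right_dyadic k x" "right_dyadic k x \<le> x + 1 / 2^k"
    using assms by (auto simp: right_dyadic_def field_simps)
qed

lemma eventually_le_real: "\<forall>\<^sub>F k in sequentially. \<bar>x\<bar> \<le> real k"
proof -
  obtain n where "\<bar>x\<bar> \<le> real n" using real_arch_simple by blast
  then show ?thesis by (auto intro!: eventually_sequentiallyI[of n])
qed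

lemma right_dyadic_ge: "\<forall>\<^sub>F k in sequentially. x \<le> right_dyadic k x"
  using eventually_le_real[of x] by eventually_elim (rule right_dyadic_bounds)

lemma right_dyadic_mono: "x \<le> y \<Longrightarrow> \<forall>\<^sub>F k in sequentially. right_dyadic k x \<le> right_dyadic k y"
  using eventually_le_real[of x] eventually_le_real[of y]
  by eventually_elim (auto simp: right_dyadic_def divide_right_mono floor_mono)

lemma right_dyadic_tendsto: "(\<lambda>k. right_dyadic k x) \<longlonglongrightarrow> x"
proof (rule tendsto_sandwich[where f="\<lambda>k. x" and h="\<lambda>k. x + 1 / 2^k"])
  show "\<forall>\<^sub>F k in sequentially. right_dyadic k x \<le> x + 1 / 2^k"
    using eventually_le_real[of x] by eventually_elim (rule right_dyadic_bounds)
  have "(\<lambda>k. x + (1/2)^k) \<longlonglongrightarrow> x + 0"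
    by (intro tendsto_intros LIMSEQ_realpow_zero) auto
  then show "(\<lambda>k. x + 1 / 2^k) \<longlonglongrightarrow> x" by (simp add: power_divide)
qed (use right_dyadic_ge in auto)

text \<open>
  Pulling \<open>g\<close> back along simple functions \<open>a k\<close> produces simple functions whatever \<open>g\<close> is. Hence
  right-continuous functions are strongly measurable even when the target space is not separable.
\<close>

lemma strongly_measurable_simple_limit:
  assumes S: "S \<in> sets lebesgue"
    and a: "\<And>k::nat. simple_function lebesgue (a k)"
    and lim: "AE x in lebesgue. x \<in> S \<longrightarrow> (\<lambda>k. g (a k x)) \<longlonglongrightarrow> h x"
  shows "strongly_measurable lebesgue (\<lambda>x. if x \<in> S then h x else 0)"
proof -
  have "simple_function lebesgue (\<lambda>x. if x \<in> S then g (a k x) else 0)" for k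
    using S a by (intro simple_function_If_set simple_function_compose1[of lebesgue "a k" g]) auto
  moreover have "AE x in lebesgue. (\<lambda>k. if x \<in> S then g (a k x) else 0) \<longlonglongrightarrow> (if x \<in> S then h x else 0)"
    using lim by eventually_elim auto
  ultimately show ?thesis by (rule strongly_measurableI)
qed

section \<open>The Bochner integral with respect to Lebesgue measure\<close>

abbreviation smeas :: "('a::euclidean_space \<Rightarrow> 'b::real_normed_vector) \<Rightarrow> bool" where
  "smeas \<equiv> strongly_measurable lebesgue"

abbreviation bintegrable :: "('a::euclidean_space \<Rightarrow> 'b::real_normed_vector) \<Rightarrow> bool" where
  "bintegrable \<equiv> bochner_integrable lebesgue"

abbreviation bint :: "('a::euclidean_space \<Rightarrow> 'b::real_normed_vector) \<Rightarrow> 'b" where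
  "bint \<equiv> bochner_integral lebesgue"

abbreviation sbi :: "('a::euclidean_space \<Rightarrow> 'b::real_normed_vector) \<Rightarrow> bool" where
  "sbi \<equiv> Bochner_Integration.simple_bochner_integrable lebesgue"

abbreviation sint :: "('a::euclidean_space \<Rightarrow> 'b::real_normed_vector) \<Rightarrow> 'b" where
  "sint \<equiv> Bochner_Integration.simple_bochner_integral lebesgue"

lemma smeas_sbi: "sbi s \<Longrightarrow> smeas s"
  by (auto elim: simple_bochner_integrable.cases intro: strongly_measurable_simple)

lemma smeas_bintegrable: "bintegrable f \<Longrightarrow> smeas f"
  by (simp add: bochner_integrable_def)

lemmas norm_measurable = borel_measurable_norm_strongly_measurable

lemma nn_integral_norm_triangle:
  assumes "smeas f" "smeas g"
  shows "(\<integral>\<^sup>+x. ennreal (norm (f x + g x)) \<partial>lebesgue) \<le>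
    (\<integral>\<^sup>+x. ennreal (norm (f x)) \<partial>lebesgue) + (\<integral>\<^sup>+x. ennreal (norm (g x)) \<partial>lebesgue)"
proof -
  have "(\<integral>\<^sup>+x. ennreal (norm (f x + g x)) \<partial>lebesgue) \<le>
     (\<integral>\<^sup>+x. ennreal (norm (f x)) + ennreal (norm (g x)) \<partial>lebesgue)"
    by (intro nn_integral_mono) (simp flip: ennreal_plus add: norm_triangle_ineq)
  also have "\<dots> = (\<integral>\<^sup>+x. ennreal (norm (f x)) \<partial>lebesgue) + (\<integral>\<^sup>+x. ennreal (norm (g x)) \<partial>lebesgue)"
    using assms by (intro nn_integral_add measurable_compose[OF norm_measurable]) auto
  finally show ?thesis .
qed

lemma nn_integral_norm_triangle_diff:
  assumes "smeas f" "smeas g" "smeas h"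
  shows "(\<integral>\<^sup>+x. ennreal (norm (f x - g x)) \<partial>lebesgue) \<le>
    (\<integral>\<^sup>+x. ennreal (norm (h x - f x)) \<partial>lebesgue) + (\<integral>\<^sup>+x. ennreal (norm (h x - g x)) \<partial>lebesgue)"
  using nn_integral_norm_triangle[of "\<lambda>x. f x - h x" "\<lambda>x. h x - g x"] assms
  by (simp add: strongly_measurable_diff norm_minus_commute)

lemma bintegrable_bound:
  assumes "smeas f" "AE x in lebesgue. ennreal (norm (f x)) \<le> g x" "(\<integral>\<^sup>+x. g x \<partial>lebesgue) < \<infinity>"
  shows "bintegrable f"
  using assms(1) le_less_trans[OF nn_integral_mono_AE[OF assms(2)] assms(3)]
  by (simp add: bochner_integrable_def)

lemma bintegrable_add:
  assumes "bintegrable f" "bintegrable g"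
  shows "bintegrable (\<lambda>x. f x + g x)"
proof -
  have "(\<integral>\<^sup>+x. ennreal (norm (f x + g x)) \<partial>lebesgue) < \<infinity>"
    using nn_integral_norm_triangle[of f g] assms
    by (auto simp: bochner_integrable_def intro: le_less_trans)
  then show ?thesis using assms by (simp add: bochner_integrable_def strongly_measurable_add)
qed

lemma bintegrable_linear:
  assumes f: "bintegrable f" and T: "bounded_linear T"
  shows "bintegrable (\<lambda>x. T (f x))"
proof -
  interpret T: bounded_linear T by fact
  obtain K where K: "K > 0" "\<And>x. norm (T x) \<le> norm x * K" using T.pos_bounded by blast
  have sm: "smeas (\<lambda>x. T (f x))"
    using strongly_measurable_apply[of UNIV "\<lambda>x. T" f] f T
    by (simp add: strongly_measurable_const smeas_bintegrable)
  have nm: "(\<lambda>x. norm (f x)) \<in> borel_measurable lebesgue" using f by (simp add: norm_measurable smeas_bintegrable)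
  show ?thesis
  proof (rule bintegrable_bound[OF sm])
    show "AE x in lebesgue. ennreal (norm (T (f x))) \<le> ennreal K * ennreal (norm (f x))"
      using K by (auto simp: mult.commute simp flip: ennreal_mult intro!: ennreal_leI)
    show "(\<integral>\<^sup>+x. ennreal K * ennreal (norm (f x)) \<partial>lebesgue) < \<infinity>"
      using f nm by (subst nn_integral_cmult) (auto simp: bochner_integrable_def ennreal_mult_less_top)
  qed
qed

lemma bintegrable_scaleR: "bintegrable f \<Longrightarrow> bintegrable (\<lambda>x. c *\<^sub>R f x)"
  by (rule bintegrable_linear[OF _ bounded_linear_scaleR_right])

lemma bintegrable_diff:
  assumes "bintegrable f" "bintegrable g"
  shows "bintegrable (\<lambda>x. f x - g x)"
  using bintegrable_add[OF assms(1) bintegrable_scaleR[OF assms(2), of "-1"]] by simp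

lemma bintegrable_AE_cong:
  assumes "bintegrable f" "AE x in lebesgue. f x = g x"
  shows "bintegrable g"
proof -
  have "(\<integral>\<^sup>+x. ennreal (norm (f x)) \<partial>lebesgue) = (\<integral>\<^sup>+x. ennreal (norm (g x)) \<partial>lebesgue)"
    using assms(2) by (intro nn_integral_cong_AE) auto
  then show ?thesis
    using assms strongly_measurable_AE_cong[of lebesgue f g] by (simp add: bochner_integrable_def)
qed

lemma sbi_imp_bintegrable:
  assumes "sbi s" shows "bintegrable s"
proof -
  have "sbi (\<lambda>x. norm (s x))"
    using assms simple_bochner_integrable_compose2[of "\<lambda>x y. norm x", OF _ assms assms] by simp
  from simple_bochner_integral_eq_nn_integral[OF this]
  have "(\<integral>\<^sup>+x. ennreal (norm (s x)) \<partial>lebesgue) < \<infinity>"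
    by (metis ennreal_less_top infinity_ennreal_def norm_ge_zero)
  then show ?thesis by (simp add: bochner_integrable_def smeas_sbi[OF assms])
qed

lemma norm_sint_le:
  assumes "sbi s" shows "ennreal (norm (sint s)) \<le> (\<integral>\<^sup>+x. ennreal (norm (s x)) \<partial>lebesgue)"
proof -
  have *: "sbi (\<lambda>x. norm (s x))"
    using assms simple_bochner_integrable_compose2[of "\<lambda>x y. norm x", OF _ assms assms] by simp
  have "ennreal (norm (sint s)) \<le> ennreal (sint (\<lambda>x. norm (s x)))"
    by (intro ennreal_leI simple_bochner_integral_norm_bound assms)
  also have "\<dots> = (\<integral>\<^sup>+x. ennreal (norm (s x)) \<partial>lebesgue)"
    by (rule simple_bochner_integral_eq_nn_integral[OF *]) simp
  finally show ?thesis .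
qed

lemma sbi_diff: "sbi s \<Longrightarrow> sbi t \<Longrightarrow> sbi (\<lambda>x. s x - t x)"
  by (rule simple_bochner_integrable_compose2) auto

lemma sbi_add: "sbi s \<Longrightarrow> sbi t \<Longrightarrow> sbi (\<lambda>x. s x + t x)"
  by (rule simple_bochner_integrable_compose2) auto

lemma sint_dist_le:
  assumes "smeas f" "sbi s" "sbi t"
  shows "ennreal (norm (sint s - sint t)) \<le>
    (\<integral>\<^sup>+x. ennreal (norm (f x - s x)) \<partial>lebesgue) + (\<integral>\<^sup>+x. ennreal (norm (f x - t x)) \<partial>lebesgue)"
proof -
  have "ennreal (norm (sint s - sint t)) = ennreal (norm (sint (\<lambda>x. s x - t x)))"
    using assms by (simp add: simple_bochner_integral_diff)
  also have "\<dots> \<le> (\<integral>\<^sup>+x. ennreal (norm (s x - t x)) \<partial>lebesgue)"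
    by (intro norm_sint_le sbi_diff assms)
  also have "\<dots> \<le> (\<integral>\<^sup>+x. ennreal (norm (f x - s x)) \<partial>lebesgue) + (\<integral>\<^sup>+x. ennreal (norm (f x - t x)) \<partial>lebesgue)"
    by (intro nn_integral_norm_triangle_diff smeas_sbi assms)
  finally show ?thesis .
qed

text \<open>
  Approximating simple functions are set to zero where they exceed \<open>2 \<parallel>f\<parallel>\<close>. This costs nothing in
  the limit, since almost everywhere the bound holds eventually (or \<open>f\<close> vanishes), and it provides the
  dominating function.
\<close>

lemma bintegrable_simple_approx:
  fixes f :: "'a::euclidean_space \<Rightarrow> 'b::real_normed_vector"
  assumes f: "bintegrable f"
  obtains s where "\<And>i::nat. sbi (s i)" "\<And>i x. norm (s i x) \<le> 2 * norm (f x)"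
    "AE x in lebesgue. (\<lambda>i. s i x) \<longlonglongrightarrow> f x"
    "(\<lambda>i. \<integral>\<^sup>+x. ennreal (norm (f x - s i x)) \<partial>lebesgue) \<longlonglongrightarrow> 0"
proof -
  have sm: "smeas f" and fin: "(\<integral>\<^sup>+x. ennreal (norm (f x)) \<partial>lebesgue) < \<infinity>"
    using f by (auto simp: bochner_integrable_def)
  obtain u where u: "\<And>i::nat. simple_function lebesgue (u i)" "AE x in lebesgue. (\<lambda>i. u i x) \<longlonglongrightarrow> f x"
    using sm unfolding strongly_measurable_def by blast
  have [measurable]: "(\<lambda>x. norm (f x)) \<in> borel_measurable lebesgue" by (rule norm_measurable[OF sm])
  have nu [measurable]: "(\<lambda>x. norm (u i x)) \<in> borel_measurable lebesgue" for i
    by (intro norm_measurable strongly_measurable_simple u)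
  define A where "A i = {x \<in> space lebesgue. norm (u i x) \<le> 2 * norm (f x)}" for i
  have [measurable]: "A i \<in> sets lebesgue" for i unfolding A_def by measurable
  define s where "s i x = (if x \<in> A i then u i x else 0)" for i x
  have ssf: "simple_function lebesgue (s i)" for i
    unfolding s_def using u(1) by (intro simple_function_If_set) auto
  have snorm: "norm (s i x) \<le> 2 * norm (f x)" for i x
    by (auto simp: s_def A_def)
  have fin2: "(\<integral>\<^sup>+x. ennreal (c * norm (f x)) \<partial>lebesgue) < \<infinity>" if "c \<ge> 0" for c
  proof -
    have "(\<integral>\<^sup>+x. ennreal (c * norm (f x)) \<partial>lebesgue) = ennreal c * (\<integral>\<^sup>+x. ennreal (norm (f x)) \<partial>lebesgue)"
      using that by (subst nn_integral_cmult[symmetric]) (auto simp: ennreal_mult)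
    then show ?thesis using fin by (simp add: ennreal_mult_less_top)
  qed
  have sbi: "sbi (s i)" for i
  proof (rule simple_bochner_integrableI_bounded[OF ssf])
    have "(\<integral>\<^sup>+x. ennreal (norm (s i x)) \<partial>lebesgue) \<le> (\<integral>\<^sup>+x. ennreal (2 * norm (f x)) \<partial>lebesgue)"
      by (intro nn_integral_mono ennreal_leI snorm)
    then show "(\<integral>\<^sup>+x. ennreal (norm (s i x)) \<partial>lebesgue) < \<infinity>" using fin2[of 2] by (auto intro: le_less_trans)
  qed
  have lim: "AE x in lebesgue. (\<lambda>i. s i x) \<longlonglongrightarrow> f x"
    using u(2)
  proof eventually_elim
    case (elim x)
    show ?case
    proof (cases "f x = 0")
      case True
      then have "s i x = 0" for i by (auto simp: s_def A_def)
      then show ?thesis using True by simp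
    next
      case False
      have "\<forall>\<^sub>F i in sequentially. norm (u i x) < 2 * norm (f x)"
        using False by (intro order_tendstoD(2)[OF tendsto_norm[OF elim]]) auto
      then have "\<forall>\<^sub>F i in sequentially. u i x = s i x"
        by eventually_elim (auto simp: s_def A_def)
      with elim show ?thesis by (rule Lim_transform_eventually)
    qed
  qed
  have "(\<lambda>i. \<integral>\<^sup>+x. ennreal (norm (f x - s i x)) \<partial>lebesgue) \<longlonglongrightarrow> (\<integral>\<^sup>+x. 0 \<partial>(lebesgue::'a measure))"
  proof (rule nn_integral_dominated_convergence[where w="\<lambda>x. ennreal (3 * norm (f x))"])
    show "(\<lambda>x. ennreal (norm (f x - s j x))) \<in> borel_measurable lebesgue" for j
      by (intro measurable_compose[OF norm_measurable] strongly_measurable_diff sm strongly_measurable_simple ssf) auto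
    show "AE x in lebesgue. ennreal (norm (f x - s j x)) \<le> ennreal (3 * norm (f x))" for j
    proof (rule AE_I2, rule ennreal_leI)
      fix x show "norm (f x - s j x) \<le> 3 * norm (f x)"
        using norm_triangle_ineq4[of "f x" "s j x"] snorm[of j x] by linarith
    qed
    show "AE x in lebesgue. (\<lambda>i. ennreal (norm (f x - s i x))) \<longlonglongrightarrow> 0"
      using lim
    proof eventually_elim
      case (elim x)
      have "(\<lambda>i. ennreal (norm (f x - s i x))) \<longlonglongrightarrow> ennreal (norm (f x - f x))"
        by (intro tendsto_ennrealI tendsto_intros elim)
      then show ?case by simp
    qed
  qed (use fin2[of 3] in auto)
  then have "(\<lambda>i. \<integral>\<^sup>+x. ennreal (norm (f x - s i x)) \<partial>lebesgue) \<longlonglongrightarrow> 0" by simp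
  with sbi snorm lim show ?thesis by (rule that)
qed

lemma tendsto_of_ennreal_dist:
  assumes "\<And>i. ennreal (norm (a i - b i)) \<le> e i" "e \<longlonglongrightarrow> 0"
  shows "(\<lambda>i. a i - b i) \<longlonglongrightarrow> (0::'b::real_normed_vector)"
proof -
  have "(\<lambda>i. ennreal (norm (a i - b i))) \<longlonglongrightarrow> 0"
    by (rule tendsto_sandwich[OF _ _ tendsto_const assms(2)]) (use assms(1) in auto)
  then have "(\<lambda>i. norm (a i - b i)) \<longlonglongrightarrow> 0"
    by (simp add: ennreal_0[symmetric] del: ennreal_0)
  then show ?thesis by (rule tendsto_norm_zero_cancel)
qed

text \<open>
  The integral does not depend on the approximating sequence: two such sequences of simple
  functions have integrals whose distance tends to zero.
\<close>

lemma has_bochner_integral_value_limit: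
  assumes f: "bintegrable f" and I: "has_bochner_integral_value lebesgue f I"
    and s: "\<And>i::nat. sbi (s i)" "(\<lambda>i. \<integral>\<^sup>+x. ennreal (norm (f x - s i x)) \<partial>lebesgue) \<longlonglongrightarrow> 0"
  shows "(\<lambda>i. sint (s i)) \<longlonglongrightarrow> I"
proof -
  obtain t where t: "\<And>i::nat. sbi (t i)" "(\<lambda>i. \<integral>\<^sup>+x. ennreal (norm (f x - t i x)) \<partial>lebesgue) \<longlonglongrightarrow> 0"
      "(\<lambda>i. sint (t i)) \<longlonglongrightarrow> I"
    using I unfolding has_bochner_integral_value_def by blast
  have "(\<lambda>i. sint (s i) - sint (t i)) \<longlonglongrightarrow> 0"
  proof (rule tendsto_of_ennreal_dist)
    show "ennreal (norm (sint (s i) - sint (t i))) \<le>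
      (\<integral>\<^sup>+x. ennreal (norm (f x - s i x)) \<partial>lebesgue) + (\<integral>\<^sup>+x. ennreal (norm (f x - t i x)) \<partial>lebesgue)" for i
      by (intro sint_dist_le smeas_bintegrable f s t)
    show "(\<lambda>i. (\<integral>\<^sup>+x. ennreal (norm (f x - s i x)) \<partial>lebesgue) + (\<integral>\<^sup>+x. ennreal (norm (f x - t i x)) \<partial>lebesgue)) \<longlonglongrightarrow> 0"
      using tendsto_add[OF s(2) t(2)] by simp
  qed
  from tendsto_add[OF this t(3)] show ?thesis by simp
qed

lemma has_bochner_integral_value_unique:
  assumes "has_bochner_integral_value lebesgue f I" "has_bochner_integral_value lebesgue f J"
  shows "I = J"
proof -
  have f: "bintegrable f" using assms(1) by (simp add: has_bochner_integral_value_def)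
  obtain t where t: "\<And>i::nat. sbi (t i)" "(\<lambda>i. \<integral>\<^sup>+x. ennreal (norm (f x - t i x)) \<partial>lebesgue) \<longlonglongrightarrow> 0"
      "(\<lambda>i. sint (t i)) \<longlonglongrightarrow> J"
    using assms(2) unfolding has_bochner_integral_value_def by blast
  show ?thesis using has_bochner_integral_value_limit[OF f assms(1) t(1,2)] t(3) by (rule LIMSEQ_unique)
qed

lemma bint_unique: "has_bochner_integral_value lebesgue f I \<Longrightarrow> bint f = I"
  unfolding bochner_integral_def using has_bochner_integral_value_unique by auto

lemma bint_value:
  fixes f :: "'a::euclidean_space \<Rightarrow> 'b::banach"
  assumes f: "bintegrable f"
  shows "has_bochner_integral_value lebesgue f (bint f)"
proof -
  obtain s where s: "\<And>i::nat. sbi (s i)"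
    "(\<lambda>i. \<integral>\<^sup>+x. ennreal (norm (f x - s i x)) \<partial>lebesgue) \<longlonglongrightarrow> 0"
    using bintegrable_simple_approx[OF f] by metis
  have "Cauchy (\<lambda>i. sint (s i))"
  proof (rule metric_CauchyI)
    fix e :: real assume e: "e > 0"
    have "\<forall>\<^sub>F i in sequentially. (\<integral>\<^sup>+x. ennreal (norm (f x - s i x)) \<partial>lebesgue) < ennreal (e/2)"
      using e by (intro order_tendstoD(2)[OF s(2)]) auto
    then obtain n where n: "\<And>i. i \<ge> n \<Longrightarrow> (\<integral>\<^sup>+x. ennreal (norm (f x - s i x)) \<partial>lebesgue) < ennreal (e/2)"
      by (auto simp: eventually_sequentially)
    have "dist (sint (s i)) (sint (s j)) < e" if "i \<ge> n" "j \<ge> n" for i j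
    proof -
      have "ennreal (norm (sint (s i) - sint (s j))) < ennreal (e/2) + ennreal (e/2)"
        by (rule le_less_trans[OF sint_dist_le add_strict_mono[OF n[OF that(1)] n[OF that(2)]]])
           (use f s in \<open>auto intro: smeas_bintegrable\<close>)
      also have "\<dots> = ennreal e" using e by (simp flip: ennreal_plus)
      finally show ?thesis using e by (simp add: dist_norm ennreal_less_iff)
    qed
    then show "\<exists>M. \<forall>m\<ge>M. \<forall>n\<ge>M. dist (sint (s m)) (sint (s n)) < e" by blast
  qed
  then obtain I where "(\<lambda>i. sint (s i)) \<longlonglongrightarrow> I"
    using Cauchy_convergent convergent_def by blast
  then have "has_bochner_integral_value lebesgue f I"
    unfolding has_bochner_integral_value_def using f s by blast
  then show ?thesis using bint_unique by metis
qed

lemma has_bochner_integral_valueI: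
  assumes "bintegrable f" "\<And>i::nat. sbi (s i)"
    "(\<lambda>i. \<integral>\<^sup>+x. ennreal (norm (f x - s i x)) \<partial>lebesgue) \<longlonglongrightarrow> 0"
    "(\<lambda>i. sint (s i)) \<longlonglongrightarrow> I"
  shows "has_bochner_integral_value lebesgue f I"
  unfolding has_bochner_integral_value_def using assms by blast

lemma norm_bint_le:
  fixes f :: "'a::euclidean_space \<Rightarrow> 'b::banach"
  assumes f: "bintegrable f"
  shows "ennreal (norm (bint f)) \<le> (\<integral>\<^sup>+x. ennreal (norm (f x)) \<partial>lebesgue)"
proof -
  obtain s where s: "\<And>i::nat. sbi (s i)"
    "(\<lambda>i. \<integral>\<^sup>+x. ennreal (norm (f x - s i x)) \<partial>lebesgue) \<longlonglongrightarrow> 0"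
    using bintegrable_simple_approx[OF f] by metis
  have lim: "(\<lambda>i. sint (s i)) \<longlonglongrightarrow> bint f"
    by (rule has_bochner_integral_value_limit[OF f bint_value[OF f] s])
  have "ennreal (norm (sint (s i))) \<le> (\<integral>\<^sup>+x. ennreal (norm (f x - s i x)) \<partial>lebesgue) + (\<integral>\<^sup>+x. ennreal (norm (f x)) \<partial>lebesgue)" for i
  proof -
    have "ennreal (norm (sint (s i))) \<le> (\<integral>\<^sup>+x. ennreal (norm (s i x - 0)) \<partial>lebesgue)"
      using norm_sint_le[OF s(1)] by simp
    also have "\<dots> \<le> (\<integral>\<^sup>+x. ennreal (norm (f x - s i x)) \<partial>lebesgue) + (\<integral>\<^sup>+x. ennreal (norm (f x - 0)) \<partial>lebesgue)"
      by (intro nn_integral_norm_triangle_diff smeas_sbi s smeas_bintegrable f strongly_measurable_const)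
    finally show ?thesis by simp
  qed
  moreover have "(\<lambda>i. (\<integral>\<^sup>+x. ennreal (norm (f x - s i x)) \<partial>lebesgue) + (\<integral>\<^sup>+x. ennreal (norm (f x)) \<partial>lebesgue))
      \<longlonglongrightarrow> 0 + (\<integral>\<^sup>+x. ennreal (norm (f x)) \<partial>lebesgue)"
    by (intro tendsto_add s tendsto_const)
  moreover have "(\<lambda>i. ennreal (norm (sint (s i)))) \<longlonglongrightarrow> ennreal (norm (bint f))"
    by (intro tendsto_ennrealI tendsto_norm lim)
  ultimately show ?thesis by (auto intro: LIMSEQ_le)
qed

lemma bint_add:
  fixes f g :: "'a::euclidean_space \<Rightarrow> 'b::banach"
  assumes f: "bintegrable f" and g: "bintegrable g"
  shows "bint (\<lambda>x. f x + g x) = bint f + bint g"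
proof (rule bint_unique)
  obtain s where s: "\<And>i::nat. sbi (s i)"
    "(\<lambda>i. \<integral>\<^sup>+x. ennreal (norm (f x - s i x)) \<partial>lebesgue) \<longlonglongrightarrow> 0"
    using bintegrable_simple_approx[OF f] by metis
  obtain t where t: "\<And>i::nat. sbi (t i)"
    "(\<lambda>i. \<integral>\<^sup>+x. ennreal (norm (g x - t i x)) \<partial>lebesgue) \<longlonglongrightarrow> 0"
    using bintegrable_simple_approx[OF g] by metis
  show "has_bochner_integral_value lebesgue (\<lambda>x. f x + g x) (bint f + bint g)"
  proof (rule has_bochner_integral_valueI[where s="\<lambda>i x. s i x + t i x"])
    show "(\<lambda>i. \<integral>\<^sup>+x. ennreal (norm (f x + g x - (s i x + t i x))) \<partial>lebesgue) \<longlonglongrightarrow> 0"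
    proof (rule tendsto_sandwich[OF _ _ tendsto_const])
      show "\<forall>\<^sub>F i in sequentially. (\<integral>\<^sup>+x. ennreal (norm (f x + g x - (s i x + t i x))) \<partial>lebesgue) \<le>
        (\<integral>\<^sup>+x. ennreal (norm (f x - s i x)) \<partial>lebesgue) + (\<integral>\<^sup>+x. ennreal (norm (g x - t i x)) \<partial>lebesgue)"
      proof (intro always_eventually allI)
        fix i
        have "(\<integral>\<^sup>+x. ennreal (norm ((f x - s i x) + (g x - t i x))) \<partial>lebesgue) \<le>
        (\<integral>\<^sup>+x. ennreal (norm (f x - s i x)) \<partial>lebesgue) + (\<integral>\<^sup>+x. ennreal (norm (g x - t i x)) \<partial>lebesgue)"
          by (intro nn_integral_norm_triangle strongly_measurable_diff smeas_bintegrable smeas_sbi f g s t)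
        then show "(\<integral>\<^sup>+x. ennreal (norm (f x + g x - (s i x + t i x))) \<partial>lebesgue) \<le>
        (\<integral>\<^sup>+x. ennreal (norm (f x - s i x)) \<partial>lebesgue) + (\<integral>\<^sup>+x. ennreal (norm (g x - t i x)) \<partial>lebesgue)"
          by (simp add: algebra_simps)
      qed
      show "(\<lambda>i. (\<integral>\<^sup>+x. ennreal (norm (f x - s i x)) \<partial>lebesgue) + (\<integral>\<^sup>+x. ennreal (norm (g x - t i x)) \<partial>lebesgue)) \<longlonglongrightarrow> 0"
        using tendsto_add[OF s(2) t(2)] by simp
    qed auto
    show "(\<lambda>i. sint (\<lambda>x. s i x + t i x)) \<longlonglongrightarrow> bint f + bint g"
      using tendsto_add[OF has_bochner_integral_value_limit[OF f bint_value[OF f] s]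
          has_bochner_integral_value_limit[OF g bint_value[OF g] t]]
      by (simp add: simple_bochner_integral_add s t)
    show "bintegrable (\<lambda>x. f x + g x)" by (rule bintegrable_add[OF f g])
    show "sbi (\<lambda>x. s i x + t i x)" for i by (rule sbi_add[OF s(1) t(1)])
  qed
qed

lemma bint_linear:
  fixes f :: "'a::euclidean_space \<Rightarrow> 'b::banach" and T :: "'b \<Rightarrow> 'c::banach"
  assumes f: "bintegrable f" and T: "bounded_linear T"
  shows "bint (\<lambda>x. T (f x)) = T (bint f)"
proof (rule bint_unique)
  interpret T: bounded_linear T by fact
  obtain s where s: "\<And>i::nat. sbi (s i)"
    "(\<lambda>i. \<integral>\<^sup>+x. ennreal (norm (f x - s i x)) \<partial>lebesgue) \<longlonglongrightarrow> 0"
    using bintegrable_simple_approx[OF f] by metis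
  obtain K where K: "K > 0" "\<And>x. norm (T x) \<le> norm x * K" using T.pos_bounded by blast
  show "has_bochner_integral_value lebesgue (\<lambda>x. T (f x)) (T (bint f))"
  proof (rule has_bochner_integral_valueI[where s="\<lambda>i x. T (s i x)"])
    show "sbi (\<lambda>x. T (s i x))" for i
      using simple_bochner_integrable_compose2[of "\<lambda>x y. T x", OF _ s(1) s(1)] by (simp add: T.zero)
    show "(\<lambda>i. \<integral>\<^sup>+x. ennreal (norm (T (f x) - T (s i x))) \<partial>lebesgue) \<longlonglongrightarrow> 0"
    proof (rule tendsto_sandwich[OF _ _ tendsto_const])
      show "\<forall>\<^sub>F i in sequentially. (\<integral>\<^sup>+x. ennreal (norm (T (f x) - T (s i x))) \<partial>lebesgue) \<le>
        ennreal K * (\<integral>\<^sup>+x. ennreal (norm (f x - s i x)) \<partial>lebesgue)"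
      proof (intro always_eventually allI)
        fix i
        have "(\<integral>\<^sup>+x. ennreal (norm (T (f x) - T (s i x))) \<partial>lebesgue) \<le>
          (\<integral>\<^sup>+x. ennreal K * ennreal (norm (f x - s i x)) \<partial>lebesgue)"
          using K by (intro nn_integral_mono) (auto simp: mult.commute simp flip: T.diff ennreal_mult intro!: ennreal_leI)
        also have "\<dots> = ennreal K * (\<integral>\<^sup>+x. ennreal (norm (f x - s i x)) \<partial>lebesgue)"
          by (intro nn_integral_cmult measurable_compose[OF norm_measurable]
              strongly_measurable_diff smeas_bintegrable smeas_sbi f s) auto
        finally show "(\<integral>\<^sup>+x. ennreal (norm (T (f x) - T (s i x))) \<partial>lebesgue) \<le>
        ennreal K * (\<integral>\<^sup>+x. ennreal (norm (f x - s i x)) \<partial>lebesgue)" .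
      qed
      show "(\<lambda>i. ennreal K * (\<integral>\<^sup>+x. ennreal (norm (f x - s i x)) \<partial>lebesgue)) \<longlonglongrightarrow> 0"
        using ennreal_tendsto_cmult[OF _ s(2), of "ennreal K"] by simp
    qed auto
    show "(\<lambda>i. sint (\<lambda>x. T (s i x))) \<longlonglongrightarrow> T (bint f)"
      using T.tendsto[OF has_bochner_integral_value_limit[OF f bint_value[OF f] s]]
      by (simp add: simple_bochner_integral_linear[OF T.linear_axioms s(1)])
  qed (rule bintegrable_linear[OF f T])
qed

lemma bint_scaleR:
  fixes f :: "'a::euclidean_space \<Rightarrow> 'b::banach"
  shows "bintegrable f \<Longrightarrow> bint (\<lambda>x. c *\<^sub>R f x) = c *\<^sub>R bint f"
  by (rule bint_linear) (auto intro: bounded_linear_scaleR_right)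

lemma bint_diff:
  fixes f g :: "'a::euclidean_space \<Rightarrow> 'b::banach"
  assumes f: "bintegrable f" and g: "bintegrable g"
  shows "bint (\<lambda>x. f x - g x) = bint f - bint g"
  using bint_add[OF f bintegrable_scaleR[OF g, of "-1"]] bint_scaleR[OF g, of "-1"] by simp

lemma bint_cong_AE:
  assumes "AE x in lebesgue. f x = g x"
  shows "bint f = bint g"
proof -
  have "has_bochner_integral_value lebesgue f I \<longleftrightarrow> has_bochner_integral_value lebesgue g I" for I
  proof -
    have "bintegrable f = bintegrable g"
      using assms bintegrable_AE_cong[of f g] bintegrable_AE_cong[of g f] by (auto simp: eq_commute)
    moreover have "(\<integral>\<^sup>+x. ennreal (norm (f x - s x)) \<partial>lebesgue) = (\<integral>\<^sup>+x. ennreal (norm (g x - s x)) \<partial>lebesgue)" for s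
      using assms by (intro nn_integral_cong_AE) auto
    ultimately show ?thesis unfolding has_bochner_integral_value_def by simp
  qed
  then have "has_bochner_integral_value lebesgue f = has_bochner_integral_value lebesgue g" by blast
  then show ?thesis unfolding bochner_integral_def by (simp only:)
qed

lemma bint_sum:
  fixes f :: "'i \<Rightarrow> 'a::euclidean_space \<Rightarrow> 'b::banach"
  assumes "\<And>i. i \<in> I \<Longrightarrow> bintegrable (f i)"
  shows "bintegrable (\<lambda>x. \<Sum>i\<in>I. f i x) \<and> bint (\<lambda>x. \<Sum>i\<in>I. f i x) = (\<Sum>i\<in>I. bint (f i))"
  using assms
proof (induction I rule: infinite_finite_induct)
  have z: "bint (\<lambda>x::'a. 0::'b) = 0"
    using bint_scaleR[OF bochner_integrable_zero, of 0] by simp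
  { case (infinite A) then show ?case using z by (simp add: bochner_integrable_zero) }
  { case empty then show ?case using z by (simp add: bochner_integrable_zero) }
  case (insert a A) then show ?case by (simp add: bint_add bintegrable_add)
qed

text \<open>
  A nearly optimal projection onto the cone. A nearest point need not exist, hence the factor 2.
\<close>

lemma closed_cone_nearest:
  fixes y :: "'b::{real_normed_vector,ordered_real_vector}"
  assumes "closed {u::'b. 0 \<le> u}"
  shows "\<exists>z\<ge>0. (0 \<le> y \<longrightarrow> z = y) \<and> (\<forall>u\<ge>0. norm (y - z) \<le> 2 * norm (y - u))"
proof (cases "0 \<le> y")
  case False
  define d where "d = infdist y {u. 0 \<le> u}"
  have ne: "{u::'b. 0 \<le> u} \<noteq> {}" by auto
  have "d > 0"
    unfolding d_def using in_closed_iff_infdist_zero[OF assms ne, of y] False infdist_nonneg[of y "{u. 0 \<le> u}"]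
    by auto
  then have "infdist y {u. 0 \<le> u} < 2 * d" by (simp add: d_def)
  then have "\<exists>z. 0 \<le> z \<and> dist y z < 2 * d"
    using ne by (auto simp: infdist_def cINF_less_iff split: if_splits)
  then obtain z where z: "0 \<le> z" "dist y z < 2 * d" by blast
  have "norm (y - z) \<le> 2 * norm (y - u)" if "u \<ge> 0" for u
    using infdist_le[of u "{u. 0 \<le> u}" y] z(2) that by (simp add: dist_norm d_def)
  with z(1) False show ?thesis by blast
qed auto

text \<open>
  Projecting the values of approximating simple functions to the cone keeps them simple and at
  most triples their distance to the positive function \<open>f\<close>. So \<open>f\<close> is approximated by positive simple
  functions, whose integrals lie in the closed cone.
\<close>

lemma bint_nonneg:
  fixes f :: "'a::euclidean_space \<Rightarrow> 'b::{banach,ordered_real_vector}"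
  assumes cl: "closed {u::'b. 0 \<le> u}" and f: "bintegrable f" and pos: "AE x in lebesgue. 0 \<le> f x"
  shows "0 \<le> bint f"
proof -
  obtain s where s: "\<And>i::nat. sbi (s i)"
    "(\<lambda>i. \<integral>\<^sup>+x. ennreal (norm (f x - s i x)) \<partial>lebesgue) \<longlonglongrightarrow> 0"
    using bintegrable_simple_approx[OF f] by metis
  obtain p :: "'b \<Rightarrow> 'b" where p: "\<And>y. 0 \<le> p y" "\<And>y. 0 \<le> y \<Longrightarrow> p y = y"
      "\<And>y u. 0 \<le> u \<Longrightarrow> norm (y - p y) \<le> 2 * norm (y - u)"
    using closed_cone_nearest[OF cl] by metis
  have sp: "sbi (\<lambda>x. p (s i x))" for i
    using simple_bochner_integrable_compose2[of "\<lambda>x y. p x", OF _ s(1) s(1)] p(2)[of 0] by simp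
  have "(\<lambda>i. \<integral>\<^sup>+x. ennreal (norm (f x - p (s i x))) \<partial>lebesgue) \<longlonglongrightarrow> 0"
  proof (rule tendsto_sandwich[OF _ _ tendsto_const])
    show "\<forall>\<^sub>F i in sequentially. (\<integral>\<^sup>+x. ennreal (norm (f x - p (s i x))) \<partial>lebesgue) \<le>
        3 * (\<integral>\<^sup>+x. ennreal (norm (f x - s i x)) \<partial>lebesgue)"
    proof (intro always_eventually allI)
      fix i
      have "(\<integral>\<^sup>+x. ennreal (norm (f x - p (s i x))) \<partial>lebesgue) \<le>
          (\<integral>\<^sup>+x. 3 * ennreal (norm (f x - s i x)) \<partial>lebesgue)"
      proof (rule nn_integral_mono_AE)
        show "AE x in lebesgue. ennreal (norm (f x - p (s i x))) \<le> 3 * ennreal (norm (f x - s i x))"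
        using pos
      proof eventually_elim
        case (elim x)
        have "norm (f x - p (s i x)) \<le> norm (f x - s i x) + norm (s i x - p (s i x))"
          by (rule norm_diff_triangle_le) auto
        also have "\<dots> \<le> 3 * norm (f x - s i x)"
          using p(3)[OF elim(1), of "s i x"] by (simp add: norm_minus_commute)
        finally have "ennreal (norm (f x - p (s i x))) \<le> ennreal (3 * norm (f x - s i x))" by (rule ennreal_leI)
        then show ?case by (simp add: ennreal_mult)
      qed
      qed
      also have "\<dots> = 3 * (\<integral>\<^sup>+x. ennreal (norm (f x - s i x)) \<partial>lebesgue)"
        by (intro nn_integral_cmult measurable_compose[OF norm_measurable]
              strongly_measurable_diff smeas_bintegrable smeas_sbi f s) auto
      finally show "(\<integral>\<^sup>+x. ennreal (norm (f x - p (s i x))) \<partial>lebesgue) \<le>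
        3 * (\<integral>\<^sup>+x. ennreal (norm (f x - s i x)) \<partial>lebesgue)" .
    qed
    show "(\<lambda>i. 3 * (\<integral>\<^sup>+x. ennreal (norm (f x - s i x)) \<partial>lebesgue)) \<longlonglongrightarrow> 0"
      using ennreal_tendsto_cmult[OF _ s(2), of 3] by simp
  qed auto
  then have "(\<lambda>i. sint (\<lambda>x. p (s i x))) \<longlonglongrightarrow> bint f"
    by (rule has_bochner_integral_value_limit[where s="\<lambda>i x. p (s i x)", OF f bint_value[OF f] sp])
  moreover have "0 \<le> sint (\<lambda>x. p (s i x))" for i
    unfolding simple_bochner_integral_def using p(1) by (intro sum_nonneg scaleR_nonneg_nonneg) auto
  ultimately show ?thesis
    using closed_sequentially[OF cl, of "\<lambda>i. sint (\<lambda>x. p (s i x))" "bint f"] by auto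
qed

lemma nn_integral_restrict_If:
  assumes S: "S \<in> sets lebesgue"
  shows "(\<integral>\<^sup>+x. f x \<partial>lebesgue_on S) = (\<integral>\<^sup>+x. (if x \<in> S then f x else 0) \<partial>lebesgue)"
  using S by (subst nn_integral_restrict_space) (auto intro!: nn_integral_cong simp: indicator_def)

lemma bochner_integrable_restrict_iff:
  assumes S: "S \<in> sets lebesgue"
  shows "bochner_integrable (lebesgue_on S) f \<longleftrightarrow> bintegrable (\<lambda>x. if x \<in> S then f x else 0)"
proof -
  have "(\<integral>\<^sup>+x. ennreal (norm (f x)) \<partial>lebesgue_on S) =
    (\<integral>\<^sup>+x. ennreal (norm (if x \<in> S then f x else 0)) \<partial>lebesgue)"
    unfolding nn_integral_restrict_If[OF S] by (rule nn_integral_cong) auto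
  then show ?thesis
    unfolding bochner_integrable_def strongly_measurable_restrict_iff[OF S] by simp
qed

lemma simple_bochner_integrable_restrict_iff:
  assumes S: "S \<in> sets lebesgue"
  shows "Bochner_Integration.simple_bochner_integrable (lebesgue_on S) f \<longleftrightarrow> sbi (\<lambda>x. if x \<in> S then f x else 0)"
proof -
  have *: "{y \<in> S. f y \<noteq> 0} = {y. (if y \<in> S then f y else 0) \<noteq> 0}" by auto
  have "emeasure (lebesgue_on S) {y \<in> S. f y \<noteq> 0} = emeasure lebesgue {y \<in> S. f y \<noteq> 0}"
    using S by (intro emeasure_restrict_space) auto
  then show ?thesis
    unfolding simple_bochner_integrable.simps simple_function_restrict_iff[OF S]
    by (simp add: * del: emeasure_completion)
qed

lemma simple_bochner_integral_restrict:
  assumes S: "S \<in> sets lebesgue" and f: "sbi (\<lambda>x. if x \<in> S then f x else 0)"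
  shows "Bochner_Integration.simple_bochner_integral (lebesgue_on S) f = sint (\<lambda>x. if x \<in> S then f x else 0)"
proof -
  let ?g = "\<lambda>x. if x \<in> S then f x else 0"
  have fin: "finite (range ?g)"
    using f by (auto elim!: simple_bochner_integrable.cases simp: simple_function_def)
  have "sint ?g = (\<Sum>y\<in>range ?g. measure lebesgue {x. ?g x = y} *\<^sub>R y)"
    by (simp add: simple_bochner_integral_def)
  also have "\<dots> = (\<Sum>y\<in>f ` S. measure (lebesgue_on S) {x \<in> S. f x = y} *\<^sub>R y)"
  proof (rule sum.mono_neutral_cong)
    have "f ` S \<subseteq> range ?g" by auto
    with fin show "finite (f ` S)" by (rule rev_finite_subset)
    show "finite (range ?g)" by (rule fin)
    show "measure lebesgue {x. ?g x = i} *\<^sub>R i = 0" if "i \<in> range ?g - f ` S" for i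
      using that by (auto split: if_splits)
    show "measure (lebesgue_on S) {x \<in> S. f x = i} *\<^sub>R i = 0" if "i \<in> f ` S - range ?g" for i
      using that by auto
    show "measure lebesgue {x. ?g x = y} *\<^sub>R y = measure (lebesgue_on S) {x \<in> S. f x = y} *\<^sub>R y" for y
    proof (cases "y = 0")
      case False
      then have "{x. ?g x = y} = {x \<in> S. f x = y}" by auto
      moreover have "measure (lebesgue_on S) {x \<in> S. f x = y} = measure lebesgue {x \<in> S. f x = y}"
        using S by (intro measure_restrict_space) auto
      ultimately show ?thesis by simp
    qed simp
  qed
  also have "\<dots> = Bochner_Integration.simple_bochner_integral (lebesgue_on S) f"
    by (simp add: simple_bochner_integral_def)
  finally show ?thesis ..
qed

text \<open>
  Approximating sequences correspond under extension by zero and under multiplication by the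
  indicator of \<open>S\<close>.
\<close>

lemma has_bochner_integral_value_restrict_iff:
  assumes S: "S \<in> sets lebesgue"
  shows "has_bochner_integral_value (lebesgue_on S) f I \<longleftrightarrow>
    has_bochner_integral_value lebesgue (\<lambda>x. if x \<in> S then f x else 0) I" (is "?L \<longleftrightarrow> ?R")
proof -
  let ?g = "\<lambda>x. if x \<in> S then f x else 0"
  have N: "(\<integral>\<^sup>+x. ennreal (norm (f x - s x)) \<partial>lebesgue_on S) =
      (\<integral>\<^sup>+x. ennreal (norm (?g x - (if x \<in> S then s x else 0))) \<partial>lebesgue)" for s
    unfolding nn_integral_restrict_If[OF S] by (rule nn_integral_cong) auto
  show ?thesis
  proof
    assume ?L
    then obtain s where s: "bochner_integrable (lebesgue_on S) f"
      "\<And>i::nat. Bochner_Integration.simple_bochner_integrable (lebesgue_on S) (s i)"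
      "(\<lambda>i. \<integral>\<^sup>+x. ennreal (norm (f x - s i x)) \<partial>lebesgue_on S) \<longlonglongrightarrow> 0"
      "(\<lambda>i. Bochner_Integration.simple_bochner_integral (lebesgue_on S) (s i)) \<longlonglongrightarrow> I"
      unfolding has_bochner_integral_value_def by blast
    have si: "sbi (\<lambda>x. if x \<in> S then s i x else 0)" for i
      using s(2) simple_bochner_integrable_restrict_iff[OF S] by blast
    show ?R
      by (rule has_bochner_integral_valueI[where s="\<lambda>i x. if x \<in> S then s i x else 0"])
        (use s si in \<open>simp_all add: bochner_integrable_restrict_iff[OF S] N simple_bochner_integral_restrict[OF S]\<close>)
  next
    assume R: ?R
    then obtain s where s: "bintegrable ?g" "\<And>i::nat. sbi (s i)"
      "(\<lambda>i. \<integral>\<^sup>+x. ennreal (norm (?g x - s i x)) \<partial>lebesgue) \<longlonglongrightarrow> 0"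
      "(\<lambda>i. sint (s i)) \<longlonglongrightarrow> I"
      unfolding has_bochner_integral_value_def by blast
    have si: "sbi (\<lambda>x. if x \<in> S then s i x else 0)" for i
    proof (rule simple_bochner_integrable.intros)
      show "simple_function lebesgue (\<lambda>x. if x \<in> S then s i x else 0)"
        using S s(2) by (intro simple_function_If_set) (auto elim: simple_bochner_integrable.cases)
      have "emeasure lebesgue {y \<in> space lebesgue. (if y \<in> S then s i y else 0) \<noteq> 0} \<le>
         emeasure lebesgue {y \<in> space lebesgue. s i y \<noteq> 0}"
      proof (rule emeasure_mono)
        have "s i \<in> measurable lebesgue (count_space UNIV)"
          using s(2)[of i] by (auto intro: measurable_simple_function elim: simple_bochner_integrable.cases)
        then show "{y \<in> space lebesgue. s i y \<noteq> 0} \<in> sets lebesgue" by measurable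
      qed auto
      also have "\<dots> < \<infinity>" using s(2)[of i] by (auto elim: simple_bochner_integrable.cases simp: less_top)
      finally show "emeasure lebesgue {y \<in> space lebesgue. (if y \<in> S then s i y else 0) \<noteq> 0} \<noteq> \<infinity>"
        by (simp add: less_top)
    qed
    have lim: "(\<lambda>i. \<integral>\<^sup>+x. ennreal (norm (?g x - (if x \<in> S then s i x else 0))) \<partial>lebesgue) \<longlonglongrightarrow> 0"
    proof (rule tendsto_sandwich[OF _ _ tendsto_const s(3)])
      show "\<forall>\<^sub>F i in sequentially. (\<integral>\<^sup>+x. ennreal (norm (?g x - (if x \<in> S then s i x else 0))) \<partial>lebesgue) \<le>
        (\<integral>\<^sup>+x. ennreal (norm (?g x - s i x)) \<partial>lebesgue)"
        by (intro always_eventually allI nn_integral_mono) auto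
    qed auto
    have "(\<lambda>i. sint (\<lambda>x. if x \<in> S then s i x else 0)) \<longlonglongrightarrow> I"
      by (rule has_bochner_integral_value_limit[OF s(1) R si lim])
    then have "(\<lambda>i. Bochner_Integration.simple_bochner_integral (lebesgue_on S) (s i)) \<longlonglongrightarrow> I"
      by (simp add: simple_bochner_integral_restrict[OF S si])
    moreover have "(\<lambda>i. \<integral>\<^sup>+x. ennreal (norm (f x - s i x)) \<partial>lebesgue_on S) \<longlonglongrightarrow> 0"
      using lim by (simp add: N)
    ultimately show ?L
      unfolding has_bochner_integral_value_def bochner_integrable_restrict_iff[OF S]
        simple_bochner_integrable_restrict_iff[OF S] using s(1) si by blast
  qed
qed

lemma bochner_integral_restrict:
  assumes S: "S \<in> sets lebesgue"
  shows "bochner_integral (lebesgue_on S) f = bint (\<lambda>x. if x \<in> S then f x else 0)"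
  unfolding bochner_integral_def has_bochner_integral_value_restrict_iff[OF S] ..

section \<open>Measure preserving maps and Fubini's theorem\<close>

definition preserves_lborel :: "('a::euclidean_space \<Rightarrow> 'b::euclidean_space) \<Rightarrow> bool" where
  "preserves_lborel \<phi> \<longleftrightarrow> \<phi> \<in> measurable lborel lborel \<and> distr lborel lborel \<phi> = lborel"

text \<open>
  Null sets of Lebesgue measure are contained in Borel null sets, which have Borel null preimages;
  preimages of general Lebesgue sets are not covered by the Borel measurability of \<open>\<phi>\<close>.
\<close>

lemma preserves_AE:
  assumes \<phi>: "preserves_lborel \<phi>" and P: "AE z in lebesgue. P z"
  shows "AE z in lebesgue. P (\<phi> z)"
proof -
  have d: "distr lborel lborel \<phi> = lborel" using \<phi> by (simp add: preserves_lborel_def)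
  have "AE z in distr lborel lborel \<phi>. P z"
    unfolding d using P by (simp only: AE_completion_iff)
  then have "AE z in lborel. P (\<phi> z)"
    using \<phi> by (intro AE_distrD[where f=\<phi>]) (auto simp: preserves_lborel_def)
  then show ?thesis by (simp add: AE_completion_iff)
qed

lemma preserves_smeas:
  assumes \<phi>: "preserves_lborel \<phi>" and k: "smeas k"
  shows "smeas (\<lambda>z. k (\<phi> z))"
proof -
  have "strongly_measurable lborel k" using k by (simp add: strongly_measurable_lebesgue_iff)
  then obtain s where s: "\<And>i::nat. simple_function lborel (s i)" "AE z in lborel. (\<lambda>i. s i z) \<longlonglongrightarrow> k z"
    unfolding strongly_measurable_def by blast
  have "simple_function lborel (\<lambda>z. s i (\<phi> z))" for i
    using s(1)[of i] \<phi> unfolding preserves_lborel_def simple_function_eq_measurable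
    by (auto intro: measurable_compose[where f=\<phi>] intro: finite_subset[of _ "range (s i)"])
  then have 1: "simple_function lebesgue (\<lambda>z. s i (\<phi> z))" for i
    by (intro simple_function_lebesgue)
  have 2: "AE z in lebesgue. (\<lambda>i. s i (\<phi> z)) \<longlonglongrightarrow> k (\<phi> z)"
    by (rule preserves_AE[OF \<phi>]) (use s(2) in \<open>simp only: AE_completion_iff\<close>)
  show ?thesis by (rule strongly_measurableI[OF 1 2])
qed

lemma measurable_lebesgue_AE_cong:
  assumes f: "f \<in> measurable lebesgue N" and ae: "AE x in lebesgue. f x = g x"
    and g: "\<And>x. g x \<in> space N"
  shows "g \<in> measurable lebesgue N"
proof (rule measurableI)
  fix A assume A: "A \<in> sets N"
  have "AE x in lebesgue. (x \<in> f -` A \<inter> space lebesgue) = (x \<in> g -` A \<inter> space lebesgue)"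
    using ae by eventually_elim simp
  then show "g -` A \<inter> space lebesgue \<in> sets lebesgue"
    using completion.in_sets_AE[OF _ measurable_sets[OF f A]] by blast
qed (rule g)

lemma preserves_nn_integral:
  assumes \<phi>: "preserves_lborel \<phi>" and q: "q \<in> borel_measurable lebesgue"
  shows "(\<integral>\<^sup>+z. q (\<phi> z) \<partial>lebesgue) = (\<integral>\<^sup>+z. q z \<partial>lebesgue)"
    "(\<lambda>z. q (\<phi> z) :: ennreal) \<in> borel_measurable lebesgue"
proof -
  obtain q' where q': "q' \<in> borel_measurable lborel" "AE z in lborel. q z = q' z"
    using completion_ex_borel_measurable[OF q] by blast
  have m: "\<phi> \<in> measurable lborel lborel" using \<phi> by (simp add: preserves_lborel_def)
  have ae: "AE z in lebesgue. q (\<phi> z) = q' (\<phi> z)"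
    by (rule preserves_AE[OF \<phi>]) (use q'(2) in \<open>simp only: AE_completion_iff\<close>)
  have "(\<integral>\<^sup>+z. q (\<phi> z) \<partial>lebesgue) = (\<integral>\<^sup>+z. q' (\<phi> z) \<partial>lborel)"
    using nn_integral_cong_AE[OF ae] by (simp add: nn_integral_completion)
  also have "\<dots> = (\<integral>\<^sup>+z. q' z \<partial>distr lborel lborel \<phi>)"
    using q'(1) m by (intro nn_integral_distr[symmetric]) auto
  also have "\<dots> = (\<integral>\<^sup>+z. q z \<partial>lebesgue)"
    using \<phi> nn_integral_cong_AE[OF q'(2)] by (simp add: preserves_lborel_def nn_integral_completion)
  finally show "(\<integral>\<^sup>+z. q (\<phi> z) \<partial>lebesgue) = (\<integral>\<^sup>+z. q z \<partial>lebesgue)" .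
  have "(\<lambda>z. q' (\<phi> z)) \<in> borel_measurable lborel"
    using measurable_compose[OF m q'(1)] .
  then have "(\<lambda>z. q' (\<phi> z)) \<in> borel_measurable lebesgue"
    by (rule measurable_completion)
  then show "(\<lambda>z. q (\<phi> z)) \<in> borel_measurable lebesgue"
    by (rule measurable_lebesgue_AE_cong) (use ae in \<open>auto simp: eq_commute\<close>)
qed

lemma preserves_bintegrable:
  assumes \<phi>: "preserves_lborel \<phi>" and k: "bintegrable k"
  shows "bintegrable (\<lambda>z. k (\<phi> z))"
  using k preserves_smeas[OF \<phi>, of k] preserves_nn_integral(1)[OF \<phi>, of "\<lambda>z. ennreal (norm (k z))"]
    measurable_compose[OF norm_measurable[of k], of ennreal borel]
  by (simp add: bochner_integrable_def)

lemma preserves_swap: "preserves_lborel (\<lambda>z::real \<times> real. (snd z, fst z))"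
proof -
  have "(\<lambda>z::real \<times> real. (snd z, fst z)) \<in> measurable (lborel \<Otimes>\<^sub>M lborel) (lborel \<Otimes>\<^sub>M lborel)"
    by measurable
  moreover have "distr (lborel \<Otimes>\<^sub>M lborel) (lborel \<Otimes>\<^sub>M lborel) (\<lambda>z::real \<times> real. (snd z, fst z)) = lborel \<Otimes>\<^sub>M lborel"
    using lborel_pair.distr_pair_swap[where ?'a=real and ?'b=real]
    by (simp add: case_prod_beta')
  ultimately show ?thesis by (simp only: preserves_lborel_def lborel_prod)
qed

lemma preserves_translation: "preserves_lborel (\<lambda>x::real. x - c)"
proof -
  have "distr lborel lborel (\<lambda>x::real. x - c) = distr lborel borel ((+) (- c))"
    by (rule distr_cong) auto
  also have "\<dots> = lborel" by (rule lborel_distr_plus)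
  finally show ?thesis unfolding preserves_lborel_def by simp
qed

text \<open>
  Sections of Lebesgue measurable sets of the plane are measurable only almost everywhere, those of
  Borel sets always are; Fubini's theorem starts from simple functions of the second kind.
\<close>

lemma bintegrable_lborel_approx:
  fixes k :: "'a::euclidean_space \<Rightarrow> 'b::real_normed_vector"
  assumes k: "bintegrable k"
  obtains t where "\<And>i::nat. simple_function lborel (t i)" "\<And>i. bintegrable (t i)"
    "AE z in lebesgue. \<forall>i. norm (t i z) \<le> 2 * norm (k z)"
    "AE z in lebesgue. (\<lambda>i. t i z) \<longlonglongrightarrow> k z"
    "(\<lambda>i. \<integral>\<^sup>+z. ennreal (norm (k z - t i z)) \<partial>lebesgue) \<longlonglongrightarrow> 0"
proof -
  obtain s where s: "\<And>i::nat. sbi (s i)" "\<And>i x. norm (s i x) \<le> 2 * norm (k x)"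
    "AE x in lebesgue. (\<lambda>i. s i x) \<longlonglongrightarrow> k x"
    "(\<lambda>i. \<integral>\<^sup>+x. ennreal (norm (k x - s i x)) \<partial>lebesgue) \<longlonglongrightarrow> 0"
    by (rule bintegrable_simple_approx[OF k], rule that)
  have "\<exists>t. simple_function lborel t \<and> (AE z in lborel. s i z = t z)" for i
    using s(1)[of i] by (intro completion_ex_simple_function) (auto elim: simple_bochner_integrable.cases)
  then obtain t where t: "\<And>i. simple_function lborel (t i)" "\<And>i. AE z in lborel. s i z = t i z"
    by metis
  have e: "AE z in lebesgue. s i z = t i z" for i
    using t(2) by (simp only: AE_completion_iff)
  then have ea: "AE z in lebesgue. \<forall>i. s i z = t i z" by (simp add: AE_all_countable)
  show ?thesis
  proof (rule that[of t])
    show "bintegrable (t i)" for i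
      by (rule bintegrable_AE_cong[OF sbi_imp_bintegrable[OF s(1)] e])
    show "AE z in lebesgue. \<forall>i. norm (t i z) \<le> 2 * norm (k z)"
      using ea
    proof eventually_elim
      case (elim z)
      show ?case using s(2)[of _ z] elim by simp
    qed
    show "AE z in lebesgue. (\<lambda>i. t i z) \<longlonglongrightarrow> k z"
      using ea s(3) by eventually_elim simp
    have "(\<integral>\<^sup>+z. ennreal (norm (k z - t i z)) \<partial>lebesgue) = (\<integral>\<^sup>+z. ennreal (norm (k z - s i z)) \<partial>lebesgue)" for i
      using e[of i] by (intro nn_integral_cong_AE) auto
    then show "(\<lambda>i. \<integral>\<^sup>+z. ennreal (norm (k z - t i z)) \<partial>lebesgue) \<longlonglongrightarrow> 0"
      using s(4) by simp
  qed (rule t)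
qed

lemma bint_sbi: 
  fixes s :: "'a::euclidean_space \<Rightarrow> 'b::banach"
  assumes s: "sbi s" shows "bint s = sint s"
  by (rule bint_unique, rule has_bochner_integral_valueI[where s="\<lambda>i. s"])
     (use s sbi_imp_bintegrable in auto)

lemma bint_indicator:
  fixes y :: "'b::banach"
  assumes A: "A \<in> sets lebesgue" "emeasure lebesgue A < \<infinity>"
  shows "bintegrable (\<lambda>x. indicator A x *\<^sub>R y)" "bint (\<lambda>x. indicator A x *\<^sub>R y) = measure lebesgue A *\<^sub>R y"
proof -
  have sI: "sbi (indicator A :: 'a \<Rightarrow> real)"
  proof (rule simple_bochner_integrable.intros)
    show "simple_function lebesgue (indicator A :: 'a \<Rightarrow> real)" using A by (intro simple_function_indicator)
    have "{y \<in> space lebesgue. (indicator A y :: real) \<noteq> 0} = A" by (auto simp: indicator_def)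
    then show "emeasure lebesgue {y \<in> space lebesgue. (indicator A y :: real) \<noteq> 0} \<noteq> \<infinity>"
      using A by simp
  qed
  have "ennreal (sint (indicator A :: 'a \<Rightarrow> real)) = (\<integral>\<^sup>+x. ennreal (indicator A x) \<partial>lebesgue)"
    by (rule simple_bochner_integral_eq_nn_integral[OF sI]) auto
  also have "\<dots> = emeasure lebesgue A"
    using A by (simp add: ennreal_indicator)
  also have "\<dots> = ennreal (measure lebesgue A)"
    using A by (intro emeasure_eq_ennreal_measure) auto
  finally have 1: "sint (indicator A :: 'a \<Rightarrow> real) = measure lebesgue A"
    by (subst (asm) ennreal_inj) auto
  have lin: "linear (\<lambda>r::real. r *\<^sub>R y)" by (rule bounded_linear.linear[OF bounded_linear_scaleR_left])
  have 2: "sbi (\<lambda>x. indicator A x *\<^sub>R y)"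
    using simple_bochner_integrable_compose2[of "\<lambda>r q. r *\<^sub>R y" lebesgue "indicator A :: 'a \<Rightarrow> real" "indicator A :: 'a \<Rightarrow> real"] sI by simp
  from 2 show "bintegrable (\<lambda>x. indicator A x *\<^sub>R y)" by (rule sbi_imp_bintegrable)
  show "bint (\<lambda>x. indicator A x *\<^sub>R y) = measure lebesgue A *\<^sub>R y"
    unfolding bint_sbi[OF 2] simple_bochner_integral_linear[OF lin sI] 1 ..
qed

lemma simple_function_decompose:
  fixes t :: "'a::euclidean_space \<Rightarrow> 'b::real_normed_vector"
  assumes t: "simple_function lborel t" "bintegrable t"
  shows "finite (range t - {0})" "\<And>y. y \<in> range t - {0} \<Longrightarrow> t -` {y} \<in> sets borel"
    "\<And>y. y \<in> range t - {0} \<Longrightarrow> emeasure lborel (t -` {y}) < \<infinity>"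
    "t = (\<lambda>x. \<Sum>y\<in>range t - {0}. indicator (t -` {y}) x *\<^sub>R y)"
proof -
  show fin: "finite (range t - {0})" using t by (simp add: simple_function_def)
  show m: "t -` {y} \<in> sets borel" if "y \<in> range t - {0}" for y
    using t(1) that by (auto simp: simple_function_def)
  show "emeasure lborel (t -` {y}) < \<infinity>" if y: "y \<in> range t - {0}" for y
  proof -
    have "ennreal (norm y) * emeasure lborel (t -` {y}) = (\<integral>\<^sup>+x. ennreal (norm y) * indicator (t -` {y}) x \<partial>lborel)"
      using m[OF y] by (intro nn_integral_cmult_indicator[symmetric]) auto
    also have "\<dots> \<le> (\<integral>\<^sup>+x. ennreal (norm (t x)) \<partial>lborel)"
      by (intro nn_integral_mono) (auto simp: indicator_def)
    also have "\<dots> < \<infinity>" using t(2) by (simp add: bochner_integrable_def nn_integral_completion)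
    finally show ?thesis using y by (auto simp: ennreal_mult_less_top)
  qed
  show "t = (\<lambda>x. \<Sum>y\<in>range t - {0}. indicator (t -` {y}) x *\<^sub>R y)"
  proof
    fix x
    have "(\<Sum>y\<in>range t - {0}. indicator (t -` {y}) x *\<^sub>R y) = (\<Sum>y\<in>range t - {0}. if y = t x then t x else 0)"
      by (rule sum.cong) (auto simp: indicator_def)
    also have "\<dots> = t x" using fin by (subst sum.delta) auto
    finally show "t x = (\<Sum>y\<in>range t - {0}. indicator (t -` {y}) x *\<^sub>R y)" ..
  qed
qed

lemma AE_lebesgue_pair:
  fixes P :: "real \<times> real \<Rightarrow> bool"
  assumes "AE z in lebesgue. P z"
  shows "AE x in lebesgue. AE y in lebesgue. P (x, y)"
proof -
  have "AE z in lborel \<Otimes>\<^sub>M lborel. P z"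
    using assms by (simp only: AE_completion_iff lborel_prod)
  from lborel_pair.AE_pair[OF this] show ?thesis
    by (simp only: AE_completion_iff)
qed

text \<open>
  Lebesgue measure on the plane is only the completion of the product of the Lebesgue measures, so
  \<open>q\<close> is replaced by a Borel function that agrees with it almost everywhere.
\<close>

lemma lebesgue_tonelli:
  fixes q :: "real \<times> real \<Rightarrow> ennreal"
  assumes q: "q \<in> borel_measurable lebesgue"
  shows "(\<integral>\<^sup>+x. \<integral>\<^sup>+y. q (x, y) \<partial>lebesgue \<partial>lebesgue) = (\<integral>\<^sup>+z. q z \<partial>lebesgue)"
    "(\<lambda>x. \<integral>\<^sup>+y. q (x, y) \<partial>lebesgue) \<in> borel_measurable lebesgue"
proof -
  obtain q' where q': "q' \<in> borel_measurable lborel" "AE z in lborel. q z = q' z"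
    using completion_ex_borel_measurable[OF q] by blast
  have q'm: "q' \<in> borel_measurable (lborel \<Otimes>\<^sub>M lborel)" using q'(1) by (simp add: lborel_prod)
  have "AE x in lebesgue. AE y in lebesgue. q (x, y) = q' (x, y)"
    by (rule AE_lebesgue_pair) (use q'(2) in \<open>simp only: AE_completion_iff\<close>)
  then have ae: "AE x in lebesgue. (\<integral>\<^sup>+y. q' (x, y) \<partial>lborel) = (\<integral>\<^sup>+y. q (x, y) \<partial>lebesgue)"
  proof eventually_elim
    case (elim x)
    have "(\<integral>\<^sup>+y. q (x, y) \<partial>lebesgue) = (\<integral>\<^sup>+y. q' (x, y) \<partial>lebesgue)"
      using elim by (intro nn_integral_cong_AE)
    then show ?case by (simp add: nn_integral_completion)
  qed
  have "(\<integral>\<^sup>+x. \<integral>\<^sup>+y. q (x, y) \<partial>lebesgue \<partial>lebesgue) = (\<integral>\<^sup>+x. \<integral>\<^sup>+y. q' (x, y) \<partial>lborel \<partial>lebesgue)"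
    using nn_integral_cong_AE[OF ae] by simp
  also have "\<dots> = (\<integral>\<^sup>+z. q' z \<partial>(lborel \<Otimes>\<^sub>M lborel))"
    unfolding nn_integral_completion by (rule lborel.nn_integral_fst[OF q'm])
  also have "\<dots> = (\<integral>\<^sup>+z. q z \<partial>lebesgue)"
    using nn_integral_cong_AE[OF q'(2)] by (simp add: lborel_prod nn_integral_completion)
  finally show "(\<integral>\<^sup>+x. \<integral>\<^sup>+y. q (x, y) \<partial>lebesgue \<partial>lebesgue) = (\<integral>\<^sup>+z. q z \<partial>lebesgue)" .
  have "(\<lambda>x. \<integral>\<^sup>+y. q' (x, y) \<partial>lborel) \<in> borel_measurable lebesgue"
    by (rule measurable_completion[OF lborel.borel_measurable_nn_integral_fst[OF q'm]])
  then show "(\<lambda>x. \<integral>\<^sup>+y. q (x, y) \<partial>lebesgue) \<in> borel_measurable lebesgue"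
    by (rule measurable_lebesgue_AE_cong[OF _ ae]) auto
qed

lemma bint_real:
  fixes f :: "'a::euclidean_space \<Rightarrow> real"
  assumes f: "f \<in> borel_measurable lebesgue" and fi: "bintegrable f"
  shows "bint f = integral\<^sup>L lebesgue f"
proof -
  have "has_bochner_integral lebesgue f (bint f)"
    using bint_value[OF fi] f
    unfolding has_bochner_integral_value_def by (blast intro: has_bochner_integral.intros)
  then show ?thesis by (rule has_bochner_integral_integral_eq[symmetric])
qed

text \<open>
  Fubini's theorem for a single function, with iterated integration over the second variable
  first. It is proved for indicators, then sums, and passes to limits.
\<close>

definition fubini_for :: "(real \<times> real \<Rightarrow> 'b::banach) \<Rightarrow> bool" where
  "fubini_for k \<longleftrightarrow> (AE x in lebesgue. bintegrable (\<lambda>y. k (x, y))) \<and>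
    bintegrable (\<lambda>x. bint (\<lambda>y. k (x, y))) \<and> bint (\<lambda>x. bint (\<lambda>y. k (x, y))) = bint k"

lemma fubini_forD:
  assumes "fubini_for k"
  shows "AE x in lebesgue. bintegrable (\<lambda>y. k (x, y))" "bintegrable (\<lambda>x. bint (\<lambda>y. k (x, y)))"
    "bint (\<lambda>x. bint (\<lambda>y. k (x, y))) = bint k"
  using assms unfolding fubini_for_def by blast+

text \<open>
  The inner integral of \<open>1\<^sub>A y\<close> is the measure of a section of \<open>A\<close> times \<open>y\<close>, so this is the scalar
  theorem on the measure of \<open>A\<close>.
\<close>

lemma fubini_indicator:
  fixes y :: "'b::banach"
  assumes A: "A \<in> sets borel" "emeasure lborel A < \<infinity>"
  shows "fubini_for (\<lambda>z. indicator A z *\<^sub>R y)"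
proof -
  have Ap: "A \<in> sets (lborel \<Otimes>\<^sub>M lborel)" using A(1) unfolding lborel_prod by simp
  have sec: "Pair x -` A \<in> sets lborel" for x using Ap by (rule sets_Pair1)
  then have secl: "Pair x -` A \<in> sets lebesgue" for x by simp
  have ind: "indicator A (x, r) *\<^sub>R y = indicator (Pair x -` A) r *\<^sub>R y" for x r
    by (simp add: indicator_def)
  define m where "m x = emeasure lborel (Pair x -` A)" for x
  have m [measurable]: "m \<in> borel_measurable lborel"
    unfolding m_def by (rule lborel.measurable_emeasure_Pair[OF Ap])
  have int_m: "(\<integral>\<^sup>+x. m x \<partial>lborel) = emeasure lborel A"
    using lborel.emeasure_pair_measure_alt[OF Ap] by (simp add: m_def lborel_prod)
  have "AE x in lborel. m x \<noteq> \<infinity>"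
    by (rule nn_integral_PInf_AE[OF m]) (use int_m A in auto)
  then have fin: "AE x in lebesgue. m x < \<infinity>"
    by (simp only: AE_completion_iff less_top[symmetric] infinity_ennreal_def)
  have bi: "AE x in lebesgue. bintegrable (\<lambda>r. indicator A (x, r) *\<^sub>R y) \<and>
      bint (\<lambda>r. indicator A (x, r) *\<^sub>R y) = enn2real (m x) *\<^sub>R y"
    using fin
  proof eventually_elim
    case (elim x)
    have *: "emeasure lebesgue (Pair x -` A) < \<infinity>" using elim sec[of x] by (simp add: m_def)
    have "measure lebesgue (Pair x -` A) = enn2real (m x)"
      using sec[of x] by (simp add: m_def Sigma_Algebra.measure_def)
    then show ?case unfolding ind using bint_indicator[OF secl *, of y] by simp
  qed
  have mr: "(\<lambda>x. enn2real (m x)) \<in> borel_measurable lebesgue"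
    by (rule measurable_completion) measurable
  have me: "(\<integral>\<^sup>+x. ennreal (enn2real (m x)) \<partial>lebesgue) = emeasure lborel A"
  proof -
    have "(\<integral>\<^sup>+x. ennreal (enn2real (m x)) \<partial>lebesgue) = (\<integral>\<^sup>+x. m x \<partial>lebesgue)"
      by (rule nn_integral_cong_AE) (use fin in \<open>eventually_elim, simp\<close>)
    then show ?thesis using int_m by (simp add: nn_integral_completion)
  qed
  have "smeas (\<lambda>x. enn2real (m x))"
    using strongly_measurable_scaleR_fun[OF mr strongly_measurable_const[of lebesgue "1::real"]] by simp
  then have bm: "bintegrable (\<lambda>x. enn2real (m x))"
    using me A by (simp add: bochner_integrable_def)
  have "ennreal (bint (\<lambda>x. enn2real (m x))) = emeasure lborel A"
    unfolding bint_real[OF mr bm] me[symmetric]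
    by (rule nn_integral_eq_integral[symmetric])
      (use me A mr in \<open>auto intro!: integrableI_bounded\<close>)
  then have "bint (\<lambda>x. enn2real (m x)) = measure lborel A"
    using A bint_real[OF mr bm]
    by (metis enn2real_ennreal integral_nonneg_AE AE_I2 enn2real_nonneg Sigma_Algebra.measure_def)
  then have val: "bint (\<lambda>x. enn2real (m x) *\<^sub>R y) = measure lborel A *\<^sub>R y"
    using bint_linear[OF bm bounded_linear_scaleR_left[of y]] by simp
  have Al: "A \<in> sets lebesgue" "emeasure lebesgue A < \<infinity>" using A by auto
  have bi2: "bintegrable (\<lambda>x. enn2real (m x) *\<^sub>R y)"
    by (rule bintegrable_linear[OF bm bounded_linear_scaleR_left])
  have ae: "AE x in lebesgue. enn2real (m x) *\<^sub>R y = bint (\<lambda>r. indicator A (x, r) *\<^sub>R y)"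
    using bi by eventually_elim simp
  show ?thesis
    unfolding fubini_for_def
  proof (intro conjI)
    show "AE x in lebesgue. bintegrable (\<lambda>r. indicator A (x, r) *\<^sub>R y)"
      using bi by eventually_elim simp
    show "bintegrable (\<lambda>x. bint (\<lambda>r. indicator A (x, r) *\<^sub>R y))"
      by (rule bintegrable_AE_cong[OF bi2 ae])
    show "bint (\<lambda>x. bint (\<lambda>r. indicator A (x, r) *\<^sub>R y)) = bint (\<lambda>z. indicator A z *\<^sub>R y)"
      using bint_cong_AE[OF ae] val bint_indicator(2)[OF Al, of y] A by simp
  qed
qed

lemma fubini_sum:
  assumes "finite I" "\<And>i. i \<in> I \<Longrightarrow> fubini_for (k i)" "\<And>i. i \<in> I \<Longrightarrow> bintegrable (k i)"
  shows "fubini_for (\<lambda>z. \<Sum>i\<in>I. k i z)"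
proof -
  have ae: "AE x in lebesgue. \<forall>i\<in>I. bintegrable (\<lambda>y. k i (x, y))"
    using assms(1,2) by (intro AE_finite_allI) (auto simp: fubini_for_def)
  then have ae2: "AE x in lebesgue. (\<Sum>i\<in>I. bint (\<lambda>y. k i (x, y))) = bint (\<lambda>y. \<Sum>i\<in>I. k i (x, y))"
    by eventually_elim (simp add: bint_sum)
  have s: "bintegrable (\<lambda>x. \<Sum>i\<in>I. bint (\<lambda>y. k i (x, y))) \<and>
     bint (\<lambda>x. \<Sum>i\<in>I. bint (\<lambda>y. k i (x, y))) = (\<Sum>i\<in>I. bint (\<lambda>x. bint (\<lambda>y. k i (x, y))))"
    using assms(2) by (intro bint_sum) (auto simp: fubini_for_def)
  show ?thesis unfolding fubini_for_def
  proof (intro conjI)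
    show "AE x in lebesgue. bintegrable (\<lambda>y. \<Sum>i\<in>I. k i (x, y))"
      using ae by eventually_elim (simp add: bint_sum)
    show "bintegrable (\<lambda>x. bint (\<lambda>y. \<Sum>i\<in>I. k i (x, y)))"
      by (rule bintegrable_AE_cong[OF conjunct1[OF s] ae2])
    have "bint (\<lambda>x. bint (\<lambda>y. \<Sum>i\<in>I. k i (x, y))) = (\<Sum>i\<in>I. bint (k i))"
      using bint_cong_AE[OF ae2] s assms(2) by (simp add: fubini_for_def)
    also have "\<dots> = bint (\<lambda>z. \<Sum>i\<in>I. k i z)"
      using bint_sum[of I k] assms(3) by simp
    finally show "bint (\<lambda>x. bint (\<lambda>y. \<Sum>i\<in>I. k i (x, y))) = bint (\<lambda>z. \<Sum>i\<in>I. k i z)" .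
  qed
qed

lemma fubini_simple:
  fixes t :: "real \<times> real \<Rightarrow> 'b::banach"
  assumes t: "simple_function lborel t" "bintegrable t"
  shows "fubini_for t"
proof -
  define I where "I = range t - {0}"
  note I = simple_function_decompose(1-3)[OF t, folded I_def]
  note eq = simple_function_decompose(4)[OF t, folded I_def]
  have "fubini_for (\<lambda>x. \<Sum>y\<in>I. indicator (t -` {y}) x *\<^sub>R y)"
    using I by (intro fubini_sum fubini_indicator bint_indicator) auto
  then show ?thesis unfolding eq[symmetric] .
qed

lemma bint_tendsto:
  fixes k :: "'a::euclidean_space \<Rightarrow> 'b::banach"
  assumes k: "bintegrable k" and t: "\<And>i::nat. bintegrable (t i)"
    and lim: "(\<lambda>i. \<integral>\<^sup>+z. ennreal (norm (k z - t i z)) \<partial>lebesgue) \<longlonglongrightarrow> 0"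
  shows "(\<lambda>i. bint (t i)) \<longlonglongrightarrow> bint k"
proof -
  have "(\<lambda>i. bint k - bint (t i)) \<longlonglongrightarrow> 0"
  proof (rule tendsto_of_ennreal_dist[OF _ lim])
    show "ennreal (norm (bint k - bint (t i))) \<le> (\<integral>\<^sup>+z. ennreal (norm (k z - t i z)) \<partial>lebesgue)" for i
      using norm_bint_le[OF bintegrable_diff[OF k t]] by (simp add: bint_diff k t)
  qed
  from tendsto_diff[OF tendsto_const[of "bint k"] this] show ?thesis by simp
qed

text \<open>
  Dominated convergence, in the form used most: convergence in mean, from which the
  convergence of the integrals follows.
\<close>

lemma bint_dominated:
  fixes k :: "'a::euclidean_space \<Rightarrow> 'b::banach"
  assumes t: "\<And>i::nat. smeas (t i)" and lim: "AE z in lebesgue. (\<lambda>i. t i z) \<longlonglongrightarrow> k z"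
    and bd: "\<And>i. AE z in lebesgue. ennreal (norm (t i z)) \<le> w z"
    and w: "w \<in> borel_measurable lebesgue" "(\<integral>\<^sup>+z. w z \<partial>lebesgue) < \<infinity>"
  shows "bintegrable k" "\<And>i. bintegrable (t i)"
    "(\<lambda>i. \<integral>\<^sup>+z. ennreal (norm (k z - t i z)) \<partial>lebesgue) \<longlonglongrightarrow> 0"
    "(\<lambda>i. bint (t i)) \<longlonglongrightarrow> bint k"
proof -
  have ks: "smeas k" by (rule strongly_measurable_lim[OF t lim])
  have kb: "AE z in lebesgue. ennreal (norm (k z)) \<le> w z"
  proof -
    have "AE z in lebesgue. \<forall>i. ennreal (norm (t i z)) \<le> w z"
      using bd by (simp add: AE_all_countable)
    with lim show ?thesis
    proof eventually_elim
      case (elim z)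
      have "(\<lambda>i. ennreal (norm (t i z))) \<longlonglongrightarrow> ennreal (norm (k z))"
        by (intro tendsto_ennrealI tendsto_norm elim)
      then show ?case by (rule LIMSEQ_le_const2) (use elim(2) in blast)
    qed
  qed
  show ki: "bintegrable k" by (rule bintegrable_bound[OF ks kb w(2)])
  show ti: "bintegrable (t i)" for i by (rule bintegrable_bound[OF t bd w(2)])
  have "(\<lambda>i. \<integral>\<^sup>+z. ennreal (norm (k z - t i z)) \<partial>lebesgue) \<longlonglongrightarrow> (\<integral>\<^sup>+z. 0 \<partial>(lebesgue :: 'a measure))"
  proof (rule nn_integral_dominated_convergence[where w="\<lambda>z. 2 * w z"])
    show "(\<lambda>z. ennreal (norm (k z - t j z))) \<in> borel_measurable lebesgue" for j
      by (intro measurable_compose[OF norm_measurable] strongly_measurable_diff ks t) auto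
    show "AE z in lebesgue. ennreal (norm (k z - t j z)) \<le> 2 * w z" for j
      using kb bd[of j]
    proof eventually_elim
      case (elim z)
      have "ennreal (norm (k z - t j z)) \<le> ennreal (norm (k z)) + ennreal (norm (t j z))"
        by (simp flip: ennreal_plus add: norm_triangle_ineq4)
      also have "\<dots> \<le> w z + w z" using elim by (intro add_mono)
      finally show ?case by (simp add: mult_2)
    qed
    show "AE z in lebesgue. (\<lambda>i. ennreal (norm (k z - t i z))) \<longlonglongrightarrow> 0"
      using lim
    proof eventually_elim
      case (elim z)
      have "(\<lambda>i. ennreal (norm (k z - t i z))) \<longlonglongrightarrow> ennreal (norm (k z - k z))"
        by (intro tendsto_ennrealI tendsto_intros elim)
      then show ?case by simp
    qed
    show "(\<integral>\<^sup>+z. 2 * w z \<partial>lebesgue) < \<infinity>"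
      using w by (subst nn_integral_cmult) (auto simp: ennreal_mult_less_top)
  qed (use w in auto)
  then show lim0: "(\<lambda>i. \<integral>\<^sup>+z. ennreal (norm (k z - t i z)) \<partial>lebesgue) \<longlonglongrightarrow> 0" by simp
  show "(\<lambda>i. bint (t i)) \<longlonglongrightarrow> bint k" by (rule bint_tendsto[OF ki ti lim0])
qed

text \<open>
  Simple functions \<open>t i\<close> that are dominated by \<open>2 \<parallel>k\<parallel>\<close> converge to \<open>k\<close> on almost every section, and the
  section of \<open>\<parallel>k\<parallel>\<close> is integrable by Tonelli. So inner integrals converge almost everywhere by
  dominated convergence, and in mean because their distance is at most the integral of \<open>\<parallel>k - t i\<parallel>\<close> over
  the plane.
\<close>

theorem bochner_fubini:
  fixes k :: "real \<times> real \<Rightarrow> 'b::banach"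
  assumes k: "bintegrable k"
  shows "fubini_for k"
proof -
  obtain t where t: "\<And>i::nat. simple_function lborel (t i)" "\<And>i. bintegrable (t i)"
    "AE z in lebesgue. \<forall>i. norm (t i z) \<le> 2 * norm (k z)"
    "AE z in lebesgue. (\<lambda>i. t i z) \<longlonglongrightarrow> k z"
    "(\<lambda>i. \<integral>\<^sup>+z. ennreal (norm (k z - t i z)) \<partial>lebesgue) \<longlonglongrightarrow> 0"
    by (rule bintegrable_lborel_approx[OF k], rule that)
  have ft: "fubini_for (t i)" for i by (rule fubini_simple[OF t(1,2)])
  have nm: "(\<lambda>z. ennreal (norm (k z))) \<in> borel_measurable lebesgue"
    by (intro measurable_compose[OF norm_measurable] smeas_bintegrable k) auto
  have a1: "AE x in lebesgue. AE y in lebesgue. \<forall>i. norm (t i (x, y)) \<le> 2 * norm (k (x, y))"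
    by (rule AE_lebesgue_pair[OF t(3)])
  have a2: "AE x in lebesgue. AE y in lebesgue. (\<lambda>i. t i (x, y)) \<longlonglongrightarrow> k (x, y)"
    by (rule AE_lebesgue_pair[OF t(4)])
  have kfin: "(\<integral>\<^sup>+x. \<integral>\<^sup>+y. ennreal (norm (k (x, y))) \<partial>lebesgue \<partial>lebesgue) < \<infinity>"
    using lebesgue_tonelli(1)[OF nm] k by (simp add: bochner_integrable_def)
  have a3: "AE x in lebesgue. (\<integral>\<^sup>+y. ennreal (norm (k (x, y))) \<partial>lebesgue) \<noteq> \<infinity>"
    by (rule nn_integral_PInf_AE[OF lebesgue_tonelli(2)[OF nm]]) (use kfin in auto)
  have a4: "AE x in lebesgue. \<forall>i. bintegrable (\<lambda>y. t i (x, y))"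
    using ft by (simp add: AE_all_countable fubini_for_def)
  have main: "AE x in lebesgue. bintegrable (\<lambda>y. k (x, y)) \<and>
      (\<lambda>i. bint (\<lambda>y. t i (x, y))) \<longlonglongrightarrow> bint (\<lambda>y. k (x, y))"
    using a1 a2 a3 a4
  proof eventually_elim
    case (elim x)
    have ts: "smeas (\<lambda>y. t i (x, y))" for i using elim(4) by (simp add: smeas_bintegrable)
    have ks: "smeas (\<lambda>y. k (x, y))" by (rule strongly_measurable_lim[OF ts elim(2)])
    have bd: "AE y in lebesgue. ennreal (norm (t i (x, y))) \<le> 2 * ennreal (norm (k (x, y)))" for i
      using elim(1) by eventually_elim (auto simp flip: ennreal_mult' ennreal_numeral intro!: ennreal_leI)
    have m: "(\<lambda>y. ennreal (norm (k (x, y)))) \<in> borel_measurable lebesgue"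
      by (intro measurable_compose[OF norm_measurable] ks) auto
    have f: "(\<integral>\<^sup>+y. 2 * ennreal (norm (k (x, y))) \<partial>lebesgue) < \<infinity>"
      using elim(3) m by (subst nn_integral_cmult) (auto simp: ennreal_mult_less_top less_top)
    show ?case
      using bint_dominated(1,4)[where t="\<lambda>i y. t i (x, y)", OF ts elim(2) bd _ f] m by simp
  qed
  have Fs: "smeas (\<lambda>x. bint (\<lambda>y. k (x, y)))"
  proof (rule strongly_measurable_lim)
    show "smeas (\<lambda>x. bint (\<lambda>y. t i (x, y)))" for i
      using ft[of i] by (simp add: fubini_for_def smeas_bintegrable)
    show "AE x in lebesgue. (\<lambda>i. bint (\<lambda>y. t i (x, y))) \<longlonglongrightarrow> bint (\<lambda>y. k (x, y))"
      using main by eventually_elim simp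
  qed
  have Fi: "bintegrable (\<lambda>x. bint (\<lambda>y. k (x, y)))"
  proof (rule bintegrable_bound[OF Fs _ kfin])
    show "AE x in lebesgue. ennreal (norm (bint (\<lambda>y. k (x, y)))) \<le> (\<integral>\<^sup>+y. ennreal (norm (k (x, y))) \<partial>lebesgue)"
      using main by eventually_elim (simp add: norm_bint_le)
  qed
  have ti: "bintegrable (\<lambda>x. bint (\<lambda>y. t i (x, y)))" for i
    using ft[of i] by (simp add: fubini_for_def)
  have "(\<lambda>i. bint (\<lambda>x. bint (\<lambda>y. t i (x, y)))) \<longlonglongrightarrow> bint (\<lambda>x. bint (\<lambda>y. k (x, y)))"
  proof (rule bint_tendsto[OF Fi ti], rule tendsto_sandwich[OF _ _ tendsto_const t(5)])
    show "\<forall>\<^sub>F i in sequentially. (\<integral>\<^sup>+x. ennreal (norm (bint (\<lambda>y. k (x, y)) - bint (\<lambda>y. t i (x, y)))) \<partial>lebesgue) \<le>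
       (\<integral>\<^sup>+z. ennreal (norm (k z - t i z)) \<partial>lebesgue)"
    proof (intro always_eventually allI)
      fix i
      have "AE x in lebesgue. ennreal (norm (bint (\<lambda>y. k (x, y)) - bint (\<lambda>y. t i (x, y)))) \<le>
        (\<integral>\<^sup>+y. ennreal (norm (k (x, y) - t i (x, y))) \<partial>lebesgue)"
        using main a4
      proof eventually_elim
        case (elim x)
        then show ?case
          using norm_bint_le[OF bintegrable_diff[of "\<lambda>y. k (x, y)" "\<lambda>y. t i (x, y)"]] by (simp add: bint_diff)
      qed
      then have "(\<integral>\<^sup>+x. ennreal (norm (bint (\<lambda>y. k (x, y)) - bint (\<lambda>y. t i (x, y)))) \<partial>lebesgue) \<le>
        (\<integral>\<^sup>+x. \<integral>\<^sup>+y. ennreal (norm (k (x, y) - t i (x, y))) \<partial>lebesgue \<partial>lebesgue)"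
        by (rule nn_integral_mono_AE)
      also have "\<dots> = (\<integral>\<^sup>+z. ennreal (norm (k z - t i z)) \<partial>lebesgue)"
        by (rule lebesgue_tonelli(1)[of "\<lambda>z. ennreal (norm (k z - t i z))"])
          (intro measurable_compose[OF norm_measurable] strongly_measurable_diff smeas_bintegrable k t, auto)
      finally show "(\<integral>\<^sup>+x. ennreal (norm (bint (\<lambda>y. k (x, y)) - bint (\<lambda>y. t i (x, y)))) \<partial>lebesgue) \<le>
         (\<integral>\<^sup>+z. ennreal (norm (k z - t i z)) \<partial>lebesgue)" .
    qed
  qed auto
  moreover have "bint (\<lambda>x. bint (\<lambda>y. t i (x, y))) = bint (t i)" for i
    using ft[of i] by (simp add: fubini_for_def)
  ultimately have "(\<lambda>i. bint (t i)) \<longlonglongrightarrow> bint (\<lambda>x. bint (\<lambda>y. k (x, y)))" by simp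
  then have "bint (\<lambda>x. bint (\<lambda>y. k (x, y))) = bint k"
    using bint_tendsto[OF k t(2) t(5)] by (rule LIMSEQ_unique)
  moreover have "AE x in lebesgue. bintegrable (\<lambda>y. k (x, y))"
    using main by eventually_elim simp
  ultimately show ?thesis using Fi by (simp add: fubini_for_def)
qed

text \<open>
  Both sides agree for indicators of Borel sets, and both are continuous with respect to
  convergence in mean.
\<close>

lemma preserves_bint:
  fixes k :: "'a::euclidean_space \<Rightarrow> 'b::banach"
  assumes \<phi>: "preserves_lborel (\<phi> :: 'a \<Rightarrow> 'a)" and k: "bintegrable k"
  shows "bint (\<lambda>z. k (\<phi> z)) = bint k"
proof -
  obtain t where t: "\<And>i::nat. simple_function lborel (t i)" "\<And>i. bintegrable (t i)"
    "AE z in lebesgue. \<forall>i. norm (t i z) \<le> 2 * norm (k z)"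
    "AE z in lebesgue. (\<lambda>i. t i z) \<longlonglongrightarrow> k z"
    "(\<lambda>i. \<integral>\<^sup>+z. ennreal (norm (k z - t i z)) \<partial>lebesgue) \<longlonglongrightarrow> 0"
    by (rule bintegrable_lborel_approx[OF k], rule that)
  have m: "\<phi> \<in> measurable borel borel" and d: "distr lborel lborel \<phi> = lborel"
    using \<phi> by (auto simp: preserves_lborel_def)
  have eq: "bint (\<lambda>z. t i (\<phi> z)) = bint (t i)" for i
  proof -
    define I where "I = range (t i) - {0}"
    note I = simple_function_decompose(1-3)[OF t(1)[of i] t(2)[of i], folded I_def]
    note eq = simple_function_decompose(4)[OF t(1)[of i] t(2)[of i], folded I_def]
    have 1: "bintegrable (\<lambda>x. indicator (t i -` {y}) x *\<^sub>R y)" "bint (\<lambda>x. indicator (t i -` {y}) x *\<^sub>R y) = measure lborel (t i -` {y}) *\<^sub>R y"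
      if "y \<in> I" for y using bint_indicator[of "t i -` {y}" y] I(2,3)[OF that] by auto
    have em: "emeasure lborel (\<phi> -` (t i -` {y})) = emeasure lborel (t i -` {y})" "\<phi> -` (t i -` {y}) \<in> sets borel" if "y \<in> I" for y
    proof -
      show "\<phi> -` (t i -` {y}) \<in> sets borel" using measurable_sets[OF m I(2)[OF that]] by simp
      have "emeasure (distr lborel lborel \<phi>) (t i -` {y}) = emeasure lborel (\<phi> -` (t i -` {y}) \<inter> space lborel)"
        using m I(2)[OF that] by (intro emeasure_distr) auto
      then show "emeasure lborel (\<phi> -` (t i -` {y})) = emeasure lborel (t i -` {y})" by (simp add: d)
    qed
    have 2: "bintegrable (\<lambda>x. indicator (\<phi> -` (t i -` {y})) x *\<^sub>R y)" "bint (\<lambda>x. indicator (\<phi> -` (t i -` {y})) x *\<^sub>R y) = measure lborel (t i -` {y}) *\<^sub>R y"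
      if "y \<in> I" for y using bint_indicator[of "\<phi> -` (t i -` {y})" y] em[OF that] I(2,3)[OF that]
      by (auto simp: Sigma_Algebra.measure_def)
    have "(\<lambda>z. t i (\<phi> z)) = (\<lambda>z. \<Sum>y\<in>I. indicator (\<phi> -` (t i -` {y})) z *\<^sub>R y)"
    proof
      fix z show "t i (\<phi> z) = (\<Sum>y\<in>I. indicator (\<phi> -` (t i -` {y})) z *\<^sub>R y)"
        using fun_cong[OF eq, of "\<phi> z"] by (simp add: indicator_def)
    qed
    then have "bint (\<lambda>z. t i (\<phi> z)) = (\<Sum>y\<in>I. measure lborel (t i -` {y}) *\<^sub>R y)"
      using bint_sum[of I "\<lambda>y z. indicator (\<phi> -` (t i -` {y})) z *\<^sub>R y"] 2 by simp
    also have "\<dots> = bint (t i)"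
      using bint_sum[of I "\<lambda>y z. indicator (t i -` {y}) z *\<^sub>R y"] 1 eq[symmetric] by simp
    finally show ?thesis .
  qed
  have "(\<lambda>i. bint (\<lambda>z. t i (\<phi> z))) \<longlonglongrightarrow> bint (\<lambda>z. k (\<phi> z))"
  proof (rule bint_tendsto)
    have "(\<integral>\<^sup>+z. ennreal (norm (k (\<phi> z) - t i (\<phi> z))) \<partial>lebesgue) = (\<integral>\<^sup>+z. ennreal (norm (k z - t i z)) \<partial>lebesgue)" for i
      by (rule preserves_nn_integral[OF \<phi>, of "\<lambda>z. ennreal (norm (k z - t i z))"])
        (intro measurable_compose[OF norm_measurable] strongly_measurable_diff smeas_bintegrable k t, auto)
    then show "(\<lambda>i. \<integral>\<^sup>+z. ennreal (norm (k (\<phi> z) - t i (\<phi> z))) \<partial>lebesgue) \<longlonglongrightarrow> 0" using t(5) by simp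
  qed (rule preserves_bintegrable[OF \<phi> k] preserves_bintegrable[OF \<phi> t(2)])+
  then have "(\<lambda>i. bint (t i)) \<longlonglongrightarrow> bint (\<lambda>z. k (\<phi> z))" by (simp add: eq)
  then show ?thesis using bint_tendsto[OF k t(2,5)] by (rule LIMSEQ_unique)
qed

lemma bochner_fubini_swap:
  fixes k :: "real \<times> real \<Rightarrow> 'b::banach"
  assumes k: "bintegrable k"
  shows "AE y in lebesgue. bintegrable (\<lambda>x. k (x, y))" "bintegrable (\<lambda>y. bint (\<lambda>x. k (x, y)))"
    "bint (\<lambda>y. bint (\<lambda>x. k (x, y))) = bint (\<lambda>x. bint (\<lambda>y. k (x, y)))"
proof -
  have f: "fubini_for (\<lambda>z. k (snd z, fst z))"
    by (rule bochner_fubini[OF preserves_bintegrable[OF preserves_swap k]])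
  from fubini_forD(1)[OF f] show "AE y in lebesgue. bintegrable (\<lambda>x. k (x, y))" by simp
  from fubini_forD(2)[OF f] show "bintegrable (\<lambda>y. bint (\<lambda>x. k (x, y)))" by simp
  have "bint (\<lambda>y. bint (\<lambda>x. k (x, y))) = bint (\<lambda>z. k (snd z, fst z))"
    using fubini_forD(3)[OF f] by simp
  also have "\<dots> = bint k" by (rule preserves_bint[OF preserves_swap k])
  also have "\<dots> = bint (\<lambda>x. bint (\<lambda>y. k (x, y)))"
    by (rule fubini_forD(3)[OF bochner_fubini[OF k], symmetric])
  finally show "bint (\<lambda>y. bint (\<lambda>x. k (x, y))) = bint (\<lambda>x. bint (\<lambda>y. k (x, y)))" .
qed

section \<open>Positive decompositions with control of the norm\<close>

text \<open>
  The quantitative form of a generating cone. The first argument only carries the type.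
\<close>

definition decomposition_bound :: "'x::{real_normed_vector,ordered_real_vector} itself \<Rightarrow> real \<Rightarrow> bool" where
  "decomposition_bound _ M \<longleftrightarrow>
    (\<forall>w::'x. \<exists>u v. 0 \<le> u \<and> 0 \<le> v \<and> w = u - v \<and> norm u + norm v \<le> M * norm w)"

lemma decomposition_bound_mono:
  assumes "decomposition_bound TYPE('x::{real_normed_vector,ordered_real_vector}) M" "M \<le> N"
  shows "decomposition_bound TYPE('x) N"
  unfolding decomposition_bound_def
proof
  fix w :: 'x
  obtain u v where uv: "0 \<le> u" "0 \<le> v" "w = u - v" "norm u + norm v \<le> M * norm w"
    using assms(1) unfolding decomposition_bound_def by blast
  have "M * norm w \<le> N * norm w" using assms(2) by (rule mult_right_mono) simp
  then show "\<exists>u v. 0 \<le> u \<and> 0 \<le> v \<and> w = u - v \<and> norm u + norm v \<le> N * norm w"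
    using uv by (intro exI[of _ u] exI[of _ v]) auto
qed

lemma closed_cone_limit:
  fixes X :: "nat \<Rightarrow> 'x::{real_normed_vector,ordered_real_vector}"
  assumes "closed {u::'x. 0 \<le> u}" "\<And>n. 0 \<le> X n" "X \<longlonglongrightarrow> l"
  shows "0 \<le> l"
  using closed_sequentially[OF assms(1), of X l] assms(2,3) by auto

lemma closed_cone_le:
  fixes X Y :: "nat \<Rightarrow> 'x::{real_normed_vector,ordered_real_vector}"
  assumes "closed {u::'x. 0 \<le> u}" "\<And>n. X n \<le> Y n" "X \<longlonglongrightarrow> l" "Y \<longlonglongrightarrow> m"
  shows "l \<le> m"
  using closed_cone_limit[OF assms(1), of "\<lambda>n. Y n - X n" "m - l"] assms(2-4)
  by (simp add: tendsto_diff)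

text \<open>
  Approximate decompositions up to half the norm can be iterated on the remainder. The positive
  and the negative parts that are found form two series dominated by \<open>C \<parallel>w\<parallel> 2\<^sup>-\<^sup>n\<close>, which explains the
  factor 2.
\<close>

lemma decomposition_by_approximation:
  fixes C :: real
  assumes cl: "closed {u::'x::{banach,ordered_real_vector}. 0 \<le> u}"
    and ap: "\<And>(x::'x) e. e > 0 \<Longrightarrow> \<exists>p q. 0 \<le> p \<and> 0 \<le> q \<and> norm (x - (p - q)) \<le> e \<and> norm p + norm q \<le> C * norm x"
  shows "decomposition_bound TYPE('x) (2 * C)"
  unfolding decomposition_bound_def
proof
  fix w :: 'x
  have "\<exists>p q. 0 \<le> p \<and> 0 \<le> q \<and> norm (x - (p - q)) \<le> norm x / 2 \<and> norm p + norm q \<le> C * norm x" for x :: 'x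
  proof (cases "x = 0")
    case False
    then show ?thesis using ap[of "norm x / 2" x] by auto
  next
    case True
    then show ?thesis by (intro exI[of _ 0]) auto
  qed
  then obtain P Q :: "'x \<Rightarrow> 'x" where PQ: "\<And>x. 0 \<le> P x" "\<And>x. 0 \<le> Q x"
      "\<And>x. norm (x - (P x - Q x)) \<le> norm x / 2" "\<And>x. norm (P x) + norm (Q x) \<le> C * norm x"
    by metis
  \<comment> \<open>the remainder after \<open>n\<close> approximations\<close>
  define y where "y n = ((\<lambda>x. x - (P x - Q x)) ^^ n) w" for n
  have y0: "y 0 = w" and yS: "y (Suc n) = y n - (P (y n) - Q (y n))" for n by (simp_all add: y_def)
  have yn: "norm (y n) \<le> norm w * (1/2)^n" for n
  proof (induction n)
    case (Suc n)
    have "norm (y (Suc n)) \<le> norm (y n) / 2" unfolding yS by (rule PQ(3))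
    with Suc show ?case by simp
  qed (simp add: y0)
  have C0: "0 \<le> C * norm x" for x :: 'x
    using PQ(4)[of x] norm_ge_zero[of "P x"] norm_ge_zero[of "Q x"] by linarith
  have PQn: "norm (P (y n)) + norm (Q (y n)) \<le> C * norm w * (1/2)^n" for n
  proof (cases "C \<ge> 0")
    case True
    then show ?thesis using PQ(4)[of "y n"] mult_left_mono[OF yn[of n] True] by (simp add: mult.assoc)
  next
    case False
    then have "norm w = 0" "norm (y n) = 0" using C0[of w] C0[of "y n"]
      by (smt (verit) mult_neg_pos norm_ge_zero)+
    then show ?thesis using PQ(4)[of "y n"] by simp
  qed
  have geo: "summable (\<lambda>n. C * norm w * (1/2)^n)" by (intro summable_mult summable_geometric) auto
  have nP: "norm (P (y n)) \<le> C * norm w * (1/2)^n" for n using PQn[of n] norm_ge_zero[of "Q (y n)"] by linarith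
  have nQ: "norm (Q (y n)) \<le> C * norm w * (1/2)^n" for n using PQn[of n] norm_ge_zero[of "P (y n)"] by linarith
  have sPn: "summable (\<lambda>n. norm (P (y n)))" by (rule summable_comparison_test'[OF geo]) (use nP in auto)
  have sQn: "summable (\<lambda>n. norm (Q (y n)))" by (rule summable_comparison_test'[OF geo]) (use nQ in auto)
  have sP: "summable (\<lambda>n. P (y n))" by (rule summable_norm_cancel[OF sPn])
  have sQ: "summable (\<lambda>n. Q (y n))" by (rule summable_norm_cancel[OF sQn])
  have remainder: "w - (\<Sum>k<n. P (y k) - Q (y k)) = y n" for n
    by (induction n) (auto simp: y0 yS algebra_simps)
  have "(\<lambda>n. norm w * (1/2)^n) \<longlonglongrightarrow> norm w * 0" by (intro tendsto_intros LIMSEQ_realpow_zero) auto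
  then have "y \<longlonglongrightarrow> 0" using yn by (intro Lim_null_comparison[of y "\<lambda>n. norm w * (1/2)^n"]) auto
  then have "(\<lambda>n. w - (\<Sum>k<n. P (y k) - Q (y k))) \<longlonglongrightarrow> 0" by (simp add: remainder)
  from tendsto_diff[OF tendsto_const[of w] this] have "(\<lambda>n. P (y n) - Q (y n)) sums w"
    by (simp add: sums_def)
  moreover have "(\<lambda>n. P (y n) - Q (y n)) sums ((\<Sum>n. P (y n)) - (\<Sum>n. Q (y n)))"
    by (intro sums_diff summable_sums sP sQ)
  ultimately have w: "w = (\<Sum>n. P (y n)) - (\<Sum>n. Q (y n))" by (rule sums_unique2)
  have "0 \<le> (\<Sum>n. P (y n))" "0 \<le> (\<Sum>n. Q (y n))"
    using closed_cone_limit[OF cl _ summable_LIMSEQ[OF sP]] closed_cone_limit[OF cl _ summable_LIMSEQ[OF sQ]]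
    by (simp_all add: sum_nonneg PQ)
  moreover have "norm (\<Sum>n. P (y n)) + norm (\<Sum>n. Q (y n)) \<le> 2 * C * norm w"
  proof -
    have "norm (\<Sum>n. P (y n)) + norm (\<Sum>n. Q (y n)) \<le> (\<Sum>n. norm (P (y n))) + (\<Sum>n. norm (Q (y n)))"
      by (intro add_mono summable_norm sPn sQn)
    also have "\<dots> = (\<Sum>n. norm (P (y n)) + norm (Q (y n)))" by (rule suminf_add[OF sPn sQn])
    also have "\<dots> \<le> (\<Sum>n. C * norm w * (1/2)^n)" by (intro suminf_le PQn summable_add sPn sQn geo)
    also have "\<dots> = C * norm w * 2" by (subst suminf_mult) (auto simp: suminf_geometric summable_geometric)
    finally show ?thesis by simp
  qed
  ultimately show "\<exists>u v. 0 \<le> u \<and> 0 \<le> v \<and> w = u - v \<and> norm u + norm v \<le> 2 * C * norm w"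
    using w by blast
qed

text \<open>
  Let \<open>A n\<close> be the set of differences \<open>p - q\<close> of positive elements with \<open>\<parallel>p\<parallel> + \<parallel>q\<parallel> \<le> n\<close>. These sets cover the
  space, so by Baire's theorem the closure of some \<open>A n\<close> contains a ball, and, being convex and
  symmetric, a ball around 0. After scaling, every \<open>x\<close> is a limit of differences \<open>p - q\<close> with
  \<open>\<parallel>p\<parallel> + \<parallel>q\<parallel> \<le> C \<parallel>x\<parallel>\<close>, and closedness of the cone allows exact decompositions.
\<close>

theorem generating_closed_cone_decomposition:
  assumes cl: "closed {u::'x::{banach,ordered_real_vector}. 0 \<le> u}"
    and gen: "\<forall>w::'x. \<exists>u v. 0 \<le> u \<and> 0 \<le> v \<and> w = u - v"
  shows "\<exists>M. decomposition_bound TYPE('x) M"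
proof -
  define A :: "nat \<Rightarrow> 'x set" where "A n = {p - q | p q. 0 \<le> p \<and> 0 \<le> q \<and> norm p + norm q \<le> real n}" for n
  have "(\<Union>n. closure (A n)) = UNIV"
  proof -
    have "\<exists>n. w \<in> closure (A n)" for w
    proof -
      obtain u v where uv: "0 \<le> u" "0 \<le> v" "w = u - v" using gen by blast
      obtain n where "norm u + norm v \<le> real n" using real_arch_simple by blast
      then have "w \<in> A n" using uv by (auto simp: A_def)
      then show ?thesis using closure_subset by blast
    qed
    then show ?thesis by blast
  qed
  then have "\<exists>n. interior (closure (A n)) \<noteq> {}"
    using Baire_category_alt[of "euclidean :: 'x topology" "range (\<lambda>n. closure (A n))"]
    by (auto simp: completely_metrizable_space_euclidean)
  then obtain n x0 where "x0 \<in> interior (closure (A n))" by blast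
  then obtain r where r: "r > 0" "ball x0 r \<subseteq> closure (A n)"
    using mem_interior by blast
  have sym: "- y \<in> closure (A n)" if "y \<in> closure (A n)" for y
  proof -
    have "uminus ` A n \<subseteq> A n"
    proof
      fix z assume "z \<in> uminus ` A n"
      then obtain p q where "z = q - p" "0 \<le> p" "0 \<le> q" "norm p + norm q \<le> real n"
        by (auto simp: A_def)
      then show "z \<in> A n" unfolding A_def
        by (intro CollectI exI[of _ q] exI[of _ p]) (auto simp: add.commute)
    qed
    then have "closure (uminus ` A n) \<subseteq> closure (A n)" by (rule closure_mono)
    moreover have "uminus ` closure (A n) \<subseteq> closure (uminus ` A n)"
      by (rule continuous_image_closure_subset[of UNIV]) (auto intro: continuous_intros)
    ultimately show ?thesis using that by blast
  qed
  have conv: "convex (closure (A n))"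
  proof (rule convex_closure, rule convexI)
    fix x y :: 'x and a b :: real
    assume x: "x \<in> A n" and y: "y \<in> A n" and ab: "0 \<le> a" "0 \<le> b" "a + b = 1"
    obtain p q where pq: "x = p - q" "0 \<le> p" "0 \<le> q" "norm p + norm q \<le> real n" using x by (auto simp: A_def)
    obtain p' q' where pq': "y = p' - q'" "0 \<le> p'" "0 \<le> q'" "norm p' + norm q' \<le> real n" using y by (auto simp: A_def)
    have "norm (a *\<^sub>R p + b *\<^sub>R p') + norm (a *\<^sub>R q + b *\<^sub>R q') \<le> a * (norm p + norm q) + b * (norm p' + norm q')"
      using norm_triangle_ineq[of "a *\<^sub>R p" "b *\<^sub>R p'"] norm_triangle_ineq[of "a *\<^sub>R q" "b *\<^sub>R q'"] ab
      by (simp add: algebra_simps)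
    also have "\<dots> \<le> a * real n + b * real n"
      using pq pq' ab by (intro add_mono mult_left_mono) auto
    also have "\<dots> = real n" using ab by (simp flip: distrib_right)
    finally have "norm (a *\<^sub>R p + b *\<^sub>R p') + norm (a *\<^sub>R q + b *\<^sub>R q') \<le> real n" .
    moreover have "a *\<^sub>R x + b *\<^sub>R y = (a *\<^sub>R p + b *\<^sub>R p') - (a *\<^sub>R q + b *\<^sub>R q')"
      unfolding pq(1) pq'(1) by (simp add: algebra_simps)
    moreover have "0 \<le> a *\<^sub>R p + b *\<^sub>R p'" "0 \<le> a *\<^sub>R q + b *\<^sub>R q'"
      using pq pq' ab by (auto intro!: add_nonneg_nonneg scaleR_nonneg_nonneg)
    ultimately show "a *\<^sub>R x + b *\<^sub>R y \<in> A n" unfolding A_def by blast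
  qed
  \<comment> \<open>\<open>y\<close> is the midpoint of \<open>x0 + y\<close> and \<open>- (x0 - y)\<close>\<close>
  have ball0: "y \<in> closure (A n)" if "norm y < r" for y
  proof -
    have "x0 + y \<in> closure (A n)" "x0 - y \<in> closure (A n)"
      using r that by (auto simp: subset_iff dist_norm)
    then have "(1/2) *\<^sub>R (x0 + y) + (1/2) *\<^sub>R (- (x0 - y)) \<in> closure (A n)"
      by (intro convexD[OF conv] sym) auto
    then show ?thesis by (simp add: algebra_simps flip: scaleR_add_left)
  qed
  \<comment> \<open>\<open>c x\<close> below has norm \<open>r / 2\<close>, so scaling back multiplies \<open>n\<close> by \<open>2 \<parallel>x\<parallel> / r\<close>\<close>
  define C where "C = 2 * real n / r"
  have "decomposition_bound TYPE('x) (2 * C)"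
  proof (rule decomposition_by_approximation[OF cl])
    fix x :: 'x and e :: real assume e: "e > 0"
    show "\<exists>p q. 0 \<le> p \<and> 0 \<le> q \<and> norm (x - (p - q)) \<le> e \<and> norm p + norm q \<le> C * norm x"
    proof (cases "x = 0")
      case True
      then show ?thesis using e by (intro exI[of _ 0]) auto
    next
      case False
      define c where "c = r / (2 * norm x)"
      have c: "c > 0" using r False by (simp add: c_def)
      have "norm (c *\<^sub>R x) < r" using False r c by (simp add: c_def)
      then have "c *\<^sub>R x \<in> closure (A n)" by (rule ball0)
      moreover have "c * e > 0" using c e by simp
      ultimately obtain z where z: "z \<in> A n" "dist z (c *\<^sub>R x) < c * e"
        unfolding closure_approachable by blast
      then obtain p q where pq: "z = p - q" "0 \<le> p" "0 \<le> q" "norm p + norm q \<le> real n" by (auto simp: A_def)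
      have "x - (p /\<^sub>R c - q /\<^sub>R c) = (c *\<^sub>R x - z) /\<^sub>R c"
        using c pq by (simp add: scaleR_diff_right)
      then have "norm (x - (p /\<^sub>R c - q /\<^sub>R c)) = dist z (c *\<^sub>R x) / c"
        using c by (simp add: dist_norm norm_minus_commute divide_inverse mult.commute)
      also have "\<dots> \<le> e" using z(2) c by (simp add: field_simps)
      finally have 1: "norm (x - (p /\<^sub>R c - q /\<^sub>R c)) \<le> e" .
      have "norm (p /\<^sub>R c) + norm (q /\<^sub>R c) = (norm p + norm q) / c"
        using c by (simp add: field_simps)
      also have "\<dots> \<le> real n / c" using pq c by (simp add: divide_right_mono)
      also have "\<dots> = C * norm x" using False r by (simp add: C_def c_def field_simps)
      finally have "norm (p /\<^sub>R c) + norm (q /\<^sub>R c) \<le> C * norm x" .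
      moreover have "0 \<le> p /\<^sub>R c" "0 \<le> q /\<^sub>R c" using c pq by (auto intro!: scaleR_nonneg_nonneg)
      ultimately show ?thesis using 1 by blast
    qed
  qed
  then show ?thesis by blast
qed

section \<open>Integrable functions on the half-line\<close>

text \<open>
  Extending representatives by zero moves all integrals to the whole line, where Lebesgue measure is
  translation invariant.
\<close>

definition rp :: "'e::real_normed_vector L1 \<Rightarrow> real \<Rightarrow> 'e" where
  "rp F r = (if 0 \<le> r then rep_L1 F r else 0)"

lemma half_line_set: "{0::real..} \<in> sets lebesgue" by simp

lemmas half_line_integrable_iff = bochner_integrable_restrict_iff[OF half_line_set, unfolded atLeast_iff]

lemma AE_half_line_iff: "(AE x in half_line. P x) \<longleftrightarrow> (AE x in lebesgue. 0 \<le> x \<longrightarrow> P x)"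
  using AE_lebesgue_on_iff[OF half_line_set, of P] by simp

lemma L1_rel_rep: "L1_rel (rep_L1 F) (rep_L1 F)"
  by (rule Quotient3_rep_reflp[OF Quotient3_L1])

lemma abs_rep_L1: "abs_L1 (rep_L1 F) = F"
  by (rule Quotient3_abs_rep[OF Quotient3_L1])

lemma L1_rel_refl: "L1_rel g g \<longleftrightarrow> bochner_integrable half_line g"
  by (auto simp: L1_rel_def)

lemma bintegrable_rp: "bintegrable (rp F)"
  using L1_rel_rep[of F] unfolding L1_rel_refl half_line_integrable_iff
  by (simp add: rp_def[abs_def])

lemma smeas_rp: "smeas (rp F)"
  by (rule smeas_bintegrable[OF bintegrable_rp])

lemma bintegrable_If_zero:
  assumes g: "bintegrable g" and A: "A \<in> sets lebesgue"
  shows "bintegrable (\<lambda>x. if x \<in> A then g x else 0)"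
  by (rule bintegrable_bound[where g="\<lambda>x. ennreal (norm (g x))"])
    (use g strongly_measurable_If_zero[OF smeas_bintegrable[OF g] A] in \<open>auto simp: bochner_integrable_def\<close>)

lemma half_line_integrable: "bintegrable g \<Longrightarrow> bochner_integrable half_line g"
  unfolding half_line_integrable_iff
  using bintegrable_If_zero[OF _ half_line_set, of g] by simp

lemma rp_abs:
  assumes "bochner_integrable half_line g"
  shows "AE x in lebesgue. rp (abs_L1 g) x = (if 0 \<le> x then g x else 0)"
proof -
  have "L1_rel (rep_L1 (abs_L1 g)) g"
    using Quotient3_rep_abs[OF Quotient3_L1, of g] assms by (simp add: L1_rel_refl)
  then have "AE x in lebesgue. 0 \<le> x \<longrightarrow> rep_L1 (abs_L1 g) x = g x"
    by (simp add: L1_rel_def AE_half_line_iff)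
  then show ?thesis by eventually_elim (auto simp: rp_def)
qed

lemma rp_abs':
  assumes "bintegrable g" "\<And>x. x < 0 \<Longrightarrow> g x = 0"
  shows "AE x in lebesgue. rp (abs_L1 g) x = g x"
  using rp_abs[OF half_line_integrable[OF assms(1)]]
  by eventually_elim (use assms(2) in auto)

lemma abs_L1_eqI:
  assumes "bochner_integrable half_line g" "AE x in lebesgue. 0 \<le> x \<longrightarrow> g x = h x"
  shows "abs_L1 g = abs_L1 h"
proof -
  have "bochner_integrable half_line h"
    using assms unfolding half_line_integrable_iff
    by (elim bintegrable_AE_cong) (auto elim: eventually_mono)
  then have "L1_rel g h" using assms by (simp add: L1_rel_def AE_half_line_iff)
  then show ?thesis by (rule Quotient3_rel_abs[OF Quotient3_L1])
qed

lemma L1_eqI: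
  assumes "AE x in lebesgue. rp F x = rp G x"
  shows "F = G"
proof -
  have "abs_L1 (rep_L1 F) = abs_L1 (rep_L1 G)"
    using L1_rel_rep[of F] assms
    by (intro abs_L1_eqI) (auto simp: L1_rel_refl rp_def elim!: eventually_mono split: if_splits)
  then show ?thesis by (simp add: abs_rep_L1)
qed

text \<open>
  Norms in \<open>L1\<close> as integrals over the whole line; almost all estimates below start from this.
\<close>

lemma norm_rp: "ennreal (norm F) = (\<integral>\<^sup>+x. ennreal (norm (rp F x)) \<partial>lebesgue)"
proof -
  have i: "bochner_integrable half_line (rep_L1 F)" using L1_rel_rep by (simp add: L1_rel_refl)
  have "norm F = norm (abs_L1 (rep_L1 F))" by (simp add: abs_rep_L1)
  also have "\<dots> = (\<integral>x. norm (rep_L1 F x) \<partial>half_line)"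
    by (rule norm_L1.abs_eq[OF L1_rel_rep])
  finally have "ennreal (norm F) = (\<integral>\<^sup>+x. ennreal (norm (rep_L1 F x)) \<partial>half_line)"
    using bochner_integrable_norm[OF i] by (simp add: nn_integral_eq_integral)
  also have "\<dots> = (\<integral>\<^sup>+x. ennreal (norm (rp F x)) \<partial>lebesgue)"
    unfolding nn_integral_restrict_If[OF half_line_set] by (rule nn_integral_cong) (auto simp: rp_def)
  finally show ?thesis .
qed

lemma norm_abs_L1:
  assumes "bintegrable g" "\<And>x. x < 0 \<Longrightarrow> g x = 0"
  shows "ennreal (norm (abs_L1 g)) = (\<integral>\<^sup>+x. ennreal (norm (g x)) \<partial>lebesgue)"
  unfolding norm_rp
  by (rule nn_integral_cong_AE, rule eventually_mono[OF rp_abs'[OF assms]]) simp_all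

lemma rp_add: "AE x in lebesgue. rp (F + G) x = rp F x + rp G x"
proof -
  have "F + G = abs_L1 (\<lambda>x. rep_L1 F x + rep_L1 G x)"
    using plus_L1.abs_eq[OF L1_rel_rep[of F] L1_rel_rep[of G]] by (simp add: abs_rep_L1)
  moreover have "bochner_integrable half_line (\<lambda>x. rep_L1 F x + rep_L1 G x)"
    using L1_rel_rep by (intro bochner_integrable_add) (auto simp: L1_rel_refl[symmetric])
  ultimately have "AE x in lebesgue. rp (F + G) x = (if 0 \<le> x then rep_L1 F x + rep_L1 G x else 0)"
    using rp_abs[of "\<lambda>x. rep_L1 F x + rep_L1 G x"] by simp
  then show ?thesis by eventually_elim (simp add: rp_def[of F] rp_def[of G])
qed

lemma rp_scaleR: "AE x in lebesgue. rp (c *\<^sub>R F) x = c *\<^sub>R rp F x"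
proof -
  have "c *\<^sub>R F = abs_L1 (\<lambda>x. c *\<^sub>R rep_L1 F x)"
    using scaleR_L1.abs_eq[OF L1_rel_rep[of F]] by (simp add: abs_rep_L1)
  moreover have "bochner_integrable half_line (\<lambda>x. c *\<^sub>R rep_L1 F x)"
    using L1_rel_rep by (intro bochner_integrable_scaleR) (auto simp: L1_rel_refl[symmetric])
  ultimately have "AE x in lebesgue. rp (c *\<^sub>R F) x = (if 0 \<le> x then c *\<^sub>R rep_L1 F x else 0)"
    using rp_abs[of "\<lambda>x. c *\<^sub>R rep_L1 F x"] by simp
  then show ?thesis by eventually_elim (simp add: rp_def[of F])
qed

lemma rp_diff: "AE x in lebesgue. rp (F - G) x = rp F x - rp G x"
proof -
  have "AE x in lebesgue. rp (F + (-1) *\<^sub>R G) x = rp F x + rp ((-1) *\<^sub>R G) x" by (rule rp_add)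
  with rp_scaleR[of "-1" G] show ?thesis by eventually_elim simp
qed

lemma rp_zero: "AE x in lebesgue. rp 0 x = 0"
  using rp_scaleR[of 0 0] by simp

lemma L1_le_iff: "F \<le> G \<longleftrightarrow> (AE x in lebesgue. rp F x \<le> rp G x)"
proof -
  have "F \<le> G \<longleftrightarrow> abs_L1 (rep_L1 F) \<le> abs_L1 (rep_L1 G)" by (simp add: abs_rep_L1)
  also have "\<dots> \<longleftrightarrow> (AE x in half_line. rep_L1 F x \<le> rep_L1 G x)"
    by (rule less_eq_L1.abs_eq[OF L1_rel_rep L1_rel_rep])
  also have "\<dots> \<longleftrightarrow> (AE x in lebesgue. rp F x \<le> rp G x)"
    unfolding AE_half_line_iff by (intro arg_cong[where f="almost_everywhere lebesgue"] ext) (auto simp: rp_def)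
  finally show ?thesis .
qed

lemma L1_nonneg_iff:
  fixes F :: "'e::{real_normed_vector,ordered_real_vector} L1"
  shows "0 \<le> F \<longleftrightarrow> (AE x in lebesgue. 0 \<le> rp F x)"
proof -
  have "AE x in lebesgue. (rp 0 x \<le> rp F x) = (0 \<le> rp F x)"
    using rp_zero[where 'a='e] by eventually_elim simp
  then have "(AE x in lebesgue. rp 0 x \<le> rp F x) \<longleftrightarrow> (AE x in lebesgue. 0 \<le> rp F x)"
    by (rule eventually_subst)
  then show ?thesis unfolding L1_le_iff .
qed

lemma abs_L1_rp: "abs_L1 (rp F) = F"
proof (rule L1_eqI)
  show "AE x in lebesgue. rp (abs_L1 (rp F)) x = rp F x"
    by (rule rp_abs'[OF bintegrable_rp]) (simp add: rp_def)
qed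

lemma norm_diff_rp: "ennreal (norm (F - G)) = (\<integral>\<^sup>+x. ennreal (norm (rp F x - rp G x)) \<partial>lebesgue)"
  unfolding norm_rp
  by (rule nn_integral_cong_AE, rule eventually_mono[OF rp_diff[of F G]]) simp

section \<open>The ordered Banach space of integrable functions\<close>

lemma strongly_measurable_compose_continuous:
  assumes f: "smeas f" and g: "continuous_on UNIV g"
  shows "smeas (\<lambda>x. g (f x))"
proof -
  obtain s where s: "\<And>i::nat. simple_function lebesgue (s i)" "AE x in lebesgue. (\<lambda>i. s i x) \<longlonglongrightarrow> f x"
    using f unfolding strongly_measurable_def by blast
  have 1: "simple_function lebesgue (\<lambda>x. g (s i x))" for i by (rule simple_function_compose1[OF s(1)])
  have 2: "AE x in lebesgue. (\<lambda>i. g (s i x)) \<longlonglongrightarrow> g (f x)"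
    using s(2) by eventually_elim (rule continuous_on_tendsto_compose[OF g], auto)
  show ?thesis by (rule strongly_measurableI[OF 1 2])
qed

text \<open>
  The distance of \<open>F x\<close> to the cone is at most \<open>\<parallel>F x - X n x\<parallel>\<close> for positive \<open>X n\<close>, so its integral is zero.
\<close>

lemma L1_closed_cone:
  assumes cl: "closed {u::'e::{banach,ordered_real_vector}. 0 \<le> u}"
  shows "closed {F::'e L1. 0 \<le> F}"
  unfolding closed_sequential_limits
proof (intro allI impI, elim conjE)
  fix X and F :: "'e L1" assume X: "\<forall>n. X n \<in> {F. 0 \<le> F}" and lim: "X \<longlonglongrightarrow> F"
  define q where "q x = infdist (rp F x) {u. 0 \<le> u}" for x
  have "smeas q" unfolding q_def
    by (rule strongly_measurable_compose_continuous[OF smeas_rp]) (intro continuous_intros)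
  from norm_measurable[OF this] have qm: "q \<in> borel_measurable lebesgue"
    by (simp add: q_def[abs_def] infdist_nonneg)
  have le: "(\<integral>\<^sup>+x. ennreal (q x) \<partial>lebesgue) \<le> ennreal (norm (F - X n))" for n
    unfolding norm_diff_rp
  proof (rule nn_integral_mono_AE)
    have "AE x in lebesgue. 0 \<le> rp (X n) x" using X by (simp add: L1_nonneg_iff)
    then show "AE x in lebesgue. ennreal (q x) \<le> ennreal (norm (rp F x - rp (X n) x))"
      by eventually_elim (auto simp: q_def dist_norm[symmetric] intro!: ennreal_leI infdist_le)
  qed
  have "(\<lambda>n. ennreal (norm (F - X n))) \<longlonglongrightarrow> ennreal (norm (F - F))"
    by (intro tendsto_ennrealI tendsto_intros lim)
  then have "(\<integral>\<^sup>+x. ennreal (q x) \<partial>lebesgue) \<le> ennreal (norm (F - F))"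
    by (rule LIMSEQ_le_const) (use le in blast)
  then have "AE x in lebesgue. ennreal (q x) = 0"
    using qm by (subst nn_integral_0_iff_AE[symmetric]) auto
  then have "AE x in lebesgue. 0 \<le> rp F x"
  proof eventually_elim
    case (elim x)
    then have "q x = 0" using infdist_nonneg[of "rp F x" "{u. 0 \<le> u}"] by (simp add: q_def)
    moreover have "{u::'e. 0 \<le> u} \<noteq> {}" by auto
    ultimately show ?case
      using in_closed_iff_infdist_zero[OF cl, of "rp F x"] by (simp add: q_def)
  qed
  then show "F \<in> {F. 0 \<le> F}" by (simp add: L1_nonneg_iff)
qed

lemma L1_norm_additive:
  fixes F G :: "'e::{banach,ordered_real_vector} L1"
  assumes add: "\<forall>u v::'e. 0 \<le> u \<longrightarrow> 0 \<le> v \<longrightarrow> norm (u + v) = norm u + norm v"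
    and FG: "0 \<le> F" "0 \<le> G"
  shows "norm (F + G) = norm F + norm G"
proof -
  have FG': "AE x in lebesgue. 0 \<le> rp F x" "AE x in lebesgue. 0 \<le> rp G x"
    using FG by (simp_all add: L1_nonneg_iff)
  have "ennreal (norm (F + G)) = (\<integral>\<^sup>+x. ennreal (norm (rp F x)) + ennreal (norm (rp G x)) \<partial>lebesgue)"
    unfolding norm_rp
  proof (rule nn_integral_cong_AE)
    show "AE x in lebesgue. ennreal (norm (rp (F + G) x)) = ennreal (norm (rp F x)) + ennreal (norm (rp G x))"
      using FG' rp_add[of F G] by eventually_elim (simp add: add flip: ennreal_plus)
  qed
  also have "\<dots> = ennreal (norm F) + ennreal (norm G)"
    unfolding norm_rp by (intro nn_integral_add measurable_compose[OF norm_measurable] smeas_rp) auto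
  finally show ?thesis by (simp flip: ennreal_plus)
qed

text \<open>
  The pointwise series is dominated by the function \<open>tail 0\<close>, which has finite integral; its remainders
  are dominated by \<open>tail n\<close>, of integral at most \<open>2 \<cdot> 2\<^sup>-\<^sup>n\<close>.
\<close>

lemma L1_summable_limit:
  fixes D :: "nat \<Rightarrow> 'e::banach L1"
  assumes D: "\<And>k. norm (D k) \<le> (1/2)^k"
  shows "\<exists>F. (\<lambda>n. \<Sum>k<n. D k) \<longlonglongrightarrow> F"
proof -
  have nm [measurable]: "(\<lambda>x. ennreal (norm (rp (D k) x))) \<in> borel_measurable lebesgue" for k
    by (intro measurable_compose[OF norm_measurable] smeas_rp) auto
  define tail where "tail n x = (\<Sum>k. ennreal (norm (rp (D (k + n)) x)))" for n x
  have tail: "(\<integral>\<^sup>+x. tail n x \<partial>lebesgue) \<le> ennreal (2 * (1/2)^n)" for n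
  proof -
    have "(\<integral>\<^sup>+x. tail n x \<partial>lebesgue) = (\<Sum>k. ennreal (norm (D (k + n))))"
      unfolding tail_def norm_rp by (rule nn_integral_suminf[OF nm])
    also have "\<dots> \<le> (\<Sum>k. ennreal ((1/2)^n * (1/2)^k))"
      by (intro suminf_le ennreal_leI) (use D[of "_ + n"] in \<open>auto simp: power_add mult.commute\<close>)
    also have "\<dots> = ennreal (\<Sum>k. (1/2)^n * (1/2)^k)"
      by (intro suminf_ennreal2 summable_mult summable_geometric) auto
    also have "(\<Sum>k. (1/2)^n * (1/2)^k) = (1/2)^n * (2::real)"
      by (subst suminf_mult) (auto simp: suminf_geometric summable_geometric)
    finally show ?thesis by (simp add: mult.commute)
  qed
  have tm: "tail n \<in> borel_measurable lebesgue" for n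
    unfolding tail_def by measurable
  have "(\<integral>\<^sup>+x. tail 0 x \<partial>lebesgue) \<noteq> \<infinity>" using tail[of 0] by (auto simp: top_unique)
  then have fin: "AE x in lebesgue. tail 0 x \<noteq> \<infinity>" by (rule nn_integral_PInf_AE[OF tm])
  define f where "f x = (if tail 0 x \<noteq> \<infinity> then \<Sum>k. rp (D k) x else 0)" for x
  have sums: "summable (\<lambda>k. norm (rp (D k) x))" if "tail 0 x \<noteq> \<infinity>" for x
    using that by (intro summable_suminf_not_top) (auto simp: tail_def)
  have lim: "AE x in lebesgue. (\<lambda>n. \<Sum>k<n. rp (D k) x) \<longlonglongrightarrow> f x"
    using fin by eventually_elim (simp add: f_def summable_LIMSEQ summable_norm_cancel[OF sums])
  have fs: "smeas f"
    by (rule strongly_measurable_lim[OF _ lim]) (intro strongly_measurable_sum smeas_rp)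
  have dist: "AE x in lebesgue. ennreal (norm (f x - (\<Sum>k<n. rp (D k) x))) \<le> tail n x" for n
    using fin
  proof eventually_elim
    case (elim x)
    have s: "summable (\<lambda>k. norm (rp (D (k + n)) x))"
      using sums[OF elim] by (subst summable_iff_shift)
    have "f x - (\<Sum>k<n. rp (D k) x) = (\<Sum>k. rp (D (k + n)) x)"
      using elim suminf_minus_initial_segment[OF summable_norm_cancel[OF sums[OF elim]], of n] by (simp add: f_def)
    then have "ennreal (norm (f x - (\<Sum>k<n. rp (D k) x))) \<le> ennreal (\<Sum>k. norm (rp (D (k + n)) x))"
      using summable_norm[OF s] by (auto intro: ennreal_leI)
    also have "\<dots> = tail n x" unfolding tail_def by (rule suminf_ennreal2[symmetric]) (use s in auto)
    finally show ?case .
  qed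
  have fi: "bintegrable f"
  proof (rule bintegrable_bound[OF fs])
    show "AE x in lebesgue. ennreal (norm (f x)) \<le> tail 0 x" using dist[of 0] by simp
    show "(\<integral>\<^sup>+x. tail 0 x \<partial>lebesgue) < \<infinity>" using tail[of 0] by (auto intro: le_less_trans)
  qed
  have f0: "f x = 0" if "x < 0" for x using that by (simp add: f_def rp_def)
  have rpf: "AE x in lebesgue. rp (abs_L1 f) x = f x"
    by (rule rp_abs'[OF fi]) (rule f0)
  have rps: "AE x in lebesgue. rp (\<Sum>k<n. D k) x = (\<Sum>k<n. rp (D k) x)" for n
  proof (induction n)
    case 0 then show ?case using rp_zero by simp
  next
    case (Suc n)
    with rp_add[of "\<Sum>k<n. D k" "D n"] show ?case by eventually_elim simp
  qed
  have "ennreal (norm (abs_L1 f - (\<Sum>k<n. D k))) \<le> ennreal (2 * (1/2)^n)" for n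
  proof -
    have "ennreal (norm (abs_L1 f - (\<Sum>k<n. D k))) \<le> (\<integral>\<^sup>+x. tail n x \<partial>lebesgue)"
      unfolding norm_diff_rp
      by (rule nn_integral_mono_AE) (use dist[of n] rps[of n] rpf in \<open>eventually_elim, simp\<close>)
    also note tail[of n]
    finally show ?thesis .
  qed
  then have "norm (abs_L1 f - (\<Sum>k<n. D k)) \<le> 2 * (1/2)^n" for n
    by (rule ennreal_le_iff[THEN iffD1, rotated]) simp
  then have ev: "\<forall>\<^sub>F n in sequentially. norm (abs_L1 f - (\<Sum>k<n. D k)) \<le> 2 * (1/2)^n"
    by (intro always_eventually allI)
  have "(\<lambda>n. 2 * (1/2)^n :: real) \<longlonglongrightarrow> 2 * 0" by (intro tendsto_intros LIMSEQ_realpow_zero) auto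
  then have "(\<lambda>n. 2 * (1/2)^n :: real) \<longlonglongrightarrow> 0" by simp
  with ev have "(\<lambda>n. abs_L1 f - (\<Sum>k<n. D k)) \<longlonglongrightarrow> 0"
    by (rule Lim_null_comparison)
  from tendsto_diff[OF tendsto_const[of "abs_L1 f"] this]
  have "(\<lambda>n. \<Sum>k<n. D k) \<longlonglongrightarrow> abs_L1 f" by simp
  then show ?thesis by blast
qed

instance L1 :: (banach) banach
proof
  fix X :: "nat \<Rightarrow> 'a L1" assume X: "Cauchy X"
  have "\<exists>r :: nat \<Rightarrow> nat. strict_mono r \<and> (\<forall>k. norm (X (r (Suc k)) - X (r k)) \<le> (1/2)^k)"
  proof -
    have "\<exists>N. \<forall>m\<ge>N. \<forall>n\<ge>N. norm (X m - X n) < (1/2)^k" for k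
      using X by (auto simp: Cauchy_iff)
    then obtain N where N: "\<And>k m n. m \<ge> N k \<Longrightarrow> n \<ge> N k \<Longrightarrow> norm (X m - X n) < (1/2)^k" by metis
    define r where "r k = (\<Sum>j\<le>k. Suc (N j))" for k
    have r: "r k \<ge> N k" "strict_mono r" for k
    proof -
      have "Suc (N k) \<le> r k" unfolding r_def by (rule member_le_sum) auto
      then show "r k \<ge> N k" by simp
      show "strict_mono r" by (rule strict_monoI_Suc) (simp add: r_def)
    qed
    have "norm (X (r (Suc k)) - X (r k)) \<le> (1/2)^k" for k
    proof (rule less_imp_le, rule N)
      show "r (Suc k) \<ge> N k" using r(1)[of k] strict_mono_less[OF r(2), of k "Suc k"] by simp
    qed (rule r)
    then show ?thesis using r(2) by blast
  qed
  then obtain r :: "nat \<Rightarrow> nat" where r: "strict_mono r" "\<And>k. norm (X (r (Suc k)) - X (r k)) \<le> (1/2)^k" by blast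
  obtain F where "(\<lambda>n. \<Sum>k<n. X (r (Suc k)) - X (r k)) \<longlonglongrightarrow> F"
    using L1_summable_limit[of "\<lambda>k. X (r (Suc k)) - X (r k)", OF r(2)] by blast
  then have "(\<lambda>n. (X (r n) - X (r 0)) + X (r 0)) \<longlonglongrightarrow> F + X (r 0)"
    using sum_lessThan_telescope[of "\<lambda>k. X (r k)"] by (intro tendsto_add tendsto_const) simp
  then have "(X \<circ> r) \<longlonglongrightarrow> F + X (r 0)" by (simp add: o_def)
  then show "convergent X"
    using Cauchy_converges_subseq[OF X r(1)] by (auto simp: convergent_def)
qed

text \<open>
  A bounded decomposition \<open>w = P w - Q w\<close> chosen in \<open>'e\<close> is in general not measurable in \<open>w\<close>, but it can
  be applied to simple functions. Thus integrable functions are approximately differences of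
  positive ones. The inner factor 2 comes from simple functions being bounded by \<open>2 \<parallel>F\<parallel>\<close> pointwise, the
  outer one from \<open>decomposition_by_approximation\<close>.
\<close>

lemma L1_decomposition_bound:
  assumes cl: "closed {u::'e::{banach,ordered_real_vector}. 0 \<le> u}"
    and M: "decomposition_bound TYPE('e) M" and M0: "0 \<le> M"
  shows "decomposition_bound TYPE('e L1) (2 * (2 * M))"
proof (rule decomposition_by_approximation[OF L1_closed_cone[OF cl]])
  fix F :: "'e L1" and e :: real assume e: "e > 0"
  obtain P Q :: "'e \<Rightarrow> 'e" where PQ: "\<And>w. 0 \<le> P w" "\<And>w. 0 \<le> Q w" "\<And>w. w = P w - Q w"
      "\<And>w. norm (P w) + norm (Q w) \<le> M * norm w"
    using M unfolding decomposition_bound_def by metis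
  \<comment> \<open>this makes \<open>P (t x)\<close> and \<open>Q (t x)\<close> vanish wherever the simple function \<open>t\<close> does\<close>
  have "norm (P 0) \<le> 0" "norm (Q 0) \<le> 0"
    using PQ(4)[of 0, unfolded norm_zero mult_zero_right] norm_ge_zero[of "P 0"] norm_ge_zero[of "Q 0"]
    by linarith+
  then have P0: "P 0 = 0" "Q 0 = 0" by simp_all
  obtain s where s: "\<And>i::nat. sbi (s i)" "\<And>i x. norm (s i x) \<le> 2 * norm (rp F x)"
    "AE x in lebesgue. (\<lambda>i. s i x) \<longlonglongrightarrow> rp F x"
    "(\<lambda>i. \<integral>\<^sup>+x. ennreal (norm (rp F x - s i x)) \<partial>lebesgue) \<longlonglongrightarrow> 0"
    by (rule bintegrable_simple_approx[OF bintegrable_rp], rule that)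
  have "\<forall>\<^sub>F i in sequentially. (\<integral>\<^sup>+x. ennreal (norm (rp F x - s i x)) \<partial>lebesgue) < ennreal e"
    using e by (intro order_tendstoD(2)[OF s(4)]) auto
  then obtain i where i: "(\<integral>\<^sup>+x. ennreal (norm (rp F x - s i x)) \<partial>lebesgue) < ennreal e"
    by (auto simp: eventually_sequentially)
  define t where "t = s i"
  have t0: "t x = 0" if "x < 0" for x using s(2)[of i x] that by (simp add: t_def rp_def)
  have ti: "bintegrable t" unfolding t_def by (rule sbi_imp_bintegrable[OF s(1)])
  have "sbi (\<lambda>x. P (t x))" "sbi (\<lambda>x. Q (t x))"
    using simple_bochner_integrable_compose2[of "\<lambda>x y. P x", OF _ s(1)[of i] s(1)[of i]]
      simple_bochner_integrable_compose2[of "\<lambda>x y. Q x", OF _ s(1)[of i] s(1)[of i]]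
    by (simp_all add: P0 t_def)
  then have PQi: "bintegrable (\<lambda>x. P (t x))" "bintegrable (\<lambda>x. Q (t x))"
    by (simp_all add: sbi_imp_bintegrable)
  define p q where "p = abs_L1 (\<lambda>x. P (t x))" and "q = abs_L1 (\<lambda>x. Q (t x))"
  have rpp: "AE x in lebesgue. rp p x = P (t x)" and rpq: "AE x in lebesgue. rp q x = Q (t x)"
    unfolding p_def q_def by (rule rp_abs'; simp add: PQi t0 P0)+
  have "0 \<le> p" "0 \<le> q"
    unfolding L1_nonneg_iff
    by (rule eventually_mono[OF rpp], simp add: PQ, rule eventually_mono[OF rpq], simp add: PQ)
  moreover have "norm (F - (p - q)) \<le> e"
  proof -
    have "ennreal (norm (F - (p - q))) = (\<integral>\<^sup>+x. ennreal (norm (rp F x - t x)) \<partial>lebesgue)"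
      unfolding norm_diff_rp
    proof (rule nn_integral_cong_AE)
      show "AE x in lebesgue. ennreal (norm (rp F x - rp (p - q) x)) = ennreal (norm (rp F x - t x))"
        using rpp rpq rp_diff[of p q] by eventually_elim (simp flip: PQ(3))
    qed
    then have "ennreal (norm (F - (p - q))) \<le> ennreal e" using i by (simp add: t_def)
    then show ?thesis using e by (simp add: ennreal_le_iff)
  qed
  moreover have "norm p + norm q \<le> 2 * M * norm F"
  proof -
    have "ennreal (norm p + norm q) = ennreal (norm p) + ennreal (norm q)" by simp
    also have "\<dots> = (\<integral>\<^sup>+x. ennreal (norm (P (t x))) \<partial>lebesgue) + (\<integral>\<^sup>+x. ennreal (norm (Q (t x))) \<partial>lebesgue)"
      unfolding p_def q_def by (intro arg_cong2[where f="(+)"] norm_abs_L1 PQi) (simp_all add: t0 P0)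
    also have "\<dots> = (\<integral>\<^sup>+x. ennreal (norm (P (t x))) + ennreal (norm (Q (t x))) \<partial>lebesgue)"
      by (intro nn_integral_add[symmetric] measurable_compose[OF norm_measurable] smeas_bintegrable PQi) auto
    also have "\<dots> \<le> (\<integral>\<^sup>+x. ennreal (2 * M) * ennreal (norm (rp F x)) \<partial>lebesgue)"
    proof (rule nn_integral_mono)
      fix x
      have "norm (P (t x)) + norm (Q (t x)) \<le> M * norm (t x)" by (rule PQ)
      also have "\<dots> \<le> M * (2 * norm (rp F x))" using s(2)[of i x] M0 by (intro mult_left_mono) (auto simp: t_def)
      finally have "ennreal (norm (P (t x)) + norm (Q (t x))) \<le> ennreal (2 * M * norm (rp F x))"
        by (intro ennreal_leI) simp
      then show "ennreal (norm (P (t x))) + ennreal (norm (Q (t x))) \<le> ennreal (2 * M) * ennreal (norm (rp F x))"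
        using M0 by (simp add: ennreal_mult)
    qed
    also have "\<dots> = ennreal (2 * M) * ennreal (norm F)"
      unfolding norm_rp by (intro nn_integral_cmult measurable_compose[OF norm_measurable] smeas_rp) auto
    also have "\<dots> = ennreal (2 * M * norm F)" using M0 by (simp add: ennreal_mult)
    finally show ?thesis by (rule ennreal_le_iff[THEN iffD1, rotated]) (use M0 in simp)
  qed
  ultimately show "\<exists>p q. 0 \<le> p \<and> 0 \<le> q \<and> norm (F - (p - q)) \<le> e \<and> norm p + norm q \<le> 2 * M * norm F"
    by blast
qed

lemma abs_L1_tendsto:
  assumes f: "bintegrable f" and g: "\<And>i::nat. bintegrable (g i)"
    and lim: "(\<lambda>i. \<integral>\<^sup>+x. ennreal (norm (f x - g i x)) \<partial>lebesgue) \<longlonglongrightarrow> 0"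
  shows "(\<lambda>i. abs_L1 (g i)) \<longlonglongrightarrow> abs_L1 f"
proof -
  have "(\<lambda>i. abs_L1 f - abs_L1 (g i)) \<longlonglongrightarrow> 0"
  proof (rule tendsto_of_ennreal_dist[OF _ lim])
    fix i
    have "AE x in lebesgue. ennreal (norm (rp (abs_L1 f) x - rp (abs_L1 (g i)) x)) \<le> ennreal (norm (f x - g i x))"
      using rp_abs[OF half_line_integrable[OF f]] rp_abs[OF half_line_integrable[OF g[of i]]]
      by eventually_elim simp
    then show "ennreal (norm (abs_L1 f - abs_L1 (g i))) \<le> (\<integral>\<^sup>+x. ennreal (norm (f x - g i x)) \<partial>lebesgue)"
      unfolding norm_diff_rp by (rule nn_integral_mono_AE)
  qed
  from tendsto_diff[OF tendsto_const[of "abs_L1 f"] this] show ?thesis by simp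
qed

lemma abs_L1_sum:
  fixes g :: "'i \<Rightarrow> real \<Rightarrow> 'b::banach"
  assumes "finite I" "\<And>i. i \<in> I \<Longrightarrow> bintegrable (g i)"
  shows "abs_L1 (\<lambda>x. \<Sum>i\<in>I. g i x) = (\<Sum>i\<in>I. abs_L1 (g i))"
  using assms
proof (induction I rule: finite_induct)
  case empty
  show ?case by (simp add: zero_L1_def)
next
  case (insert a I)
  have b: "bintegrable (\<lambda>x. \<Sum>i\<in>I. g i x)" using bint_sum[of I g] insert(4) by simp
  have "L1_rel (g a) (g a)" "L1_rel (\<lambda>x. \<Sum>i\<in>I. g i x) (\<lambda>x. \<Sum>i\<in>I. g i x)"
    unfolding L1_rel_refl using b insert by (auto intro: half_line_integrable)
  from plus_L1.abs_eq[OF this] show ?case using insert by simp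
qed

text \<open>
  A closed subspace that contains all \<open>c x\<close> with \<open>x\<close> fixed and \<open>c\<close> continuous of compact support is
  everything: it contains \<open>1\<^sub>S x\<close> for bounded open \<open>S\<close>, then for bounded measurable \<open>S\<close> by outer regularity,
  then for \<open>S\<close> of finite measure, and these span the simple functions.
\<close>

lemma L1_dense_induct:
  fixes \<A> :: "'e::banach L1 set"
  assumes cl: "closed \<A>" and sub: "subspace \<A>"
    and c: "\<And>c (x::'e). continuous_on UNIV c \<Longrightarrow> (\<exists>b. \<forall>r. \<bar>r\<bar> > b \<longrightarrow> c r = 0) \<Longrightarrow>
      (\<forall>r. 0 \<le> c r \<and> c r \<le> 1) \<Longrightarrow> abs_L1 (\<lambda>r. (c r :: real) *\<^sub>R x) \<in> \<A>"
  shows "F \<in> \<A>"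
proof -
  have seqcl: "X \<longlonglongrightarrow> l \<Longrightarrow> (\<And>n. X n \<in> \<A>) \<Longrightarrow> l \<in> \<A>" for X and l :: "'e L1"
    by (rule closed_sequentially[OF cl])
  have limit: "abs_L1 f \<in> \<A>" if "\<And>i::nat. smeas (g i)" "AE z in lebesgue. (\<lambda>i. g i z) \<longlonglongrightarrow> f z"
      "\<And>i. AE z in lebesgue. norm (g i z) \<le> indicator {-b..b} z * C" "\<And>i. abs_L1 (g i) \<in> \<A>" for f g b C
  proof -
    have bd: "AE z in lebesgue. ennreal (norm (g i z)) \<le> ennreal \<bar>C\<bar> * indicator {-b..b} z" for i
      using that(3)[of i] by eventually_elim (auto simp: indicator_def intro!: ennreal_leI)
    have w: "(\<integral>\<^sup>+z. ennreal \<bar>C\<bar> * indicator {-b..b} z \<partial>lebesgue) < \<infinity>"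
      by (subst nn_integral_cmult_indicator) (auto simp: ennreal_mult_less_top emeasure_lborel_Icc_eq)
    have [measurable]: "{-b..b} \<in> sets lebesgue" by simp
    have wm: "(\<lambda>z. ennreal \<bar>C\<bar> * indicator {-b..b} z) \<in> borel_measurable lebesgue" by measurable
    have "(\<lambda>i. abs_L1 (g i)) \<longlonglongrightarrow> abs_L1 f"
      by (rule abs_L1_tendsto[OF bint_dominated(1-3)[OF that(1,2) bd wm w]])
    then show ?thesis by (rule seqcl) (rule that(4))
  qed
  \<comment> \<open>open sets: the functions \<open>min 1 (n d(r, - U))\<close> increase to \<open>1\<^sub>U\<close>\<close>
  have step1: "abs_L1 (\<lambda>r. indicator U r *\<^sub>R x) \<in> \<A>" if U: "open U" "U \<subseteq> {-b..b}" for U b and x :: 'e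
  proof -
    define c where "c n r = min 1 (real n * infdist r (- U))" for n r
    have ne: "- U \<noteq> {}"
    proof
      assume "- U = {}"
      then have "U = UNIV" by auto
      with U(2) have "\<bar>b\<bar> + 1 \<in> {-b..b}" by blast
      then show False by (simp add: abs_if split: if_splits)
    qed
    have c0: "c n r = 0" if "r \<notin> U" for n r using that by (simp add: c_def)
    have c1: "0 \<le> c n r" "c n r \<le> 1" for n r by (auto simp: c_def infdist_nonneg)
    have cc: "continuous_on UNIV (c n)" for n unfolding c_def by (intro continuous_intros)
    have cm: "c n \<in> borel_measurable lebesgue" for n
      by (intro measurable_completion) (simp add: borel_measurable_continuous_onI cc)
    show ?thesis
    proof (rule limit[where g="\<lambda>n r. c n r *\<^sub>R x" and b=b and C="norm x"])
      show "smeas (\<lambda>r. c n r *\<^sub>R x)" for n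
        by (intro strongly_measurable_scaleR_fun cm strongly_measurable_const)
      show "AE r in lebesgue. (\<lambda>n. c n r *\<^sub>R x) \<longlonglongrightarrow> indicator U r *\<^sub>R x"
      proof (rule AE_I2)
        fix r
        show "(\<lambda>n. c n r *\<^sub>R x) \<longlonglongrightarrow> indicator U r *\<^sub>R x"
        proof (cases "r \<in> U")
          case True
          have "infdist r (- U) \<noteq> 0"
            using in_closed_iff_infdist_zero[of "- U" r] U ne True by (simp add: closed_Compl)
          then have d: "infdist r (- U) > 0" using infdist_nonneg[of r "- U"] by linarith
          obtain N where N: "1 < real N * infdist r (- U)" using reals_Archimedean3[OF d] by blast
          have "c n r = 1" if "n \<ge> N" for n
          proof -
            have "real N * infdist r (- U) \<le> real n * infdist r (- U)"
              using that d by (intro mult_right_mono) auto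
            then show ?thesis using N by (simp add: c_def min_absorb1)
          qed
          then have "\<forall>\<^sub>F n in sequentially. c n r *\<^sub>R x = indicator U r *\<^sub>R x"
            using True by (intro eventually_sequentiallyI[of N]) simp
          then show ?thesis by (rule tendsto_eventually)
        qed (simp add: c0)
      qed
      show "AE r in lebesgue. norm (c n r *\<^sub>R x) \<le> indicator {-b..b} r * norm x" for n
      proof (rule AE_I2)
        fix r show "norm (c n r *\<^sub>R x) \<le> indicator {-b..b} r * norm x"
          using c1[of n r] c0[of r n] U(2) by (cases "r \<in> U") (auto simp: indicator_def intro!: mult_left_le_one_le)
      qed
      show "abs_L1 (\<lambda>r. c n r *\<^sub>R x) \<in> \<A>" for n
      proof (rule c[OF cc])
        show "\<exists>b'. \<forall>r. \<bar>r\<bar> > b' \<longrightarrow> c n r = 0"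
          using U(2) c0 by (intro exI[of _ b]) force
      qed (use c1 in auto)
    qed
  qed
  \<comment> \<open>bounded measurable sets\<close>
  have step2: "abs_L1 (\<lambda>r. indicator S r *\<^sub>R x) \<in> \<A>"
    if S: "S \<in> sets lebesgue" "S \<subseteq> {-b<..<b}" for S b and x :: 'e
  proof -
    have "\<exists>U. open U \<and> S \<subseteq> U \<and> U \<subseteq> {-b..b} \<and> emeasure lebesgue (U - S) < ennreal (inverse (Suc n))" for n
    proof -
      obtain T where T: "open T" "S \<subseteq> T" "emeasure lebesgue (T - S) < ennreal (inverse (Suc n))" "(T - S) \<in> lmeasurable"
        using sets_lebesgue_outer_open[OF S(1), of "inverse (Suc n)"] by auto
      have "emeasure lebesgue (T \<inter> {-b<..<b} - S) \<le> emeasure lebesgue (T - S)"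
        using T(4) by (intro emeasure_mono) auto
      then show ?thesis using T S(2)
        by (intro exI[of _ "T \<inter> {-b<..<b}"]) (auto intro: le_less_trans simp: subset_iff)
    qed
    then obtain U where U: "\<And>n. open (U n)" "\<And>n. S \<subseteq> U n" "\<And>n. U n \<subseteq> {-b..b}"
        "\<And>n. emeasure lebesgue (U n - S) < ennreal (inverse (Suc n))" by metis
    have meas: "U n \<in> sets lebesgue" for n using U(1) by simp
    have fin: "emeasure lebesgue A < \<infinity>" if "A \<subseteq> {-b..b}" for A
    proof -
      have "emeasure lebesgue A \<le> emeasure lebesgue {-b..b}" using that by (intro emeasure_mono) auto
      also have "\<dots> < \<infinity>" by (simp add: emeasure_lborel_Icc_eq)
      finally show ?thesis .
    qed
    have Sb: "S \<subseteq> {-b..b}" using S(2) by force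
    have bi: "bintegrable (\<lambda>r. indicator S r *\<^sub>R x)" "\<And>n. bintegrable (\<lambda>r. indicator (U n) r *\<^sub>R x)"
      using bint_indicator(1) S(1) meas fin Sb U(3) by blast+
    have "(\<lambda>n. abs_L1 (\<lambda>r. indicator (U n) r *\<^sub>R x)) \<longlonglongrightarrow> abs_L1 (\<lambda>r. indicator S r *\<^sub>R x)"
    proof (rule abs_L1_tendsto[OF bi], rule tendsto_sandwich[OF _ _ tendsto_const])
      show "\<forall>\<^sub>F n in sequentially. (\<integral>\<^sup>+r. ennreal (norm (indicator S r *\<^sub>R x - indicator (U n) r *\<^sub>R x)) \<partial>lebesgue)
        \<le> ennreal (norm x * inverse (Suc n))"
      proof (intro always_eventually allI)
        fix n
        have "(\<integral>\<^sup>+r. ennreal (norm (indicator S r *\<^sub>R x - indicator (U n) r *\<^sub>R x)) \<partial>lebesgue) =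
          (\<integral>\<^sup>+r. ennreal (norm x) * indicator (U n - S) r \<partial>lebesgue)"
          using U(2)[of n] by (intro nn_integral_cong) (auto simp: indicator_def)
        also have "\<dots> = ennreal (norm x) * emeasure lebesgue (U n - S)"
          using meas S(1) by (intro nn_integral_cmult_indicator) auto
        also have "\<dots> \<le> ennreal (norm x) * ennreal (inverse (Suc n))"
          using U(4)[of n] by (intro mult_left_mono) auto
        finally show "(\<integral>\<^sup>+r. ennreal (norm (indicator S r *\<^sub>R x - indicator (U n) r *\<^sub>R x)) \<partial>lebesgue)
          \<le> ennreal (norm x * inverse (Suc n))" by (simp add: ennreal_mult)
      qed
      have "(\<lambda>n. norm x * inverse (real (Suc n))) \<longlonglongrightarrow> norm x * 0"
        by (intro tendsto_intros LIMSEQ_inverse_real_of_nat)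
      then show "(\<lambda>n. ennreal (norm x * inverse (real (Suc n)))) \<longlonglongrightarrow> 0"
        using tendsto_ennrealI by fastforce
    qed auto
    then show ?thesis by (rule seqcl) (rule step1[OF U(1,3)])
  qed
  \<comment> \<open>sets of finite measure\<close>
  have step3: "abs_L1 (\<lambda>r. indicator S r *\<^sub>R x) \<in> \<A>"
    if S: "S \<in> sets lebesgue" "emeasure lebesgue S < \<infinity>" for S and x :: 'e
  proof -
    define Sn where "Sn n = S \<inter> {- real n<..<real n}" for n
    have Sn: "Sn n \<in> sets lebesgue" for n unfolding Sn_def using S(1) by (intro sets.Int) auto
    have w: "(\<integral>\<^sup>+r. ennreal (norm x) * indicator S r \<partial>lebesgue) < \<infinity>"
      using S by (subst nn_integral_cmult_indicator) (auto simp: ennreal_mult_less_top)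
    have sm: "smeas (\<lambda>r. indicator (Sn n) r *\<^sub>R x)" for n
      using Sn by (intro strongly_measurable_scaleR_fun strongly_measurable_const) auto
    have lim: "AE r in lebesgue. (\<lambda>n. indicator (Sn n) r *\<^sub>R x) \<longlonglongrightarrow> indicator S r *\<^sub>R x"
    proof (rule AE_I2)
      fix r
      have "\<forall>\<^sub>F n in sequentially. \<bar>r\<bar> < real n"
      proof -
        obtain N where "\<bar>r\<bar> < real N" using reals_Archimedean2 by blast
        then show ?thesis by (intro eventually_sequentiallyI[of N]) linarith
      qed
      then have "\<forall>\<^sub>F n in sequentially. indicator (Sn n) r *\<^sub>R x = indicator S r *\<^sub>R x"
        by eventually_elim (auto simp: Sn_def indicator_def)
      then show "(\<lambda>n. indicator (Sn n) r *\<^sub>R x) \<longlonglongrightarrow> indicator S r *\<^sub>R x" by (rule tendsto_eventually)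
    qed
    have bd: "AE r in lebesgue. ennreal (norm (indicator (Sn n) r *\<^sub>R x)) \<le> ennreal (norm x) * indicator S r" for n
      by (rule AE_I2) (auto simp: Sn_def indicator_def)
    have wm: "(\<lambda>r. ennreal (norm x) * indicator S r) \<in> borel_measurable lebesgue" using S by measurable
    have "(\<lambda>n. abs_L1 (\<lambda>r. indicator (Sn n) r *\<^sub>R x)) \<longlonglongrightarrow> abs_L1 (\<lambda>r. indicator S r *\<^sub>R x)"
      by (rule abs_L1_tendsto[OF bint_dominated(1-3)[where t="\<lambda>n r. indicator (Sn n) r *\<^sub>R x", OF sm lim bd wm w]])
    moreover have "abs_L1 (\<lambda>r. indicator (Sn n) r *\<^sub>R x) \<in> \<A>" for n
      by (rule step2[OF Sn, where b="real n"]) (auto simp: Sn_def)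
    ultimately show ?thesis by (rule seqcl)
  qed
  obtain t where t: "\<And>i::nat. simple_function lborel (t i)" "\<And>i. bintegrable (t i)"
    "AE z in lebesgue. \<forall>i. norm (t i z) \<le> 2 * norm (rp F z)"
    "AE z in lebesgue. (\<lambda>i. t i z) \<longlonglongrightarrow> rp F z"
    "(\<lambda>i. \<integral>\<^sup>+z. ennreal (norm (rp F z - t i z)) \<partial>lebesgue) \<longlonglongrightarrow> 0"
    by (rule bintegrable_lborel_approx[OF bintegrable_rp], rule that)
  have "abs_L1 (t i) \<in> \<A>" for i
  proof -
    define I where "I = range (t i) - {0}"
    note I = simple_function_decompose(1-3)[OF t(1)[of i] t(2)[of i], folded I_def]
    note eq = simple_function_decompose(4)[OF t(1)[of i] t(2)[of i], folded I_def]
    have "abs_L1 (\<lambda>x. \<Sum>y\<in>I. indicator (t i -` {y}) x *\<^sub>R y) = (\<Sum>y\<in>I. abs_L1 (\<lambda>x. indicator (t i -` {y}) x *\<^sub>R y))"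
      using I by (intro abs_L1_sum bint_indicator) auto
    also have "\<dots> \<in> \<A>" using I by (intro subspace_sum[OF sub] step3) auto
    finally show ?thesis unfolding eq[symmetric] .
  qed
  note ti = this
  have "(\<lambda>i. abs_L1 (t i)) \<longlonglongrightarrow> abs_L1 (rp F)" by (rule abs_L1_tendsto[OF bintegrable_rp t(2,5)])
  then have "abs_L1 (rp F) \<in> \<A>" by (rule seqcl) (rule ti)
  then show ?thesis by (simp add: abs_L1_rp)
qed

section \<open>Laplace transforms of bounded semigroups\<close>

text \<open>
  Riemann sums with positive values lie in the closed cone.
\<close>

lemma has_integral_nonneg_cone:
  fixes f :: "real \<Rightarrow> 'x::{banach,ordered_real_vector}"
  assumes cl: "closed {u::'x. 0 \<le> u}" and f: "(f has_integral I) {a..b}"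
    and pos: "\<And>t. t \<in> {a..b} \<Longrightarrow> 0 \<le> f t"
  shows "0 \<le> I"
proof -
  have "\<exists>J. 0 \<le> J \<and> dist J I < e" if e: "e > 0" for e
  proof -
    have "(f has_integral I) (cbox a b)" using f by simp
    then obtain g where g: "gauge g"
        "\<And>p. p tagged_division_of cbox a b \<Longrightarrow> g fine p \<Longrightarrow> norm ((\<Sum>(x, k)\<in>p. measure lborel k *\<^sub>R f x) - I) < e"
      using e unfolding has_integral by metis
    obtain p where p: "p tagged_division_of cbox a b" "g fine p"
      using fine_division_exists[OF g(1)] by blast
    have "0 \<le> (\<Sum>(x, k)\<in>p. measure lborel k *\<^sub>R f x)"
    proof (rule sum_nonneg, clarify)
      fix x k assume "(x, k) \<in> p"
      then have "x \<in> {a..b}" using tag_in_interval[OF p(1)] by auto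
      then show "0 \<le> measure lborel k *\<^sub>R f x" by (intro scaleR_nonneg_nonneg pos) auto
    qed
    moreover have "dist (\<Sum>(x, k)\<in>p. measure lborel k *\<^sub>R f x) I < e"
      using g(2)[OF p] by (simp add: dist_norm)
    ultimately show ?thesis by blast
  qed
  then have "I \<in> closure {u. 0 \<le> u}" unfolding closure_approachable by blast
  then show ?thesis using cl by (simp add: closure_closed)
qed

text \<open>
  Semigroups with \<open>\<parallel>S t\<parallel> \<le> M\<close>. For these every \<open>\<mu> > 0\<close> belongs to the resolvent set of the generator, and the
  resolvent is the Laplace transform of the orbits.
\<close>

locale bounded_semigroup =
  fixes S :: "real \<Rightarrow> 'x::banach \<Rightarrow> 'x" and M :: real
  assumes c0: "c0_semigroup S"
    and bound: "\<And>t x. 0 \<le> t \<Longrightarrow> norm (S t x) \<le> M * norm x"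
begin

lemma bl: "0 \<le> t \<Longrightarrow> bounded_linear (S t)"
  using c0 by (simp add: c0_semigroup_def)

lemma S0 [simp]: "S 0 x = x"
  using c0 by (simp add: c0_semigroup_def)

lemma S_add: "0 \<le> s \<Longrightarrow> 0 \<le> t \<Longrightarrow> S (s + t) x = S s (S t x)"
  using c0 by (simp add: c0_semigroup_def)

lemma S_comm: "0 \<le> s \<Longrightarrow> 0 \<le> t \<Longrightarrow> S s (S t x) = S t (S s x)"
  using S_add[of s t x] S_add[of t s x] by (simp add: add.commute)

lemma S_right: "((\<lambda>t. S t x) \<longlongrightarrow> x) (at_right 0)"
  using c0 by (simp add: c0_semigroup_def)

lemma one_le_M: assumes "x \<noteq> (0::'x)" shows "1 \<le> M"
  using bound[of 0 x] assms by simp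

lemma M_mult_nonneg: "0 \<le> M * norm (x::'x)"
  using bound[of 0 x] norm_ge_zero[of x] by (simp del: norm_ge_zero)

lemma Cauchy_estimate_aux:
  assumes "0 \<le> s" "s \<le> t" shows "norm (S t x - S s x) \<le> M * norm (S (t - s) x - x)"
proof -
  interpret bounded_linear "S s" using assms by (intro bl)
  have "S t x - S s x = S s (S (t - s) x - x)"
    using S_add[of s "t - s" x] assms by (simp add: diff)
  then show ?thesis using bound[of s "S (t - s) x - x"] assms by simp
qed

lemma Cauchy_estimate: "0 \<le> s \<Longrightarrow> 0 \<le> t \<Longrightarrow> norm (S t x - S s x) \<le> M * norm (S \<bar>t - s\<bar> x - x)"
  using Cauchy_estimate_aux[of s t x] Cauchy_estimate_aux[of t s x]
  by (cases "s \<le> t") (auto simp: norm_minus_commute)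

lemma continuous_S: "continuous_on {0..} (\<lambda>t. S t x)"
  unfolding continuous_on_iff
proof (intro ballI allI impI)
  fix t e :: real assume "t \<in> {0..}" and e: "0 < e"
  then have t: "0 \<le> t" by simp
  show "\<exists>d>0. \<forall>s\<in>{0..}. dist s t < d \<longrightarrow> dist (S s x) (S t x) < e"
  proof (cases "x = 0")
    case True
    then show ?thesis using e bounded_linear.linear[OF bl] t
      by (intro exI[of _ 1]) (auto simp: linear_0)
  next
    case False
    then have M: "M > 0" using one_le_M[OF False] by simp
    have "\<forall>\<^sub>F h in at_right 0. dist (S h x) x < e / M"
      using tendstoD[OF S_right[of x], of "e / M"] e M by simp
    then obtain d where d: "d > 0" "\<And>h. 0 < h \<Longrightarrow> h < d \<Longrightarrow> dist (S h x) x < e / M"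
      unfolding eventually_at_right_field by auto
    have "dist (S s x) (S t x) < e" if "s \<ge> 0" "dist s t < d" for s
    proof -
      have "norm (S \<bar>s - t\<bar> x - x) < e / M"
        using d(2)[of "\<bar>s - t\<bar>"] that e M by (cases "s = t") (auto simp: dist_norm)
      then have "M * norm (S \<bar>s - t\<bar> x - x) < e" using M by (simp add: field_simps)
      then show ?thesis using Cauchy_estimate[of t s x] that t by (simp add: dist_norm)
    qed
    then show ?thesis using d(1) by (intro exI[of _ d]) auto
  qed
qed

definition damped_orbit :: "real \<Rightarrow> 'x \<Rightarrow> real \<Rightarrow> 'x" where "damped_orbit \<mu> x t = exp (- \<mu> * t) *\<^sub>R S t x"

lemma continuous_damped_orbit: "0 \<le> a \<Longrightarrow> continuous_on {a..b} (damped_orbit \<mu> x)"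
  unfolding damped_orbit_def by (intro continuous_intros continuous_on_subset[OF continuous_S]) auto

lemma integrable_damped_orbit: "0 \<le> a \<Longrightarrow> damped_orbit \<mu> x integrable_on {a..b}"
  by (intro integrable_continuous_real continuous_damped_orbit)

text \<open>
  Laplace integral over \<open>[0, h]\<close>. For \<open>\<mu> = 0\<close> it regularizes: its values are in the domain of the
  generator.
\<close>

definition orbit_integral :: "real \<Rightarrow> real \<Rightarrow> 'x \<Rightarrow> 'x" where "orbit_integral \<mu> h x = integral {0..h} (damped_orbit \<mu> x)"

lemma integral_damped_orbit_shift:
  assumes "0 \<le> a" "0 \<le> c" "a \<le> b"
  shows "integral {a + c..b + c} (damped_orbit \<mu> x) = exp (- \<mu> * c) *\<^sub>R S c (integral {a..b} (damped_orbit \<mu> x))"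
proof -
  have "(damped_orbit \<mu> x has_integral integral {a + c..b + c} (damped_orbit \<mu> x)) (cbox (a + c) (b + c))"
    using integrable_damped_orbit[of "a + c" \<mu> x "b + c"] assms by (simp add: integrable_integral)
  from has_integral_affinity[OF this, of 1 c]
  have "((\<lambda>t. damped_orbit \<mu> x (t + c)) has_integral integral {a + c..b + c} (damped_orbit \<mu> x)) ((\<lambda>t. t - c) ` cbox (a + c) (b + c))"
    by simp
  moreover have "(\<lambda>t. t - c) ` cbox (a + c) (b + c) = {a..b}"
    by (auto simp: image_iff intro!: bexI[where x="_ + c"])
  ultimately have 1: "((\<lambda>t. damped_orbit \<mu> x (t + c)) has_integral integral {a + c..b + c} (damped_orbit \<mu> x)) {a..b}" by simp
  have bl': "bounded_linear (\<lambda>y. exp (- \<mu> * c) *\<^sub>R S c y)"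
    using bounded_linear_compose[OF bounded_linear_scaleR_right bl[OF assms(2)]] .
  have "((\<lambda>t. exp (- \<mu> * c) *\<^sub>R S c (damped_orbit \<mu> x t)) has_integral exp (- \<mu> * c) *\<^sub>R S c (integral {a..b} (damped_orbit \<mu> x))) {a..b}"
    using has_integral_linear[OF integrable_integral[OF integrable_damped_orbit[OF assms(1), of \<mu> x b]] bl']
    by (simp add: o_def)
  moreover have "exp (- \<mu> * c) *\<^sub>R S c (damped_orbit \<mu> x t) = damped_orbit \<mu> x (t + c)" if "t \<in> {a..b}" for t
    using that assms S_add[of c t x] linear_scale[OF bounded_linear.linear[OF bl[OF assms(2)]]]
    by (simp add: damped_orbit_def add.commute algebra_simps flip: exp_add)
  ultimately have "((\<lambda>t. damped_orbit \<mu> x (t + c)) has_integral exp (- \<mu> * c) *\<^sub>R S c (integral {a..b} (damped_orbit \<mu> x))) {a..b}"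
    using has_integral_cong[of "{a..b}" "\<lambda>t. exp (- \<mu> * c) *\<^sub>R S c (damped_orbit \<mu> x t)" "\<lambda>t. damped_orbit \<mu> x (t + c)"] by simp
  with 1 show ?thesis by (rule has_integral_unique)
qed

text \<open>
  Both sides are the integral over \<open>[h, a + h]\<close>.
\<close>

lemma orbit_integral_shift:
  assumes "0 \<le> a" "0 \<le> h"
  shows "exp (- \<mu> * h) *\<^sub>R S h (orbit_integral \<mu> a x) = orbit_integral \<mu> a x - orbit_integral \<mu> h x + exp (- \<mu> * a) *\<^sub>R S a (orbit_integral \<mu> h x)"
proof -
  have "orbit_integral \<mu> h x + integral {h..a + h} (damped_orbit \<mu> x) = orbit_integral \<mu> (a + h) x"
    unfolding orbit_integral_def using assms
    by (intro Henstock_Kurzweil_Integration.integral_combine integrable_damped_orbit) auto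
  moreover have "orbit_integral \<mu> a x + integral {a..h + a} (damped_orbit \<mu> x) = orbit_integral \<mu> (h + a) x"
    unfolding orbit_integral_def using assms
    by (intro Henstock_Kurzweil_Integration.integral_combine integrable_damped_orbit) auto
  ultimately show ?thesis
    using integral_damped_orbit_shift[of 0 h a \<mu> x] integral_damped_orbit_shift[of 0 a h \<mu> x] assms
    by (simp add: orbit_integral_def add.commute algebra_simps)
qed

lemma orbit_integral_commute: "0 \<le> h \<Longrightarrow> 0 \<le> a \<Longrightarrow> orbit_integral \<mu> a (S h x) = S h (orbit_integral \<mu> a x)"
proof -
  assume h: "0 \<le> h" "0 \<le> a"
  have "integral {0..a} (S h \<circ> damped_orbit \<mu> x) = S h (integral {0..a} (damped_orbit \<mu> x))"
    by (rule integral_linear[OF integrable_damped_orbit bl]) (use h in auto)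
  moreover have "integral {0..a} (S h \<circ> damped_orbit \<mu> x) = integral {0..a} (damped_orbit \<mu> (S h x))"
    using h S_comm linear_scale[OF bounded_linear.linear[OF bl[OF h(1)]]]
    by (intro integral_cong) (simp add: damped_orbit_def)
  ultimately show ?thesis by (simp add: orbit_integral_def)
qed

lemma linear_orbit_integral: "0 \<le> a \<Longrightarrow> linear (orbit_integral \<mu> a)"
proof (rule linearI)
  assume a: "0 \<le> a"
  fix x y c
  have "integral {0..a} (damped_orbit \<mu> (x + y)) = integral {0..a} (\<lambda>t. damped_orbit \<mu> x t + damped_orbit \<mu> y t)"
    using linear_add[OF bounded_linear.linear[OF bl]]
    by (intro integral_cong) (auto simp: damped_orbit_def scaleR_add_right)
  then show "orbit_integral \<mu> a (x + y) = orbit_integral \<mu> a x + orbit_integral \<mu> a y"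
    by (simp add: orbit_integral_def Henstock_Kurzweil_Integration.integral_add integrable_damped_orbit)
  have "integral {0..a} (damped_orbit \<mu> (c *\<^sub>R x)) = integral {0..a} (\<lambda>t. c *\<^sub>R damped_orbit \<mu> x t)"
    using linear_scale[OF bounded_linear.linear[OF bl]]
    by (intro integral_cong) (auto simp: damped_orbit_def)
  then show "orbit_integral \<mu> a (c *\<^sub>R x) = c *\<^sub>R orbit_integral \<mu> a x"
    by (simp add: orbit_integral_def)
qed

lemma norm_orbit_integral_le:
  assumes "0 \<le> \<mu>" "0 \<le> a"
  shows "norm (orbit_integral \<mu> a x) \<le> M * norm x * a"
proof -
  have "norm (integral (cbox 0 a) (damped_orbit \<mu> x)) \<le> M * norm x * measure lborel (cbox 0 a)"
  proof (rule integrable_bound)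
    show "damped_orbit \<mu> x integrable_on cbox 0 a" using integrable_damped_orbit[of 0 \<mu> x a] by simp
    fix t assume "t \<in> cbox 0 a"
    then have "exp (- \<mu> * t) * norm (S t x) \<le> 1 * (M * norm x)"
      using assms bound[of t x] by (intro mult_mono) auto
    then show "norm (damped_orbit \<mu> x t) \<le> M * norm x" by (simp add: damped_orbit_def)
  qed (rule M_mult_nonneg)
  then show ?thesis using assms by (simp add: orbit_integral_def)
qed

lemma bounded_linear_orbit_integral: "0 \<le> \<mu> \<Longrightarrow> 0 \<le> a \<Longrightarrow> bounded_linear (orbit_integral \<mu> a)"
  using linear_orbit_integral[of a \<mu>] norm_orbit_integral_le[of \<mu> a]
  by (intro bounded_linear_intro[where K="M * a"])
    (auto simp: linear_add linear_scale algebra_simps)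

lemma orbit_integral_average: "((\<lambda>h. orbit_integral \<mu> h x /\<^sub>R h) \<longlongrightarrow> x) (at_right 0)"
proof (rule tendstoI)
  fix e :: real assume e: "e > 0"
  have "(damped_orbit \<mu> x \<longlongrightarrow> exp (- \<mu> * 0) *\<^sub>R x) (at_right 0)"
    unfolding damped_orbit_def by (intro tendsto_intros S_right) 
  then have "\<forall>\<^sub>F t in at_right 0. dist (damped_orbit \<mu> x t) x < e / 2"
    using e by (intro tendstoD) auto
  then obtain d where d: "d > 0" "\<And>t. 0 < t \<Longrightarrow> t < d \<Longrightarrow> dist (damped_orbit \<mu> x t) x < e / 2"
    unfolding eventually_at_right_field by auto
  have "dist (orbit_integral \<mu> h x /\<^sub>R h) x < e" if h: "0 < h" "h < d" for h
  proof -
    have "norm (integral (cbox 0 h) (\<lambda>t. damped_orbit \<mu> x t - x)) \<le> e / 2 * measure lborel (cbox 0 h)"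
    proof (rule integrable_bound)
      show "(\<lambda>t. damped_orbit \<mu> x t - x) integrable_on cbox 0 h"
        using integrable_damped_orbit[of 0 \<mu> x h] by (auto intro: integrable_diff)
      fix t assume "t \<in> cbox 0 h"
      then show "norm (damped_orbit \<mu> x t - x) \<le> e / 2"
        using d(2)[of t] h e by (cases "t = 0") (auto simp: dist_norm damped_orbit_def)
    qed (use e in auto)
    moreover have "integral (cbox 0 h) (\<lambda>t. damped_orbit \<mu> x t - x) = orbit_integral \<mu> h x - h *\<^sub>R x"
    proof -
      have "integral (cbox 0 h) (\<lambda>t. damped_orbit \<mu> x t - x) = integral (cbox 0 h) (damped_orbit \<mu> x) - integral (cbox 0 h) (\<lambda>t. x)"
        using integrable_damped_orbit[of 0 \<mu> x h] by (intro Henstock_Kurzweil_Integration.integral_diff) auto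
      then show ?thesis using h by (simp add: orbit_integral_def)
    qed
    ultimately have "norm (orbit_integral \<mu> h x - h *\<^sub>R x) \<le> e / 2 * h" using h by simp
    moreover have "orbit_integral \<mu> h x /\<^sub>R h - x = (orbit_integral \<mu> h x - h *\<^sub>R x) /\<^sub>R h"
      using h by (simp add: scaleR_diff_right)
    then have "norm (orbit_integral \<mu> h x /\<^sub>R h - x) = norm (orbit_integral \<mu> h x - h *\<^sub>R x) / h"
      using h by (simp add: divide_inverse mult.commute)
    ultimately have "norm (orbit_integral \<mu> h x /\<^sub>R h - x) \<le> e / 2"
      using h by (simp add: pos_divide_le_eq)
    then show ?thesis using e by (simp add: dist_norm)
  qed
  then show "\<forall>\<^sub>F h in at_right 0. dist (orbit_integral \<mu> h x /\<^sub>R h) x < e"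
    unfolding eventually_at_right_field using d(1) by auto
qed

lemma generatorI:
  assumes "((\<lambda>h. (S h x - x) /\<^sub>R h) \<longlongrightarrow> y) (at_right 0)"
  shows "x \<in> generator_domain S" "generator S x = y"
  using assms unfolding generator_domain_def generator_def by (auto intro!: tendsto_Lim)

lemma generatorD:
  assumes "x \<in> generator_domain S"
  shows "((\<lambda>h. (S h x - x) /\<^sub>R h) \<longlongrightarrow> generator S x) (at_right 0)"
  using assms generatorI(2) unfolding generator_domain_def by fastforce

lemma eventually_pos_at_right: "\<forall>\<^sub>F h in at_right (0::real). 0 < h"
  by (simp add: eventually_at_right_less)

lemma orbit_integral_in_domain:
  assumes "0 \<le> a"
  shows "orbit_integral 0 a x \<in> generator_domain S" "generator S (orbit_integral 0 a x) = S a x - x"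
proof -
  interpret Sa: bounded_linear "S a" using assms by (rule bl)
  have "((\<lambda>h. S a (orbit_integral 0 h x /\<^sub>R h) - orbit_integral 0 h x /\<^sub>R h) \<longlongrightarrow> S a x - x) (at_right 0)"
    by (intro tendsto_diff Sa.tendsto orbit_integral_average)
  then have "((\<lambda>h. (S h (orbit_integral 0 a x) - orbit_integral 0 a x) /\<^sub>R h) \<longlongrightarrow> S a x - x) (at_right 0)"
  proof (rule Lim_transform_eventually)
    show "\<forall>\<^sub>F h in at_right 0. S a (orbit_integral 0 h x /\<^sub>R h) - orbit_integral 0 h x /\<^sub>R h = (S h (orbit_integral 0 a x) - orbit_integral 0 a x) /\<^sub>R h"
      using eventually_pos_at_right
    proof eventually_elim
      case (elim h)
      then show ?case using orbit_integral_shift[of a h 0 x] assms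
        by (simp add: Sa.scaleR scaleR_diff_right)
    qed
  qed
  from generatorI[OF this] show "orbit_integral 0 a x \<in> generator_domain S" "generator S (orbit_integral 0 a x) = S a x - x" .
qed

text \<open>
  The averages \<open>orbit_integral 0 h x / h\<close> are in the domain and tend to \<open>x\<close>.
\<close>

lemma domain_dense: "\<exists>y \<in> generator_domain S. dist y x < e" if "e > 0"
proof -
  have "\<forall>\<^sub>F h in at_right 0. dist (orbit_integral 0 h x /\<^sub>R h) x < e"
    by (rule tendstoD[OF orbit_integral_average that])
  then have "\<forall>\<^sub>F h in at_right 0. dist (orbit_integral 0 h x /\<^sub>R h) x < e \<and> 0 < h"
    using eventually_pos_at_right by eventually_elim simp
  then obtain h where h: "dist (orbit_integral 0 h x /\<^sub>R h) x < e" "0 < h"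
    using eventually_happens[of _ "at_right (0::real)"] by auto
  have "orbit_integral 0 h (x /\<^sub>R h) = orbit_integral 0 h x /\<^sub>R h"
    using linear_scale[OF linear_orbit_integral, of h 0 "inverse h" x] h by simp
  then show ?thesis using h orbit_integral_in_domain(1)[of h "x /\<^sub>R h"] by (intro bexI[of _ "orbit_integral 0 h (x /\<^sub>R h)"]) auto
qed

text \<open>
  The generator at \<open>orbit_integral 0 a x\<close>, computed in two ways: it is \<open>S a x - x\<close>, and, commuting \<open>S h\<close> with the
  integral, it is the limit of \<open>orbit_integral 0 a ((S h x - x) / h)\<close>.
\<close>

lemma S_diff_orbit_integral:
  assumes x: "x \<in> generator_domain S" and a: "0 \<le> a"
  shows "S a x - x = orbit_integral 0 a (generator S x)"
proof -
  interpret P: bounded_linear "orbit_integral 0 a" using a by (intro bounded_linear_orbit_integral) auto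
  have "((\<lambda>h. orbit_integral 0 a ((S h x - x) /\<^sub>R h)) \<longlongrightarrow> orbit_integral 0 a (generator S x)) (at_right 0)"
    by (rule P.tendsto[OF generatorD[OF x]])
  then have "((\<lambda>h. (S h (orbit_integral 0 a x) - orbit_integral 0 a x) /\<^sub>R h) \<longlongrightarrow> orbit_integral 0 a (generator S x)) (at_right 0)"
  proof (rule Lim_transform_eventually)
    show "\<forall>\<^sub>F h in at_right 0. orbit_integral 0 a ((S h x - x) /\<^sub>R h) = (S h (orbit_integral 0 a x) - orbit_integral 0 a x) /\<^sub>R h"
      using eventually_pos_at_right
      by eventually_elim (simp add: P.scaleR P.diff orbit_integral_commute a)
  qed
  from generatorI(2)[OF this] orbit_integral_in_domain(2)[OF a, of x] show ?thesis by simp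
qed

definition damped_step :: "real \<Rightarrow> nat \<Rightarrow> 'x \<Rightarrow> 'x" where "damped_step \<mu> k y = exp (- \<mu> * real k) *\<^sub>R S (real k) y"

text \<open>
  The Laplace integral over \<open>[0, \<infinity>)\<close> as the sum of its parts over the intervals \<open>[k, k + 1]\<close>; this avoids
  improper integrals.
\<close>

definition res :: "real \<Rightarrow> 'x \<Rightarrow> 'x" where "res \<mu> x = (\<Sum>k. damped_step \<mu> k (orbit_integral \<mu> 1 x))"

context
  fixes \<mu> :: real assumes \<mu>: "\<mu> > 0"
begin

lemma bl_damped_step: "bounded_linear (damped_step \<mu> k)"
  unfolding damped_step_def by (rule bounded_linear_compose[OF bounded_linear_scaleR_right bl]) simp

lemma norm_damped_step_le: "norm (damped_step \<mu> k y) \<le> exp (- \<mu>) ^ k * (M * norm y)"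
proof -
  have "norm (damped_step \<mu> k y) = exp (- \<mu> * real k) * norm (S (real k) y)" by (simp add: damped_step_def)
  also have "\<dots> \<le> exp (- \<mu> * real k) * (M * norm y)" by (intro mult_left_mono bound) auto
  also have "exp (- \<mu> * real k) = exp (- \<mu>) ^ k" by (simp add: exp_of_nat_mult[symmetric] mult.commute)
  finally show ?thesis .
qed

lemma geometric: "summable (\<lambda>k. exp (- \<mu>) ^ k * c)" for c :: real
  using \<mu> by (intro summable_mult2 summable_geometric) auto

lemma summable_norm_damped_step: "summable (\<lambda>k. norm (damped_step \<mu> k y))"
  by (rule summable_comparison_test'[OF geometric]) (use norm_damped_step_le in auto)

lemma summable_damped_step: "summable (\<lambda>k. damped_step \<mu> k y)"
  by (rule summable_norm_cancel[OF summable_norm_damped_step])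

lemma damped_step_telescope: "(\<lambda>k. damped_step \<mu> k (y - exp (- \<mu>) *\<^sub>R S 1 y)) sums y"
proof -
  have "(\<lambda>k. damped_step \<mu> k y - damped_step \<mu> (Suc k) y) sums (damped_step \<mu> 0 y - 0)"
    by (rule telescope_sums'[OF summable_LIMSEQ_zero[OF summable_damped_step]])
  moreover have "damped_step \<mu> k y - damped_step \<mu> (Suc k) y = damped_step \<mu> k (y - exp (- \<mu>) *\<^sub>R S 1 y)" for k
  proof -
    interpret W: bounded_linear "damped_step \<mu> k" by (rule bl_damped_step)
    have "damped_step \<mu> (Suc k) y = exp (- \<mu>) *\<^sub>R damped_step \<mu> k (S 1 y)"
      using S_add[of "real k" 1 y] by (simp add: damped_step_def distrib_left add.commute exp_add[symmetric] algebra_simps)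
    then show ?thesis by (simp add: W.diff W.scaleR)
  qed
  ultimately show ?thesis by (simp add: damped_step_def)
qed

text \<open>
  The integral over \<open>[h, \<infinity>)\<close>. In terms of the series, \<open>orbit_integral_shift\<close> leaves a telescoping sum.
\<close>

lemma res_shift:
  assumes h: "0 \<le> h"
  shows "exp (- \<mu> * h) *\<^sub>R S h (res \<mu> x) = res \<mu> x - orbit_integral \<mu> h x"
proof -
  have bl': "bounded_linear (\<lambda>y. exp (- \<mu> * h) *\<^sub>R S h y)"
    by (rule bounded_linear_compose[OF bounded_linear_scaleR_right bl[OF h]])
  have "exp (- \<mu> * h) *\<^sub>R S h (res \<mu> x) = (\<Sum>k. exp (- \<mu> * h) *\<^sub>R S h (damped_step \<mu> k (orbit_integral \<mu> 1 x)))"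
    unfolding res_def by (rule bounded_linear.suminf[OF bl' summable_damped_step])
  also have "\<dots> = (\<Sum>k. damped_step \<mu> k (orbit_integral \<mu> 1 x) - damped_step \<mu> k (orbit_integral \<mu> h x - exp (- \<mu>) *\<^sub>R S 1 (orbit_integral \<mu> h x)))"
  proof (rule suminf_cong)
    fix k
    interpret W: bounded_linear "damped_step \<mu> k" by (rule bl_damped_step)
    interpret Sh: bounded_linear "S h" by (rule bl[OF h])
    have "exp (- \<mu> * h) *\<^sub>R S h (damped_step \<mu> k (orbit_integral \<mu> 1 x)) = damped_step \<mu> k (exp (- \<mu> * h) *\<^sub>R S h (orbit_integral \<mu> 1 x))"
      using S_comm[OF h, of "real k"] linear_scale[OF bounded_linear.linear[OF bl]]
      by (simp add: damped_step_def Sh.scaleR)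
    also have "\<dots> = damped_step \<mu> k (orbit_integral \<mu> 1 x) - damped_step \<mu> k (orbit_integral \<mu> h x - exp (- \<mu>) *\<^sub>R S 1 (orbit_integral \<mu> h x))"
      using orbit_integral_shift[of 1 h \<mu> x] h by (simp add: W.diff W.add)
    finally show "exp (- \<mu> * h) *\<^sub>R S h (damped_step \<mu> k (orbit_integral \<mu> 1 x)) =
      damped_step \<mu> k (orbit_integral \<mu> 1 x) - damped_step \<mu> k (orbit_integral \<mu> h x - exp (- \<mu>) *\<^sub>R S 1 (orbit_integral \<mu> h x))" .
  qed
  also have "\<dots> = res \<mu> x - orbit_integral \<mu> h x"
    unfolding res_def using suminf_diff[OF summable_damped_step[of "orbit_integral \<mu> 1 x"] sums_summable[OF damped_step_telescope[of "orbit_integral \<mu> h x"]]]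
      sums_unique[OF damped_step_telescope[of "orbit_integral \<mu> h x"]] by simp
  finally show ?thesis .
qed

text \<open>
  By \<open>res_shift\<close>, the difference quotient of the orbit of \<open>res \<mu> x\<close> at time \<open>h\<close> is a combination of
  \<open>(exp (\<mu> h) - 1) / h\<close> and the average \<open>orbit_integral \<mu> h x / h\<close>.
\<close>

lemma res_in_domain:
  shows "res \<mu> x \<in> generator_domain S" "generator S (res \<mu> x) = \<mu> *\<^sub>R res \<mu> x - x"
proof -
  have "((\<lambda>h. exp (\<mu> * h)) has_real_derivative \<mu>) (at 0)"
    by (auto intro!: derivative_eq_intros)
  then have "((\<lambda>h. (exp (\<mu> * h) - 1) / h) \<longlongrightarrow> \<mu>) (at 0)" by (simp add: DERIV_def)
  then have e: "((\<lambda>h. (exp (\<mu> * h) - 1) / h) \<longlongrightarrow> \<mu>) (at_right 0)"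
    by (rule tendsto_within_subset) auto
  have "((\<lambda>h::real. exp (\<mu> * h)) \<longlongrightarrow> exp (\<mu> * 0)) (at_right 0)" by (intro tendsto_intros)
  then have e1: "((\<lambda>h::real. exp (\<mu> * h)) \<longlongrightarrow> 1) (at_right 0)" by simp
  have "((\<lambda>h. ((exp (\<mu> * h) - 1) / h) *\<^sub>R res \<mu> x - exp (\<mu> * h) *\<^sub>R (orbit_integral \<mu> h x /\<^sub>R h)) \<longlongrightarrow>
      \<mu> *\<^sub>R res \<mu> x - 1 *\<^sub>R x) (at_right 0)"
    by (intro tendsto_intros e e1 orbit_integral_average)
  then have "((\<lambda>h. (S h (res \<mu> x) - res \<mu> x) /\<^sub>R h) \<longlongrightarrow> \<mu> *\<^sub>R res \<mu> x - 1 *\<^sub>R x) (at_right 0)"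
  proof (rule Lim_transform_eventually)
    show "\<forall>\<^sub>F h in at_right 0. ((exp (\<mu> * h) - 1) / h) *\<^sub>R res \<mu> x - exp (\<mu> * h) *\<^sub>R (orbit_integral \<mu> h x /\<^sub>R h) =
        (S h (res \<mu> x) - res \<mu> x) /\<^sub>R h"
      using eventually_pos_at_right
    proof eventually_elim
      case (elim h)
      have "S h (res \<mu> x) = exp (\<mu> * h) *\<^sub>R (exp (- \<mu> * h) *\<^sub>R S h (res \<mu> x))"
        by (simp add: exp_minus)
      also have "\<dots> = exp (\<mu> * h) *\<^sub>R (res \<mu> x - orbit_integral \<mu> h x)"
        using res_shift[of h x] elim by simp
      finally have Sh: "S h (res \<mu> x) = exp (\<mu> * h) *\<^sub>R res \<mu> x - exp (\<mu> * h) *\<^sub>R orbit_integral \<mu> h x"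
        by (simp add: scaleR_diff_right)
      show ?case unfolding Sh by (simp add: divide_inverse algebra_simps)
    qed
  qed
  from generatorI[OF this] show "res \<mu> x \<in> generator_domain S" "generator S (res \<mu> x) = \<mu> *\<^sub>R res \<mu> x - x" by simp_all
qed

lemma bounded_linear_res: "bounded_linear (res \<mu>)"
proof (rule bounded_linear_intro[where K="(\<Sum>k. exp (- \<mu>) ^ k) * (M * M)"])
  fix x y :: 'x and c :: real
  have P: "linear (orbit_integral \<mu> 1)" by (rule linear_orbit_integral) simp
  have W: "linear (damped_step \<mu> k)" for k by (rule bounded_linear.linear[OF bl_damped_step])
  show "res \<mu> (x + y) = res \<mu> x + res \<mu> y"
    unfolding res_def by (simp add: linear_add[OF P] linear_add[OF W] suminf_add summable_damped_step)
  show "res \<mu> (c *\<^sub>R x) = c *\<^sub>R res \<mu> x"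
    unfolding res_def by (simp add: linear_scale[OF P] linear_scale[OF W] suminf_scaleR_right summable_damped_step)
  have "norm (res \<mu> x) \<le> (\<Sum>k. norm (damped_step \<mu> k (orbit_integral \<mu> 1 x)))"
    unfolding res_def by (rule summable_norm[OF summable_norm_damped_step])
  also have "\<dots> \<le> (\<Sum>k. exp (- \<mu>) ^ k * (M * norm (orbit_integral \<mu> 1 x)))"
    by (intro suminf_le norm_damped_step_le summable_norm_damped_step geometric)
  also have "\<dots> = (\<Sum>k. exp (- \<mu>) ^ k) * (M * norm (orbit_integral \<mu> 1 x))"
    using geometric[of 1] by (subst suminf_mult2) auto
  also have "\<dots> \<le> (\<Sum>k. exp (- \<mu>) ^ k) * (M * (M * norm x))"
  proof (cases "x = 0")
    case False
    then have "M \<ge> 0" using one_le_M[OF False] by simp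
    moreover have "0 \<le> (\<Sum>k. exp (- \<mu>) ^ k)" using geometric[of 1] by (intro suminf_nonneg) auto
    ultimately show ?thesis using norm_orbit_integral_le[of \<mu> 1 x] \<mu> by (intro mult_left_mono) auto
  qed (simp add: linear_0[OF P])
  finally show "norm (res \<mu> x) \<le> norm x * ((\<Sum>k. exp (- \<mu>) ^ k) * (M * M))" by (simp add: mult_ac)
qed

lemma res_commute: "0 \<le> h \<Longrightarrow> res \<mu> (S h x) = S h (res \<mu> x)"
proof -
  assume h: "0 \<le> h"
  have c: "S h (damped_step \<mu> k y) = damped_step \<mu> k (S h y)" for k y
    using S_comm[OF h, of "real k"] linear_scale[OF bounded_linear.linear[OF bl[OF h]]]
    by (simp add: damped_step_def)
  have "S h (res \<mu> x) = (\<Sum>k. S h (damped_step \<mu> k (orbit_integral \<mu> 1 x)))"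
    unfolding res_def by (rule bounded_linear.suminf[OF bl[OF h] summable_damped_step])
  then show ?thesis using orbit_integral_commute[OF h, of 1 \<mu> x] by (simp add: res_def c)
qed

text \<open>
  \<open>res \<mu>\<close> is bounded and commutes with \<open>S h\<close>, so it can be applied to difference quotients.
\<close>

lemma res_generator:
  assumes x: "x \<in> generator_domain S"
  shows "res \<mu> (generator S x) = \<mu> *\<^sub>R res \<mu> x - x"
proof -
  interpret R: bounded_linear "res \<mu>" by (rule bounded_linear_res)
  have "((\<lambda>h. res \<mu> ((S h x - x) /\<^sub>R h)) \<longlongrightarrow> res \<mu> (generator S x)) (at_right 0)"
    by (rule R.tendsto[OF generatorD[OF x]])
  then have "((\<lambda>h. (S h (res \<mu> x) - res \<mu> x) /\<^sub>R h) \<longlongrightarrow> res \<mu> (generator S x)) (at_right 0)"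
  proof (rule Lim_transform_eventually)
    show "\<forall>\<^sub>F h in at_right 0. res \<mu> ((S h x - x) /\<^sub>R h) = (S h (res \<mu> x) - res \<mu> x) /\<^sub>R h"
      using eventually_pos_at_right by eventually_elim (simp add: R.scaleR R.diff res_commute)
  qed
  from generatorI(2)[OF this] res_in_domain(2)[of x] show ?thesis by simp
qed

lemma res_inverse: "x \<in> generator_domain S \<Longrightarrow> res \<mu> (\<mu> *\<^sub>R x - generator S x) = x"
proof -
  assume x: "x \<in> generator_domain S"
  interpret R: bounded_linear "res \<mu>" by (rule bounded_linear_res)
  show ?thesis using res_generator[OF x] by (simp add: R.diff R.scaleR)
qed

lemma res_unique: "x \<in> generator_domain S \<Longrightarrow> \<mu> *\<^sub>R x - generator S x = y \<Longrightarrow> x = res \<mu> y"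
  using res_inverse[of x] by simp

lemma bij_resolvent: "bij_betw (\<lambda>x. \<mu> *\<^sub>R x - generator S x) (generator_domain S) UNIV"
proof (rule bij_betwI[where g="res \<mu>"])
  show "res \<mu> (\<mu> *\<^sub>R x - generator S x) = x" if "x \<in> generator_domain S" for x by (rule res_inverse[OF that])
qed (auto simp: res_in_domain)

lemma resolvent_eq_res: "resolvent (generator_domain S) (generator S) \<mu> = res \<mu>"
proof
  fix y
  show "resolvent (generator_domain S) (generator S) \<mu> y = res \<mu> y"
    unfolding resolvent_def
    by (rule inv_into_f_eq[OF bij_betw_imp_inj_on[OF bij_resolvent]]) (simp_all add: res_in_domain)
qed

lemma in_resolvent_set: "\<mu> \<in> resolvent_set (generator_domain S) (generator S)"
  by (simp add: resolvent_set_def bij_resolvent resolvent_eq_res bounded_linear_res)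

end

end

section \<open>Substochastic semigroups and the exponential formula\<close>

text \<open>
  A substochastic semigroup contracts the norm on the cone only; on the whole space it is bounded
  by the decomposition constant \<open>M\<close>. Additivity of the norm is what makes its resolvent share both
  properties.
\<close>

locale positive_semigroup =
  fixes S :: "real \<Rightarrow> 'x::{banach,ordered_real_vector} \<Rightarrow> 'x" and M :: real
  assumes cl: "closed {u::'x. 0 \<le> u}"
    and add: "\<forall>u v::'x. 0 \<le> u \<longrightarrow> 0 \<le> v \<longrightarrow> norm (u + v) = norm u + norm v"
    and M: "decomposition_bound TYPE('x) M"
    and sub: "substochastic_semigroup S"
begin

lemma norm_le_of_cone:
  assumes f: "linear f" and le: "\<And>u. 0 \<le> u \<Longrightarrow> norm (f u) \<le> norm u"
  shows "norm (f (x::'x) :: 'x) \<le> M * norm x"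
proof -
  obtain u v where uv: "0 \<le> u" "0 \<le> v" "x = u - v" "norm u + norm v \<le> M * norm x"
    using M unfolding decomposition_bound_def by metis
  have "norm (f x) \<le> norm (f u) + norm (f v)"
    using linear_diff[OF f, of u v] uv(3) norm_triangle_ineq4[of "f u" "f v"] by simp
  also have "\<dots> \<le> norm u + norm v" by (intro add_mono le uv)
  finally show ?thesis using uv(4) by simp
qed

sublocale bounded_semigroup S M
proof
  show "c0_semigroup S" using sub by (simp add: substochastic_semigroup_def)
  then show "norm (S t x) \<le> M * norm x" if "0 \<le> t" for t x
    using that sub
    by (intro norm_le_of_cone) (auto simp: substochastic_semigroup_def c0_semigroup_def bounded_linear.linear)
qed

lemma S_nonneg: "0 \<le> t \<Longrightarrow> 0 \<le> u \<Longrightarrow> 0 \<le> S t u"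
  and S_contr: "0 \<le> t \<Longrightarrow> 0 \<le> u \<Longrightarrow> norm (S t u) \<le> norm u"
  using sub by (auto simp: substochastic_semigroup_def)

lemma orbit_integral_nonneg: "0 \<le> a \<Longrightarrow> 0 \<le> u \<Longrightarrow> 0 \<le> orbit_integral \<mu> a u"
  unfolding orbit_integral_def
  by (rule has_integral_nonneg_cone[OF cl integrable_integral[OF integrable_damped_orbit]])
    (auto simp: damped_orbit_def intro!: scaleR_nonneg_nonneg S_nonneg)

lemma res_nonneg: "0 < \<mu> \<Longrightarrow> 0 \<le> u \<Longrightarrow> 0 \<le> res \<mu> u"
  unfolding res_def
  by (rule closed_cone_limit[OF cl _ summable_LIMSEQ[OF summable_damped_step]])
    (auto simp: damped_step_def intro!: sum_nonneg scaleR_nonneg_nonneg S_nonneg orbit_integral_nonneg)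

text \<open>
  From \<open>res_shift\<close>, \<open>res \<mu> u = orbit_integral \<mu> h u + exp (- \<mu> h) S h (res \<mu> u)\<close> is a sum of positive elements, and the
  norm is additive. Dividing by \<open>h\<close> and letting \<open>h\<close> tend to 0 gives \<open>\<mu> \<parallel>res \<mu> u\<parallel> \<le> \<parallel>u\<parallel>\<close>.
\<close>

lemma norm_res_le:
  assumes \<mu>: "0 < \<mu>" and u: "0 \<le> u"
  shows "\<mu> * norm (res \<mu> u) \<le> norm u"
proof -
  \<comment> \<open>the inequality before the passage to the limit\<close>
  have le: "norm (res \<mu> u) * ((1 - exp (- \<mu> * h)) / h) \<le> norm (orbit_integral \<mu> h u /\<^sub>R h)" if h: "0 < h" for h
  proof -
    have "res \<mu> u = orbit_integral \<mu> h u + exp (- \<mu> * h) *\<^sub>R S h (res \<mu> u)"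
      using res_shift[OF \<mu>, of h u] h by simp
    moreover have "0 \<le> exp (- \<mu> * h) *\<^sub>R S h (res \<mu> u)"
      using h by (intro scaleR_nonneg_nonneg S_nonneg res_nonneg \<mu> u) auto
    ultimately have "norm (res \<mu> u) = norm (orbit_integral \<mu> h u) + norm (exp (- \<mu> * h) *\<^sub>R S h (res \<mu> u))"
      using add orbit_integral_nonneg[of h u \<mu>] h u by (metis less_imp_le)
    also have "norm (exp (- \<mu> * h) *\<^sub>R S h (res \<mu> u)) \<le> exp (- \<mu> * h) * norm (res \<mu> u)"
      using S_contr[OF _ res_nonneg[OF \<mu> u], of h] h by simp
    finally have "norm (res \<mu> u) * (1 - exp (- \<mu> * h)) \<le> norm (orbit_integral \<mu> h u)"
      by (simp add: algebra_simps)
    then have "norm (res \<mu> u) * (1 - exp (- \<mu> * h)) / h \<le> norm (orbit_integral \<mu> h u) / h"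
      using h by (intro divide_right_mono) auto
    then show ?thesis using h by (simp add: divide_inverse mult.commute)
  qed
  have "((\<lambda>h. exp (- \<mu> * h)) has_real_derivative - \<mu>) (at 0)"
    by (auto intro!: derivative_eq_intros)
  then have "((\<lambda>h. (exp (- \<mu> * h) - 1) / h) \<longlongrightarrow> - \<mu>) (at 0)" by (simp add: DERIV_def)
  then have "((\<lambda>h. (exp (- \<mu> * h) - 1) / h) \<longlongrightarrow> - \<mu>) (at_right 0)"
    by (rule tendsto_within_subset) auto
  from tendsto_minus[OF this] have "((\<lambda>h. (1 - exp (- \<mu> * h)) / h) \<longlongrightarrow> \<mu>) (at_right 0)"
    by (simp add: minus_divide_left)
  then have l: "((\<lambda>h. norm (res \<mu> u) * ((1 - exp (- \<mu> * h)) / h)) \<longlongrightarrow> norm (res \<mu> u) * \<mu>) (at_right 0)"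
    by (intro tendsto_intros)
  have r: "((\<lambda>h. norm (orbit_integral \<mu> h u /\<^sub>R h)) \<longlongrightarrow> norm u) (at_right 0)"
    by (intro tendsto_norm orbit_integral_average)
  have "norm (res \<mu> u) * \<mu> \<le> norm u"
    by (rule tendsto_le[OF _ r l]) (use le eventually_pos_at_right in \<open>auto elim: eventually_mono\<close>)
  then show ?thesis by (simp add: mult.commute)
qed

text \<open>
  Resolvent step of size \<open>h\<close> of the implicit Euler scheme, \<open>(1 - h A)\<inverse>\<close> for the generator \<open>A\<close>.
\<close>

definition J :: "real \<Rightarrow> 'x \<Rightarrow> 'x" where "J h x = (1 / h) *\<^sub>R res (1 / h) x"

context
  fixes h :: real assumes h: "h > 0"
begin

lemma bounded_linear_J: "bounded_linear (J h)"
  unfolding J_def using h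
  by (intro bounded_linear_compose[OF bounded_linear_scaleR_right bounded_linear_res]) auto

lemma J_nonneg: "0 \<le> u \<Longrightarrow> 0 \<le> J h u"
  unfolding J_def using h by (intro scaleR_nonneg_nonneg res_nonneg) auto

lemma norm_J_le: "0 \<le> u \<Longrightarrow> norm (J h u) \<le> norm u"
  unfolding J_def using h norm_res_le[of "1 / h" u] by simp

lemma linear_J_pow: "linear (J h ^^ n)"
proof (induction n)
  case 0 show ?case by (simp add: linear_iff)
next
  case (Suc n)
  have "linear (J h \<circ> J h ^^ n)" by (rule linear_compose[OF Suc bounded_linear.linear[OF bounded_linear_J]])
  then show ?case by (simp only: funpow.simps)
qed

lemma J_pow_nonneg: "0 \<le> u \<Longrightarrow> 0 \<le> (J h ^^ n) u"
  by (induction n) (auto intro: J_nonneg)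

lemma norm_J_pow_cone: "0 \<le> u \<Longrightarrow> norm ((J h ^^ n) u) \<le> norm u"
proof (induction n)
  case (Suc n)
  then show ?case using norm_J_le[OF J_pow_nonneg[OF Suc.prems, of n]] by simp
qed simp

text \<open>
  All powers are contractions on the cone, so they share the bound \<open>M\<close>; estimating the powers of
  \<open>\<parallel>J h\<parallel>\<close> would give \<open>M\<^sup>n\<close>.
\<close>

lemma norm_J_pow: "norm ((J h ^^ n) x) \<le> M * norm x"
  by (rule norm_le_of_cone[OF linear_J_pow norm_J_pow_cone])

lemma J_diff:
  assumes x: "x \<in> generator_domain S"
  shows "J h x - x = h *\<^sub>R J h (generator S x)"
proof -
  have "J h x - x = res (1 / h) (generator S x)"
    using res_generator[of "1 / h" x] h x by (simp add: J_def)
  also have "\<dots> = h *\<^sub>R J h (generator S x)" using h by (simp add: J_def)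
  finally show ?thesis .
qed

lemma J_commute: "0 \<le> t \<Longrightarrow> J h (S t x) = S t (J h x)"
  using h res_commute[of "1 / h" t x] linear_scale[OF bounded_linear.linear[OF bl]]
  by (simp add: J_def)

end

lemma J_tendsto: "((\<lambda>h. J h x) \<longlongrightarrow> x) (at_right 0)"
proof (rule tendstoI)
  fix e :: real assume e: "e > 0"
  define M' where "M' = \<bar>M\<bar> + 1"
  have M': "M' > 0" by (simp add: M'_def)
  have nJ: "norm (J h z) \<le> M' * norm z" if "h > 0" for h z
  proof -
    have "M * norm z \<le> M' * norm z" by (intro mult_right_mono) (auto simp: M'_def)
    then show ?thesis using norm_J_pow[OF that, of 1 z] by simp
  qed
  obtain y where y: "y \<in> generator_domain S" "dist y x < e / (3 * M')"
    using domain_dense[of "e / (3 * M')" x] e M' by auto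
  have ye: "M' * norm (x - y) < e / 3" "norm (x - y) < e / 3"
  proof -
    show 1: "M' * norm (x - y) < e / 3" using y(2) M' by (simp add: dist_norm norm_minus_commute field_simps)
    have "1 * norm (x - y) \<le> M' * norm (x - y)" by (intro mult_right_mono) (auto simp: M'_def)
    then show "norm (x - y) < e / 3" using 1 by simp
  qed
  define D where "D = M' * norm (generator S y) + 1"
  define d where "d = e / (3 * D)"
  have den: "D > 0" using M' by (simp add: D_def add_nonneg_pos)
  have d: "d > 0" using e den by (simp add: d_def)
  have "dist (J h x) x < e" if h: "0 < h" "h < d" for h
  proof -
    interpret J: bounded_linear "J h" using h by (intro bounded_linear_J)
    have "J h x - x = J h (x - y) + (J h y - y) - (x - y)" by (simp add: J.diff)
    then have "norm (J h x - x) \<le> norm (J h (x - y)) + norm (J h y - y) + norm (x - y)"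
      using norm_triangle_ineq4[of "J h (x - y) + (J h y - y)" "x - y"] norm_triangle_ineq[of "J h (x - y)" "J h y - y"]
      by simp
    moreover have "norm (J h (x - y)) < e / 3" using nJ[OF h(1), of "x - y"] ye by simp
    moreover have "norm (J h y - y) < e / 3"
    proof -
      have "norm (J h y - y) \<le> h * (M' * norm (generator S y))"
        unfolding J_diff[OF h(1) y(1)] using nJ[OF h(1), of "generator S y"] h by simp
      also have "\<dots> \<le> h * D" using h by (simp add: D_def)
      also have "\<dots> < d * D" using h den by (intro mult_strict_right_mono)
      also have "\<dots> = e / 3" using den by (simp add: d_def)
      finally show ?thesis .
    qed
    ultimately show ?thesis using ye by (simp add: dist_norm)
  qed
  then show "\<forall>\<^sub>F h in at_right 0. dist (J h x) x < e"
    unfolding eventually_at_right_field using d by auto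
qed

text \<open>
  Telescoping \<open>S(h)\<^sup>n - J(h)\<^sup>n\<close> leaves \<open>n\<close> local errors \<open>S h x - J h x\<close>. Each of them is \<open>h\<close> times a quantity
  that tends to zero with \<open>h\<close>, as \<open>x\<close> is in the domain.
\<close>

lemma exponential_estimate:
  assumes x: "x \<in> generator_domain S" and h: "h > 0"
  shows "norm (S (real n * h) x - (J h ^^ n) x) \<le>
    real n * h * (M * (M * norm (orbit_integral 0 h (generator S x) /\<^sub>R h - J h (generator S x))))"
proof -
  define \<delta> where "\<delta> = orbit_integral 0 h (generator S x) /\<^sub>R h - J h (generator S x)"
  interpret J: bounded_linear "J h" by (rule bounded_linear_J[OF h])
  have step: "S (real (Suc i) * h) x - J h (S (real i * h) x) = h *\<^sub>R S (real i * h) \<delta>" for i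
  proof -
    interpret Si: bounded_linear "S (real i * h)" using h by (intro bl) simp
    have "S h x - J h x = (S h x - x) - (J h x - x)" by simp
    also have "\<dots> = orbit_integral 0 h (generator S x) - h *\<^sub>R J h (generator S x)"
      using S_diff_orbit_integral[OF x, of h] J_diff[OF h x] h by simp
    also have "\<dots> = h *\<^sub>R \<delta>" using h by (simp add: \<delta>_def scaleR_diff_right)
    finally have "S (real i * h) (S h x - J h x) = h *\<^sub>R S (real i * h) \<delta>" by (simp add: Si.scaleR)
    moreover have "S (real (Suc i) * h) x = S (real i * h) (S h x)"
      using S_add[of "real i * h" h x] h by (simp add: algebra_simps)
    ultimately show ?thesis using J_commute[OF h, of "real i * h" x] h by (simp add: Si.diff)
  qed
  have "S (real n * h) x - (J h ^^ n) x = (\<Sum>i<n. (J h ^^ (n - Suc i)) (h *\<^sub>R S (real i * h) \<delta>))"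
  proof (induction n)
    case (Suc n)
    have "S (real (Suc n) * h) x - (J h ^^ Suc n) x =
      (S (real (Suc n) * h) x - J h (S (real n * h) x)) + J h (S (real n * h) x - (J h ^^ n) x)"
      by (simp add: J.diff)
    also have "\<dots> = h *\<^sub>R S (real n * h) \<delta> + (\<Sum>i<n. J h ((J h ^^ (n - Suc i)) (h *\<^sub>R S (real i * h) \<delta>)))"
      unfolding step Suc J.sum ..
    also have "(\<Sum>i<n. J h ((J h ^^ (n - Suc i)) (h *\<^sub>R S (real i * h) \<delta>))) =
       (\<Sum>i<n. (J h ^^ (Suc n - Suc i)) (h *\<^sub>R S (real i * h) \<delta>))"
    proof (rule sum.cong[OF refl])
      fix i assume "i \<in> {..<n}"
      then have "Suc n - Suc i = Suc (n - Suc i)" by auto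
      then show "J h ((J h ^^ (n - Suc i)) (h *\<^sub>R S (real i * h) \<delta>)) = (J h ^^ (Suc n - Suc i)) (h *\<^sub>R S (real i * h) \<delta>)"
        by simp
    qed
    finally show ?case by (simp add: add.commute)
  qed simp
  then have "norm (S (real n * h) x - (J h ^^ n) x) \<le> (\<Sum>i<n. norm ((J h ^^ (n - Suc i)) (h *\<^sub>R S (real i * h) \<delta>)))"
    by (simp add: norm_sum)
  also have "\<dots> \<le> (\<Sum>i<n. h * (M * (M * norm \<delta>)))"
  proof (rule sum_mono)
    fix i
    have "norm ((J h ^^ (n - Suc i)) (h *\<^sub>R S (real i * h) \<delta>)) = h * norm ((J h ^^ (n - Suc i)) (S (real i * h) \<delta>))"
      using h linear_scale[OF linear_J_pow[OF h]] by simp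
    also have "\<dots> \<le> h * (M * norm (S (real i * h) \<delta>))"
      using h by (intro mult_left_mono norm_J_pow) auto
    also have "\<dots> \<le> h * (M * (M * norm \<delta>))"
    proof (cases "\<delta> = 0")
      case True
      have "linear (S (real i * h))" using h by (intro bounded_linear.linear[OF bl]) simp
      then show ?thesis using True by (simp add: linear_0)
    next
      case False
      then have "M \<ge> 0" using one_le_M[OF False] by simp
      then show ?thesis using h by (intro mult_left_mono bound) auto
    qed
    finally show "norm ((J h ^^ (n - Suc i)) (h *\<^sub>R S (real i * h) \<delta>)) \<le> h * (M * (M * norm \<delta>))" .
  qed
  finally show ?thesis by (simp add: \<delta>_def mult_ac)
qed

text \<open>
  For \<open>x\<close> in the domain this is \<open>exponential_estimate\<close>; in general it follows by density, because
  all powers of \<open>J h\<close> are bounded by \<open>M\<close>.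
\<close>

theorem exponential_formula:
  assumes t: "t > 0"
  shows "(\<lambda>n. (J (t / real (Suc n)) ^^ Suc n) x) \<longlonglongrightarrow> S t x"
proof (rule LIMSEQ_I)
  fix e :: real assume e: "e > 0"
  define M' where "M' = \<bar>M\<bar> + 1"
  have M': "M' > 0" by (simp add: M'_def)
  have MM: "M * norm z \<le> M' * norm z" for z :: 'x by (intro mult_right_mono) (auto simp: M'_def)
  obtain y where y: "y \<in> generator_domain S" "dist y x < e / (3 * M')"
    using domain_dense[of "e / (3 * M')" x] e M' by auto
  have ye: "M' * norm (x - y) < e / 3" using y(2) M' by (simp add: dist_norm norm_minus_commute field_simps)
  define \<delta> where "\<delta> h = orbit_integral 0 h (generator S y) /\<^sub>R h - J h (generator S y)" for h
  have h: "t / real (Suc n) > 0" for n using t by simp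
  have "(\<lambda>n. t / real (Suc n)) \<longlonglongrightarrow> 0"
    by (rule LIMSEQ_Suc[OF lim_const_over_n])
  then have "filterlim (\<lambda>n. t / real (Suc n)) (at_right 0) sequentially"
    using h by (auto simp: filterlim_at intro!: always_eventually)
  moreover have "(\<delta> \<longlongrightarrow> generator S y - generator S y) (at_right 0)"
    unfolding \<delta>_def by (intro tendsto_diff orbit_integral_average J_tendsto)
  ultimately have "(\<lambda>n. \<delta> (t / real (Suc n))) \<longlonglongrightarrow> 0"
    using filterlim_compose by fastforce
  then have "(\<lambda>n. t * (M * (M * norm (\<delta> (t / real (Suc n)))))) \<longlonglongrightarrow> t * (M * (M * norm (0::'x)))"
    by (intro tendsto_intros)
  then have "(\<lambda>n. t * (M * (M * norm (\<delta> (t / real (Suc n)))))) \<longlonglongrightarrow> 0" by simp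
  then have "\<forall>\<^sub>F n in sequentially. t * (M * (M * norm (\<delta> (t / real (Suc n))))) < e / 3"
    using e by (intro order_tendstoD) auto
  then obtain N where N: "\<And>n. n \<ge> N \<Longrightarrow> t * (M * (M * norm (\<delta> (t / real (Suc n))))) < e / 3"
    by (auto simp: eventually_sequentially)
  have "norm ((J (t / real (Suc n)) ^^ Suc n) x - S t x) < e" if n: "n \<ge> N" for n
  proof -
    let ?J = "J (t / real (Suc n)) ^^ Suc n"
    interpret St: bounded_linear "S t" using t by (intro bl) simp
    have J: "linear ?J" by (rule linear_J_pow[OF h])
    have "norm (S (real (Suc n) * (t / real (Suc n))) y - ?J y) \<le>
        real (Suc n) * (t / real (Suc n)) * (M * (M * norm (\<delta> (t / real (Suc n)))))"
      unfolding \<delta>_def by (rule exponential_estimate[OF y(1) h])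
    then have 1: "norm (?J y - S t y) < e / 3" using N[OF n] by (simp add: norm_minus_commute del: funpow.simps)
    have 2: "norm (?J (x - y)) < e / 3" using norm_J_pow[OF h, of "Suc n" n "x - y"] MM[of "x - y"] ye by linarith
    have 3: "norm (S t (x - y)) < e / 3" using bound[of t "x - y"] MM[of "x - y"] ye t by simp
    have eq: "?J x - S t x = ?J (x - y) + (?J y - S t y) - S t (x - y)"
      unfolding linear_diff[OF J] St.diff by (simp del: funpow.simps of_nat_Suc)
    show ?thesis
      unfolding eq
      using norm_triangle_ineq4[of "?J (x - y) + (?J y - S t y)" "S t (x - y)"]
        norm_triangle_ineq[of "?J (x - y)" "?J y - S t y"] 1 2 3 by linarith
  qed
  then show "\<exists>N. \<forall>n\<ge>N. norm ((J (t / real (Suc n)) ^^ Suc n) x - S t x) < e" by blast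
qed

end

text \<open>
  Inequalities between positive operators are preserved by powers and by limits, hence by the
  exponential formula.
\<close>

lemma semigroup_le_of_resolvent_le:
  fixes S T :: "real \<Rightarrow> 'x::{banach,ordered_real_vector} \<Rightarrow> 'x"
  assumes S: "positive_semigroup S M" and T: "positive_semigroup T M"
    and le: "\<And>\<mu> f. 0 < \<mu> \<Longrightarrow> 0 \<le> f \<Longrightarrow> bounded_semigroup.res T \<mu> f \<le> bounded_semigroup.res S \<mu> f"
    and t: "0 \<le> t" and f: "0 \<le> f"
  shows "T t f \<le> S t f"
proof -
  interpret S: positive_semigroup S M by fact
  interpret T: positive_semigroup T M by fact
  show ?thesis
  proof (cases "t = 0")
    case False
    then have t: "t > 0" using t by simp
    have Jle: "T.J h u \<le> S.J h u" if "h > 0" "0 \<le> u" for h u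
      unfolding T.J_def S.J_def using le[of "1 / h" u] that by (intro scaleR_left_mono) auto
    \<comment> \<open>the smaller operator is applied first, to a positive element\<close>
    have pow: "(T.J h ^^ n) f \<le> (S.J h ^^ n) f" if h: "h > 0" for h n
    proof (induction n)
      case (Suc n)
      interpret SJ: bounded_linear "S.J h" by (rule S.bounded_linear_J[OF h])
      have "T.J h ((T.J h ^^ n) f) \<le> S.J h ((T.J h ^^ n) f)"
        by (rule Jle[OF h T.J_pow_nonneg[OF h f]])
      also have "\<dots> \<le> S.J h ((S.J h ^^ n) f)"
        using S.J_nonneg[OF h, of "(S.J h ^^ n) f - (T.J h ^^ n) f"] Suc by (simp add: SJ.diff)
      finally show ?case by simp
    qed simp
    show ?thesis
      by (rule closed_cone_le[OF S.cl _ T.exponential_formula[OF t] S.exponential_formula[OF t]])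
        (rule pow, use t in simp)
  qed simp
qed

section \<open>Perturbation terms\<close>

text \<open>
  The standing assumptions, with the decomposition constant \<open>M\<close> made explicit. Values \<open>M \<ge> 1\<close> avoid
  case distinctions in estimates.
\<close>

locale perturbed_evolution =
  fixes U :: "real \<Rightarrow> real \<Rightarrow> 'e::{banach, ordered_real_vector} \<Rightarrow> 'e"
    and D :: "real \<Rightarrow> 'e set"
    and B :: "real \<Rightarrow> 'e \<Rightarrow> 'e"
    and M :: real
  assumes cone_closed: "closed {u::'e. 0 \<le> u}"
    and decomposition: "decomposition_bound TYPE('e) M"
    and M_ge_1: "1 \<le> M"
    and norm_additive: "\<forall>u v::'e. 0 \<le> u \<longrightarrow> 0 \<le> v \<longrightarrow> norm (u + v) = norm u + norm v"
    and evolution_family: "evolution_family U"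
    and B_linear: "\<forall>t\<ge>0. linear_on_domain (D t) (B t)"
    and U_pos: "\<forall>t s u. 0 \<le> s \<and> s \<le> t \<and> 0 \<le> u \<longrightarrow> 0 \<le> U t s u"
    and U_contr: "\<forall>t s u. 0 \<le> s \<and> s \<le> t \<and> 0 \<le> u \<longrightarrow> norm (U t s u) \<le> norm u"
    and B_pos: "\<forall>t\<ge>0. \<forall>u\<in>D t. 0 \<le> u \<longrightarrow> 0 \<le> B t u"
    and BU_domain: "\<forall>s\<ge>0. \<forall>u. AE t in lebesgue_on {s..}. U t s u \<in> D t"
    and BU_measurable: "\<forall>s\<ge>0. \<forall>u. strongly_measurable (lebesgue_on {s..}) (\<lambda>t. B t (U t s u))"
    and BU_bound: "\<forall>t s u. 0 \<le> s \<and> s \<le> t \<and> 0 \<le> u \<longrightarrow>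
      (\<integral>\<^sup>+\<tau>. ennreal (norm (B \<tau> (U \<tau> s u))) \<partial>lebesgue_on {s..t}) \<le> ennreal (norm u - norm (U t s u))"
    and BUf_measurable: "\<forall>f. bochner_integrable half_line f \<longrightarrow>
      (AE (t, s) in lebesgue_on {(t, s). 0 \<le> s \<and> s \<le> t}. U t s (f s) \<in> D t) \<and>
      strongly_measurable (lebesgue_on {(t, s). 0 \<le> s \<and> s \<le> t}) (\<lambda>(t, s). B t (U t s (f s)))"
begin

lemma U_bl: "0 \<le> s \<Longrightarrow> s \<le> t \<Longrightarrow> bounded_linear (U t s)"
  using evolution_family by (simp add: evolution_family_def)

lemma U_lin: "0 \<le> s \<Longrightarrow> s \<le> t \<Longrightarrow> linear (U t s)"
  by (rule bounded_linear.linear[OF U_bl])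

lemma U_comp: "0 \<le> s \<Longrightarrow> s \<le> r \<Longrightarrow> r \<le> t \<Longrightarrow> U t r (U r s u) = U t s u"
  using evolution_family unfolding evolution_family_def by metis

lemma U_id: "0 \<le> t \<Longrightarrow> U t t u = u"
  using evolution_family unfolding evolution_family_def by metis

lemma U_tendsto:
  assumes "(X \<longlongrightarrow> t) F" "(Y \<longlongrightarrow> s) F" "0 \<le> s" "s \<le> t"
    and "\<forall>\<^sub>F k in F. 0 \<le> Y k \<and> Y k \<le> X k"
  shows "((\<lambda>k. U (X k) (Y k) u) \<longlongrightarrow> U t s u) F"
proof -
  have "continuous_on {(t, s). 0 \<le> s \<and> s \<le> t} (\<lambda>z. U (fst z) (snd z) u)"
    using evolution_family unfolding evolution_family_def by (simp add: case_prod_beta')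
  then have "((\<lambda>k. U (fst (X k, Y k)) (snd (X k, Y k)) u) \<longlongrightarrow> U (fst (t, s)) (snd (t, s)) u) F"
    by (rule continuous_on_tendsto_compose) (use assms in \<open>auto intro!: tendsto_Pair\<close>)
  then show ?thesis by simp
qed

text \<open>
  Joint continuity at the diagonal. Below, continuity of \<open>V n\<close> and of the perturbed family is
  reduced to this.
\<close>

lemma U_near_id:
  assumes "(X \<longlongrightarrow> s) F" "(Y \<longlongrightarrow> s) F" "0 \<le> s" "\<forall>\<^sub>F k in F. 0 \<le> Y k \<and> Y k \<le> X k"
  shows "((\<lambda>k. norm (U (X k) (Y k) u - u)) \<longlongrightarrow> 0) F"
proof -
  have "((\<lambda>k. norm (U (X k) (Y k) u - u)) \<longlongrightarrow> norm (U s s u - u)) F"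
    by (intro tendsto_norm tendsto_diff tendsto_const U_tendsto assms) simp
  then show ?thesis using U_id[OF assms(3)] by simp
qed

lemma decompose:
  obtains u v where "0 \<le> u" "0 \<le> v" "w = u - v" "norm u + norm v \<le> M * norm (w::'e)"
  using decomposition unfolding decomposition_bound_def by metis

lemma bound_from_cone:
  fixes f :: "'e \<Rightarrow> 'e"
  assumes "linear f" "\<And>u. 0 \<le> u \<Longrightarrow> norm (f u) \<le> norm u"
  shows "norm (f w) \<le> M * norm w"
proof -
  obtain u v where uv: "0 \<le> u" "0 \<le> v" "w = u - v" "norm u + norm v \<le> M * norm w"
    by (rule decompose[of w], rule that)
  have "norm (f w) \<le> norm (f u) + norm (f v)"
    using linear_diff[OF assms(1), of u v] uv(3) norm_triangle_ineq4[of "f u" "f v"] by simp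
  then show ?thesis using assms(2)[OF uv(1)] assms(2)[OF uv(2)] uv(4) by linarith
qed

lemma norm_diff_le: "0 \<le> s \<Longrightarrow> s \<le> t \<Longrightarrow> norm u - norm (U t s u) \<le> norm (U t s u - u)"
  using norm_triangle_ineq2[of u "U t s u"] by (simp add: norm_minus_commute)

text \<open>
  The integrand \<open>B U\<close> of the perturbation terms on the interval from \<open>s\<close> to \<open>t\<close>.
\<close>

definition bu :: "real \<Rightarrow> real \<Rightarrow> 'e \<Rightarrow> real \<Rightarrow> 'e" where
  "bu t s w r = (if r \<in> {s..t} then B r (U r s w) else 0)"

lemma Icc_lebesgue: "{s..t::real} \<in> sets lebesgue" by simp

lemma Ici_lebesgue: "{s::real..} \<in> sets lebesgue" by simp

lemma bu_smeas: "0 \<le> s \<Longrightarrow> smeas (bu t s w)"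
proof -
  assume s: "0 \<le> s"
  have "smeas (\<lambda>r. if r \<in> {s..} then B r (U r s w) else 0)"
    using BU_measurable s unfolding strongly_measurable_restrict_iff[OF Ici_lebesgue] by blast
  from strongly_measurable_If_zero[OF this Icc_lebesgue[of s t]]
  show ?thesis by (rule strongly_measurable_AE_cong) (auto simp: bu_def)
qed

lemma BU_domain_AE: "0 \<le> s \<Longrightarrow> AE r in lebesgue. s \<le> r \<longrightarrow> U r s w \<in> D r"
  using BU_domain unfolding AE_lebesgue_on_iff[OF Ici_lebesgue] by simp

lemma B_diff: "0 \<le> r \<Longrightarrow> x \<in> D r \<Longrightarrow> y \<in> D r \<Longrightarrow> B r (x - y) = B r x - B r y"
proof -
  assume a: "0 \<le> r" "x \<in> D r" "y \<in> D r"
  have l: "linear_on_domain (D r) (B r)" using B_linear a by simp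
  then have "(-1) *\<^sub>R y \<in> D r" "B r ((-1) *\<^sub>R y) = (-1) *\<^sub>R B r y"
    using a unfolding linear_on_domain_def by (blast intro: subspace_scale)+
  then show ?thesis using l a unfolding linear_on_domain_def by (metis diff_conv_add_uminus scaleR_minus1_left)
qed

lemma bu_diff:
  assumes "0 \<le> s" shows "AE r in lebesgue. bu t s (u - v) r = bu t s u r - bu t s v r"
  using BU_domain_AE[OF assms, of u] BU_domain_AE[OF assms, of v]
proof eventually_elim
  case (elim r)
  then show ?case using assms by (auto simp: bu_def linear_diff[OF U_lin] B_diff)
qed

lemma bu_add:
  assumes "0 \<le> s" shows "AE r in lebesgue. bu t s (u + v) r = bu t s u r + bu t s v r"
  using BU_domain_AE[OF assms, of u] BU_domain_AE[OF assms, of v]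
proof eventually_elim
  case (elim r)
  then show ?case using assms B_linear by (auto simp: bu_def linear_add[OF U_lin] linear_on_domain_def)
qed

lemma bu_scaleR:
  assumes "0 \<le> s" shows "AE r in lebesgue. bu t s (c *\<^sub>R u) r = c *\<^sub>R bu t s u r"
  using BU_domain_AE[OF assms, of u]
proof eventually_elim
  case (elim r)
  then show ?case using assms B_linear by (auto simp: bu_def linear_scale[OF U_lin] linear_on_domain_def)
qed

lemma bu_nonneg:
  assumes "0 \<le> s" "0 \<le> u" shows "AE r in lebesgue. 0 \<le> bu t s u r"
  using BU_domain_AE[OF assms(1), of u]
proof eventually_elim
  case (elim r)
  then show ?case using assms B_pos U_pos by (auto simp: bu_def)
qed

lemma bu_nn_integral_cone:
  assumes "0 \<le> s" "s \<le> t" "0 \<le> u"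
  shows "(\<integral>\<^sup>+r. ennreal (norm (bu t s u r)) \<partial>lebesgue) \<le> ennreal (norm u - norm (U t s u))"
proof -
  have "(\<integral>\<^sup>+r. ennreal (norm (bu t s u r)) \<partial>lebesgue) = (\<integral>\<^sup>+\<tau>. ennreal (norm (B \<tau> (U \<tau> s u))) \<partial>lebesgue_on {s..t})"
    unfolding nn_integral_restrict_If[OF Icc_lebesgue] by (rule nn_integral_cong) (simp add: bu_def)
  then show ?thesis using BU_bound assms by simp
qed

text \<open>
  The bound on the cone is at most \<open>\<parallel>u\<parallel>\<close>; decomposing \<open>w\<close> costs the constant \<open>M\<close>.
\<close>

lemma bu_nn_integral:
  assumes "0 \<le> s"
  shows "(\<integral>\<^sup>+r. ennreal (norm (bu t s w r)) \<partial>lebesgue) \<le> ennreal (M * norm w)"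
proof (cases "s \<le> t")
  case True
  obtain u v where uv: "0 \<le> u" "0 \<le> v" "w = u - v" "norm u + norm v \<le> M * norm w"
    by (rule decompose[of w], rule that)
  have c: "(\<integral>\<^sup>+r. ennreal (norm (bu t s u r)) \<partial>lebesgue) \<le> ennreal (norm u)" if "0 \<le> u" for u
    using order_trans[OF bu_nn_integral_cone[OF assms True that] ennreal_leI[of _ "norm u"]] by simp
  have "(\<integral>\<^sup>+r. ennreal (norm (bu t s w r)) \<partial>lebesgue) = (\<integral>\<^sup>+r. ennreal (norm (bu t s u r - bu t s v r)) \<partial>lebesgue)"
    unfolding uv(3) by (rule nn_integral_cong_AE, rule eventually_mono[OF bu_diff[OF assms, of t u v]]) simp
  also have "\<dots> \<le> (\<integral>\<^sup>+r. ennreal (norm (0 - bu t s u r)) \<partial>lebesgue) + (\<integral>\<^sup>+r. ennreal (norm (0 - bu t s v r)) \<partial>lebesgue)"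
    by (intro nn_integral_norm_triangle_diff bu_smeas assms strongly_measurable_const)
  also have "\<dots> \<le> ennreal (norm u) + ennreal (norm v)"
    using c[OF uv(1)] c[OF uv(2)] by (intro add_mono) auto
  also have "\<dots> \<le> ennreal (M * norm w)" using uv(4) by (simp flip: ennreal_plus add: ennreal_leI)
  finally show ?thesis .
qed (simp add: bu_def)

abbreviation V :: "nat \<Rightarrow> real \<Rightarrow> real \<Rightarrow> 'e \<Rightarrow> 'e" where "V \<equiv> perturbation_term U B"

text \<open>
  Properties that have to be proved together by induction on \<open>n\<close>: the integral defining
  \<open>V (Suc n)\<close> exists because \<open>V n\<close> is measurable in its initial time, which rests on the cocycle identity
  and on the bound for the sum of the norms.
\<close>

definition good :: "nat \<Rightarrow> bool" where
  "good n \<longleftrightarrow>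
    (\<forall>s t. 0 \<le> s \<and> s \<le> t \<longrightarrow> linear (V n t s) \<and> (\<forall>u\<ge>0. 0 \<le> V n t s u) \<and>
      (\<forall>u\<ge>0. (\<Sum>k\<le>n. norm (V k t s u)) \<le> norm u)) \<and>
    (\<forall>s r t w. 0 \<le> s \<and> s \<le> r \<and> r \<le> t \<longrightarrow> V n t s w = (\<Sum>j\<le>n. V j t r (V (n - j) r s w)))"

context
  fixes n :: nat assumes good: "\<forall>k\<le>n. good k"
begin

lemma V_lin: "k \<le> n \<Longrightarrow> 0 \<le> s \<Longrightarrow> s \<le> t \<Longrightarrow> linear (V k t s)"
  using good unfolding good_def by blast

lemma V_nonneg: "k \<le> n \<Longrightarrow> 0 \<le> s \<Longrightarrow> s \<le> t \<Longrightarrow> 0 \<le> u \<Longrightarrow> 0 \<le> V k t s u"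
  using good unfolding good_def by blast

lemma V_sum_le: "0 \<le> s \<Longrightarrow> s \<le> t \<Longrightarrow> 0 \<le> u \<Longrightarrow> (\<Sum>k\<le>n. norm (V k t s u)) \<le> norm u"
  using good unfolding good_def by blast

lemma V_cocycle: "k \<le> n \<Longrightarrow> 0 \<le> s \<Longrightarrow> s \<le> r \<Longrightarrow> r \<le> t \<Longrightarrow> V k t s w = (\<Sum>j\<le>k. V j t r (V (k - j) r s w))"
  using good unfolding good_def by blast

lemma V_contr: "k \<le> n \<Longrightarrow> 0 \<le> s \<Longrightarrow> s \<le> t \<Longrightarrow> 0 \<le> u \<Longrightarrow> norm (V k t s u) \<le> norm u"
  using V_sum_le[of s t u] member_le_sum[of k "{..n}" "\<lambda>k. norm (V k t s u)"] by auto

lemma V_bound: "k \<le> n \<Longrightarrow> 0 \<le> s \<Longrightarrow> s \<le> t \<Longrightarrow> norm (V k t s w) \<le> M * norm w"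
  by (rule bound_from_cone) (auto intro: V_lin V_contr)

lemma V_bl: "k \<le> n \<Longrightarrow> 0 \<le> s \<Longrightarrow> s \<le> t \<Longrightarrow> bounded_linear (V k t s)"
  by (rule bounded_linear_intro[where K=M])
    (use V_lin V_bound in \<open>auto simp: linear_add linear_scale mult.commute\<close>)

text \<open>
  The bound \<open>\<parallel>U u\<parallel> + \<parallel>V 1 u\<parallel> + \<dots> \<le> \<parallel>u\<parallel>\<close> leaves at most \<open>\<parallel>u\<parallel> - \<parallel>U u\<parallel>\<close> for the later terms, which is small if
  \<open>t\<close> is near \<open>s\<close>.
\<close>

lemma V_tail_le:
  assumes "0 \<le> s" "s \<le> t" "0 \<le> u" "k \<le> n"
  shows "(\<Sum>j\<in>{1..k}. norm (V j t s u)) \<le> norm (U t s u - u)"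
proof -
  have "{..k} = insert 0 {1..k}" by auto
  then have "norm (U t s u) + (\<Sum>j\<in>{1..k}. norm (V j t s u)) = (\<Sum>j\<le>k. norm (V j t s u))" by simp
  also have "\<dots> \<le> (\<Sum>j\<le>n. norm (V j t s u))" using assms(4) by (intro sum_mono2) auto
  also have "\<dots> \<le> norm u" by (intro V_sum_le assms)
  finally show ?thesis using norm_diff_le[of s t u] assms by simp
qed

text \<open>
  In the cocycle identity at the intermediate time \<open>s'\<close>, the summand with \<open>V k t s' (U s' s u)\<close> compares
  with \<open>V k t s' u\<close>, and the other summands contain a factor \<open>V (k - j) s' s u\<close> with \<open>k - j \<ge> 1\<close>, bounded by
  \<open>V_tail_le\<close>.
\<close>

lemma V_initial_time:
  assumes k: "k \<le> n" and s: "0 \<le> s" "s \<le> s'" "s' \<le> t" and u: "0 \<le> u"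
  shows "norm (V k t s u - V k t s' u) \<le> 2 * M * norm (U s' s u - u)"
proof -
  have "{..k} = insert k {..<k}" by auto
  then have "V k t s u = V k t s' (U s' s u) + (\<Sum>j<k. V j t s' (V (k - j) s' s u))"
    using V_cocycle[OF k s, of u] by simp
  then have "V k t s u - V k t s' u = V k t s' (U s' s u - u) + (\<Sum>j<k. V j t s' (V (k - j) s' s u))"
    using linear_diff[OF V_lin[OF k, of s' t]] s by simp
  then have "norm (V k t s u - V k t s' u) \<le> norm (V k t s' (U s' s u - u)) + norm (\<Sum>j<k. V j t s' (V (k - j) s' s u))"
    by (simp add: norm_triangle_ineq)
  moreover have "norm (V k t s' (U s' s u - u)) \<le> M * norm (U s' s u - u)"
    using s by (intro V_bound k) auto
  moreover have "norm (\<Sum>j<k. V j t s' (V (k - j) s' s u)) \<le> (\<Sum>j<k. norm (V (k - j) s' s u))"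
    by (rule order_trans[OF norm_sum sum_mono], rule V_contr) (use k s u in \<open>auto intro: V_nonneg\<close>)
  moreover have "(\<Sum>j<k. norm (V (k - j) s' s u)) = (\<Sum>j\<in>{1..k}. norm (V j s' s u))"
    by (rule sum.reindex_bij_witness[where i="\<lambda>j. k - j" and j="\<lambda>j. k - j"]) auto
  moreover have "(\<Sum>j\<in>{1..k}. norm (V j s' s u)) \<le> norm (U s' s u - u)" using s by (intro V_tail_le u k) auto
  moreover have "1 * norm (U s' s u - u) \<le> M * norm (U s' s u - u)" using M_ge_1 by (intro mult_right_mono) auto
  ultimately show ?thesis by linarith
qed

lemma V_initial_time_tendsto:
  assumes k: "k \<le> n" and t: "\<forall>\<^sub>F i in F. 0 \<le> Y i \<and> Y i \<le> X i \<and> s \<le> X i" and Y: "(Y \<longlongrightarrow> s) F" and s: "0 \<le> s"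
  shows "((\<lambda>i. V k (X i) (Y i) w - V k (X i) s w) \<longlongrightarrow> 0) F"
proof -
  have cone: "((\<lambda>i. V k (X i) (Y i) u - V k (X i) s u) \<longlongrightarrow> 0) F" if u: "0 \<le> u" for u
  proof (rule Lim_null_comparison)
    show "\<forall>\<^sub>F i in F. norm (V k (X i) (Y i) u - V k (X i) s u) \<le> 2 * M * norm (U (max (Y i) s) (min (Y i) s) u - u)"
      using t
    proof eventually_elim
      case (elim i)
      show ?case
      proof (cases "Y i \<le> s")
        case True
        then show ?thesis using V_initial_time[OF k, of "Y i" s "X i" u] elim u by (simp add: max_def min_def)
      next
        case False
        then show ?thesis using V_initial_time[OF k, of s "Y i" "X i" u] elim u s
          by (simp add: max_def min_def norm_minus_commute)
      qed
    qed
    have "((\<lambda>i. norm (U (max (Y i) s) (min (Y i) s) u - u)) \<longlongrightarrow> 0) F"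
    proof (rule U_near_id[where s=s])
      show "((\<lambda>i. max (Y i) s) \<longlongrightarrow> s) F" using tendsto_max[OF Y tendsto_const[of s]] by simp
      show "((\<lambda>i. min (Y i) s) \<longlongrightarrow> s) F" using tendsto_min[OF Y tendsto_const[of s]] by simp
      show "\<forall>\<^sub>F i in F. 0 \<le> min (Y i) s \<and> min (Y i) s \<le> max (Y i) s"
        using t by eventually_elim (use s in auto)
    qed (rule s)
    then show "((\<lambda>i. 2 * M * norm (U (max (Y i) s) (min (Y i) s) u - u)) \<longlongrightarrow> 0) F"
      by (rule tendsto_mult_right_zero)
  qed
  obtain u v where uv: "0 \<le> u" "0 \<le> v" "w = u - v" "norm u + norm v \<le> M * norm w"
    by (rule decompose[of w], rule that)
  have "((\<lambda>i. (V k (X i) (Y i) u - V k (X i) s u) - (V k (X i) (Y i) v - V k (X i) s v)) \<longlongrightarrow> 0 - 0) F"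
    by (intro tendsto_diff cone uv)
  then have l: "((\<lambda>i. (V k (X i) (Y i) u - V k (X i) s u) - (V k (X i) (Y i) v - V k (X i) s v)) \<longlongrightarrow> 0) F" by simp
  show ?thesis
  proof (rule Lim_transform_eventually[OF l])
    show "\<forall>\<^sub>F i in F. V k (X i) (Y i) u - V k (X i) s u - (V k (X i) (Y i) v - V k (X i) s v) =
       V k (X i) (Y i) w - V k (X i) s w"
      using t
    proof eventually_elim
      case (elim i)
      have "V k (X i) (Y i) w = V k (X i) (Y i) u - V k (X i) (Y i) v" "V k (X i) s w = V k (X i) s u - V k (X i) s v"
        unfolding uv(3) using linear_diff[OF V_lin[OF k]] s elim by auto
      then show ?case by simp
    qed
  qed
qed

text \<open>
  Continuity in the initial time is uniform in the final time. In the final time only continuity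
  from the right is shown, using the cocycle identity at the intermediate time \<open>t\<close>; that is what
  measurability needs.
\<close>

lemma V_right_continuous:
  assumes k: "k \<le> n" and X: "(X \<longlongrightarrow> t) F" and Y: "(Y \<longlongrightarrow> s) F" and st: "0 \<le> s" "s \<le> t"
    and ev: "\<forall>\<^sub>F i in F. t \<le> X i \<and> 0 \<le> Y i \<and> Y i \<le> X i"
  shows "((\<lambda>i. V k (X i) (Y i) w) \<longlongrightarrow> V k t s w) F"
proof -
  \<comment> \<open>all terms except the one with \<open>U\<close> are bounded by \<open>V_tail_le\<close>\<close>
  have cone: "((\<lambda>i. V k (X i) s u - V k t s u) \<longlongrightarrow> 0) F" if u: "0 \<le> u" for u
  proof (rule Lim_null_comparison)
    define w where "w j = V j t s u" for j
    have w0: "0 \<le> w j" if "j \<le> n" for j unfolding w_def using that st u by (intro V_nonneg)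
    show "\<forall>\<^sub>F i in F. norm (V k (X i) s u - V k t s u) \<le> (\<Sum>j\<le>k. norm (U (X i) t (w (k - j)) - w (k - j)))"
      using ev
    proof eventually_elim
      case (elim i)
      have "V k (X i) s u = (\<Sum>j\<le>k. V j (X i) t (w (k - j)))"
        unfolding w_def using elim st by (intro V_cocycle k) auto
      moreover have split: "{..k} = insert 0 {1..k}" by auto
      ultimately have "V k (X i) s u - V k t s u = (U (X i) t (w k) - w k) + (\<Sum>j\<in>{1..k}. V j (X i) t (w (k - j)))"
        by (simp add: w_def)
      then have "norm (V k (X i) s u - V k t s u) \<le> norm (U (X i) t (w k) - w k) + norm (\<Sum>j\<in>{1..k}. V j (X i) t (w (k - j)))"
        by (simp add: norm_triangle_ineq)
      moreover have "norm (\<Sum>j\<in>{1..k}. V j (X i) t (w (k - j))) \<le> (\<Sum>j\<in>{1..k}. norm (V j (X i) t (w (k - j))))"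
        by (rule norm_sum)
      moreover have "(\<Sum>j\<in>{1..k}. norm (V j (X i) t (w (k - j)))) \<le> (\<Sum>j\<in>{1..k}. norm (U (X i) t (w (k - j)) - w (k - j)))"
      proof (rule sum_mono)
        fix j assume j: "j \<in> {1..k}"
        have "norm (V j (X i) t (w (k - j))) \<le> (\<Sum>l\<in>{1..k}. norm (V l (X i) t (w (k - j))))"
          using j member_le_sum[of j "{1..k}" "\<lambda>l. norm (V l (X i) t (w (k - j)))"] by simp
        also have "\<dots> \<le> norm (U (X i) t (w (k - j)) - w (k - j))"
          using elim st k by (intro V_tail_le w0) auto
        finally show "norm (V j (X i) t (w (k - j))) \<le> norm (U (X i) t (w (k - j)) - w (k - j))" .
      qed
      moreover have "(\<Sum>j\<le>k. norm (U (X i) t (w (k - j)) - w (k - j))) =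
        norm (U (X i) t (w k) - w k) + (\<Sum>j\<in>{1..k}. norm (U (X i) t (w (k - j)) - w (k - j)))"
        unfolding split by simp
      ultimately show ?case by linarith
    qed
    have "((\<lambda>i. \<Sum>j\<le>k. norm (U (X i) t (w (k - j)) - w (k - j))) \<longlongrightarrow> (\<Sum>j\<le>k. 0)) F"
    proof (rule tendsto_sum, rule U_near_id[OF X tendsto_const])
      show "0 \<le> t" using st by simp
      show "\<forall>\<^sub>F i in F. 0 \<le> t \<and> t \<le> X i" using ev by eventually_elim (use st in auto)
    qed
    then show "((\<lambda>i. \<Sum>j\<le>k. norm (U (X i) t (w (k - j)) - w (k - j))) \<longlongrightarrow> 0) F" by simp
  qed
  obtain u v where uv: "0 \<le> u" "0 \<le> v" "w = u - v" "norm u + norm v \<le> M * norm w"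
    by (rule decompose[of w], rule that)
  have "((\<lambda>i. (V k (X i) s u - V k t s u) - (V k (X i) s v - V k t s v) +
     (V k (X i) (Y i) w - V k (X i) s w) + V k t s w) \<longlongrightarrow> 0 - 0 + 0 + V k t s w) F"
  proof (intro tendsto_add tendsto_diff cone uv tendsto_const V_initial_time_tendsto[OF k _ Y st(1)])
    show "\<forall>\<^sub>F i in F. 0 \<le> Y i \<and> Y i \<le> X i \<and> s \<le> X i" using ev by eventually_elim (use st in auto)
  qed
  then have l: "((\<lambda>i. (V k (X i) s u - V k t s u) - (V k (X i) s v - V k t s v) +
     (V k (X i) (Y i) w - V k (X i) s w) + V k t s w) \<longlongrightarrow> V k t s w) F" by simp
  show ?thesis
  proof (rule Lim_transform_eventually[OF l])
    show "\<forall>\<^sub>F i in F. V k (X i) s u - V k t s u - (V k (X i) s v - V k t s v) +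
       (V k (X i) (Y i) w - V k (X i) s w) + V k t s w = V k (X i) (Y i) w"
      using ev
    proof eventually_elim
      case (elim i)
      have "V k (X i) s w = V k (X i) s u - V k (X i) s v" "V k t s w = V k t s u - V k t s v"
        unfolding uv(3) using linear_diff[OF V_lin[OF k]] st elim by auto
      then show ?case by simp
    qed
  qed
qed

text \<open>
  Approximating \<open>r\<close> by dyadic numbers from above leaves the interval only at \<open>r = t\<close>, a null set.
\<close>

lemma V_smeas_initial:
  assumes k: "k \<le> n" and s: "0 \<le> s" "s \<le> t"
  shows "smeas (\<lambda>r. if r \<in> {s..t} then V k t r w else 0)"
proof (rule strongly_measurable_simple_limit[OF Icc_lebesgue])
  show "simple_function lebesgue (right_dyadic i)" for i
    by (rule simple_function_lebesgue) (use simple_function_right_dyadic[of i] in \<open>simp add: simple_function_def\<close>)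
  have "AE r in lebesgue. r \<noteq> t" by (intro AE_completion AE_lborel_singleton)
  then show "AE r in lebesgue. r \<in> {s..t} \<longrightarrow> (\<lambda>i. V k t (right_dyadic i r) w) \<longlonglongrightarrow> V k t r w"
  proof eventually_elim
    case (elim r)
    show ?case
    proof
      assume r: "r \<in> {s..t}"
      then have rt: "r < t" "0 \<le> r" using elim s by auto
      have "\<forall>\<^sub>F i in sequentially. right_dyadic i r < t"
        by (rule order_tendstoD(2)[OF right_dyadic_tendsto rt(1)])
      then have ev: "\<forall>\<^sub>F i in sequentially. 0 \<le> right_dyadic i r \<and> right_dyadic i r \<le> t \<and> r \<le> t"
        using right_dyadic_ge[of r] by eventually_elim (use rt in auto)
      have "(\<lambda>i. (V k t (right_dyadic i r) w - V k t r w) + V k t r w) \<longlonglongrightarrow> 0 + V k t r w"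
        by (intro tendsto_add tendsto_const V_initial_time_tendsto[OF k, where X="\<lambda>i. t"] ev right_dyadic_tendsto rt)
      then show "(\<lambda>i. V k t (right_dyadic i r) w) \<longlonglongrightarrow> V k t r w" by simp
    qed
  qed
qed

lemma V_integrand:
  assumes k: "k \<le> n" and s: "0 \<le> s" "s \<le> t"
  shows "bintegrable (\<lambda>r. if r \<in> {s..t} then V k t r (bu t s w r) else 0)"
proof (rule bintegrable_bound)
  show "smeas (\<lambda>r. if r \<in> {s..t} then V k t r (bu t s w r) else 0)"
    by (rule strongly_measurable_apply[OF Icc_lebesgue _ V_smeas_initial[OF k s] bu_smeas[OF s(1)]])
      (use s k in \<open>auto intro: V_bl\<close>)
  show "AE r in lebesgue. ennreal (norm (if r \<in> {s..t} then V k t r (bu t s w r) else 0)) \<le> ennreal M * ennreal (norm (bu t s w r))"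
    using V_bound[OF k, of _ t] s M_ge_1 by (auto simp flip: ennreal_mult intro!: ennreal_leI)
  have "(\<integral>\<^sup>+r. ennreal M * ennreal (norm (bu t s w r)) \<partial>lebesgue) = ennreal M * (\<integral>\<^sup>+r. ennreal (norm (bu t s w r)) \<partial>lebesgue)"
    by (intro nn_integral_cmult measurable_compose[OF norm_measurable[OF bu_smeas[OF s(1)]]]) auto
  also have "\<dots> < \<infinity>" using bu_nn_integral[OF s(1), of t w] by (auto simp: ennreal_mult_less_top intro: le_less_trans)
  finally show "(\<integral>\<^sup>+r. ennreal M * ennreal (norm (bu t s w r)) \<partial>lebesgue) < \<infinity>" .
qed

end

lemma V_Suc: "V (Suc n) t s u = bint (\<lambda>r. if r \<in> {s..t} then V n t r (bu t s u r) else 0)"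
  unfolding perturbation_term.simps bochner_integral_restrict[OF Icc_lebesgue]
  by (rule arg_cong[where f=bint]) (auto simp: bu_def)

end

context perturbed_evolution
begin

lemma good_0: "good 0"
  unfolding good_def using U_lin U_pos U_contr U_comp by auto

text \<open>
  Linearity and positivity pass through the integral. The norm bound integrates the bound for
  \<open>B U\<close>, applying the sum bound for \<open>V 0, \<dots>, V n\<close> under the integral. For the cocycle identity the integral is
  split at \<open>r\<close>: before \<open>r\<close> the induction hypothesis applies to the integrand, after \<open>r\<close> the identity
  \<open>U \<tau> s = U \<tau> r U r s\<close> does.
\<close>

lemma good_Suc:
  assumes g: "\<forall>k\<le>n. good k"
  shows "good (Suc n)"
proof -
  note lin = V_lin[of n, OF g] and nonneg = V_nonneg[of n, OF g] and bl = V_bl[of n, OF g]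
  note int = V_integrand[of n, OF g]
  note sum_le = V_sum_le[of n, OF g] and coc = V_cocycle[of n, OF g]
  \<comment> \<open>linearity; \<open>B\<close> is linear only on its domain, so this holds under the integral almost everywhere\<close>
  have L: "linear (V (Suc n) t s)" if st: "0 \<le> s" "s \<le> t" for s t
  proof (rule linearI)
    fix u v :: 'e and c :: real
    have "AE r in lebesgue. (if r \<in> {s..t} then V n t r (bu t s (u + v) r) else 0) =
      (if r \<in> {s..t} then V n t r (bu t s u r) else 0) + (if r \<in> {s..t} then V n t r (bu t s v r) else 0)"
      using bu_add[OF st(1), of t u v]
      by eventually_elim (use st in \<open>simp add: linear_add[OF lin]\<close>)
    from bint_cong_AE[OF this] show "V (Suc n) t s (u + v) = V (Suc n) t s u + V (Suc n) t s v"
      unfolding V_Suc using bint_add[OF int[OF order_refl st, of u] int[OF order_refl st, of v]] by simp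
    have "AE r in lebesgue. (if r \<in> {s..t} then V n t r (bu t s (c *\<^sub>R u) r) else 0) =
      c *\<^sub>R (if r \<in> {s..t} then V n t r (bu t s u r) else 0)"
      using bu_scaleR[OF st(1), of t c u]
      by eventually_elim (use st in \<open>simp add: linear_scale[OF lin]\<close>)
    from bint_cong_AE[OF this] show "V (Suc n) t s (c *\<^sub>R u) = c *\<^sub>R V (Suc n) t s u"
      unfolding V_Suc using bint_scaleR[OF int[OF order_refl st, of u], of c] by simp
  qed
  have P: "0 \<le> V (Suc n) t s u" if st: "0 \<le> s" "s \<le> t" "0 \<le> u" for s t u
    unfolding V_Suc
  proof (rule bint_nonneg[OF cone_closed int[OF order_refl st(1,2)]])
    show "AE r in lebesgue. 0 \<le> (if r \<in> {s..t} then V n t r (bu t s u r) else 0)"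
      using bu_nonneg[OF st(1,3), of t] by eventually_elim (use st in \<open>auto intro!: nonneg\<close>)
  qed
  have S: "(\<Sum>k\<le>Suc n. norm (V k t s u)) \<le> norm u" if st: "0 \<le> s" "s \<le> t" and u: "0 \<le> u" for s t u
  proof -
    \<comment> \<open>by \<open>BU_bound\<close>, the later terms have at most the norm lost by \<open>U\<close>\<close>
    let ?f = "\<lambda>k r. if r \<in> {s..t} then V k t r (bu t s u r) else 0"
    have "ennreal (\<Sum>k\<le>n. norm (V (Suc k) t s u)) = (\<Sum>k\<le>n. ennreal (norm (bint (?f k))))"
      unfolding V_Suc by (simp add: sum_ennreal)
    also have "\<dots> \<le> (\<Sum>k\<le>n. \<integral>\<^sup>+r. ennreal (norm (?f k r)) \<partial>lebesgue)"
      by (intro sum_mono norm_bint_le int st) auto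
    also have "\<dots> = (\<integral>\<^sup>+r. (\<Sum>k\<le>n. ennreal (norm (?f k r))) \<partial>lebesgue)"
      by (intro nn_integral_sum[symmetric] measurable_compose[OF norm_measurable[OF smeas_bintegrable[OF int]]] st) auto
    also have "\<dots> \<le> (\<integral>\<^sup>+r. ennreal (norm (bu t s u r)) \<partial>lebesgue)"
    proof (rule nn_integral_mono_AE)
      show "AE r in lebesgue. (\<Sum>k\<le>n. ennreal (norm (?f k r))) \<le> ennreal (norm (bu t s u r))"
        using bu_nonneg[OF st(1) u, of t]
      proof eventually_elim
        case (elim r)
        show ?case
        proof (cases "r \<in> {s..t}")
          case True
          then have "(\<Sum>k\<le>n. norm (V k t r (bu t s u r))) \<le> norm (bu t s u r)"
            using st elim by (intro sum_le) auto
          then show ?thesis using True by (simp add: sum_ennreal ennreal_leI)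
        next
          case False
          then show ?thesis by (simp only: if_False norm_zero ennreal_0 sum.neutral_const zero_le)
        qed
      qed
    qed
    also have "\<dots> \<le> ennreal (norm u - norm (U t s u))" by (rule bu_nn_integral_cone[OF st u])
    finally have "(\<Sum>k\<le>n. norm (V (Suc k) t s u)) \<le> norm u - norm (U t s u)"
      by (rule ennreal_le_iff[THEN iffD1, rotated]) (use U_contr st u in simp)
    then show ?thesis by (simp only: sum.atMost_Suc_shift perturbation_term.simps(1))
  qed
  have C: "V (Suc n) t s w = (\<Sum>j\<le>Suc n. V j t r (V (Suc n - j) r s w))"
    if st: "0 \<le> s" "s \<le> r" "r \<le> t" for s r t w
  proof -
    \<comment> \<open>\<open>?F1\<close> and \<open>?F2\<close> are the contributions of perturbations before and after the time \<open>r\<close>\<close>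
    let ?F = "\<lambda>\<tau>. if \<tau> \<in> {s..t} then V n t \<tau> (bu t s w \<tau>) else 0"
    let ?F1 = "\<lambda>\<tau>. \<Sum>j\<le>n. V j t r (if \<tau> \<in> {s..r} then V (n - j) r \<tau> (bu r s w \<tau>) else 0)"
    let ?F2 = "\<lambda>\<tau>. if \<tau> \<in> {r..t} then V n t \<tau> (bu t r (U r s w) \<tau>) else 0"
    have st': "s \<le> t" "0 \<le> r" using st by auto
    have i1: "bintegrable (\<lambda>\<tau>. V j t r (if \<tau> \<in> {s..r} then V (n - j) r \<tau> (bu r s w \<tau>) else 0))" if "j \<le> n" for j
      by (rule bintegrable_linear[OF int bl]) (use that st in auto)
    have F1: "bintegrable ?F1" "bint ?F1 = (\<Sum>j\<le>n. V j t r (V (Suc n - j) r s w))"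
    proof -
      show "bintegrable ?F1" using bint_sum[of "{..n}", OF i1] by simp
      have "bint ?F1 = (\<Sum>j\<le>n. bint (\<lambda>\<tau>. V j t r (if \<tau> \<in> {s..r} then V (n - j) r \<tau> (bu r s w \<tau>) else 0)))"
        using bint_sum[of "{..n}", OF i1] by simp
      also have "\<dots> = (\<Sum>j\<le>n. V j t r (V (Suc n - j) r s w))"
      proof (rule sum.cong[OF refl])
        fix j assume "j \<in> {..n}"
        then have j: "j \<le> n" by simp
        have "bint (\<lambda>\<tau>. V j t r (if \<tau> \<in> {s..r} then V (n - j) r \<tau> (bu r s w \<tau>) else 0)) =
          V j t r (bint (\<lambda>\<tau>. if \<tau> \<in> {s..r} then V (n - j) r \<tau> (bu r s w \<tau>) else 0))"
          by (rule bint_linear[OF int bl]) (use j st in auto)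
        also have "\<dots> = V j t r (V (Suc (n - j)) r s w)" by (simp only: V_Suc)
        finally show "bint (\<lambda>\<tau>. V j t r (if \<tau> \<in> {s..r} then V (n - j) r \<tau> (bu r s w \<tau>) else 0)) =
          V j t r (V (Suc n - j) r s w)" using j by (simp only: Suc_diff_le)
      qed
      finally show "bint ?F1 = (\<Sum>j\<le>n. V j t r (V (Suc n - j) r s w))" .
    qed
    have F2: "bintegrable ?F2" "bint ?F2 = V (Suc n) t r (U r s w)"
      using int[OF order_refl st'(2) st(3), of "U r s w"] by (simp_all only: V_Suc)
    have "AE \<tau> in lebesgue. \<tau> \<noteq> r" by (intro AE_completion AE_lborel_singleton)
    then have "AE \<tau> in lebesgue. ?F \<tau> = ?F1 \<tau> + ?F2 \<tau>"
    proof eventually_elim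
      case (elim \<tau>)
      consider "\<tau> < s" | "s \<le> \<tau>" "\<tau> < r" | "r < \<tau>" "\<tau> \<le> t" | "t < \<tau>" using elim by linarith
      then show ?case
      proof cases
        case 1
        then show ?thesis using st by (auto simp: linear_0[OF lin] intro!: sum.neutral[symmetric])
      next
        case 2
        have "V n t \<tau> (bu t s w \<tau>) = (\<Sum>j\<le>n. V j t r (V (n - j) r \<tau> (bu t s w \<tau>)))"
          using 2 st by (intro coc) auto
        then show ?thesis using 2 st by (simp add: bu_def)
      next
        case 3
        have "U \<tau> r (U r s w) = U \<tau> s w" using 3 st by (intro U_comp) auto
        then show ?thesis using 3 st by (auto simp: bu_def linear_0[OF lin] intro!: sum.neutral[symmetric])
      next
        case 4
        then show ?thesis using st by (auto simp: linear_0[OF lin] intro!: sum.neutral[symmetric])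
      qed
    qed
    then have "bint ?F = bint ?F1 + bint ?F2"
      using bint_cong_AE[of ?F "\<lambda>\<tau>. ?F1 \<tau> + ?F2 \<tau>"] bint_add[OF F1(1) F2(1)] by (simp only:)
    then have "V (Suc n) t s w = (\<Sum>j\<le>n. V j t r (V (Suc n - j) r s w)) + V (Suc n) t r (U r s w)"
      by (simp only: V_Suc[of n t s w] F1(2) F2(2))
    then show ?thesis by (simp only: sum.atMost_Suc diff_self_eq_0 perturbation_term.simps(1))
  qed
  show ?thesis
    unfolding good_def
  proof (intro conjI allI impI; (elim conjE)?)
    show "linear (V (Suc n) t s)" if "0 \<le> s" "s \<le> t" for s t by (rule L[OF that])
    show "0 \<le> V (Suc n) t s u" if "0 \<le> s" "s \<le> t" "0 \<le> u" for s t u by (rule P[OF that])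
    show "(\<Sum>k\<le>Suc n. norm (V k t s u)) \<le> norm u" if "0 \<le> s" "s \<le> t" "0 \<le> u" for s t u by (rule S[OF that])
    show "V (Suc n) t s w = (\<Sum>j\<le>Suc n. V j t r (V (Suc n - j) r s w))" if "0 \<le> s" "s \<le> r" "r \<le> t" for s r t w
      by (rule C[OF that])
  qed
qed

lemma all_good: "\<forall>k\<le>n. good k"
proof (induction n)
  case 0 then show ?case using good_0 by simp
next
  case (Suc n)
  then have "good (Suc n)" by (rule good_Suc)
  with Suc show ?case by (auto simp: le_Suc_eq)
qed

lemmas Vn_lin = V_lin[OF all_good order_refl]
  and Vn_nonneg = V_nonneg[OF all_good order_refl]
  and Vn_sum_le = V_sum_le[OF all_good]
  and Vn_cocycle = V_cocycle[OF all_good order_refl]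
  and Vn_bound = V_bound[OF all_good order_refl]
  and Vn_bl = V_bl[OF all_good order_refl]
  and Vn_tail_le = V_tail_le[OF all_good _ _ _ order_refl]
  and Vn_right_continuous = V_right_continuous[OF all_good order_refl]
  and Vn_integrand = V_integrand[OF all_good order_refl]
  and Vn_smeas_initial = V_smeas_initial[OF all_good order_refl]

text \<open>
  Measurability along the lines \<open>t - s = const\<close>, as needed for evolution semigroups. It does not
  follow from measurability on the plane.
\<close>

lemma Vn_smeas_diagonal:
  assumes t: "0 \<le> t"
  shows "smeas (\<lambda>s. if t \<le> s then V n s (s - t) w else 0)"
proof -
  have "smeas (\<lambda>s. if s \<in> {t..} then V n s (s - t) w else 0)"
  proof (rule strongly_measurable_simple_limit[OF Ici_lebesgue])
    show "simple_function lebesgue (right_dyadic i)" for i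
      by (rule simple_function_lebesgue) (use simple_function_right_dyadic[of i] in \<open>simp add: simple_function_def\<close>)
    show "AE s in lebesgue. s \<in> {t..} \<longrightarrow> (\<lambda>i. V n (right_dyadic i s) (right_dyadic i s - t) w) \<longlonglongrightarrow> V n s (s - t) w"
    proof (intro AE_I2 impI)
      fix s assume "s \<in> {t..}"
      then show "(\<lambda>i. V n (right_dyadic i s) (right_dyadic i s - t) w) \<longlonglongrightarrow> V n s (s - t) w"
        using t by (intro Vn_right_continuous tendsto_diff right_dyadic_tendsto tendsto_const)
          (auto intro: eventually_mono[OF right_dyadic_ge[of s]])
    qed
  qed
  then show ?thesis by simp
qed

definition triangle :: "(real \<times> real) set" where "triangle = {z. 0 \<le> snd z \<and> snd z \<le> fst z}"

lemma triangle_borel: "triangle \<in> sets borel"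
proof -
  have "closed triangle" unfolding triangle_def
    by (intro closed_Collect_conj closed_Collect_le continuous_intros)
  then show ?thesis by simp
qed

lemma triangle_lebesgue: "triangle \<in> sets lebesgue"
  using triangle_borel by simp

lemma Vn_smeas_triangle: "smeas (\<lambda>z. if z \<in> triangle then V n (fst z) (snd z) w else 0)"
proof (rule strongly_measurable_simple_limit[OF triangle_lebesgue])
  show "simple_function lebesgue (\<lambda>z::real \<times> real. (right_dyadic i (fst z), right_dyadic i (snd z)))" for i
  proof (rule simple_function_lebesgue, rule simple_function_Pair)
    have 1: "right_dyadic i \<in> measurable borel (count_space UNIV)" "finite (range (right_dyadic i))"
      using simple_function_right_dyadic[of i] by (auto simp: simple_function_eq_measurable)
    have "(\<lambda>z::real\<times>real. right_dyadic i (fst z)) \<in> measurable borel (count_space UNIV)"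
        "(\<lambda>z::real\<times>real. right_dyadic i (snd z)) \<in> measurable borel (count_space UNIV)"
      by (intro measurable_compose[OF _ 1(1)] borel_measurable_continuous_onI continuous_intros)+
    moreover have "finite (range (\<lambda>z::real\<times>real. right_dyadic i (fst z)))" "finite (range (\<lambda>z::real\<times>real. right_dyadic i (snd z)))"
      by (rule finite_subset[OF _ 1(2)], blast)+
    ultimately show "simple_function lborel (\<lambda>z::real\<times>real. right_dyadic i (fst z))"
        "simple_function lborel (\<lambda>z::real\<times>real. right_dyadic i (snd z))"
      by (simp_all add: simple_function_eq_measurable)
  qed
  show "AE z in lebesgue. z \<in> triangle \<longrightarrow>
    (\<lambda>i. (\<lambda>y. V n (fst y) (snd y) w) (right_dyadic i (fst z), right_dyadic i (snd z))) \<longlonglongrightarrow> V n (fst z) (snd z) w"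
  proof (intro AE_I2 impI)
    fix z assume "z \<in> triangle"
    then have z: "0 \<le> snd z" "snd z \<le> fst z" by (auto simp: triangle_def)
    have ev: "\<forall>\<^sub>F i in sequentially. fst z \<le> right_dyadic i (fst z) \<and> 0 \<le> right_dyadic i (snd z) \<and> right_dyadic i (snd z) \<le> right_dyadic i (fst z)"
      using right_dyadic_ge[of "fst z"] right_dyadic_ge[of "snd z"] right_dyadic_mono[OF z(2)]
      by eventually_elim (use z in auto)
    show "(\<lambda>i. (\<lambda>y. V n (fst y) (snd y) w) (right_dyadic i (fst z), right_dyadic i (snd z))) \<longlonglongrightarrow> V n (fst z) (snd z) w"
      using Vn_right_continuous[OF right_dyadic_tendsto right_dyadic_tendsto z ev] by simp
  qed
qed

section \<open>The perturbed family\<close>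

abbreviation Vs :: "real \<Rightarrow> real \<Rightarrow> 'e \<Rightarrow> 'e" where "Vs \<equiv> perturbed_family U B"

text \<open>
  Partial sums are bounded on the cone by \<open>\<parallel>u\<parallel>\<close>, hence in general by \<open>M \<parallel>w\<parallel>\<close>.
\<close>

lemma V_summable_norm:
  assumes "0 \<le> s" "s \<le> t"
  shows "summable (\<lambda>n. norm (V n t s w))" "(\<Sum>n. norm (V n t s w)) \<le> M * norm w"
proof -
  have bound: "(\<Sum>k\<le>n. norm (V k t s w)) \<le> M * norm w" for n
  proof -
    obtain u v where uv: "0 \<le> u" "0 \<le> v" "w = u - v" "norm u + norm v \<le> M * norm w"
      by (rule decompose[of w], rule that)
    have "(\<Sum>k\<le>n. norm (V k t s w)) \<le> (\<Sum>k\<le>n. norm (V k t s u) + norm (V k t s v))"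
      unfolding uv(3) linear_diff[OF Vn_lin[OF assms]] by (intro sum_mono norm_triangle_ineq4)
    also have "\<dots> \<le> norm u + norm v"
      unfolding sum.distrib by (intro add_mono Vn_sum_le assms uv)
    finally show ?thesis using uv(4) by simp
  qed
  show s: "summable (\<lambda>n. norm (V n t s w))"
  proof (rule bounded_imp_summable)
    show "sum (\<lambda>n. norm (V n t s w)) {..n} \<le> M * norm w" for n by (rule bound)
  qed simp
  show "(\<Sum>n. norm (V n t s w)) \<le> M * norm w"
  proof (rule suminf_le_const[OF s])
    fix n
    have "(\<Sum>k<n. norm (V k t s w)) \<le> (\<Sum>k\<le>n. norm (V k t s w))" by (intro sum_mono2) auto
    then show "(\<Sum>k<n. norm (V k t s w)) \<le> M * norm w" using bound[of n] by simp
  qed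
qed

lemma V_sums: "0 \<le> s \<Longrightarrow> s \<le> t \<Longrightarrow> (\<lambda>n. V n t s w) sums Vs t s w"
  unfolding perturbed_family_def by (rule summable_sums[OF summable_norm_cancel[OF V_summable_norm(1)]])

lemma norm_Vs_cone: 
  assumes "0 \<le> s" "s \<le> t" "0 \<le> u" shows "norm (Vs t s u) \<le> norm u"
proof (rule LIMSEQ_le_const2)
  show "(\<lambda>n. norm (\<Sum>k<n. V k t s u)) \<longlonglongrightarrow> norm (Vs t s u)"
    using V_sums[OF assms(1,2), of u] unfolding sums_def by (rule tendsto_norm)
  have "norm (\<Sum>k<n. V k t s u) \<le> norm u" for n
  proof -
    have "norm (\<Sum>k<n. V k t s u) \<le> (\<Sum>k<n. norm (V k t s u))" by (rule norm_sum)
    also have "\<dots> \<le> (\<Sum>k\<le>n. norm (V k t s u))" by (intro sum_mono2) auto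
    also have "\<dots> \<le> norm u" by (intro Vn_sum_le assms)
    finally show ?thesis .
  qed
  then show "\<exists>N. \<forall>n\<ge>N. norm (\<Sum>k<n. V k t s u) \<le> norm u" by blast
qed

lemma Vs_nonneg: 
  assumes "0 \<le> s" "s \<le> t" "0 \<le> u" shows "0 \<le> Vs t s u"
  by (rule closed_cone_limit[OF cone_closed _ V_sums[OF assms(1,2), of u, unfolded sums_def]])
    (auto intro!: sum_nonneg Vn_nonneg assms)

lemma Vs_lin: assumes "0 \<le> s" "s \<le> t" shows "linear (Vs t s)"
proof (rule linearI)
  fix u v :: 'e and c :: real
  have "(\<lambda>n. V n t s (u + v)) sums (Vs t s u + Vs t s v)"
    unfolding linear_add[OF Vn_lin[OF assms]] by (intro sums_add V_sums assms)
  then show "Vs t s (u + v) = Vs t s u + Vs t s v" by (rule sums_unique2[OF V_sums[OF assms]])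
  have "(\<lambda>n. V n t s (c *\<^sub>R u)) sums (c *\<^sub>R Vs t s u)"
    unfolding linear_scale[OF Vn_lin[OF assms]] by (intro sums_scaleR_right V_sums assms)
  then show "Vs t s (c *\<^sub>R u) = c *\<^sub>R Vs t s u" by (rule sums_unique2[OF V_sums[OF assms]])
qed

lemma Vs_bound: "0 \<le> s \<Longrightarrow> s \<le> t \<Longrightarrow> norm (Vs t s w) \<le> M * norm w"
  by (rule bound_from_cone) (auto intro: Vs_lin norm_Vs_cone)

lemma Vs_bl: "0 \<le> s \<Longrightarrow> s \<le> t \<Longrightarrow> bounded_linear (Vs t s)"
  by (rule bounded_linear_intro[where K=M])
    (use Vs_lin Vs_bound in \<open>auto simp: linear_add linear_scale mult.commute\<close>)

text \<open>
  One multiple of the bound is the distance of \<open>U u\<close> to \<open>u\<close>, the other one the sum of all later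
  terms, by \<open>V_tail_le\<close>.
\<close>

lemma Vs_near_id:
  assumes s: "0 \<le> s" "s \<le> t" and u: "0 \<le> u"
  shows "norm (Vs t s u - u) \<le> 2 * norm (U t s u - u)"
proof (rule LIMSEQ_le_const2)
  show "(\<lambda>n. norm ((\<Sum>k<n. V k t s u) - u)) \<longlonglongrightarrow> norm (Vs t s u - u)"
    using V_sums[OF s, of u] unfolding sums_def by (intro tendsto_norm tendsto_diff tendsto_const)
  have "norm ((\<Sum>k<Suc n. V k t s u) - u) \<le> 2 * norm (U t s u - u)" for n
  proof -
    have "{..<Suc n} = insert 0 {1..n}" by auto
    then have eq: "(\<Sum>k<Suc n. V k t s u) - u = (U t s u - u) + (\<Sum>k\<in>{1..n}. V k t s u)" by simp
    have "norm ((\<Sum>k<Suc n. V k t s u) - u) \<le> norm (U t s u - u) + norm (\<Sum>k\<in>{1..n}. V k t s u)"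
      unfolding eq by (rule norm_triangle_ineq)
    moreover have "norm (\<Sum>k\<in>{1..n}. V k t s u) \<le> (\<Sum>k\<in>{1..n}. norm (V k t s u))" by (rule norm_sum)
    ultimately show ?thesis using Vn_tail_le[OF s u, of n] by linarith
  qed
  then show "\<exists>N. \<forall>n\<ge>N. norm ((\<Sum>k<n. V k t s u) - u) \<le> 2 * norm (U t s u - u)"
    by (intro exI[of _ 1] allI impI) (metis Suc_pred' less_eq_Suc_le One_nat_def)
qed

lemma Vs_id: "0 \<le> t \<Longrightarrow> Vs t t w = w"
proof -
  assume t: "0 \<le> t"
  have cone: "Vs t t u = u" if "0 \<le> u" for u using Vs_near_id[OF t order_refl that] U_id[OF t, of u] by simp
  obtain u v where uv: "0 \<le> u" "0 \<le> v" "w = u - v" "norm u + norm v \<le> M * norm w"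
    by (rule decompose[of w], rule that)
  then show ?thesis using cone by (simp add: linear_diff[OF Vs_lin[OF t order_refl]])
qed

lemma norm_mono: "0 \<le> x \<Longrightarrow> x \<le> y \<Longrightarrow> norm (x::'e) \<le> norm y"
  using norm_additive[rule_format, of x "y - x"] by simp

text \<open>
  The cocycle identity says that \<open>V n t s\<close> is the Cauchy product of the two series. On the cone all
  summands are positive, so the triangular partial sums \<open>C N\<close> and the square ones \<open>P N\<close> satisfy
  \<open>C N \<le> P N \<le> C (2 N)\<close>, and by monotonicity of the norm they have the same limit.
\<close>

lemma Vs_comp_cone:
  assumes s: "0 \<le> s" "s \<le> r" "r \<le> t" and w: "0 \<le> w"
  shows "Vs t r (Vs r s w) = Vs t s w"
proof -
  have t: "0 \<le> r" "s \<le> t" using s by auto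
  define a where "a i j = V i t r (V j r s w)" for i j
  have a0: "0 \<le> a i j" for i j unfolding a_def using s t w by (intro Vn_nonneg)
  define C where "C N = (\<Sum>n<N. V n t s w)" for N
  define P where "P N = (\<Sum>i<N. V i t r (\<Sum>j<N. V j r s w))" for N
  have C: "C N = (\<Sum>(i, j)\<in>{(i, j). i + j < N}. a i j)" for N
    unfolding C_def a_def sum.triangle_reindex by (intro sum.cong refl Vn_cocycle s)
  have P: "P N = (\<Sum>(i, j)\<in>{..<N} \<times> {..<N}. a i j)" for N
    unfolding P_def a_def by (simp add: sum.cartesian_product[symmetric] linear_sum[OF Vn_lin[OF t(1) s(3)]])
  have fin: "finite {(i, j). i + j < (N::nat)}" for N
    by (rule finite_subset[of _ "{..<N} \<times> {..<N}"]) auto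
  have CP: "C N \<le> P N" for N
    unfolding C P by (rule sum_mono2) (auto simp: a0)
  have PC: "P N \<le> C (2 * N)" for N
    unfolding C P by (rule sum_mono2[OF fin]) (auto simp: a0)
  have Clim: "C \<longlonglongrightarrow> Vs t s w" unfolding C_def using V_sums[OF s(1) t(2), of w] by (simp add: sums_def)
  have C2lim: "(\<lambda>N. C (2 * N)) \<longlonglongrightarrow> Vs t s w"
    using LIMSEQ_subseq_LIMSEQ[OF Clim, of "\<lambda>N. 2 * N"] by (simp add: strict_mono_def o_def)
  have "(\<lambda>N. P N - C N) \<longlonglongrightarrow> 0"
  proof (rule Lim_null_comparison)
    show "\<forall>\<^sub>F N in sequentially. norm (P N - C N) \<le> norm (C (2 * N) - C N)"
      using CP PC by (intro always_eventually allI norm_mono) auto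
    show "(\<lambda>N. norm (C (2 * N) - C N)) \<longlonglongrightarrow> 0"
      using tendsto_norm[OF tendsto_diff[OF C2lim Clim]] by simp
  qed
  from tendsto_add[OF this Clim] have Plim: "P \<longlonglongrightarrow> Vs t s w" by simp
  \<comment> \<open>the square partial sums also converge to the composition, with error \<open>M \<parallel>b N - x\<parallel>\<close>\<close>
  define x where "x = Vs r s w"
  define b where "b N = (\<Sum>j<N. V j r s w)" for N
  have b: "b \<longlonglongrightarrow> x" unfolding b_def x_def using V_sums[OF s(1,2), of w] by (simp add: sums_def)
  have PP: "P N = (\<Sum>i<N. V i t r x) + (\<Sum>i<N. V i t r (b N - x))" for N
    unfolding P_def b_def[symmetric] by (simp add: linear_diff[OF Vn_lin[OF t(1) s(3)]] sum_subtractf)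
  have "(\<lambda>N. \<Sum>i<N. V i t r (b N - x)) \<longlonglongrightarrow> 0"
  proof (rule Lim_null_comparison)
    show "\<forall>\<^sub>F N in sequentially. norm (\<Sum>i<N. V i t r (b N - x)) \<le> M * norm (b N - x)"
    proof (intro always_eventually allI)
      fix N
      have "norm (\<Sum>i<N. V i t r (b N - x)) \<le> (\<Sum>i<N. norm (V i t r (b N - x)))" by (rule norm_sum)
      also have "\<dots> \<le> (\<Sum>i. norm (V i t r (b N - x)))"
        by (rule sum_le_suminf[OF V_summable_norm(1)[OF t(1) s(3)]]) auto
      also have "\<dots> \<le> M * norm (b N - x)" by (rule V_summable_norm(2)[OF t(1) s(3)])
      finally show "norm (\<Sum>i<N. V i t r (b N - x)) \<le> M * norm (b N - x)" .
    qed
    have "(\<lambda>N. M * norm (b N - x)) \<longlonglongrightarrow> M * norm (x - x)" by (intro tendsto_intros b)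
    then show "(\<lambda>N. M * norm (b N - x)) \<longlonglongrightarrow> 0" by simp
  qed
  from tendsto_add[OF V_sums[OF t(1) s(3), of x, unfolded sums_def] this]
  have "P \<longlonglongrightarrow> Vs t r x" unfolding PP by simp
  from LIMSEQ_unique[OF this Plim] show ?thesis by (simp only: x_def)
qed

lemma Vs_comp:
  assumes s: "0 \<le> s" "s \<le> r" "r \<le> t"
  shows "Vs t r (Vs r s w) = Vs t s w"
proof -
  have t: "0 \<le> r" "s \<le> t" using s by auto
  obtain u v where uv: "0 \<le> u" "0 \<le> v" "w = u - v" "norm u + norm v \<le> M * norm w"
    by (rule decompose[of w], rule that)
  show ?thesis
    unfolding uv(3) linear_diff[OF Vs_lin[OF s(1,2)]] linear_diff[OF Vs_lin[OF t(1) s(3)]] linear_diff[OF Vs_lin[OF s(1) t(2)]]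
    by (simp add: Vs_comp_cone s uv)
qed

text \<open>
  The properties shared by \<open>U\<close>, all \<open>V n\<close> and the perturbed family that make the evolution semigroup and
  the Laplace integral well defined.
\<close>

definition regular_kernel :: "(real \<Rightarrow> real \<Rightarrow> 'e \<Rightarrow> 'e) \<Rightarrow> bool" where
  "regular_kernel W \<longleftrightarrow>
    (\<forall>s t. 0 \<le> s \<and> s \<le> t \<longrightarrow> bounded_linear (W t s) \<and> (\<forall>w. norm (W t s w) \<le> M * norm w)) \<and>
    (\<forall>w. smeas (\<lambda>z. if z \<in> triangle then W (fst z) (snd z) w else 0)) \<and>
    (\<forall>t\<ge>0. \<forall>w. smeas (\<lambda>s. if t \<le> s then W s (s - t) w else 0))"

lemma regular_kernel_V: "regular_kernel (V n)"
  unfolding regular_kernel_def by (auto intro: Vn_bl Vn_bound Vn_smeas_triangle Vn_smeas_diagonal)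

lemma regular_kernel_Vs: "regular_kernel Vs"
  unfolding regular_kernel_def
proof (intro conjI allI impI)
  fix w :: 'e
  show "smeas (\<lambda>z. if z \<in> triangle then Vs (fst z) (snd z) w else 0)"
  proof (rule strongly_measurable_lim)
    show "smeas (\<lambda>z. \<Sum>k<n. if z \<in> triangle then V k (fst z) (snd z) w else 0)" for n
      by (intro strongly_measurable_sum Vn_smeas_triangle)
    show "AE z in lebesgue. (\<lambda>n. \<Sum>k<n. if z \<in> triangle then V k (fst z) (snd z) w else 0)
       \<longlonglongrightarrow> (if z \<in> triangle then Vs (fst z) (snd z) w else 0)"
      using V_sums by (intro AE_I2) (auto simp: triangle_def sums_def)
  qed
  fix t :: real assume t: "0 \<le> t"
  show "smeas (\<lambda>s. if t \<le> s then Vs s (s - t) w else 0)"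
  proof (rule strongly_measurable_lim)
    show "smeas (\<lambda>s. \<Sum>k<n. if t \<le> s then V k s (s - t) w else 0)" for n
      by (intro strongly_measurable_sum Vn_smeas_diagonal t)
    show "AE s in lebesgue. (\<lambda>n. \<Sum>k<n. if t \<le> s then V k s (s - t) w else 0)
       \<longlonglongrightarrow> (if t \<le> s then Vs s (s - t) w else 0)"
      using V_sums t by (intro AE_I2) (auto simp: sums_def)
  qed
qed (auto intro: Vs_bl Vs_bound)

text \<open>
  The last inequality replaces continuity: strong continuity of the evolution semigroup of \<open>W\<close>
  is obtained by comparison with \<open>U\<close>.
\<close>

definition positive_evolution :: "(real \<Rightarrow> real \<Rightarrow> 'e \<Rightarrow> 'e) \<Rightarrow> bool" where
  "positive_evolution W \<longleftrightarrow> regular_kernel W \<and>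
    (\<forall>t w. 0 \<le> t \<longrightarrow> W t t w = w) \<and>
    (\<forall>s r t w. 0 \<le> s \<and> s \<le> r \<and> r \<le> t \<longrightarrow> W t r (W r s w) = W t s w) \<and>
    (\<forall>s t u. 0 \<le> s \<and> s \<le> t \<and> 0 \<le> u \<longrightarrow>
      0 \<le> W t s u \<and> norm (W t s u) \<le> norm u \<and> norm (W t s u - u) \<le> 2 * norm (U t s u - u))"

lemma positive_evolution_U: "positive_evolution U"
  unfolding positive_evolution_def
  using regular_kernel_V[of 0] U_id U_comp U_pos U_contr by auto

lemma positive_evolution_Vs: "positive_evolution Vs"
  unfolding positive_evolution_def
  by (auto intro: regular_kernel_Vs Vs_id Vs_comp Vs_nonneg norm_Vs_cone Vs_near_id)

end

section \<open>Evolution semigroups\<close>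

text \<open>
  Lebesgue null sets are enclosed in Borel null sets, whose cylinders are null sets in the product.
\<close>

lemma AE_lebesgue_snd:
  fixes P :: "real \<Rightarrow> bool"
  assumes "AE y in lebesgue. P y"
  shows "AE z::real \<times> real in lebesgue. P (snd z)"
proof -
  have "AE y in lborel. P y" using assms by (simp only: AE_completion_iff)
  then obtain N where N: "{y \<in> space lborel. \<not> P y} \<subseteq> N" "emeasure lborel N = 0" "N \<in> sets lborel"
    by (rule AE_E)
  have "AE z in lborel \<Otimes>\<^sub>M lborel. snd z \<notin> N"
  proof (rule lborel_pair.AE_pair_measure)
    have [measurable]: "N \<in> sets borel" using N(3) by simp
    show "{z \<in> space (lborel \<Otimes>\<^sub>M lborel). snd z \<notin> N} \<in> sets (lborel \<Otimes>\<^sub>M (lborel::real measure))" by measurable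
    have "AE y in lborel. y \<notin> N" using N by (intro AE_not_in) (auto simp: null_sets_def)
    then show "AE x in lborel. AE y in lborel. snd (x, y) \<notin> N" by simp
  qed
  then have "AE z in lborel. snd (z::real\<times>real) \<notin> N" by (simp only: lborel_prod)
  then have "AE z::real\<times>real in lborel. P (snd z)" by eventually_elim (use N(1) in auto)
  then show ?thesis by (simp only: AE_completion_iff)
qed

lemma smeas_snd:
  fixes f :: "real \<Rightarrow> 'b::real_normed_vector"
  assumes f: "smeas f"
  shows "smeas (\<lambda>z::real \<times> real. f (snd z))"
proof -
  have "strongly_measurable lborel f" using f by (simp add: strongly_measurable_lebesgue_iff)
  then obtain s where s: "\<And>i::nat. simple_function lborel (s i)" "AE z in lborel. (\<lambda>i. s i z) \<longlonglongrightarrow> f z"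
    unfolding strongly_measurable_def by blast
  have "simple_function lborel (\<lambda>z::real\<times>real. s i (snd z))" for i
  proof -
    have 1: "s i \<in> measurable borel (count_space UNIV)" "finite (range (s i))"
      using s(1)[of i] by (auto simp: simple_function_eq_measurable)
    have "(\<lambda>z::real\<times>real. s i (snd z)) \<in> measurable borel (count_space UNIV)"
      by (intro measurable_compose[OF _ 1(1)] borel_measurable_continuous_onI continuous_intros)
    moreover have "finite (range (\<lambda>z::real\<times>real. s i (snd z)))"
      by (rule finite_subset[OF _ 1(2)], blast)
    ultimately show ?thesis by (simp add: simple_function_eq_measurable)
  qed
  then have 1: "simple_function lebesgue (\<lambda>z::real\<times>real. s i (snd z))" for i by (rule simple_function_lebesgue)
  have 2: "AE z::real\<times>real in lebesgue. (\<lambda>i. s i (snd z)) \<longlonglongrightarrow> f (snd z)"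
    by (rule AE_lebesgue_snd) (use s(2) in \<open>simp only: AE_completion_iff\<close>)
  show ?thesis by (rule strongly_measurableI[OF 1 2])
qed

lemma smeas_fst:
  fixes f :: "real \<Rightarrow> 'b::real_normed_vector"
  assumes f: "smeas f"
  shows "smeas (\<lambda>z::real \<times> real. f (fst z))"
  using preserves_smeas[OF preserves_swap smeas_snd[OF f]] by simp

lemma lebesgue_tonelli_swap:
  fixes q :: "real \<times> real \<Rightarrow> ennreal"
  assumes q: "q \<in> borel_measurable lebesgue"
  shows "(\<integral>\<^sup>+z. q z \<partial>lebesgue) = (\<integral>\<^sup>+y. \<integral>\<^sup>+x. q (x, y) \<partial>lebesgue \<partial>lebesgue)"
  using preserves_nn_integral[OF preserves_swap q] lebesgue_tonelli(1)[of "\<lambda>z. q (snd z, fst z)"]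
  by simp

lemma tendsto_ennreal_norm_zero:
  assumes "\<And>i. ennreal (norm (a i - b)) \<le> e i" "e \<longlonglongrightarrow> 0"
  shows "a \<longlonglongrightarrow> (b::'b::real_normed_vector)"
  using tendsto_add[OF tendsto_of_ennreal_dist[OF assms(1) assms(2)] tendsto_const[of b]] by simp

context perturbed_evolution
begin

lemma regular_bl: "regular_kernel W \<Longrightarrow> 0 \<le> s \<Longrightarrow> s \<le> t \<Longrightarrow> bounded_linear (W t s)"
  and regular_bound: "regular_kernel W \<Longrightarrow> 0 \<le> s \<Longrightarrow> s \<le> t \<Longrightarrow> norm (W t s w) \<le> M * norm w"
  and regular_triangle: "regular_kernel W \<Longrightarrow> smeas (\<lambda>z. if z \<in> triangle then W (fst z) (snd z) w else 0)"
  and regular_diagonal: "regular_kernel W \<Longrightarrow> 0 \<le> a \<Longrightarrow> smeas (\<lambda>s. if a \<le> s then W s (s - a) w else 0)"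
  unfolding regular_kernel_def by blast+

lemma regular_lin: "regular_kernel W \<Longrightarrow> 0 \<le> s \<Longrightarrow> s \<le> t \<Longrightarrow> linear (W t s)"
  by (rule bounded_linear.linear[OF regular_bl])

text \<open>
  The formula of the evolution semigroup, for representatives that are extended by zero.
\<close>

definition shifted :: "(real \<Rightarrow> real \<Rightarrow> 'e \<Rightarrow> 'e) \<Rightarrow> real \<Rightarrow> 'e L1 \<Rightarrow> real \<Rightarrow> 'e" where
  "shifted W t f s = (if t \<le> s then W s (s - t) (rp f (s - t)) else 0)"

abbreviation TW :: "(real \<Rightarrow> real \<Rightarrow> 'e \<Rightarrow> 'e) \<Rightarrow> real \<Rightarrow> 'e L1 \<Rightarrow> 'e L1" where
  "TW \<equiv> evolution_semigroup"

lemma TW_shifted: "TW W t f = abs_L1 (shifted W t f)"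
  unfolding evolution_semigroup_def
  by (rule arg_cong[where f=abs_L1]) (auto simp: shifted_def rp_def)

lemma shifted_smeas:
  assumes W: "regular_kernel W" and t: "0 \<le> t"
  shows "smeas (shifted W t f)"
proof -
  have "smeas (\<lambda>s. if s \<in> {t..} then W s (s - t) (rp f (s - t)) else 0)"
    by (rule strongly_measurable_apply[OF Ici_lebesgue _ _ preserves_smeas[OF preserves_translation smeas_rp]])
      (use regular_bl[OF W] regular_diagonal[OF W t] t in auto)
  then show ?thesis by (rule strongly_measurable_AE_cong) (auto simp: shifted_def)
qed

lemma rp_translate_nn_integral: "(\<integral>\<^sup>+s. ennreal (norm (rp f (s - t))) \<partial>lebesgue) = ennreal (norm f)"
  unfolding norm_rp
  by (rule preserves_nn_integral(1)[OF preserves_translation, of "\<lambda>s. ennreal (norm (rp f s))"])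
    (intro measurable_compose[OF norm_measurable] smeas_rp, auto)

lemma rp_translate_measurable: "(\<lambda>s. ennreal (norm (rp f (s - t)))) \<in> borel_measurable lebesgue"
  by (intro measurable_compose[OF norm_measurable] preserves_smeas[OF preserves_translation] smeas_rp) auto

lemma shifted_norm_le:
  assumes "regular_kernel W" "0 \<le> t"
  shows "ennreal (norm (shifted W t f s)) \<le> ennreal M * ennreal (norm (rp f (s - t)))"
  using regular_bound[OF assms(1), of "s - t" s "rp f (s - t)"] assms M_ge_1
  by (auto simp: shifted_def simp flip: ennreal_mult intro!: ennreal_leI)

lemma M_rp_nn_integral: "(\<integral>\<^sup>+s. ennreal M * ennreal (norm (rp f (s - t))) \<partial>lebesgue) = ennreal (M * norm f)"
  using M_ge_1 by (simp add: nn_integral_cmult rp_translate_measurable rp_translate_nn_integral ennreal_mult)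

lemma shifted_integrable:
  assumes W: "regular_kernel W" and t: "0 \<le> t"
  shows "bintegrable (shifted W t f)"
proof (rule bintegrable_bound[OF shifted_smeas[OF assms]])
  show "AE s in lebesgue. ennreal (norm (shifted W t f s)) \<le> ennreal M * ennreal (norm (rp f (s - t)))"
    by (intro AE_I2 shifted_norm_le assms)
qed (simp add: M_rp_nn_integral)

lemma shifted_neg: "0 \<le> t \<Longrightarrow> s < 0 \<Longrightarrow> shifted W t f s = 0"
  by (simp add: shifted_def)

lemma rp_TW: "regular_kernel W \<Longrightarrow> 0 \<le> t \<Longrightarrow> AE s in lebesgue. rp (TW W t f) s = shifted W t f s"
  unfolding TW_shifted by (rule rp_abs'[OF shifted_integrable]) (auto simp: shifted_neg)

lemma norm_TW_eq:
  assumes "regular_kernel W" "0 \<le> t"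
  shows "ennreal (norm (TW W t f)) = (\<integral>\<^sup>+s. ennreal (norm (shifted W t f s)) \<partial>lebesgue)"
  unfolding norm_rp by (rule nn_integral_cong_AE, rule eventually_mono[OF rp_TW[OF assms, of f]]) simp

lemma norm_TW_le:
  assumes "regular_kernel W" "0 \<le> t"
  shows "norm (TW W t f) \<le> M * norm f"
proof -
  have "ennreal (norm (TW W t f)) \<le> (\<integral>\<^sup>+s. ennreal M * ennreal (norm (rp f (s - t))) \<partial>lebesgue)"
    unfolding norm_TW_eq[OF assms] by (intro nn_integral_mono shifted_norm_le assms)
  also have "\<dots> = ennreal (M * norm f)" by (rule M_rp_nn_integral)
  finally show ?thesis by (rule ennreal_le_iff[THEN iffD1, rotated]) (use M_ge_1 in simp)
qed

lemma AE_translate: "AE s in lebesgue. P s \<Longrightarrow> AE s in lebesgue. P (s - (a::real))"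
  by (rule preserves_AE[OF preserves_translation])

lemma TW_linear:
  assumes W: "regular_kernel W" and t: "0 \<le> t"
  shows "linear (TW W t)"
proof (rule linearI)
  fix f g :: "'e L1" and c :: real
  show "TW W t (f + g) = TW W t f + TW W t g"
  proof (rule L1_eqI)
    show "AE s in lebesgue. rp (TW W t (f + g)) s = rp (TW W t f + TW W t g) s"
      using rp_TW[OF assms, of "f + g"] rp_TW[OF assms, of f] rp_TW[OF assms, of g]
        rp_add[of "TW W t f" "TW W t g"] AE_translate[OF rp_add[of f g], of t]
      by eventually_elim (use t in \<open>auto simp: shifted_def linear_add[OF regular_lin[OF W]]\<close>)
  qed
  show "TW W t (c *\<^sub>R f) = c *\<^sub>R TW W t f"
  proof (rule L1_eqI)
    show "AE s in lebesgue. rp (TW W t (c *\<^sub>R f)) s = rp (c *\<^sub>R TW W t f) s"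
      using rp_TW[OF assms, of "c *\<^sub>R f"] rp_TW[OF assms, of f]
        rp_scaleR[of c "TW W t f"] AE_translate[OF rp_scaleR[of c f], of t]
      by eventually_elim (use t in \<open>auto simp: shifted_def linear_scale[OF regular_lin[OF W]]\<close>)
  qed
qed

lemma TW_bl:
  assumes W: "regular_kernel W" and t: "0 \<le> t"
  shows "bounded_linear (TW W t)"
  by (rule bounded_linear_intro[where K=M])
    (use norm_TW_le[OF assms] TW_linear[OF assms] in \<open>auto simp: linear_add linear_scale mult.commute\<close>)

context
  fixes W assumes W: "positive_evolution W"
begin

lemma W_reg: "regular_kernel W"
  and W_id: "0 \<le> t \<Longrightarrow> W t t w = w"
  and W_comp: "0 \<le> s \<Longrightarrow> s \<le> r \<Longrightarrow> r \<le> t \<Longrightarrow> W t r (W r s w) = W t s w"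
  and W_nonneg: "0 \<le> s \<Longrightarrow> s \<le> t \<Longrightarrow> 0 \<le> u \<Longrightarrow> 0 \<le> W t s u"
  and W_contr: "0 \<le> s \<Longrightarrow> s \<le> t \<Longrightarrow> 0 \<le> u \<Longrightarrow> norm (W t s u) \<le> norm u"
  and W_near_id: "0 \<le> s \<Longrightarrow> s \<le> t \<Longrightarrow> 0 \<le> u \<Longrightarrow> norm (W t s u - u) \<le> 2 * norm (U t s u - u)"
  using W unfolding positive_evolution_def by blast+

lemmas W_bl = regular_bl[OF W_reg] and W_lin = regular_lin[OF W_reg] and W_bound = regular_bound[OF W_reg]

lemma W_tendsto_id:
  assumes Y: "(Y \<longlongrightarrow> s) F" and s: "0 < s" and ev: "\<forall>\<^sub>F i in F. Y i \<le> s"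
  shows "((\<lambda>i. W s (Y i) w) \<longlongrightarrow> w) F"
proof -
  have ev': "\<forall>\<^sub>F i in F. 0 \<le> Y i \<and> Y i \<le> s"
    using ev order_tendstoD(1)[OF Y s] by eventually_elim auto
  have cone: "((\<lambda>i. W s (Y i) u - u) \<longlongrightarrow> 0) F" if u: "0 \<le> u" for u
  proof (rule Lim_null_comparison)
    show "\<forall>\<^sub>F i in F. norm (W s (Y i) u - u) \<le> 2 * norm (U s (Y i) u - u)"
      using ev' by eventually_elim (auto intro: W_near_id u)
    show "((\<lambda>i. 2 * norm (U s (Y i) u - u)) \<longlongrightarrow> 0) F"
      by (rule tendsto_mult_right_zero[OF U_near_id[OF tendsto_const Y _ ev']]) (use s in simp)
  qed
  obtain u v where uv: "0 \<le> u" "0 \<le> v" "w = u - v" "norm u + norm v \<le> M * norm w"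
    by (rule decompose[of w], rule that)
  have "((\<lambda>i. (W s (Y i) u - u) - (W s (Y i) v - v) + w) \<longlongrightarrow> 0 - 0 + w) F"
    by (intro tendsto_add tendsto_diff tendsto_const cone uv)
  then have l: "((\<lambda>i. (W s (Y i) u - u) - (W s (Y i) v - v) + w) \<longlongrightarrow> w) F" by simp
  show ?thesis
  proof (rule Lim_transform_eventually[OF l])
    show "\<forall>\<^sub>F i in F. (W s (Y i) u - u) - (W s (Y i) v - v) + w = W s (Y i) w"
      using ev' by eventually_elim (simp add: uv(3) linear_diff[OF W_lin])
  qed
qed

lemma TW_0: "TW W 0 f = f"
proof (rule L1_eqI)
  show "AE s in lebesgue. rp (TW W 0 f) s = rp f s"
    using rp_TW[OF W_reg order_refl, of f]
    by eventually_elim (auto simp: shifted_def W_id rp_def)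
qed

lemma TW_add:
  assumes "0 \<le> a" "0 \<le> b"
  shows "TW W (a + b) f = TW W a (TW W b f)"
proof (rule L1_eqI)
  have ab: "0 \<le> a + b" using assms by simp
  show "AE s in lebesgue. rp (TW W (a + b) f) s = rp (TW W a (TW W b f)) s"
    using rp_TW[OF W_reg ab, of f] rp_TW[OF W_reg assms(1), of "TW W b f"]
      AE_translate[OF rp_TW[OF W_reg assms(2), of f], of a]
  proof eventually_elim
    case (elim s)
    consider "s < a" | "a \<le> s" "s < a + b" | "a + b \<le> s" by linarith
    then show ?case
    proof cases
      case 2
      then show ?thesis using elim assms by (auto simp: shifted_def linear_0[OF W_lin])
    next
      case 3
      have e: "s - a - b = s - (a + b)" by simp
      have "W s (s - a) (W (s - a) (s - (a + b)) (rp f (s - (a + b)))) = W s (s - (a + b)) (rp f (s - (a + b)))"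
        using 3 assms by (intro W_comp) auto
      then show ?thesis using elim 3 assms by (simp add: shifted_def e)
    qed (use elim assms in \<open>simp add: shifted_def\<close>)
  qed
qed

lemma TW_nonneg:
  assumes t: "0 \<le> t" and f: "0 \<le> f" shows "0 \<le> TW W t f"
proof -
  have "AE s in lebesgue. 0 \<le> rp f s" using f by (simp add: L1_nonneg_iff)
  from AE_translate[OF this, of t] rp_TW[OF W_reg t, of f]
  have "AE s in lebesgue. 0 \<le> rp (TW W t f) s"
    by eventually_elim (use t in \<open>auto simp: shifted_def intro!: W_nonneg\<close>)
  then show ?thesis by (simp add: L1_nonneg_iff)
qed

lemma TW_contr:
  assumes t: "0 \<le> t" and f: "0 \<le> f" shows "norm (TW W t f) \<le> norm f"
proof -
  have "AE s in lebesgue. 0 \<le> rp f s" using f by (simp add: L1_nonneg_iff)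
  note pos = AE_translate[OF this, of t]
  have "ennreal (norm (TW W t f)) \<le> (\<integral>\<^sup>+s. ennreal (norm (rp f (s - t))) \<partial>lebesgue)"
    unfolding norm_TW_eq[OF W_reg t]
  proof (rule nn_integral_mono_AE)
    show "AE s in lebesgue. ennreal (norm (shifted W t f s)) \<le> ennreal (norm (rp f (s - t)))"
      using pos by eventually_elim (use t in \<open>auto simp: shifted_def intro!: ennreal_leI W_contr\<close>)
  qed
  then show ?thesis by (simp add: rp_translate_nn_integral)
qed

end

text \<open>
  For uniformly bounded operators the functions with the property form a closed subspace, so it
  suffices to check a dense set, and to do so along sequences, where dominated convergence is
  available.
\<close>

lemma operators_tendsto_id:
  fixes L :: "real \<Rightarrow> 'e L1 \<Rightarrow> 'e L1"
  assumes lin: "\<And>h. 0 < h \<Longrightarrow> linear (L h)" and bd: "\<And>h f. 0 < h \<Longrightarrow> norm (L h f) \<le> C * norm f"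
    and dense: "\<And>c (x::'e) H. continuous_on UNIV c \<Longrightarrow> (\<exists>b. \<forall>r. \<bar>r\<bar> > b \<longrightarrow> c r = 0) \<Longrightarrow>
      (\<forall>r. 0 \<le> c r \<and> c r \<le> (1::real)) \<Longrightarrow> (\<And>i::nat. 0 < H i) \<Longrightarrow> H \<longlonglongrightarrow> 0 \<Longrightarrow>
      (\<lambda>i. L (H i) (abs_L1 (\<lambda>r. c r *\<^sub>R x))) \<longlonglongrightarrow> abs_L1 (\<lambda>r. c r *\<^sub>R x)"
  shows "((\<lambda>h. L h f) \<longlongrightarrow> f) (at_right 0)"
proof -
  define \<A> where "\<A> = {f. ((\<lambda>h. L h f) \<longlongrightarrow> f) (at_right 0)}"
  have pos: "\<forall>\<^sub>F h in at_right (0::real). 0 < h" by (simp add: eventually_at_right_less)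
  have "f \<in> \<A>"
  proof (rule L1_dense_induct)
    show "subspace \<A>"
    proof (rule subspaceI)
      show "0 \<in> \<A>" unfolding \<A>_def mem_Collect_eq
        by (rule Lim_transform_eventually[OF tendsto_const])
          (use pos in \<open>eventually_elim, simp add: linear_0[OF lin]\<close>)
      fix f g and c :: real assume fg: "f \<in> \<A>"
      { assume "g \<in> \<A>"
        with fg have "((\<lambda>h. L h f + L h g) \<longlongrightarrow> f + g) (at_right 0)"
          unfolding \<A>_def by (intro tendsto_add) auto
        then show "f + g \<in> \<A>" unfolding \<A>_def mem_Collect_eq
          by (rule Lim_transform_eventually) (use pos in \<open>eventually_elim, simp add: linear_add[OF lin]\<close>) }
      from fg have "((\<lambda>h. c *\<^sub>R L h f) \<longlongrightarrow> c *\<^sub>R f) (at_right 0)"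
        unfolding \<A>_def by (intro tendsto_intros) auto
      then show "c *\<^sub>R f \<in> \<A>" unfolding \<A>_def mem_Collect_eq
        by (rule Lim_transform_eventually) (use pos in \<open>eventually_elim, simp add: linear_scale[OF lin]\<close>)
    qed
    show "closed \<A>"
      unfolding closed_sequential_limits
    proof (intro allI impI, elim conjE)
      fix X f assume X: "\<forall>n. X n \<in> \<A>" and lim: "X \<longlonglongrightarrow> f"
      define C' where "C' = \<bar>C\<bar> + 1"
      have C': "C' \<ge> 1" by (simp add: C'_def)
      have bd': "norm (L h g) \<le> C' * norm g" if "0 < h" for h g
      proof -
        have "C * norm g \<le> C' * norm g" by (intro mult_right_mono) (auto simp: C'_def)
        then show ?thesis using bd[OF that, of g] by simp
      qed
      have "((\<lambda>h. L h f) \<longlongrightarrow> f) (at_right 0)"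
      proof (rule tendstoI)
        fix e :: real assume e: "e > 0"
        have "\<forall>\<^sub>F n in sequentially. dist (X n) f < e / (3 * C')"
          using lim e C' by (intro tendstoD) auto
        then obtain n where "dist (X n) f < e / (3 * C')" by (auto simp: eventually_sequentially)
        then have n: "C' * norm (f - X n) < e / 3" using C' by (simp add: dist_norm norm_minus_commute field_simps)
        have n': "norm (f - X n) < e / 3"
          using n mult_right_mono[OF C', of "norm (f - X n)"] by simp
        have "\<forall>\<^sub>F h in at_right 0. dist (L h (X n)) (X n) < e / 3"
          using X e unfolding \<A>_def by (intro tendstoD) auto
        then show "\<forall>\<^sub>F h in at_right 0. dist (L h f) f < e"
          using pos
        proof eventually_elim
          case (elim h)
          have eq: "L h f - f = L h (f - X n) + (L h (X n) - X n) - (f - X n)"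
            by (simp add: linear_diff[OF lin[OF elim(2)]])
          have "norm (L h f - f) \<le> norm (L h (f - X n)) + norm (L h (X n) - X n) + norm (f - X n)"
            unfolding eq
            using norm_triangle_ineq4[of "L h (f - X n) + (L h (X n) - X n)" "f - X n"]
              norm_triangle_ineq[of "L h (f - X n)" "L h (X n) - X n"] by linarith
          moreover have "norm (L h (f - X n)) \<le> C' * norm (f - X n)" by (rule bd'[OF elim(2)])
          ultimately show ?case using n n' elim(1) by (simp add: dist_norm)
        qed
      qed
      then show "f \<in> \<A>" by (simp add: \<A>_def)
    qed
    fix c :: "real \<Rightarrow> real" and x :: 'e
    assume c: "continuous_on UNIV c" "\<exists>b. \<forall>r. \<bar>r\<bar> > b \<longrightarrow> c r = 0" "\<forall>r. 0 \<le> c r \<and> c r \<le> (1::real)"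
    show "abs_L1 (\<lambda>r. c r *\<^sub>R x) \<in> \<A>"
      unfolding \<A>_def mem_Collect_eq tendsto_at_iff_sequentially
      using dense[OF c] by (auto simp: o_def)
  qed
  then show ?thesis by (simp add: \<A>_def)
qed

lemma compact_support_integrable:
  fixes c :: "real \<Rightarrow> real"
  assumes "continuous_on UNIV c" "\<forall>r. \<bar>r\<bar> > b \<longrightarrow> c r = 0" "\<forall>r. 0 \<le> c r \<and> c r \<le> (1::real)"
  shows "bintegrable (\<lambda>r. c r *\<^sub>R (x::'e))"
proof (rule bintegrable_bound)
  have "c \<in> borel_measurable lebesgue"
    by (intro measurable_completion) (simp add: borel_measurable_continuous_onI assms)
  then show "smeas (\<lambda>r. c r *\<^sub>R x)" by (intro strongly_measurable_scaleR_fun strongly_measurable_const)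
  show "AE r in lebesgue. ennreal (norm (c r *\<^sub>R x)) \<le> ennreal (norm x) * indicator {-b..b} r"
  proof (rule AE_I2)
    fix r
    show "ennreal (norm (c r *\<^sub>R x)) \<le> ennreal (norm x) * indicator {-b..b} r"
    proof (cases "\<bar>r\<bar> > b")
      case False
      then have "\<bar>r\<bar> \<le> b" by simp
      then have "r \<in> {-b..b}" by (auto simp: abs_le_iff)
      then show ?thesis using assms(3) by (auto intro!: ennreal_leI mult_left_le_one_le)
    qed (use assms(2) in simp)
  qed
  show "(\<integral>\<^sup>+r. ennreal (norm x) * indicator {-b..b} r \<partial>lebesgue) < \<infinity>"
    by (subst nn_integral_cmult_indicator) (auto simp: ennreal_mult_less_top emeasure_lborel_Icc_eq)
qed

text \<open>
  For a function \<open>c x\<close> with \<open>c\<close> continuous and of compact support, \<open>W s (s - h) (c (s - h) x)\<close> tends to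
  \<open>c s x\<close> for each \<open>s > 0\<close>, dominated by a multiple of the indicator of a bounded interval.
\<close>

lemma TW_strongly_continuous:
  assumes W: "positive_evolution W"
  shows "((\<lambda>t. TW W t f) \<longlongrightarrow> f) (at_right 0)"
proof (rule operators_tendsto_id)
  note reg = W_reg[OF W]
  show "linear (TW W h)" if "0 < h" for h using that by (intro TW_linear reg) simp
  show "norm (TW W h f) \<le> M * norm f" if "0 < h" for h f using that by (intro norm_TW_le reg) simp
  fix c :: "real \<Rightarrow> real" and x :: 'e and H :: "nat \<Rightarrow> real"
  assume cont: "continuous_on UNIV c" and supp: "\<exists>b. \<forall>r. \<bar>r\<bar> > b \<longrightarrow> c r = 0"
    and c01: "\<forall>r. 0 \<le> c r \<and> c r \<le> (1::real)" and H: "\<And>i. 0 < H i" "H \<longlonglongrightarrow> 0"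
  define F where "F = abs_L1 (\<lambda>r. c r *\<^sub>R x)"
  obtain b where b: "\<forall>r. \<bar>r\<bar> > b \<longrightarrow> c r = 0" using supp by blast
  have ci: "bintegrable (\<lambda>r. c r *\<^sub>R x)" by (rule compact_support_integrable[OF cont b c01])
  obtain C where C: "\<And>i. norm (H i) \<le> C" using convergent_imp_Bseq[of H] H(2) unfolding Bseq_def convergent_def by blast
  have Fr: "AE r in lebesgue. rp F r = (if 0 \<le> r then c r *\<^sub>R x else 0)"
    unfolding F_def by (rule rp_abs[OF half_line_integrable[OF ci]])
  have H0: "0 \<le> H i" for i using H(1)[of i] by simp
  have wm: "(\<lambda>s. ennreal (M * norm x) * indicator {0..b + C} s) \<in> borel_measurable lebesgue"
  proof -
    have [measurable]: "{0..b + C} \<in> sets lebesgue" by simp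
    show ?thesis by measurable
  qed
  have w: "(\<integral>\<^sup>+s. ennreal (M * norm x) * indicator {0..b + C} s \<partial>lebesgue) < \<infinity>"
    by (subst nn_integral_cmult_indicator) (auto simp: ennreal_mult_less_top emeasure_lborel_Icc_eq)
  have tra: "AE s in lebesgue. \<forall>i. rp F (s - H i) = (if 0 \<le> s - H i then c (s - H i) *\<^sub>R x else 0)"
    using AE_translate[OF Fr] by (simp add: AE_all_countable)
  have lim: "AE s in lebesgue. (\<lambda>i. shifted W (H i) F s) \<longlonglongrightarrow> rp F s"
  proof -
    have "AE s in lebesgue. s \<noteq> (0::real)" by (intro AE_completion AE_lborel_singleton)
    with tra Fr show ?thesis
    proof eventually_elim
      case (elim s)
      show ?case
      proof (cases "s < 0")
        case True
        then have "shifted W (H i) F s = 0" for i using H0[of i] by (simp add: shifted_def)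
        then show ?thesis using True by (simp add: rp_def)
      next
        case False
        then have s: "0 < s" using elim by simp
        have Hs: "\<forall>\<^sub>F i in sequentially. H i < s" by (rule order_tendstoD(2)[OF H(2) s])
        have l1: "(\<lambda>i. s - H i) \<longlonglongrightarrow> s" using tendsto_diff[OF tendsto_const[of s] H(2)] by simp
        have "(\<lambda>i. c (s - H i)) \<longlonglongrightarrow> c s"
          by (rule continuous_on_tendsto_compose[OF cont l1]) auto
        moreover have "(\<lambda>i. W s (s - H i) x) \<longlonglongrightarrow> x"
          by (rule W_tendsto_id[OF W l1 s]) (use H0 in simp)
        ultimately have "(\<lambda>i. c (s - H i) *\<^sub>R W s (s - H i) x) \<longlonglongrightarrow> c s *\<^sub>R x" by (rule tendsto_scaleR)
        moreover have "\<forall>\<^sub>F i in sequentially. c (s - H i) *\<^sub>R W s (s - H i) x = shifted W (H i) F s"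
          using Hs by eventually_elim (use elim H0 in \<open>simp add: shifted_def linear_scale[OF W_lin[OF W]]\<close>)
        ultimately have "(\<lambda>i. shifted W (H i) F s) \<longlonglongrightarrow> c s *\<^sub>R x" by (rule Lim_transform_eventually)
        then show ?thesis using elim s by simp
      qed
    qed
  qed
  have bd: "AE s in lebesgue. ennreal (norm (shifted W (H i) F s)) \<le> ennreal (M * norm x) * indicator {0..b + C} s" for i
    using tra
  proof eventually_elim
    case (elim s)
    show ?case
    proof (cases "H i \<le> s \<and> \<not> \<bar>s - H i\<bar> > b")
      case True
      then have s: "s \<in> {0..b + C}" using H0[of i] C[of i] by auto
      have "norm (shifted W (H i) F s) = c (s - H i) * norm (W s (s - H i) x)"
        using True elim H0[of i] c01 by (simp add: shifted_def linear_scale[OF W_lin[OF W]])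
      also have "\<dots> \<le> 1 * (M * norm x)"
        using c01 True H0[of i] by (intro mult_mono W_bound[OF W]) auto
      finally show ?thesis using s by (simp add: ennreal_leI)
    next
      case False
      then have "shifted W (H i) F s = 0" using elim b H0[of i] by (auto simp: shifted_def linear_0[OF W_lin[OF W]])
      then show ?thesis by simp
    qed
  qed
  have "(\<lambda>i. abs_L1 (shifted W (H i) F)) \<longlonglongrightarrow> abs_L1 (rp F)"
    by (rule abs_L1_tendsto[OF bint_dominated(1-3)[OF shifted_smeas[OF reg H0] lim bd wm w]])
  then show "(\<lambda>i. TW W (H i) (abs_L1 (\<lambda>r. c r *\<^sub>R x))) \<longlonglongrightarrow> abs_L1 (\<lambda>r. c r *\<^sub>R x)"
    by (simp add: TW_shifted abs_L1_rp F_def)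
qed

lemma TW_substochastic:
  assumes W: "positive_evolution W"
  shows "substochastic_semigroup (TW W)"
  unfolding substochastic_semigroup_def c0_semigroup_def
  by (intro conjI allI impI TW_bl[OF W_reg[OF W]] TW_0[OF W] TW_add[OF W] TW_strongly_continuous[OF W]
      TW_nonneg[OF W] TW_contr[OF W])

definition M_L1 :: real where "M_L1 = 2 * (2 * M)"

lemma TW_positive_semigroup:
  assumes W: "positive_evolution W"
  shows "positive_semigroup (TW W) M_L1"
proof
  show "closed {f::'e L1. 0 \<le> f}" by (rule L1_closed_cone[OF cone_closed])
  show "\<forall>f g::'e L1. 0 \<le> f \<longrightarrow> 0 \<le> g \<longrightarrow> norm (f + g) = norm f + norm g"
    by (intro allI impI L1_norm_additive[OF norm_additive])
  show "decomposition_bound TYPE('e L1) M_L1"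
    unfolding M_L1_def by (rule L1_decomposition_bound[OF cone_closed decomposition]) (use M_ge_1 in simp)
  show "substochastic_semigroup (TW W)" by (rule TW_substochastic[OF W])
qed

text \<open>
  Pointwise the series converges to the perturbed family, and partial sums are dominated by
  \<open>M \<parallel>f (s - t)\<parallel>\<close>.
\<close>

lemma TW_sums:
  assumes t: "0 \<le> t"
  shows "(\<lambda>n. TW (V n) t f) sums TW Vs t f"
proof -
  have reg: "regular_kernel (V n)" for n by (rule regular_kernel_V)
  have sm: "smeas (\<lambda>s. \<Sum>k<n. shifted (V k) t f s)" for n by (intro strongly_measurable_sum shifted_smeas reg t)
  have lim: "AE s in lebesgue. (\<lambda>n. \<Sum>k<n. shifted (V k) t f s) \<longlonglongrightarrow> shifted Vs t f s"
    using V_sums t by (intro AE_I2) (auto simp: shifted_def sums_def)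
  have bd: "AE s in lebesgue. ennreal (norm (\<Sum>k<n. shifted (V k) t f s)) \<le> ennreal M * ennreal (norm (rp f (s - t)))" for n
  proof (rule AE_I2)
    fix s
    show "ennreal (norm (\<Sum>k<n. shifted (V k) t f s)) \<le> ennreal M * ennreal (norm (rp f (s - t)))"
    proof (cases "t \<le> s")
      case True
      have "norm (\<Sum>k<n. shifted (V k) t f s) \<le> (\<Sum>k<n. norm (shifted (V k) t f s))" by (rule norm_sum)
      also have "\<dots> = (\<Sum>k<n. norm (V k s (s - t) (rp f (s - t))))" using True by (simp add: shifted_def)
      also have "\<dots> \<le> (\<Sum>k. norm (V k s (s - t) (rp f (s - t))))"
        using t True by (intro sum_le_suminf V_summable_norm) auto
      also have "\<dots> \<le> M * norm (rp f (s - t))" using t True by (intro V_summable_norm) auto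
      finally show ?thesis using M_ge_1 by (simp add: ennreal_leI flip: ennreal_mult)
    qed (simp add: shifted_def)
  qed
  have wm: "(\<lambda>s. ennreal M * ennreal (norm (rp f (s - t)))) \<in> borel_measurable lebesgue"
    using rp_translate_measurable[of f t, measurable] by measurable
  have w: "(\<integral>\<^sup>+s. ennreal M * ennreal (norm (rp f (s - t))) \<partial>lebesgue) < \<infinity>" by (simp add: M_rp_nn_integral)
  have "(\<lambda>n. abs_L1 (\<lambda>s. \<Sum>k<n. shifted (V k) t f s)) \<longlonglongrightarrow> abs_L1 (shifted Vs t f)"
    by (rule abs_L1_tendsto[OF bint_dominated(1-3)[OF sm lim bd wm w]])
  moreover have "abs_L1 (\<lambda>s. \<Sum>k<n. shifted (V k) t f s) = (\<Sum>k<n. TW (V k) t f)" for n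
    unfolding TW_shifted by (intro abs_L1_sum shifted_integrable reg t) auto
  ultimately show ?thesis by (simp add: sums_def TW_shifted)
qed

end

section \<open>Resolvents of evolution semigroups as integral operators\<close>

text \<open>
  The class of \<open>s \<mapsto> \<integral> k(s, r) dr\<close>. All operators on \<open>L1\<close> below have this form.
\<close>

definition section_integral :: "(real \<times> real \<Rightarrow> 'b::banach) \<Rightarrow> 'b L1" where
  "section_integral k = abs_L1 (\<lambda>s. bint (\<lambda>r. k (s, r)))"

lemma bint_zero: "bint (\<lambda>x. 0 :: 'b::banach) = 0"
  using bint_scaleR[OF bochner_integrable_zero, of 0] by simp

lemma rp_section_integral:
  assumes k: "bintegrable k" and neg: "\<forall>s<0. \<forall>r. k (s, r) = 0"
  shows "AE s in lebesgue. rp (section_integral k) s = bint (\<lambda>r. k (s, r))"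
  unfolding section_integral_def
proof (rule rp_abs'[OF fubini_forD(2)[OF bochner_fubini[OF k]]])
  fix s :: real assume "s < 0"
  then show "bint (\<lambda>r. k (s, r)) = 0" using bint_zero by (simp add: neg)
qed

lemma AE_section: "bintegrable k \<Longrightarrow> AE s in lebesgue. bintegrable (\<lambda>r. k (s, r))"
  for k :: "real \<times> real \<Rightarrow> 'b::banach"
  by (rule fubini_forD(1)[OF bochner_fubini])

lemma norm_section_integral_le:
  assumes k: "bintegrable k" and neg: "\<forall>s<0. \<forall>r. k (s, r) = 0"
  shows "ennreal (norm (section_integral k)) \<le> (\<integral>\<^sup>+z. ennreal (norm (k z)) \<partial>lebesgue)"
proof -
  have "ennreal (norm (section_integral k)) \<le> (\<integral>\<^sup>+s. \<integral>\<^sup>+r. ennreal (norm (k (s, r))) \<partial>lebesgue \<partial>lebesgue)"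
    unfolding norm_rp
  proof (rule nn_integral_mono_AE)
    show "AE s in lebesgue. ennreal (norm (rp (section_integral k) s)) \<le> (\<integral>\<^sup>+r. ennreal (norm (k (s, r))) \<partial>lebesgue)"
      using rp_section_integral[OF assms] AE_section[OF k] by eventually_elim (simp add: norm_bint_le)
  qed
  also have "\<dots> = (\<integral>\<^sup>+z. ennreal (norm (k z)) \<partial>lebesgue)"
    by (rule lebesgue_tonelli(1)) (intro measurable_compose[OF norm_measurable] smeas_bintegrable k, auto)
  finally show ?thesis .
qed

lemma section_integral_add:
  assumes k: "bintegrable k" "\<forall>s<0. \<forall>r. k (s, r) = 0"
    and l: "bintegrable l" "\<forall>s<0. \<forall>r. l (s, r) = 0"
    and m: "\<And>s. AE r in lebesgue. m (s, r) = k (s, r) + l (s, r)"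
  shows "section_integral m = section_integral k + section_integral l"
proof -
  have m': "bint (\<lambda>r. m (s, r)) = bint (\<lambda>r. k (s, r) + l (s, r))" for s
    by (rule bint_cong_AE[OF m])
  have eq: "section_integral m = section_integral (\<lambda>z. k z + l z)"
    unfolding section_integral_def m' ..
  show ?thesis unfolding eq
  proof (rule L1_eqI)
    have n: "\<forall>s<0. \<forall>r. k (s, r) + l (s, r) = 0" by (simp add: k l)
    show "AE s in lebesgue. rp (section_integral (\<lambda>z. k z + l z)) s = rp (section_integral k + section_integral l) s"
      using rp_section_integral[OF bintegrable_add[OF k(1) l(1)] n] rp_section_integral[OF k] rp_section_integral[OF l] rp_add[of "section_integral k" "section_integral l"]
        AE_section[OF k(1)] AE_section[OF l(1)]
      by eventually_elim (simp add: bint_add)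
  qed
qed

lemma section_integral_scaleR:
  assumes k: "bintegrable k" "\<forall>s<0. \<forall>r. k (s, r) = 0"
    and m: "\<And>s. AE r in lebesgue. m (s, r) = c *\<^sub>R k (s, r)"
  shows "section_integral m = c *\<^sub>R section_integral k"
proof -
  have m': "bint (\<lambda>r. m (s, r)) = bint (\<lambda>r. c *\<^sub>R k (s, r))" for s
    by (rule bint_cong_AE[OF m])
  have eq: "section_integral m = section_integral (\<lambda>z. c *\<^sub>R k z)"
    unfolding section_integral_def m' ..
  show ?thesis unfolding eq
  proof (rule L1_eqI)
    have n: "\<forall>s<0. \<forall>r. c *\<^sub>R k (s, r) = 0" by (simp add: k)
    show "AE s in lebesgue. rp (section_integral (\<lambda>z. c *\<^sub>R k z)) s = rp (c *\<^sub>R section_integral k) s"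
      using rp_section_integral[OF bintegrable_scaleR[OF k(1)] n] rp_section_integral[OF k] rp_scaleR[of c "section_integral k"]
        AE_section[OF k(1)]
      by eventually_elim (simp add: bint_scaleR)
  qed
qed

lemma L1_dominated_convergence:
  fixes f :: "'e::banach L1"
  assumes lim: "AE s in lebesgue. (\<lambda>i. rp (X i) s) \<longlonglongrightarrow> rp f s"
    and bd: "\<And>i::nat. AE s in lebesgue. ennreal (norm (rp (X i) s)) \<le> w s"
    and w: "w \<in> borel_measurable lebesgue" "(\<integral>\<^sup>+s. w s \<partial>lebesgue) < \<infinity>"
  shows "X \<longlonglongrightarrow> f"
proof (rule tendsto_ennreal_norm_zero)
  show "(\<lambda>i. \<integral>\<^sup>+s. ennreal (norm (rp f s - rp (X i) s)) \<partial>lebesgue) \<longlonglongrightarrow> 0"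
    by (rule bint_dominated(3)[OF smeas_rp lim bd w])
  show "ennreal (norm (X i - f)) \<le> (\<integral>\<^sup>+s. ennreal (norm (rp f s - rp (X i) s)) \<partial>lebesgue)" for i
    unfolding norm_minus_commute[of "X i" f] norm_diff_rp by simp
qed

lemma nn_integral_exp_half_line:
  assumes l: "0 < (l::real)"
  shows "(\<integral>\<^sup>+x. (if 0 \<le> x then ennreal (exp (- l * x)) else 0) \<partial>lebesgue) < \<infinity>"
proof -
  have "((\<lambda>x. - exp (- l * x) / l) \<longlongrightarrow> - 0 / l) at_top"
    by (intro tendsto_divide tendsto_minus tendsto_const filterlim_compose[OF exp_at_bot]
        filterlim_tendsto_neg_mult_at_bot[OF tendsto_const _ filterlim_ident]) (use l in auto)
  then have lim: "((\<lambda>x. - exp (- l * x) / l) \<longlongrightarrow> 0) at_top" by simp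
  have "(\<integral>\<^sup>+x. ennreal (exp (- l * x)) * indicator {0..} x \<partial>lborel) = ennreal (0 - (- exp (- l * 0) / l))"
  proof (rule nn_integral_FTC_atLeast[OF _ _ _ lim])
    show "((\<lambda>x. - exp (- l * x) / l) has_real_derivative exp (- l * x)) (at x)" for x
      using l by (auto intro!: derivative_eq_intros)
  qed auto
  moreover have "(\<integral>\<^sup>+x. (if 0 \<le> x then ennreal (exp (- l * x)) else 0) \<partial>lebesgue) =
     (\<integral>\<^sup>+x. ennreal (exp (- l * x)) * indicator {0..} x \<partial>lborel)"
    unfolding nn_integral_completion by (intro nn_integral_cong) (auto simp: indicator_def)
  ultimately show ?thesis by simp
qed

context perturbed_evolution
begin

text \<open>
  Kernel of the integral operator obtained by exchanging time and space in the Laplace transform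
  \<open>\<integral> exp (- \<mu> t) W(s, s - t) f(s - t) dt\<close>, with \<open>r = s - t\<close>.
\<close>

definition laplace_kernel :: "real \<Rightarrow> (real \<Rightarrow> real \<Rightarrow> 'e \<Rightarrow> 'e) \<Rightarrow> 'e L1 \<Rightarrow> real \<times> real \<Rightarrow> 'e" where
  "laplace_kernel \<mu> W f z = (if z \<in> triangle then exp (- \<mu> * (fst z - snd z)) *\<^sub>R W (fst z) (snd z) (rp f (snd z)) else 0)"

text \<open>
  Majorant of convolution type for the kernels: its integral is a product of two integrals in one
  variable.
\<close>

definition kernel_majorant :: "(real \<Rightarrow> ennreal) \<Rightarrow> 'e L1 \<Rightarrow> real \<times> real \<Rightarrow> ennreal" where
  "kernel_majorant q f z = q (fst z - snd z) * (ennreal M * ennreal (norm (rp f (snd z))))"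

lemma kernel_majorant_measurable:
  assumes q: "q \<in> borel_measurable borel"
  shows "kernel_majorant q f \<in> borel_measurable lebesgue"
proof -
  have "(\<lambda>z::real\<times>real. q (fst z - snd z)) \<in> borel_measurable borel"
    by (intro measurable_compose[OF _ q] borel_measurable_continuous_onI continuous_intros)
  then have [measurable]: "(\<lambda>z::real\<times>real. q (fst z - snd z)) \<in> borel_measurable lebesgue"
    by (intro measurable_completion) simp
  have [measurable]: "(\<lambda>z::real\<times>real. norm (rp f (snd z))) \<in> borel_measurable lebesgue"
    by (rule norm_measurable[OF smeas_snd[OF smeas_rp]])
  show ?thesis unfolding kernel_majorant_def[abs_def] by measurable
qed

lemma kernel_majorant_nn_integral:
  assumes q: "q \<in> borel_measurable borel"
  shows "(\<integral>\<^sup>+z. kernel_majorant q f z \<partial>lebesgue) = (\<integral>\<^sup>+x. q x \<partial>lebesgue) * ennreal (M * norm f)"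
proof -
  have ql: "q \<in> borel_measurable lebesgue" by (intro measurable_completion) (simp add: q)
  have "(\<integral>\<^sup>+s. kernel_majorant q f (s, r) \<partial>lebesgue) = (\<integral>\<^sup>+x. q x \<partial>lebesgue) * (ennreal M * ennreal (norm (rp f r)))" for r
  proof -
    have "(\<integral>\<^sup>+s. kernel_majorant q f (s, r) \<partial>lebesgue) = (\<integral>\<^sup>+s. q (s - r) \<partial>lebesgue) * (ennreal M * ennreal (norm (rp f r)))"
      unfolding kernel_majorant_def fst_conv snd_conv
      by (rule nn_integral_multc[OF preserves_nn_integral(2)[OF preserves_translation ql]])
    then show ?thesis using preserves_nn_integral(1)[OF preserves_translation ql, of r] by simp
  qed
  then have "(\<integral>\<^sup>+z. kernel_majorant q f z \<partial>lebesgue) = (\<integral>\<^sup>+r. (\<integral>\<^sup>+x. q x \<partial>lebesgue) * (ennreal M * ennreal (norm (rp f r))) \<partial>lebesgue)"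
    using lebesgue_tonelli_swap[OF kernel_majorant_measurable[OF q]] by simp
  also have "\<dots> = (\<integral>\<^sup>+x. q x \<partial>lebesgue) * (\<integral>\<^sup>+r. ennreal M * ennreal (norm (rp f r)) \<partial>lebesgue)"
    using rp_translate_measurable[of f 0, measurable] by (intro nn_integral_cmult) simp
  also have "(\<integral>\<^sup>+r. ennreal M * ennreal (norm (rp f r)) \<partial>lebesgue) = ennreal (M * norm f)"
    using M_rp_nn_integral[of f 0] by simp
  finally show ?thesis .
qed

definition exp_weight :: "real \<Rightarrow> real \<Rightarrow> ennreal" where "exp_weight \<mu> x = (if 0 \<le> x then ennreal (exp (- \<mu> * x)) else 0)"

lemma exp_weight_measurable: "exp_weight \<mu> \<in> borel_measurable borel"
  unfolding exp_weight_def[abs_def] by measurable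

lemma weight_measurable: "(\<lambda>z::real\<times>real. exp (- \<mu> * (fst z - snd z))) \<in> borel_measurable lebesgue"
  by (intro measurable_completion) (simp, intro borel_measurable_continuous_onI continuous_intros)

lemma laplace_kernel_smeas:
  assumes W: "regular_kernel W"
  shows "smeas (laplace_kernel \<mu> W f)"
proof -
  have "smeas (\<lambda>z. if z \<in> triangle then W (fst z) (snd z) (rp f (snd z)) else 0)"
    by (rule strongly_measurable_apply[OF triangle_lebesgue _ regular_triangle[OF W] smeas_snd[OF smeas_rp]])
      (use regular_bl[OF W] in \<open>auto simp: triangle_def\<close>)
  from strongly_measurable_scaleR_fun[OF weight_measurable[of \<mu>] this]
  show ?thesis by (rule strongly_measurable_AE_cong) (auto simp: laplace_kernel_def)
qed

lemma laplace_kernel_norm_le: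
  assumes "regular_kernel W"
  shows "ennreal (norm (laplace_kernel \<mu> W f z)) \<le> kernel_majorant (exp_weight \<mu>) f z"
proof (cases "z \<in> triangle")
  case True
  then have z: "0 \<le> snd z" "snd z \<le> fst z" by (auto simp: triangle_def)
  have "norm (laplace_kernel \<mu> W f z) \<le> exp (- \<mu> * (fst z - snd z)) * (M * norm (rp f (snd z)))"
    using True regular_bound[OF assms z] by (simp add: laplace_kernel_def)
  then have "ennreal (norm (laplace_kernel \<mu> W f z)) \<le> ennreal (exp (- \<mu> * (fst z - snd z)) * (M * norm (rp f (snd z))))"
    by (rule ennreal_leI)
  also have "\<dots> = kernel_majorant (exp_weight \<mu>) f z" using z M_ge_1 by (simp add: kernel_majorant_def exp_weight_def ennreal_mult)
  finally show ?thesis .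
qed (simp add: laplace_kernel_def)

lemma laplace_kernel_neg: "\<forall>s<0. \<forall>r. laplace_kernel \<mu> W f (s, r) = 0"
  by (auto simp: laplace_kernel_def triangle_def)

definition laplace :: "real \<Rightarrow> (real \<Rightarrow> real \<Rightarrow> 'e \<Rightarrow> 'e) \<Rightarrow> 'e L1 \<Rightarrow> 'e L1" where
  "laplace \<mu> W f = section_integral (laplace_kernel \<mu> W f)"

lemma kernel_majorant_exp_weight_finite:
  assumes "0 < \<mu>" shows "(\<integral>\<^sup>+z. kernel_majorant (exp_weight \<mu>) f z \<partial>lebesgue) < \<infinity>"
  unfolding kernel_majorant_nn_integral[OF exp_weight_measurable]
  using nn_integral_exp_half_line[OF assms] by (simp add: ennreal_mult_less_top exp_weight_def[abs_def])

lemma laplace_kernel_integrable: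
  assumes "0 < \<mu>" "regular_kernel W"
  shows "bintegrable (laplace_kernel \<mu> W f)"
  by (rule bintegrable_bound[OF laplace_kernel_smeas[OF assms(2)] AE_I2[OF laplace_kernel_norm_le[OF assms(2)]] kernel_majorant_exp_weight_finite[OF assms(1)]])

lemma rp_laplace:
  assumes "0 < \<mu>" "regular_kernel W"
  shows "AE s in lebesgue. rp (laplace \<mu> W f) s = bint (\<lambda>r. laplace_kernel \<mu> W f (s, r))"
  unfolding laplace_def by (rule rp_section_integral[OF laplace_kernel_integrable[OF assms] laplace_kernel_neg])

text \<open>
  The part of the Laplace integral over times \<open>t \<le> h\<close>, which is lost when the semigroup is applied at time \<open>h\<close>.
\<close>

definition short_kernel :: "real \<Rightarrow> (real \<Rightarrow> real \<Rightarrow> 'e \<Rightarrow> 'e) \<Rightarrow> real \<Rightarrow> 'e L1 \<Rightarrow> real \<times> real \<Rightarrow> 'e" where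
  "short_kernel \<mu> W h f z = (if z \<in> {z. fst z - snd z \<le> h} then laplace_kernel \<mu> W f z else 0)"

lemma short_kernel_set: "{z::real\<times>real. fst z - snd z \<le> h} \<in> sets lebesgue"
proof -
  have "closed {z::real\<times>real. fst z - snd z \<le> h}" by (intro closed_Collect_le continuous_intros)
  then show ?thesis by simp
qed

lemma short_kernel_integrable:
  assumes "0 < \<mu>" "regular_kernel W"
  shows "bintegrable (short_kernel \<mu> W h f)"
  unfolding short_kernel_def[abs_def] by (rule bintegrable_If_zero[OF laplace_kernel_integrable[OF assms] short_kernel_set])

lemma short_kernel_neg: "\<forall>s<0. \<forall>r. short_kernel \<mu> W h f (s, r) = 0"
  by (simp add: short_kernel_def laplace_kernel_neg)

lemma short_kernel_norm_le:
  assumes W: "regular_kernel W" and \<mu>: "0 < \<mu>"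
  shows "norm (short_kernel \<mu> W h f (s, r)) \<le> indicator {s - h..s} r * (M * norm (rp f r))"
proof (cases "(s, r) \<in> triangle \<and> s - r \<le> h")
  case True
  then have z: "0 \<le> r" "r \<le> s" "s - h \<le> r" by (auto simp: triangle_def)
  have "norm (short_kernel \<mu> W h f (s, r)) = exp (- \<mu> * (s - r)) * norm (W s r (rp f r))"
    using True by (simp add: short_kernel_def laplace_kernel_def)
  also have "\<dots> \<le> 1 * (M * norm (rp f r))"
    using z \<mu> by (intro mult_mono regular_bound[OF W]) auto
  finally show ?thesis using z by simp
next
  case False
  then have "short_kernel \<mu> W h f (s, r) = 0" by (auto simp: short_kernel_def laplace_kernel_def)
  then show ?thesis using M_ge_1 by simp
qed

definition short_laplace :: "real \<Rightarrow> (real \<Rightarrow> real \<Rightarrow> 'e \<Rightarrow> 'e) \<Rightarrow> real \<Rightarrow> 'e L1 \<Rightarrow> 'e L1" where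
  "short_laplace \<mu> W h f = section_integral (short_kernel \<mu> W h f)"

lemma rp_short_laplace:
  assumes "0 < \<mu>" "regular_kernel W"
  shows "AE s in lebesgue. rp (short_laplace \<mu> W h f) s = bint (\<lambda>r. short_kernel \<mu> W h f (s, r))"
  unfolding short_laplace_def by (rule rp_section_integral[OF short_kernel_integrable[OF assms] short_kernel_neg])

lemma short_laplace_linear:
  assumes "0 < \<mu>" and W: "regular_kernel W"
  shows "linear (short_laplace \<mu> W h)"
proof (rule linearI)
  note i = short_kernel_integrable[OF assms]
  fix f g :: "'e L1" and c :: real
  show "short_laplace \<mu> W h (f + g) = short_laplace \<mu> W h f + short_laplace \<mu> W h g"
    unfolding short_laplace_def
  proof (rule section_integral_add[OF i short_kernel_neg i short_kernel_neg])
    show "AE r in lebesgue. short_kernel \<mu> W h (f + g) (s, r) = short_kernel \<mu> W h f (s, r) + short_kernel \<mu> W h g (s, r)" for s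
      using rp_add[of f g]
      by eventually_elim (auto simp: short_kernel_def laplace_kernel_def triangle_def linear_add[OF regular_lin[OF W]] scaleR_add_right)
  qed
  show "short_laplace \<mu> W h (c *\<^sub>R f) = c *\<^sub>R short_laplace \<mu> W h f"
    unfolding short_laplace_def
  proof (rule section_integral_scaleR[OF i short_kernel_neg])
    show "AE r in lebesgue. short_kernel \<mu> W h (c *\<^sub>R f) (s, r) = c *\<^sub>R short_kernel \<mu> W h f (s, r)" for s
      using rp_scaleR[of c f]
      by eventually_elim (auto simp: short_kernel_def laplace_kernel_def triangle_def linear_scale[OF regular_lin[OF W]])
  qed
qed

lemma norm_short_laplace_le:
  assumes \<mu>: "0 < \<mu>" and W: "regular_kernel W" and h: "0 < h"
  shows "norm (short_laplace \<mu> W h f) \<le> h * (M * norm f)"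
proof -
  have q: "(indicator {0..h} :: real \<Rightarrow> ennreal) \<in> borel_measurable borel" by simp
  have "ennreal (norm (short_laplace \<mu> W h f)) \<le> (\<integral>\<^sup>+z. ennreal (norm (short_kernel \<mu> W h f z)) \<partial>lebesgue)"
    unfolding short_laplace_def by (rule norm_section_integral_le[OF short_kernel_integrable[OF \<mu> W] short_kernel_neg])
  also have "\<dots> \<le> (\<integral>\<^sup>+z. kernel_majorant (indicator {0..h}) f z \<partial>lebesgue)"
  proof (rule nn_integral_mono)
    fix z :: "real \<times> real"
    obtain s r where z: "z = (s, r)" by (cases z)
    have "ennreal (norm (short_kernel \<mu> W h f (s, r))) \<le> ennreal (indicator {s - h..s} r * (M * norm (rp f r)))"
      by (intro ennreal_leI short_kernel_norm_le W \<mu>)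
    also have "\<dots> = kernel_majorant (indicator {0..h}) f (s, r)"
      using M_ge_1 by (auto simp: kernel_majorant_def indicator_def ennreal_mult)
    finally show "ennreal (norm (short_kernel \<mu> W h f z)) \<le> kernel_majorant (indicator {0..h}) f z" by (simp add: z)
  qed
  also have "\<dots> = ennreal h * ennreal (M * norm f)"
    unfolding kernel_majorant_nn_integral[OF q] using h by simp
  also have "\<dots> = ennreal (h * (M * norm f))" using h M_ge_1 by (simp add: ennreal_mult)
  finally show ?thesis by (rule ennreal_le_iff[THEN iffD1, rotated]) (use h M_ge_1 in simp)
qed

lemma average_tendsto:
  fixes \<phi> :: "real \<Rightarrow> 'e"
  assumes lim: "(\<phi> \<longlongrightarrow> y) (at_left s)" and \<phi>s: "\<phi> s = y"
    and H: "\<And>i::nat. 0 < H i" "H \<longlonglongrightarrow> 0"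
    and k: "\<And>i. bintegrable (k i)" "\<forall>\<^sub>F i in sequentially. AE r in lebesgue. k i r = indicator {s - H i..s} r *\<^sub>R \<phi> r"
  shows "(\<lambda>i. bint (k i) /\<^sub>R H i) \<longlonglongrightarrow> y"
proof (rule tendstoI)
  fix e :: real assume e: "e > 0"
  have "\<forall>\<^sub>F r in at_left s. dist (\<phi> r) y < e / 2" using lim e by (intro tendstoD) auto
  then obtain d where d: "d < s" "\<And>r. d < r \<Longrightarrow> r < s \<Longrightarrow> dist (\<phi> r) y < e / 2"
    unfolding eventually_at_left_field by auto
  have "\<forall>\<^sub>F i in sequentially. H i < s - d" using d(1) by (intro order_tendstoD(2)[OF H(2)]) simp
  then show "\<forall>\<^sub>F i in sequentially. dist (bint (k i) /\<^sub>R H i) y < e"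
    using k(2)
  proof eventually_elim
    case (elim i)
    have ind: "bintegrable (\<lambda>r. indicator {s - H i..s} r *\<^sub>R y)" "bint (\<lambda>r. indicator {s - H i..s} r *\<^sub>R y) = H i *\<^sub>R y"
      using bint_indicator[of "{s - H i..s}" y] H(1)[of i] by (auto simp: less_imp_le)
    have "ennreal (norm (bint (k i) - H i *\<^sub>R y)) = ennreal (norm (bint (\<lambda>r. k i r - indicator {s - H i..s} r *\<^sub>R y)))"
      by (simp add: bint_diff[OF k(1) ind(1)] ind(2))
    also have "\<dots> \<le> (\<integral>\<^sup>+r. ennreal (norm (k i r - indicator {s - H i..s} r *\<^sub>R y)) \<partial>lebesgue)"
      by (rule norm_bint_le[OF bintegrable_diff[OF k(1) ind(1)]])
    also have "\<dots> \<le> (\<integral>\<^sup>+r. ennreal (e / 2) * indicator {s - H i..s} r \<partial>lebesgue)"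
    proof (rule nn_integral_mono_AE)
      show "AE r in lebesgue. ennreal (norm (k i r - indicator {s - H i..s} r *\<^sub>R y)) \<le> ennreal (e / 2) * indicator {s - H i..s} r"
        using elim(2)
      proof eventually_elim
        case (elim r)
        have "norm (\<phi> r - y) \<le> e / 2" if "r \<in> {s - H i..s}"
          using that d(2)[of r] \<open>H i < s - d\<close> \<phi>s e by (cases "r = s") (auto simp: dist_norm)
        then show ?case using elim by (auto simp: indicator_def intro: ennreal_leI)
      qed
    qed
    also have "\<dots> = ennreal (e / 2) * ennreal (H i)"
      using H(1)[of i] by (subst nn_integral_cmult_indicator) auto
    also have "\<dots> = ennreal (e / 2 * H i)"
      by (rule ennreal_mult[symmetric]) (use e H(1)[of i] in auto)
    finally have le: "norm (bint (k i) - H i *\<^sub>R y) \<le> e / 2 * H i"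
      by (rule ennreal_le_iff[THEN iffD1, rotated]) (use e H(1)[of i] in simp)
    have "bint (k i) /\<^sub>R H i - y = (bint (k i) - H i *\<^sub>R y) /\<^sub>R H i"
      using H(1)[of i] by (simp add: scaleR_diff_right)
    then have "norm (bint (k i) /\<^sub>R H i - y) = norm (bint (k i) - H i *\<^sub>R y) / H i"
      using H(1)[of i] by (simp add: divide_inverse mult.commute)
    also have "\<dots> \<le> e / 2" using le H(1)[of i] by (simp add: pos_divide_le_eq)
    finally show ?case using e by (simp add: dist_norm)
  qed
qed

text \<open>
  The analogue of \<open>orbit_integral_average\<close> for integral operators. For \<open>f = c x\<close> it is an average of the function
  \<open>r \<mapsto> exp (- \<mu> (s - r)) c(r) W(s, r) x\<close> over \<open>[s - h, s]\<close>.
\<close>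

lemma short_laplace_average:
  assumes \<mu>: "0 < \<mu>" and W: "positive_evolution W"
  shows "((\<lambda>h. short_laplace \<mu> W h f /\<^sub>R h) \<longlongrightarrow> f) (at_right 0)"
proof (rule operators_tendsto_id)
  note reg = W_reg[OF W]
  show "linear (\<lambda>f. short_laplace \<mu> W h f /\<^sub>R h)" for h
    using linear_compose[OF short_laplace_linear[OF \<mu> reg] linear_scale_self[of "inverse h"], of h] by (simp add: o_def)
  show "norm (short_laplace \<mu> W h f /\<^sub>R h) \<le> M * norm f" if "0 < h" for h f
  proof -
    have "norm (short_laplace \<mu> W h f /\<^sub>R h) = inverse h * norm (short_laplace \<mu> W h f)" using that by simp
    also have "\<dots> \<le> inverse h * (h * (M * norm f))"
      using that by (intro mult_left_mono norm_short_laplace_le[OF \<mu> reg]) auto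
    also have "\<dots> = M * norm f" using that by simp
    finally show ?thesis .
  qed
  fix c :: "real \<Rightarrow> real" and x :: 'e and H :: "nat \<Rightarrow> real"
  assume cont: "continuous_on UNIV c" and supp: "\<exists>b. \<forall>r. \<bar>r\<bar> > b \<longrightarrow> c r = 0"
    and c01: "\<forall>r. 0 \<le> c r \<and> c r \<le> (1::real)" and H: "\<And>i. 0 < H i" "H \<longlonglongrightarrow> 0"
  define F where "F = abs_L1 (\<lambda>r. c r *\<^sub>R x)"
  obtain b where b: "\<forall>r. \<bar>r\<bar> > b \<longrightarrow> c r = 0" using supp by blast
  have ci: "bintegrable (\<lambda>r. c r *\<^sub>R x)" by (rule compact_support_integrable[OF cont b c01])
  obtain C where C: "\<And>i. norm (H i) \<le> C" using convergent_imp_Bseq[of H] H(2) unfolding Bseq_def convergent_def by blast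
  have Fr: "AE r in lebesgue. rp F r = (if 0 \<le> r then c r *\<^sub>R x else 0)"
    unfolding F_def by (rule rp_abs[OF half_line_integrable[OF ci]])
  define k where "k i s = (\<lambda>r. short_kernel \<mu> W (H i) F (s, r))" for i s
  have rpk: "AE s in lebesgue. \<forall>i. rp (short_laplace \<mu> W (H i) F /\<^sub>R H i) s = bint (k i s) /\<^sub>R H i"
    unfolding AE_all_countable
  proof
    fix i
    show "AE s in lebesgue. rp (short_laplace \<mu> W (H i) F /\<^sub>R H i) s = bint (k i s) /\<^sub>R H i"
      using rp_scaleR[of "inverse (H i)" "short_laplace \<mu> W (H i) F"] rp_short_laplace[OF \<mu> reg, of "H i" F]
      by eventually_elim (simp add: k_def)
  qed
  have ki: "AE s in lebesgue. \<forall>i. bintegrable (k i s)"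
    unfolding AE_all_countable k_def using AE_section[OF short_kernel_integrable[OF \<mu> reg]] by blast
  have "(\<lambda>i. short_laplace \<mu> W (H i) F /\<^sub>R H i) \<longlonglongrightarrow> F"
  proof (rule L1_dominated_convergence)
    show "(\<lambda>s. ennreal (M * norm x) * indicator {0..b + C} s) \<in> borel_measurable lebesgue"
    proof -
      have [measurable]: "{0..b + C} \<in> sets lebesgue" by simp
      show ?thesis by measurable
    qed
    show "(\<integral>\<^sup>+s. ennreal (M * norm x) * indicator {0..b + C} s \<partial>lebesgue) < \<infinity>"
      by (subst nn_integral_cmult_indicator) (auto simp: ennreal_mult_less_top emeasure_lborel_Icc_eq)
    have "AE s in lebesgue. s \<noteq> (0::real)" by (intro AE_completion AE_lborel_singleton)
    with rpk ki Fr show "AE s in lebesgue. (\<lambda>i. rp (short_laplace \<mu> W (H i) F /\<^sub>R H i) s) \<longlonglongrightarrow> rp F s"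
    proof eventually_elim
      case (elim s)
      show ?case
      proof (cases "s < 0")
        case True
        then have "k i s = (\<lambda>r. 0)" for i by (auto simp: k_def short_kernel_neg)
        then show ?thesis using True elim by (simp add: rp_def bint_zero)
      next
        case False
        then have s: "0 < s" using elim by simp
        define \<phi> where "\<phi> r = (exp (- \<mu> * (s - r)) * c r) *\<^sub>R W s r x" for r
        have "(\<phi> \<longlongrightarrow> (exp (- \<mu> * (s - s)) * c s) *\<^sub>R x) (at_left s)"
          unfolding \<phi>_def
        proof (intro tendsto_intros)
          show "(c \<longlongrightarrow> c s) (at_left s)"
            using cont by (auto simp: continuous_on_def intro: tendsto_within_subset)
          show "((\<lambda>r. W s r x) \<longlongrightarrow> x) (at_left s)"
            by (rule W_tendsto_id[OF W tendsto_ident_at s]) (auto simp: eventually_at_left_field intro!: exI[of _ "s - 1"])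
        qed
        then have l: "(\<phi> \<longlongrightarrow> c s *\<^sub>R x) (at_left s)" by simp
        have "(\<lambda>i. bint (k i s) /\<^sub>R H i) \<longlonglongrightarrow> c s *\<^sub>R x"
        proof (rule average_tendsto[OF l _ H])
          show "\<phi> s = c s *\<^sub>R x" using s by (simp add: \<phi>_def W_id[OF W])
          show "bintegrable (k i s)" for i using elim by simp
          have "\<forall>\<^sub>F i in sequentially. H i < s" by (rule order_tendstoD(2)[OF H(2) s])
          then show "\<forall>\<^sub>F i in sequentially. AE r in lebesgue. k i s r = indicator {s - H i..s} r *\<^sub>R \<phi> r"
          proof eventually_elim
            case (elim i)
            show ?case
              using Fr
            proof eventually_elim
              case (elim r)
              show ?case
                using elim \<open>H i < s\<close>
                by (auto simp: k_def short_kernel_def laplace_kernel_def triangle_def \<phi>_def indicator_def linear_scale[OF W_lin[OF W]])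
            qed
          qed
        qed
        then show ?thesis using elim s by simp
      qed
    qed
    show "AE s in lebesgue. ennreal (norm (rp (short_laplace \<mu> W (H i) F /\<^sub>R H i) s)) \<le> ennreal (M * norm x) * indicator {0..b + C} s" for i
      using rpk ki
    proof eventually_elim
      case (elim s)
      have kb: "AE r in lebesgue. ennreal (norm (k i s r)) \<le> (ennreal (M * norm x) * indicator {0..b + C} s) * indicator {s - H i..s} r"
        using Fr
      proof eventually_elim
        case (elim r)
        show ?case
        proof (cases "s \<in> {0..b + C}")
          case True
          have "norm (k i s r) \<le> indicator {s - H i..s} r * (M * norm (rp F r))"
            unfolding k_def by (rule short_kernel_norm_le[OF reg \<mu>])
          also have "\<dots> \<le> indicator {s - H i..s} r * (M * norm x)"
            using elim c01 M_ge_1 by (intro mult_left_mono) (auto intro: mult_left_le_one_le)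
          finally have "ennreal (norm (k i s r)) \<le> ennreal (indicator {s - H i..s} r * (M * norm x))" by (rule ennreal_leI)
          then show ?thesis using True by (auto simp: indicator_def)
        next
          case False
          have "k i s r = 0"
          proof (rule ccontr)
            assume nz: "k i s r \<noteq> 0"
            then have t: "0 \<le> r" "r \<le> s" "s - r \<le> H i" by (auto simp: k_def short_kernel_def laplace_kernel_def triangle_def split: if_splits)
            have "rp F r \<noteq> 0" using nz t by (auto simp: k_def short_kernel_def laplace_kernel_def linear_0[OF W_lin[OF W]] split: if_splits)
            then have "c r \<noteq> 0" using elim by (auto split: if_splits)
            then have "\<not> \<bar>r\<bar> > b" using b by blast
            then show False using False t C[of i] H(1)[of i] by auto
          qed
          then show ?thesis by simp
        qed
      qed
      have "ennreal (norm (rp (short_laplace \<mu> W (H i) F /\<^sub>R H i) s)) = ennreal (inverse (H i)) * ennreal (norm (bint (k i s)))"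
        using elim H(1)[of i] by (simp add: ennreal_mult)
      also have "\<dots> \<le> ennreal (inverse (H i)) * (\<integral>\<^sup>+r. (ennreal (M * norm x) * indicator {0..b + C} s) * indicator {s - H i..s} r \<partial>lebesgue)"
        using elim by (intro mult_left_mono order_trans[OF norm_bint_le nn_integral_mono_AE[OF kb]]) auto
      also have "\<dots> = ennreal (inverse (H i)) * ((ennreal (M * norm x) * indicator {0..b + C} s) * ennreal (H i))"
        using H(1)[of i] by (subst nn_integral_cmult_indicator) auto
      also have "\<dots> = (ennreal (inverse (H i)) * ennreal (H i)) * (ennreal (M * norm x) * indicator {0..b + C} s)"
        by (simp add: mult_ac)
      also have "ennreal (inverse (H i)) * ennreal (H i) = 1"
        using H(1)[of i] by (simp flip: ennreal_mult)
      finally show ?case by simp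
    qed
  qed
  then show "(\<lambda>i. short_laplace \<mu> W (H i) (abs_L1 (\<lambda>r. c r *\<^sub>R x)) /\<^sub>R H i) \<longlonglongrightarrow> abs_L1 (\<lambda>r. c r *\<^sub>R x)"
    by (simp add: F_def)
qed

text \<open>
  The semigroup law under the integral: \<open>W s (s - h) W (s - h) r = W s r\<close>, for \<open>r \<le> s - h\<close>; what is missing is
  the integral over times up to \<open>h\<close>.
\<close>

lemma TW_laplace:
  assumes \<mu>: "0 < \<mu>" and W: "positive_evolution W" and h: "0 < h"
  shows "TW W h (laplace \<mu> W f) = exp (\<mu> * h) *\<^sub>R (laplace \<mu> W f - short_laplace \<mu> W h f)"
proof (rule L1_eqI)
  note reg = W_reg[OF W]
  have h0: "0 \<le> h" using h by simp
  note ki = AE_section[OF laplace_kernel_integrable[OF \<mu> reg, of f]]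
  show "AE s in lebesgue. rp (TW W h (laplace \<mu> W f)) s = rp (exp (\<mu> * h) *\<^sub>R (laplace \<mu> W f - short_laplace \<mu> W h f)) s"
    using rp_TW[OF reg h0, of "laplace \<mu> W f"] rp_scaleR[of "exp (\<mu> * h)" "laplace \<mu> W f - short_laplace \<mu> W h f"]
      rp_diff[of "laplace \<mu> W f" "short_laplace \<mu> W h f"] rp_laplace[OF \<mu> reg, of f] rp_short_laplace[OF \<mu> reg, of h f]
      AE_translate[OF rp_laplace[OF \<mu> reg, of f], of h] ki AE_translate[OF ki, of h] AE_section[OF short_kernel_integrable[OF \<mu> reg, of h f]]
  proof eventually_elim
    case (elim s)
    have rhs: "rp (exp (\<mu> * h) *\<^sub>R (laplace \<mu> W f - short_laplace \<mu> W h f)) s =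
      bint (\<lambda>r. exp (\<mu> * h) *\<^sub>R (laplace_kernel \<mu> W f (s, r) - short_kernel \<mu> W h f (s, r)))"
      using elim by (simp add: bint_scaleR[OF bintegrable_diff] bint_diff)
    show ?case
    proof (cases "h \<le> s")
      case True
      have b: "bounded_linear (W s (s - h))" using True h by (intro W_bl[OF W]) auto
      have "rp (TW W h (laplace \<mu> W f)) s = W s (s - h) (bint (\<lambda>r. laplace_kernel \<mu> W f (s - h, r)))"
        using elim True by (simp add: shifted_def)
      also have "\<dots> = bint (\<lambda>r. W s (s - h) (laplace_kernel \<mu> W f (s - h, r)))"
        by (rule bint_linear[OF elim(8) b, symmetric])
      also have "\<dots> = bint (\<lambda>r. exp (\<mu> * h) *\<^sub>R (laplace_kernel \<mu> W f (s, r) - short_kernel \<mu> W h f (s, r)))"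
      proof (rule bint_cong_AE)
        have "AE r in lebesgue. r \<noteq> s - h" by (intro AE_completion AE_lborel_singleton)
        then show "AE r in lebesgue. W s (s - h) (laplace_kernel \<mu> W f (s - h, r)) = exp (\<mu> * h) *\<^sub>R (laplace_kernel \<mu> W f (s, r) - short_kernel \<mu> W h f (s, r))"
        proof eventually_elim
          case (elim r)
          consider "r < 0" | "0 \<le> r" "r < s - h" | "0 \<le> r" "s - h < r" using elim by linarith
          then show ?case
          proof cases
            case 2
            have e: "exp (- (\<mu> * (s - h - r))) = exp (\<mu> * h) * exp (- (\<mu> * (s - r)))"
              by (simp flip: exp_add add: algebra_simps)
            have "W s (s - h) (W (s - h) r (rp f r)) = W s r (rp f r)"
              using 2 h by (intro W_comp[OF W]) auto
            then show ?thesis using 2 h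
              by (simp add: laplace_kernel_def short_kernel_def triangle_def e linear_scale[OF bounded_linear.linear[OF b]])
          qed (use h in \<open>auto simp: laplace_kernel_def short_kernel_def triangle_def linear_0[OF bounded_linear.linear[OF b]]\<close>)
        qed
      qed
      finally show ?thesis by (simp only: rhs)
    next
      case False
      have "exp (\<mu> * h) *\<^sub>R (laplace_kernel \<mu> W f (s, r) - short_kernel \<mu> W h f (s, r)) = 0" for r
        using False by (auto simp: laplace_kernel_def short_kernel_def triangle_def)
      then show ?thesis unfolding rhs using elim(1) False by (simp add: shifted_def bint_zero)
    qed
  qed
qed

text \<open>
  By \<open>TW_laplace\<close>, the difference quotient of the semigroup at \<open>laplace \<mu> W f\<close> tends to \<open>\<mu> laplace \<mu> W f - f\<close>, exactly as
  for the Laplace transform of orbits in \<open>res_in_domain\<close>. This identifies the two without having to integrate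
  functions with values in \<open>L1\<close> pointwise.
\<close>

theorem laplace_resolvent:
  assumes \<mu>: "0 < \<mu>" and W: "positive_evolution W"
  shows "bounded_semigroup.res (TW W) \<mu> f = laplace \<mu> W f"
proof -
  interpret S: positive_semigroup "TW W" M_L1 by (rule TW_positive_semigroup[OF W])
  have "((\<lambda>h. exp (\<mu> * h)) has_real_derivative \<mu>) (at 0)"
    by (auto intro!: derivative_eq_intros)
  then have "((\<lambda>h. (exp (\<mu> * h) - 1) / h) \<longlongrightarrow> \<mu>) (at 0)" by (simp add: DERIV_def)
  then have e: "((\<lambda>h. (exp (\<mu> * h) - 1) / h) \<longlongrightarrow> \<mu>) (at_right 0)"
    by (rule tendsto_within_subset) auto
  have "((\<lambda>h::real. exp (\<mu> * h)) \<longlongrightarrow> exp (\<mu> * 0)) (at_right 0)" by (intro tendsto_intros)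
  then have e1: "((\<lambda>h::real. exp (\<mu> * h)) \<longlongrightarrow> 1) (at_right 0)" by simp
  have "((\<lambda>h. ((exp (\<mu> * h) - 1) / h) *\<^sub>R laplace \<mu> W f - exp (\<mu> * h) *\<^sub>R (short_laplace \<mu> W h f /\<^sub>R h)) \<longlongrightarrow>
      \<mu> *\<^sub>R laplace \<mu> W f - 1 *\<^sub>R f) (at_right 0)"
    by (intro tendsto_intros e e1 short_laplace_average \<mu> W)
  then have "((\<lambda>h. (TW W h (laplace \<mu> W f) - laplace \<mu> W f) /\<^sub>R h) \<longlongrightarrow> \<mu> *\<^sub>R laplace \<mu> W f - 1 *\<^sub>R f) (at_right 0)"
  proof (rule Lim_transform_eventually)
    show "\<forall>\<^sub>F h in at_right 0. ((exp (\<mu> * h) - 1) / h) *\<^sub>R laplace \<mu> W f - exp (\<mu> * h) *\<^sub>R (short_laplace \<mu> W h f /\<^sub>R h) =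
        (TW W h (laplace \<mu> W f) - laplace \<mu> W f) /\<^sub>R h"
      using S.eventually_pos_at_right
    proof eventually_elim
      case (elim h)
      show ?case unfolding TW_laplace[OF \<mu> W elim] by (simp add: divide_inverse algebra_simps)
    qed
  qed
  from S.generatorI[OF this] have "laplace \<mu> W f \<in> generator_domain (TW W)"
    "\<mu> *\<^sub>R laplace \<mu> W f - generator (TW W) (laplace \<mu> W f) = f" by simp_all
  from S.res_unique[OF \<mu> this] show ?thesis by simp
qed

end

context perturbed_evolution
begin

section \<open>The perturbation series of the resolvent\<close>

definition BU_kernel :: "real \<Rightarrow> 'e L1 \<Rightarrow> real \<times> real \<Rightarrow> 'e" where
  "BU_kernel \<mu> f z = (if z \<in> triangle then exp (- \<mu> * (fst z - snd z)) *\<^sub>R B (fst z) (U (fst z) (snd z) (rp f (snd z))) else 0)"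

lemma BU_rp:
  shows "AE z in lebesgue. z \<in> triangle \<longrightarrow> U (fst z) (snd z) (rp f (snd z)) \<in> D (fst z)"
    "smeas (\<lambda>z. if z \<in> triangle then B (fst z) (U (fst z) (snd z) (rp f (snd z))) else 0)"
proof -
  have "bochner_integrable half_line (rp f)" by (rule half_line_integrable[OF bintegrable_rp])
  then have "(AE z in lebesgue_on triangle. U (fst z) (snd z) (rp f (snd z)) \<in> D (fst z)) \<and>
      strongly_measurable (lebesgue_on triangle) (\<lambda>z. B (fst z) (U (fst z) (snd z) (rp f (snd z))))"
    using BUf_measurable[rule_format, of "rp f"] unfolding triangle_def case_prod_beta' by blast
  then show "AE z in lebesgue. z \<in> triangle \<longrightarrow> U (fst z) (snd z) (rp f (snd z)) \<in> D (fst z)"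
    "smeas (\<lambda>z. if z \<in> triangle then B (fst z) (U (fst z) (snd z) (rp f (snd z))) else 0)"
    unfolding AE_lebesgue_on_iff[OF triangle_lebesgue] strongly_measurable_restrict_iff[OF triangle_lebesgue]
    by simp_all
qed

lemma BU_kernel_smeas: "smeas (BU_kernel \<mu> f)"
  by (rule strongly_measurable_AE_cong[OF strongly_measurable_scaleR_fun[OF weight_measurable[of \<mu>] BU_rp(2)[of f]]])
    (auto simp: BU_kernel_def)

lemma BU_kernel_neg: "\<forall>s<0. \<forall>r. BU_kernel \<mu> f (s, r) = 0"
  by (auto simp: BU_kernel_def triangle_def)

text \<open>
  The bounds over \<open>[r, n]\<close> are uniform in \<open>n\<close>, and monotone convergence extends them to \<open>[r, \<infinity>)\<close>.
\<close>

lemma BU_total: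
  assumes "0 \<le> r"
  shows "(\<integral>\<^sup>+s. (if r \<le> s then ennreal (norm (B s (U s r w))) else 0) \<partial>lebesgue) \<le> ennreal (M * norm w)"
proof -
  define g where "g n s = ennreal (norm (bu (real n) r w s))" for n :: nat and s
  have gm: "g n \<in> borel_measurable lebesgue" for n
    unfolding g_def by (intro measurable_compose[OF norm_measurable[OF bu_smeas[OF assms]]]) auto
  have inc: "incseq g"
    by (auto simp: incseq_def le_fun_def g_def bu_def)
  have "(\<integral>\<^sup>+s. (if r \<le> s then ennreal (norm (B s (U s r w))) else 0) \<partial>lebesgue) \<le> (\<integral>\<^sup>+s. (SUP n. g n s) \<partial>lebesgue)"
  proof (rule nn_integral_mono)
    fix s
    obtain n where n: "s \<le> real n" using real_arch_simple by blast
    have "(if r \<le> s then ennreal (norm (B s (U s r w))) else 0) \<le> g n s"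
      using n by (simp add: g_def bu_def)
    also have "\<dots> \<le> (SUP n. g n s)" by (rule SUP_upper) simp
    finally show "(if r \<le> s then ennreal (norm (B s (U s r w))) else 0) \<le> (SUP n. g n s)" .
  qed
  also have "\<dots> = (SUP n. integral\<^sup>N lebesgue (g n))"
    by (rule nn_integral_monotone_convergence_SUP[OF inc gm])
  also have "\<dots> \<le> ennreal (M * norm w)"
    unfolding g_def by (intro SUP_least bu_nn_integral assms)
  finally show ?thesis .
qed

text \<open>
  Integrating over \<open>s\<close> first, the inner integral is the total mass produced by \<open>B U\<close> from \<open>f r\<close>.
\<close>

lemma BU_kernel_nn_integral:
  assumes \<mu>: "0 < \<mu>"
  shows "(\<integral>\<^sup>+z. ennreal (norm (BU_kernel \<mu> f z)) \<partial>lebesgue) \<le> ennreal (M * norm f)"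
proof -
  have m: "(\<lambda>z. ennreal (norm (BU_kernel \<mu> f z))) \<in> borel_measurable lebesgue"
    by (intro measurable_compose[OF norm_measurable[OF BU_kernel_smeas]]) auto
  have inner: "(\<integral>\<^sup>+s. ennreal (norm (BU_kernel \<mu> f (s, r))) \<partial>lebesgue) \<le> ennreal M * ennreal (norm (rp f r))" for r
  proof (cases "0 \<le> r")
    case True
    have "(\<integral>\<^sup>+s. ennreal (norm (BU_kernel \<mu> f (s, r))) \<partial>lebesgue) \<le>
        (\<integral>\<^sup>+s. (if r \<le> s then ennreal (norm (B s (U s r (rp f r)))) else 0) \<partial>lebesgue)"
    proof (rule nn_integral_mono)
      fix s
      have "exp (- \<mu> * (s - r)) * norm (B s (U s r (rp f r))) \<le> 1 * norm (B s (U s r (rp f r)))" if "r \<le> s"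
        using that \<mu> by (intro mult_right_mono) auto
      then show "ennreal (norm (BU_kernel \<mu> f (s, r))) \<le> (if r \<le> s then ennreal (norm (B s (U s r (rp f r)))) else 0)"
        by (auto simp: BU_kernel_def triangle_def intro: ennreal_leI)
    qed
    also have "\<dots> \<le> ennreal (M * norm (rp f r))" by (rule BU_total[OF True])
    finally show ?thesis using M_ge_1 by (simp add: ennreal_mult)
  next
    case False
    then have "BU_kernel \<mu> f (s, r) = 0" for s by (simp add: BU_kernel_def triangle_def)
    then show ?thesis by simp
  qed
  have "(\<integral>\<^sup>+z. ennreal (norm (BU_kernel \<mu> f z)) \<partial>lebesgue) \<le> (\<integral>\<^sup>+r. ennreal M * ennreal (norm (rp f (r - 0))) \<partial>lebesgue)"
    unfolding lebesgue_tonelli_swap[OF m] by (intro nn_integral_mono) (simp add: inner)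
  then show ?thesis unfolding M_rp_nn_integral .
qed

lemma BU_kernel_integrable: "0 < \<mu> \<Longrightarrow> bintegrable (BU_kernel \<mu> f)"
  using BU_kernel_smeas[of \<mu> f] BU_kernel_nn_integral[of \<mu> f]
  by (auto simp: bochner_integrable_def intro: le_less_trans)

text \<open>
  The operator \<open>B\<close> applied to the resolvent of \<open>Z\<close>, computed pointwise under the integral sign.
\<close>

definition K :: "real \<Rightarrow> 'e L1 \<Rightarrow> 'e L1" where "K \<mu> f = section_integral (BU_kernel \<mu> f)"

lemma rp_K:
  assumes "0 < \<mu>"
  shows "AE s in lebesgue. rp (K \<mu> f) s = bint (\<lambda>r. BU_kernel \<mu> f (s, r))"
  unfolding K_def by (rule rp_section_integral[OF BU_kernel_integrable[OF assms] BU_kernel_neg])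

lemma K_nonneg:
  assumes \<mu>: "0 < \<mu>" and f: "0 \<le> f" shows "0 \<le> K \<mu> f"
proof -
  have "AE r in lebesgue. 0 \<le> rp f r" using f by (simp add: L1_nonneg_iff)
  from AE_lebesgue_snd[OF this] BU_rp(1)[of f]
  have "AE z in lebesgue. 0 \<le> BU_kernel \<mu> f z"
  proof eventually_elim
    case (elim z)
    show ?case
    proof (cases "z \<in> triangle")
      case True
      then have z: "0 \<le> snd z" "snd z \<le> fst z" by (auto simp: triangle_def)
      then have "0 \<le> B (fst z) (U (fst z) (snd z) (rp f (snd z)))"
        using elim True B_pos U_pos by auto
      then show ?thesis using True by (simp add: BU_kernel_def scaleR_nonneg_nonneg)
    qed (simp add: BU_kernel_def)
  qed
  from AE_lebesgue_pair[OF this] AE_section[OF BU_kernel_integrable[OF \<mu>, of f]] rp_K[OF \<mu>, of f]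
  have "AE s in lebesgue. 0 \<le> rp (K \<mu> f) s"
    by eventually_elim (simp add: bint_nonneg[OF cone_closed])
  then show ?thesis by (simp add: L1_nonneg_iff)
qed

text \<open>
  Written out, both sides integrate \<open>exp (- \<mu> (s - r)) V n s \<tau> (B \<tau> (U \<tau> r (f r)))\<close> over
  \<open>0 \<le> r \<le> \<tau> \<le> s\<close>: integration over \<open>\<tau>\<close> first gives \<open>V (Suc n) s r (f r)\<close>, integration over \<open>r\<close> first gives
  \<open>V n s \<tau> (K \<mu> f \<tau>)\<close>, since the exponential splits at \<open>\<tau>\<close>.
\<close>

lemma laplace_Suc:
  assumes \<mu>: "0 < \<mu>"
  shows "laplace \<mu> (V (Suc n)) f = laplace \<mu> (V n) (K \<mu> f)"
proof (rule L1_eqI)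
  have eq: "bint (\<lambda>r. laplace_kernel \<mu> (V (Suc n)) f (s, r)) = bint (\<lambda>\<tau>. laplace_kernel \<mu> (V n) (K \<mu> f) (s, \<tau>))" for s
  proof (cases "0 \<le> s")
    case False
    then show ?thesis using laplace_kernel_neg by simp
  next
    case True
    \<comment> \<open>the integrand on the strip \<open>0 \<le> \<tau> \<le> s\<close>; it vanishes unless \<open>0 \<le> r \<le> \<tau>\<close>\<close>
    define S where "S = {z :: real \<times> real. fst z \<in> {0..s}}"
    define \<Phi>0 where "\<Phi>0 z = (if z \<in> S then V n s (fst z) (BU_kernel \<mu> f z) else 0)" for z
    define \<Phi> where "\<Phi> z = exp (- \<mu> * (s - fst z)) *\<^sub>R \<Phi>0 z" for z
    have Sl: "S \<in> sets lebesgue"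
    proof -
      have "closed S" unfolding S_def atLeastAtMost_iff by (intro closed_Collect_conj closed_Collect_le continuous_intros)
      then show ?thesis by simp
    qed
    have sm0: "smeas \<Phi>0"
    proof -
      have "smeas (\<lambda>z. if z \<in> S then V n s (fst z) (BU_kernel \<mu> f z) else 0)"
      proof (rule strongly_measurable_apply[OF Sl _ _ BU_kernel_smeas])
        show "bounded_linear (V n s (fst z))" if "z \<in> S" for z
          using that by (intro Vn_bl) (auto simp: S_def)
        show "smeas (\<lambda>z. if z \<in> S then V n s (fst z) w else 0)" for w
          using smeas_fst[OF Vn_smeas_initial[OF order_refl True, of n w]] by (simp add: S_def)
      qed
      then show ?thesis by (simp add: \<Phi>0_def[abs_def])
    qed
    have wm: "(\<lambda>z::real\<times>real. exp (- \<mu> * (s - fst z))) \<in> borel_measurable lebesgue"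
      by (intro measurable_completion) (simp, intro borel_measurable_continuous_onI continuous_intros)
    have \<Phi>i: "bintegrable \<Phi>"
    proof (rule bintegrable_bound)
      show "smeas \<Phi>" unfolding \<Phi>_def[abs_def] by (rule strongly_measurable_scaleR_fun[OF wm sm0])
      show "AE z in lebesgue. ennreal (norm (\<Phi> z)) \<le> ennreal M * ennreal (norm (BU_kernel \<mu> f z))"
      proof (rule AE_I2)
        fix z
        show "ennreal (norm (\<Phi> z)) \<le> ennreal M * ennreal (norm (BU_kernel \<mu> f z))"
        proof (cases "z \<in> S")
          case True
          then have z: "0 \<le> fst z" "fst z \<le> s" by (auto simp: S_def)
          have "norm (\<Phi> z) = exp (- \<mu> * (s - fst z)) * norm (V n s (fst z) (BU_kernel \<mu> f z))"
            using True by (simp add: \<Phi>_def \<Phi>0_def)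
          also have "\<dots> \<le> 1 * (M * norm (BU_kernel \<mu> f z))"
            using z \<mu> by (intro mult_mono Vn_bound) auto
          finally show ?thesis using M_ge_1 by (simp add: ennreal_leI flip: ennreal_mult)
        qed (simp add: \<Phi>_def \<Phi>0_def)
      qed
      have "(\<integral>\<^sup>+z. ennreal M * ennreal (norm (BU_kernel \<mu> f z)) \<partial>lebesgue) = ennreal M * (\<integral>\<^sup>+z. ennreal (norm (BU_kernel \<mu> f z)) \<partial>lebesgue)"
        by (intro nn_integral_cmult measurable_compose[OF norm_measurable[OF BU_kernel_smeas]]) auto
      also have "\<dots> < \<infinity>"
        using BU_kernel_nn_integral[OF \<mu>, of f] by (auto simp: ennreal_mult_less_top intro: le_less_trans)
      finally show "(\<integral>\<^sup>+z. ennreal M * ennreal (norm (BU_kernel \<mu> f z)) \<partial>lebesgue) < \<infinity>" .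
    qed
    have A: "bint (\<lambda>\<tau>. \<Phi> (\<tau>, r)) = laplace_kernel \<mu> (V (Suc n)) f (s, r)" for r
    proof (cases "0 \<le> r \<and> r \<le> s")
      case r: True
      have "\<Phi> (\<tau>, r) = exp (- \<mu> * (s - r)) *\<^sub>R (if \<tau> \<in> {r..s} then V n s \<tau> (bu s r (rp f r) \<tau>) else 0)" for \<tau>
      proof -
        consider "\<tau> < 0" | "0 \<le> \<tau>" "\<tau> < r" | "r \<le> \<tau>" "\<tau> \<le> s" | "s < \<tau>" by linarith
        then show ?thesis
        proof cases
          case 2
          then show ?thesis using r by (auto simp: \<Phi>_def \<Phi>0_def S_def BU_kernel_def triangle_def linear_0[OF Vn_lin])
        next
          case 3
          have "\<Phi> (\<tau>, r) = (exp (- (\<mu> * (s - \<tau>))) * exp (- (\<mu> * (\<tau> - r)))) *\<^sub>R V n s \<tau> (bu s r (rp f r) \<tau>)"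
            using 3 r by (simp add: \<Phi>_def \<Phi>0_def S_def BU_kernel_def triangle_def bu_def linear_scale[OF Vn_lin])
          also have "exp (- (\<mu> * (s - \<tau>))) * exp (- (\<mu> * (\<tau> - r))) = exp (- \<mu> * (s - r))"
            by (simp flip: exp_add add: algebra_simps)
          finally show ?thesis using 3 by simp
        qed (use r in \<open>auto simp: \<Phi>_def \<Phi>0_def S_def\<close>)
      qed
      then have "bint (\<lambda>\<tau>. \<Phi> (\<tau>, r)) =
          exp (- \<mu> * (s - r)) *\<^sub>R bint (\<lambda>\<tau>. if \<tau> \<in> {r..s} then V n s \<tau> (bu s r (rp f r) \<tau>) else 0)"
        using r by (simp only: bint_scaleR[OF Vn_integrand])
      also have "\<dots> = laplace_kernel \<mu> (V (Suc n)) f (s, r)"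
        unfolding V_Suc[symmetric] using r by (simp add: laplace_kernel_def triangle_def del: perturbation_term.simps)
      finally show ?thesis .
    next
      case False
      then have "\<Phi> (\<tau>, r) = 0" for \<tau>
        by (auto simp: \<Phi>_def \<Phi>0_def S_def BU_kernel_def triangle_def linear_0[OF Vn_lin])
      then show ?thesis using False by (auto simp: laplace_kernel_def triangle_def bint_zero simp del: perturbation_term.simps)
    qed
    have Bq: "AE \<tau> in lebesgue. bint (\<lambda>r. \<Phi> (\<tau>, r)) = laplace_kernel \<mu> (V n) (K \<mu> f) (s, \<tau>)"
      using rp_K[OF \<mu>, of f] AE_section[OF BU_kernel_integrable[OF \<mu>, of f]]
    proof eventually_elim
      case (elim \<tau>)
      show ?case
      proof (cases "\<tau> \<in> {0..s}")
        case t: True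
        then have t': "0 \<le> \<tau>" "\<tau> \<le> s" by auto
        have "bounded_linear (\<lambda>y. exp (- \<mu> * (s - \<tau>)) *\<^sub>R V n s \<tau> y)"
          by (rule bounded_linear_compose[OF bounded_linear_scaleR_right Vn_bl[OF t']])
        from bint_linear[OF elim(2) this]
        have "bint (\<lambda>r. \<Phi> (\<tau>, r)) = exp (- \<mu> * (s - \<tau>)) *\<^sub>R V n s \<tau> (rp (K \<mu> f) \<tau>)"
          using t elim(1) by (simp add: \<Phi>_def \<Phi>0_def S_def)
        then show ?thesis using t' by (simp add: laplace_kernel_def triangle_def)
      next
        case False
        then have "\<Phi> (\<tau>, r) = 0" for r by (auto simp: \<Phi>_def \<Phi>0_def S_def)
        then show ?thesis using False by (auto simp: laplace_kernel_def triangle_def bint_zero)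
      qed
    qed
    have "bint (\<lambda>r. laplace_kernel \<mu> (V (Suc n)) f (s, r)) = bint (\<lambda>r. bint (\<lambda>\<tau>. \<Phi> (\<tau>, r)))" by (simp only: A)
    also have "\<dots> = bint (\<lambda>\<tau>. bint (\<lambda>r. \<Phi> (\<tau>, r)))" by (rule bochner_fubini_swap(3)[OF \<Phi>i])
    also have "\<dots> = bint (\<lambda>\<tau>. laplace_kernel \<mu> (V n) (K \<mu> f) (s, \<tau>))" by (rule bint_cong_AE[OF Bq])
    finally show ?thesis .
  qed
  show "AE s in lebesgue. rp (laplace \<mu> (V (Suc n)) f) s = rp (laplace \<mu> (V n) (K \<mu> f)) s"
    using rp_laplace[OF \<mu> regular_kernel_V[of "Suc n"], of f] rp_laplace[OF \<mu> regular_kernel_V[of n], of "K \<mu> f"]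
    by eventually_elim (simp only: eq)
qed

text \<open>
  The sums of kernels converge pointwise and are dominated by the majorant of a single kernel,
  because \<open>\<Sum>\<^sub>n \<parallel>V n s r w\<parallel> \<le> M \<parallel>w\<parallel>\<close>.
\<close>

lemma laplace_sums:
  assumes \<mu>: "0 < \<mu>"
  shows "(\<lambda>n. laplace \<mu> (V n) f) sums laplace \<mu> Vs f"
proof -
  note ki = laplace_kernel_integrable[OF \<mu> regular_kernel_V] and kv = laplace_kernel_integrable[OF \<mu> regular_kernel_Vs]
  define k where "k n z = (\<Sum>j<n. laplace_kernel \<mu> (V j) f z)" for n z
  have kn: "\<forall>s<0. \<forall>r. k n (s, r) = 0" for n using laplace_kernel_neg by (simp add: k_def)
  have k: "bintegrable (k n)" for n
    unfolding k_def[abs_def] using bint_sum[of "{..<n}" "\<lambda>j. laplace_kernel \<mu> (V j) f", OF ki] by blast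
  have sum: "(\<Sum>j<n. laplace \<mu> (V j) f) = section_integral (k n)" for n
  proof (induction n)
    case 0
    have "section_integral (k 0) = 0 *\<^sub>R section_integral (k 0)"
      by (rule section_integral_scaleR[OF k kn]) (simp add: k_def)
    then show ?case by simp
  next
    case (Suc n)
    have "section_integral (k (Suc n)) = section_integral (k n) + section_integral (laplace_kernel \<mu> (V n) f)"
      by (rule section_integral_add[OF k kn ki laplace_kernel_neg]) (simp add: k_def)
    then show ?case using Suc by (simp add: laplace_def)
  qed
  have lim: "AE z in lebesgue. (\<lambda>n. k n z) \<longlonglongrightarrow> laplace_kernel \<mu> Vs f z"
  proof (rule AE_I2)
    fix z
    show "(\<lambda>n. k n z) \<longlonglongrightarrow> laplace_kernel \<mu> Vs f z"
    proof (cases "z \<in> triangle")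
      case True
      then have z: "0 \<le> snd z" "snd z \<le> fst z" by (auto simp: triangle_def)
      show ?thesis
        using sums_scaleR_right[OF V_sums[OF z, of "rp f (snd z)"], of "exp (- \<mu> * (fst z - snd z))"] True
        by (simp add: laplace_kernel_def k_def sums_def)
    qed (simp add: laplace_kernel_def k_def)
  qed
  have bd: "AE z in lebesgue. ennreal (norm (k n z)) \<le> kernel_majorant (exp_weight \<mu>) f z" for n
  proof (rule AE_I2)
    fix z
    show "ennreal (norm (k n z)) \<le> kernel_majorant (exp_weight \<mu>) f z"
    proof (cases "z \<in> triangle")
      case True
      then have z: "0 \<le> snd z" "snd z \<le> fst z" by (auto simp: triangle_def)
      have "norm (k n z) \<le> (\<Sum>j<n. norm (laplace_kernel \<mu> (V j) f z))" unfolding k_def by (rule norm_sum)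
      also have "\<dots> = exp (- \<mu> * (fst z - snd z)) * (\<Sum>j<n. norm (V j (fst z) (snd z) (rp f (snd z))))"
        using True by (simp add: laplace_kernel_def sum_distrib_left)
      also have "\<dots> \<le> exp (- \<mu> * (fst z - snd z)) * (M * norm (rp f (snd z)))"
        using order_trans[OF sum_le_suminf[OF V_summable_norm(1)[OF z]] V_summable_norm(2)[OF z]]
        by (intro mult_left_mono) auto
      finally have "ennreal (norm (k n z)) \<le> ennreal (exp (- \<mu> * (fst z - snd z)) * (M * norm (rp f (snd z))))"
        by (rule ennreal_leI)
      also have "\<dots> = kernel_majorant (exp_weight \<mu>) f z" using z M_ge_1 by (simp add: kernel_majorant_def exp_weight_def ennreal_mult)
      finally show ?thesis .
    qed (simp add: laplace_kernel_def k_def)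
  qed
  have "(\<lambda>n. section_integral (k n)) \<longlonglongrightarrow> section_integral (laplace_kernel \<mu> Vs f)"
  proof (rule tendsto_ennreal_norm_zero)
    show "(\<lambda>n. \<integral>\<^sup>+z. ennreal (norm (laplace_kernel \<mu> Vs f z - k n z)) \<partial>lebesgue) \<longlonglongrightarrow> 0"
      by (rule bint_dominated(3)[OF smeas_bintegrable[OF k] lim bd kernel_majorant_measurable[OF exp_weight_measurable] kernel_majorant_exp_weight_finite[OF \<mu>]])
    fix n
    have d: "bintegrable (\<lambda>z. laplace_kernel \<mu> Vs f z - k n z)" by (rule bintegrable_diff[OF kv k])
    have dn: "\<forall>s<0. \<forall>r. laplace_kernel \<mu> Vs f (s, r) - k n (s, r) = 0" using laplace_kernel_neg kn by simp
    have "section_integral (laplace_kernel \<mu> Vs f) = section_integral (k n) + section_integral (\<lambda>z. laplace_kernel \<mu> Vs f z - k n z)"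
      by (rule section_integral_add[OF k kn d dn]) simp
    then have "norm (section_integral (k n) - section_integral (laplace_kernel \<mu> Vs f)) = norm (section_integral (\<lambda>z. laplace_kernel \<mu> Vs f z - k n z))"
      by (simp add: norm_minus_commute)
    then show "ennreal (norm (section_integral (k n) - section_integral (laplace_kernel \<mu> Vs f))) \<le> (\<integral>\<^sup>+z. ennreal (norm (laplace_kernel \<mu> Vs f z - k n z)) \<partial>lebesgue)"
      using norm_section_integral_le[OF d dn] by simp
  qed
  then show ?thesis unfolding sums_def sum by (simp add: laplace_def)
qed

section \<open>Generators and minimality\<close>

sublocale T0: positive_semigroup "TW U" M_L1 by (rule TW_positive_semigroup[OF positive_evolution_U])

sublocale T: positive_semigroup "TW Vs" M_L1 by (rule TW_positive_semigroup[OF positive_evolution_Vs])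

lemma res_T0: "0 < \<mu> \<Longrightarrow> T0.res \<mu> f = laplace \<mu> U f"
  by (rule laplace_resolvent[OF _ positive_evolution_U])

lemma res_T: "0 < \<mu> \<Longrightarrow> T.res \<mu> f = laplace \<mu> Vs f"
  by (rule laplace_resolvent[OF _ positive_evolution_Vs])

lemma laplace_V: "0 < \<mu> \<Longrightarrow> laplace \<mu> (V n) f = T0.res \<mu> ((K \<mu> ^^ n) f)"
  by (induction n arbitrary: f) (simp_all add: res_T0 laplace_Suc funpow_swap1 del: perturbation_term.simps(2))

lemma res_series: "0 < \<mu> \<Longrightarrow> (\<lambda>n. T0.res \<mu> ((K \<mu> ^^ n) f)) sums T.res \<mu> f"
  using laplace_sums[of \<mu> f] by (simp add: res_T laplace_V)

text \<open>
  Splitting off the first term of \<open>res_series\<close>.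
\<close>

lemma res_T_eq:
  assumes \<mu>: "0 < \<mu>"
  shows "T.res \<mu> f = T0.res \<mu> f + T.res \<mu> (K \<mu> f)"
proof -
  have "(\<lambda>n. T0.res \<mu> ((K \<mu> ^^ Suc n) f)) sums T.res \<mu> (K \<mu> f)"
    using res_series[OF \<mu>, of "K \<mu> f"] by (simp add: funpow_swap1)
  then have "(\<lambda>n. T0.res \<mu> ((K \<mu> ^^ n) f)) sums (T.res \<mu> (K \<mu> f) + T0.res \<mu> ((K \<mu> ^^ 0) f))"
    by (rule sums_Suc)
  then show ?thesis using sums_unique2[OF res_series[OF \<mu>, of f]] by (simp add: add.commute)
qed

text \<open>
  By \<open>res_T_eq\<close>, \<open>T0.res \<mu> g\<close> is the value of the other resolvent at \<open>g - K \<mu> g\<close>, so both generators can be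
  evaluated at it.
\<close>

lemma res_T0_in_domain:
  assumes \<mu>: "0 < \<mu>"
  shows "T0.res \<mu> g \<in> generator_domain (TW Vs)"
    "generator (TW Vs) (T0.res \<mu> g) - generator (TW U) (T0.res \<mu> g) = K \<mu> g"
proof -
  interpret R: bounded_linear "T.res \<mu>" by (rule T.bounded_linear_res[OF \<mu>])
  have eq: "T0.res \<mu> g = T.res \<mu> (g - K \<mu> g)"
    using res_T_eq[OF \<mu>, of g] by (simp add: R.diff)
  show "T0.res \<mu> g \<in> generator_domain (TW Vs)" unfolding eq by (rule T.res_in_domain[OF \<mu>])
  have "generator (TW Vs) (T0.res \<mu> g) = \<mu> *\<^sub>R T0.res \<mu> g - (g - K \<mu> g)"
    using T.res_in_domain(2)[OF \<mu>, of "g - K \<mu> g"] by (simp only: eq)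
  then show "generator (TW Vs) (T0.res \<mu> g) - generator (TW U) (T0.res \<mu> g) = K \<mu> g"
    using T0.res_in_domain(2)[OF \<mu>, of g] by simp
qed

lemma domain_inclusion: "generator_domain (TW U) \<subseteq> generator_domain (TW Vs)"
proof
  fix x assume x: "x \<in> generator_domain (TW U)"
  have "x = T0.res 1 (1 *\<^sub>R x - generator (TW U) x)"
    using T0.res_inverse[OF _ x, of 1] by simp
  then show "x \<in> generator_domain (TW Vs)" using res_T0_in_domain(1)[of 1] by (metis zero_less_one)
qed

lemma resolvent_formula:
  assumes \<mu>: "0 < \<mu>"
  defines "R \<equiv> resolvent (generator_domain (TW U)) (generator (TW U)) \<mu>"
  shows "(\<lambda>n. R (\<Sum>k\<le>n. (((\<lambda>f. generator (TW Vs) f - generator (TW U) f) \<circ> R) ^^ k) f))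
    \<longlonglongrightarrow> resolvent (generator_domain (TW Vs)) (generator (TW Vs)) \<mu> f"
proof -
  interpret R0: bounded_linear "T0.res \<mu>" by (rule T0.bounded_linear_res[OF \<mu>])
  have R: "R = T0.res \<mu>" unfolding R_def by (rule T0.resolvent_eq_res[OF \<mu>])
  have BR: "(\<lambda>f. generator (TW Vs) f - generator (TW U) f) \<circ> R = K \<mu>"
    unfolding R by (rule ext) (simp add: res_T0_in_domain(2)[OF \<mu>])
  have "(\<lambda>n. \<Sum>k\<le>n. T0.res \<mu> ((K \<mu> ^^ k) f)) \<longlonglongrightarrow> T.res \<mu> f"
    using res_series[OF \<mu>, of f] by (simp add: sums_def_le)
  then show ?thesis
    unfolding BR unfolding R T.resolvent_eq_res[OF \<mu>] by (simp add: R0.sum)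
qed

text \<open>
  On the domain of \<open>Z\<close> the generator of \<open>S\<close> is the one of the perturbed semigroup, hence
  \<open>S.res \<mu> g = T0.res \<mu> g + S.res \<mu> (K \<mu> g)\<close> as for the perturbed semigroup itself. Iteration compares
  \<open>S.res \<mu>\<close> with the partial sums of \<open>res_series\<close>.
\<close>

lemma minimality:
  assumes S: "substochastic_semigroup S"
    and ext: "\<And>x. x \<in> generator_domain (TW U) \<Longrightarrow> x \<in> generator_domain S \<and> generator S x = generator (TW Vs) x"
    and t: "0 \<le> t" and f: "0 \<le> f"
  shows "TW Vs t f \<le> S t f"
proof -
  have Sp: "positive_semigroup S M_L1"
    by (rule positive_semigroup.intro[OF T0.cl T0.add T0.M S])
  interpret S: positive_semigroup S M_L1 by (rule Sp)
  have Tp: "positive_semigroup (TW Vs) M_L1" by (rule TW_positive_semigroup[OF positive_evolution_Vs])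
  show ?thesis
  proof (rule semigroup_le_of_resolvent_le[OF Sp Tp _ t f])
    fix \<mu> :: real and f :: "'e L1" assume \<mu>: "0 < \<mu>" and f: "0 \<le> f"
    interpret SR: bounded_linear "S.res \<mu>" by (rule S.bounded_linear_res[OF \<mu>])
    have step: "S.res \<mu> g = T0.res \<mu> g + S.res \<mu> (K \<mu> g)" for g
    proof -
      have d: "T0.res \<mu> g \<in> generator_domain (TW U)" by (rule T0.res_in_domain[OF \<mu>])
      have "\<mu> *\<^sub>R T0.res \<mu> g - generator S (T0.res \<mu> g) = g - K \<mu> g"
        using ext[OF d] res_T0_in_domain(2)[OF \<mu>, of g] T0.res_in_domain(2)[OF \<mu>, of g]
        by (simp add: algebra_simps)
      then have "T0.res \<mu> g = S.res \<mu> (g - K \<mu> g)"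
        using ext[OF d] by (intro S.res_unique[OF \<mu>]) auto
      then show ?thesis by (simp add: SR.diff)
    qed
    have Kn: "0 \<le> (K \<mu> ^^ n) f" for n
      by (induction n) (simp_all add: f K_nonneg[OF \<mu>])
    have expand: "S.res \<mu> f = (\<Sum>k<n. T0.res \<mu> ((K \<mu> ^^ k) f)) + S.res \<mu> ((K \<mu> ^^ n) f)" for n
    proof (induction n)
      case (Suc n)
      then show ?case using step[of "(K \<mu> ^^ n) f"] by (simp add: add.assoc)
    qed simp
    have "(\<Sum>k<n. T0.res \<mu> ((K \<mu> ^^ k) f)) \<le> S.res \<mu> f" for n
      using expand[of n] S.res_nonneg[OF \<mu> Kn[of n]] by simp
    then show "T.res \<mu> f \<le> S.res \<mu> f"
      using closed_cone_le[OF T0.cl _ _ tendsto_const[of "S.res \<mu> f"], of "\<lambda>n. \<Sum>k<n. T0.res \<mu> ((K \<mu> ^^ k) f)"]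
        res_series[OF \<mu>, of f] by (simp add: sums_def)
  qed
qed

end

section \<open>The perturbation theorem\<close>

theorem theorem3p11:
  fixes U :: "real \<Rightarrow> real \<Rightarrow> 'e::{banach, ordered_real_vector} \<Rightarrow> 'e"
    and D :: "real \<Rightarrow> 'e set"
    and B :: "real \<Rightarrow> 'e \<Rightarrow> 'e"
    and T0 T :: "real \<Rightarrow> 'e L1 \<Rightarrow> 'e L1"
    and Tn :: "nat \<Rightarrow> real \<Rightarrow> 'e L1 \<Rightarrow> 'e L1"
    and DZ DG :: "'e L1 set"
    and Z G Bhat :: "'e L1 \<Rightarrow> 'e L1"
  assumes cone_closed: "closed {u::'e. 0 \<le> u}"
    and cone_generating: "\<forall>w::'e. \<exists>u v. 0 \<le> u \<and> 0 \<le> v \<and> w = u - v"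
    and norm_additive: "\<forall>u v::'e. 0 \<le> u \<longrightarrow> 0 \<le> v \<longrightarrow> norm (u + v) = norm u + norm v"
    and evolution_family: "evolution_family U"
    and B_linear: "\<forall>t\<ge>0. linear_on_domain (D t) (B t)"
    and U_pos: "\<forall>t s u. 0 \<le> s \<and> s \<le> t \<and> 0 \<le> u \<longrightarrow> 0 \<le> U t s u"
    and U_contr: "\<forall>t s u. 0 \<le> s \<and> s \<le> t \<and> 0 \<le> u \<longrightarrow> norm (U t s u) \<le> norm u"
    and B_pos: "\<forall>t\<ge>0. \<forall>u\<in>D t. 0 \<le> u \<longrightarrow> 0 \<le> B t u"
    and BU_domain: "\<forall>s\<ge>0. \<forall>u. AE t in lebesgue_on {s..}. U t s u \<in> D t"
    and BU_measurable: "\<forall>s\<ge>0. \<forall>u. strongly_measurable (lebesgue_on {s..}) (\<lambda>t. B t (U t s u))"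
    and BU_bound: "\<forall>t s u. 0 \<le> s \<and> s \<le> t \<and> 0 \<le> u \<longrightarrow>
      (\<integral>\<^sup>+\<tau>. ennreal (norm (B \<tau> (U \<tau> s u))) \<partial>lebesgue_on {s..t}) \<le> ennreal (norm u - norm (U t s u))"
    and BUf_measurable: "\<forall>f. bochner_integrable half_line f \<longrightarrow>
      (AE (t, s) in lebesgue_on {(t, s). 0 \<le> s \<and> s \<le> t}. U t s (f s) \<in> D t) \<and>
      strongly_measurable (lebesgue_on {(t, s). 0 \<le> s \<and> s \<le> t}) (\<lambda>(t, s). B t (U t s (f s)))"
  defines "T0 \<equiv> evolution_semigroup U"
    and "T \<equiv> evolution_semigroup (perturbed_family U B)"
    and "Tn \<equiv> \<lambda>n. evolution_semigroup (perturbation_term U B n)"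
    and "DZ \<equiv> generator_domain T0" and "Z \<equiv> generator T0"
    and "DG \<equiv> generator_domain T" and "G \<equiv> generator T"
    and "Bhat \<equiv> \<lambda>f. G f - Z f"
  shows "(\<forall>\<mu>>0. \<mu> \<in> resolvent_set DZ Z \<and> \<mu> \<in> resolvent_set DG G \<and>
           (\<forall>f. (\<lambda>n. resolvent DZ Z \<mu> (\<Sum>k\<le>n. ((Bhat \<circ> resolvent DZ Z \<mu>) ^^ k) f))
                 \<longlonglongrightarrow> resolvent DG G \<mu> f))
       \<and> substochastic_semigroup T
       \<and> operator_extends DG G DZ (\<lambda>f. Z f + Bhat f)
       \<and> (\<forall>S. substochastic_semigroup S \<and>
              operator_extends (generator_domain S) (generator S) DZ (\<lambda>f. Z f + Bhat f) \<longrightarrow>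
              (\<forall>t\<ge>0. \<forall>f\<ge>0. T t f \<le> S t f))
       \<and> (\<forall>t\<ge>0. \<forall>f. (\<lambda>n. Tn n t f) sums T t f)"
proof -
  obtain M' where M': "decomposition_bound TYPE('e) M'"
    using generating_closed_cone_decomposition[OF cone_closed cone_generating] by blast
  define M where "M = max M' 1"
  have M: "decomposition_bound TYPE('e) M" "1 \<le> M"
    unfolding M_def by (auto intro: decomposition_bound_mono[OF M'])
  interpret perturbed_evolution U D B M
    by (unfold_locales; fact)
  have minimal: "T t f \<le> S t f"
    if "substochastic_semigroup S"
      and "operator_extends (generator_domain S) (generator S) DZ (\<lambda>f. Z f + Bhat f)"
      and "0 \<le> t" "0 \<le> f" for S t f
    using minimality[OF that(1) _ that(3,4)] that(2)
    unfolding T_def T0_def DZ_def G_def Z_def Bhat_def operator_extends_def by auto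
  show ?thesis
  proof (intro conjI allI impI)
    fix \<mu> :: real assume \<mu>: "0 < \<mu>"
    show "\<mu> \<in> resolvent_set DZ Z"
      unfolding DZ_def Z_def T0_def by (rule T0.in_resolvent_set[OF \<mu>])
    show "\<mu> \<in> resolvent_set DG G"
      unfolding DG_def G_def T_def by (rule T.in_resolvent_set[OF \<mu>])
    show "(\<lambda>n. resolvent DZ Z \<mu> (\<Sum>k\<le>n. ((Bhat \<circ> resolvent DZ Z \<mu>) ^^ k) f))
        \<longlonglongrightarrow> resolvent DG G \<mu> f" for f
      unfolding DZ_def Z_def T0_def DG_def G_def T_def Bhat_def by (rule resolvent_formula[OF \<mu>])
  next
    show "substochastic_semigroup T"
      unfolding T_def by (rule TW_substochastic[OF positive_evolution_Vs])
    show "operator_extends DG G DZ (\<lambda>f. Z f + Bhat f)"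
      using domain_inclusion by (simp add: operator_extends_def DZ_def T0_def DG_def T_def Bhat_def)
    show "(\<lambda>n. Tn n t f) sums T t f" if "0 \<le> t" for t f
      unfolding Tn_def T_def by (rule TW_sums[OF that])
  qed (use minimal in blast)
qed

end
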